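(* Let $G$ be a connected real reductive algebraic group whose maximal compact subgroup is a (finite) product of special unitary groups $\mathrm{SU}(n)$ and groups of the form $Sp(m)$ (with possibly varying $n$ and $m$). Then, for every $d\in\mathbb{N}$, the space $\mathsf{Hom}(\mathbb{Z}^{2d},G)/\!\!/G$ is path connected.
   Context: $Sp(m)$ denotes the maximal compact subgroup of $\mathrm{Sp}(2m,\mathbb{C})$. For a connected real reductive algebraic group $G$ and $k\ge 0$, $\mathsf{Hom}(\mathbb{Z}^{k},G)$ is identified with the set of $k$-tuples $(g_1,\dots,g_k)\in G^k$ of pairwise commuting elements, with the subspace topology from $G^k$ (Euclidean topology). A representation $\rho:\mathbb{Z}^k\to G$ is called reductive if its composition with the adjoint representation of $G$ is completely reducible; equivalently, all the elements $g_1,\dots,g_k$ are semisimple; equivalently, the conjugation orbit of $\rho$ is closed. Let $\mathsf{Hom}(\mathbb{Z}^{k},G)^{+}\subset\mathsf{Hom}(\mathbb{Z}^{k},G)$ be the subspace of reductive representations. Then $\mathsf{Hom}(\mathbb{Z}^{k},G)/\!\!/G:=\mathsf{Hom}(\mathbb{Z}^{k},G)^{+}/G$, the quotient by the conjugation action of $G$, with the quotient topology. *)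

theory Defs
  imports
    "Jordan_Normal_Form.Schur_Decomposition"
    "HOL-Algebra.Product_Groups"
    "HOL-Analysis.Analysis"
begin

section \<open>Real reductive algebraic groups\<close>

text \<open>
  A real algebraic group is taken to be the group of real points of a linear algebraic group
  defined over the reals, i.e. a Zariski closed subgroup of some real general linear group.
  Topological notions refer to the Euclidean topology.
\<close>

definition GL :: "(real^'n^'n) monoid" where
  "GL = \<lparr>carrier = {A. invertible A}, monoid.mult = (**),
         one = Finite_Cartesian_Product.mat 1\<rparr>"

text \<open>
  On \<open>GL\<close> the polynomials in the entries have the same zero sets as the regular functions, which
  also involve the inverse of the determinant.
\<close>

definition zariski_closed :: "(real^'n^'n) set \<Rightarrow> bool" where
  "zariski_closed S \<longleftrightarrow>
     (\<exists>P. (\<forall>p\<in>P. real_polynomial_function p) \<and>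
          S = {A \<in> carrier GL. \<forall>p\<in>P. p A = 0})"

definition real_algebraic_group :: "(real^'n^'n) set \<Rightarrow> bool" where
  "real_algebraic_group G \<longleftrightarrow> subgroup G GL \<and> zariski_closed G"

definition unipotent :: "real^'n^'n \<Rightarrow> bool" where
  "unipotent A \<longleftrightarrow>
     (\<exists>m. ((**) (A - Finite_Cartesian_Product.mat 1) ^^ m) (Finite_Cartesian_Product.mat 1) = 0)"

text \<open>
  Reductive means that the unipotent radical is trivial.  Since the reals have characteristic zero,
  the unipotent radical of the complexification is defined over the reals and its real points are
  Zariski dense in it, so it does not matter whether it is formed over the reals or the complex
  numbers.  Connectedness of \<open>N\<close> is automatic.
\<close>

definition real_reductive_algebraic_group :: "(real^'n^'n) set \<Rightarrow> bool" where
  "real_reductive_algebraic_group G \<longleftrightarrow>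
     real_algebraic_group G \<and>
     (\<forall>N. real_algebraic_group N \<and> connected N \<and> (\<forall>A\<in>N. unipotent A) \<and>
          N \<lhd> GL\<lparr>carrier := G\<rparr> \<longrightarrow> N = {Finite_Cartesian_Product.mat 1})"

definition maximal_compact_subgroup :: "(real^'n^'n) set \<Rightarrow> (real^'n^'n) set \<Rightarrow> bool" where
  "maximal_compact_subgroup K G \<longleftrightarrow>
     subgroup K GL \<and> compact K \<and> K \<subseteq> G \<and>
     (\<forall>L. subgroup L GL \<and> compact L \<and> K \<subseteq> L \<and> L \<subseteq> G \<longrightarrow> L = K)"

section \<open>Products of special unitary and compact symplectic groups\<close>

definition SU :: "nat \<Rightarrow> complex mat monoid" where
  "SU n = \<lparr>carrier = {A \<in> carrier_mat n n. mat_adjoint A * A = 1\<^sub>m n \<and> Determinant.det A = 1},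
           monoid.mult = (*), one = 1\<^sub>m n\<rparr>"

definition symplectic_form :: "nat \<Rightarrow> complex mat" where
  "symplectic_form m = four_block_mat (0\<^sub>m m m) (1\<^sub>m m) (- 1\<^sub>m m) (0\<^sub>m m m)"

text \<open>
  \<open>Sp m\<close> is the maximal compact subgroup of the complex symplectic group of rank \<open>m\<close> (unique up
  to conjugation) formed by its unitary elements.
\<close>

definition Sp :: "nat \<Rightarrow> complex mat monoid" where
  "Sp m = \<lparr>carrier = {A \<in> carrier_mat (2 * m) (2 * m).
             transpose_mat A * symplectic_form m * A = symplectic_form m \<and>
             mat_adjoint A * A = 1\<^sub>m (2 * m)},
           monoid.mult = (*), one = 1\<^sub>m (2 * m)\<rparr>"

text \<open>
  On a set of matrices of fixed size this is the Euclidean topology: the function space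
  \<open>nat \<times> nat \<Rightarrow> complex\<close> carries the product topology, and all but finitely many of the
  coordinates vanish identically.
\<close>

definition mat_topology :: "complex mat set \<Rightarrow> complex mat topology" where
  "mat_topology S =
     pullback_topology S
       (\<lambda>A (i, j). if i < dim_row A \<and> j < dim_col A then A $$ (i, j) else 0)
       euclidean"

definition SU_Sp_product :: "(real^'n^'n) set \<Rightarrow> bool" where
  "SU_Sp_product K \<longleftrightarrow>
     (\<exists>r F \<phi>.
        (\<forall>j<r. (\<exists>n\<ge>1. F j = SU n) \<or> (\<exists>m\<ge>1. F j = Sp m)) \<and>
        \<phi> \<in> iso (GL\<lparr>carrier := K\<rparr>) (product_group {..<(r::nat)} F) \<and>
        homeomorphic_map (top_of_set K)
          (product_topology (\<lambda>j. mat_topology (carrier (F j))) {..<r}) \<phi>)"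

section \<open>The space of reductive representations modulo conjugation\<close>

definition Hom_Z :: "nat \<Rightarrow> (real^'n^'n) set \<Rightarrow> (nat \<Rightarrow> real^'n^'n) set" where
  "Hom_Z k G = {g \<in> {..<k} \<rightarrow>\<^sub>E G. \<forall>i<k. \<forall>j<k. g i ** g j = g j ** g i}"

text \<open>The Lie algebra, as the tangent space of \<open>G\<close> at the identity.\<close>

definition lie_algebra :: "(real^'n^'n) set \<Rightarrow> (real^'n^'n) set" where
  "lie_algebra G =
     {X. \<exists>\<gamma>. (\<forall>t. \<gamma> t \<in> G) \<and> \<gamma> 0 = Finite_Cartesian_Product.mat 1 \<and>
             (\<gamma> has_vector_derivative X) (at (0::real))}"

definition Ad :: "real^'n^'n \<Rightarrow> real^'n^'n \<Rightarrow> real^'n^'n" where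
  "Ad h X = h ** X ** matrix_inv h"

text \<open>
  Equality in \<open>Ad (g i) ` W = W\<close> amounts to stability under \<open>Ad (g i)\<close> and its inverse, hence
  under the whole image of the representation.
\<close>

definition Ad_invariant ::
    "nat \<Rightarrow> (real^'n^'n) set \<Rightarrow> (nat \<Rightarrow> real^'n^'n) \<Rightarrow> (real^'n^'n) set \<Rightarrow> bool" where
  "Ad_invariant k G g W \<longleftrightarrow>
     subspace W \<and> W \<subseteq> lie_algebra G \<and> (\<forall>i<k. Ad (g i) ` W = W)"

text \<open>Complete reducibility of \<open>Ad \<circ> \<rho>\<close>: every subrepresentation has a complementary one.\<close>

definition reductive_rep :: "nat \<Rightarrow> (real^'n^'n) set \<Rightarrow> (nat \<Rightarrow> real^'n^'n) \<Rightarrow> bool" where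
  "reductive_rep k G g \<longleftrightarrow>
     (\<forall>W. Ad_invariant k G g W \<longrightarrow>
        (\<exists>W'. Ad_invariant k G g W' \<and> W \<inter> W' = {0} \<and>
              {x + y | x y. x \<in> W \<and> y \<in> W'} = lie_algebra G))"

definition Hom_Z_reductive :: "nat \<Rightarrow> (real^'n^'n) set \<Rightarrow> (nat \<Rightarrow> real^'n^'n) set" where
  "Hom_Z_reductive k G = {g \<in> Hom_Z k G. reductive_rep k G g}"

definition Hom_Z_reductive_topology ::
    "nat \<Rightarrow> (real^'n^'n) set \<Rightarrow> (nat \<Rightarrow> real^'n^'n) topology" where
  "Hom_Z_reductive_topology k G =
     subtopology (product_topology (\<lambda>_. top_of_set G) {..<k}) (Hom_Z_reductive k G)"

definition conj_orbit ::
    "nat \<Rightarrow> (real^'n^'n) set \<Rightarrow> (nat \<Rightarrow> real^'n^'n) \<Rightarrow> (nat \<Rightarrow> real^'n^'n) set" where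
  "conj_orbit k G g = (\<lambda>h. \<lambda>i\<in>{..<k}. h ** g i ** matrix_inv h) ` G"

definition quotient_topology :: "'a topology \<Rightarrow> ('a \<Rightarrow> 'b) \<Rightarrow> 'b topology" where
  "quotient_topology X q =
     topology (\<lambda>U. U \<subseteq> q ` topspace X \<and> openin X {x \<in> topspace X. q x \<in> U})"

lemma openin_quotient_topology:
  "openin (quotient_topology X q) U \<longleftrightarrow>
     U \<subseteq> q ` topspace X \<and> openin X {x \<in> topspace X. q x \<in> U}"
proof -
  have "istopology (\<lambda>U. U \<subseteq> q ` topspace X \<and> openin X {x \<in> topspace X. q x \<in> U})"
    unfolding istopology_def
  proof (intro conjI allI impI)
    fix S T
    assume "S \<subseteq> q ` topspace X \<and> openin X {x \<in> topspace X. q x \<in> S}"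
      and "T \<subseteq> q ` topspace X \<and> openin X {x \<in> topspace X. q x \<in> T}"
    moreover have "{x \<in> topspace X. q x \<in> S \<inter> T} =
        {x \<in> topspace X. q x \<in> S} \<inter> {x \<in> topspace X. q x \<in> T}"
      by blast
    ultimately show "S \<inter> T \<subseteq> q ` topspace X" "openin X {x \<in> topspace X. q x \<in> S \<inter> T}"
      by (auto intro: openin_Int)
  next
    fix \<U>
    assume \<U>: "\<forall>U\<in>\<U>. U \<subseteq> q ` topspace X \<and> openin X {x \<in> topspace X. q x \<in> U}"
    then show "\<Union>\<U> \<subseteq> q ` topspace X" by blast
    have "{x \<in> topspace X. q x \<in> \<Union>\<U>} = (\<Union>U\<in>\<U>. {x \<in> topspace X. q x \<in> U})"
      by blast
    then show "openin X {x \<in> topspace X. q x \<in> \<Union>\<U>}"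
      using \<U> by (auto intro: openin_Union)
  qed
  then show ?thesis
    by (simp add: quotient_topology_def)
qed

lemma topspace_quotient_topology: "topspace (quotient_topology X q) = q ` topspace X"
proof -
  have "{x \<in> topspace X. q x \<in> q ` topspace X} = topspace X" by blast
  then have "openin (quotient_topology X q) (q ` topspace X)"
    by (simp add: openin_quotient_topology)
  then show ?thesis
    using openin_subset openin_topspace openin_quotient_topology by (metis subset_antisym)
qed

lemma quotient_map_quotient_topology: "quotient_map X (quotient_topology X q) q"
  by (simp add: quotient_map_def topspace_quotient_topology openin_quotient_topology)

definition character_space ::
    "nat \<Rightarrow> (real^'n^'n) set \<Rightarrow> (nat \<Rightarrow> real^'n^'n) set topology" where
  "character_space k G = quotient_topology (Hom_Z_reductive_topology k G) (conj_orbit k G)"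

end

theory Submission
  imports Defs
begin

text \<open>
  A reductive tuple \<open>g\<close> is joined to the tuple of elliptic parts of its members by the path whose
  value at \<open>s\<close> is \<open>E H\<^sup>s U\<^sup>s\<close> in each entry, where \<open>E\<close>, \<open>H\<close> and \<open>U\<close> are the elliptic, hyperbolic and unipotent
  parts.  By Zariski density the path stays in \<open>G\<close>, and for \<open>s > 0\<close> it does not change the
  \<open>Ad\<close>-invariant subspaces, so it consists of reductive tuples.  The elliptic tuple preserves a positive
  definite form, hence lies in a compact subgroup and is conjugate to a tuple in \<open>K\<close>.  There each factor
  of the elements has a joint orthonormal eigenbasis (compatible with the quaternionic structure for
  \<open>Sp m\<close>), and scaling the angles of the eigenvalues to \<open>0\<close> contracts the tuple to the trivial one.

  Conjugacy of compact subgroups into \<open>K\<close> is a fixed point argument.  Let \<open>\<Pi>\<close> be the projection onto the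
  Lie algebra along its orthogonal complement for the trace form, which is nondegenerate because an
  ideal of nilpotent matrices would give a unipotent normal subgroup.  The squared norm of the conjugate
  of \<open>\<Pi>\<close> by \<open>x\<close> is a convex function of \<open>x\<close> on the symmetric space of the general linear group,
  invariant under \<open>G\<close> and its commutant.  It attains its minimum by complete reducibility of the standard
  representation (obtained from the Casimir operator), and \<open>G\<close> times its commutant acts transitively on
  the set of minima.  A compact subgroup \<open>L\<close> fixes a point there, the
  minimum of the strictly convex function sending \<open>x\<close> to the supremum of \<open>psi\<close> over \<open>L x\<close>.
\<close>

section \<open>The algebra of square matrices\<close>

text \<open>The group is not assumed to be stable under transposition, so it comes with no Cartan
  decomposition. Points \<open>x\<close> of GL modulo orthogonal matrices, i.e. inner products,
  serve as a substitute: the function \<open>FF\<close> searches for an inner product adapted to the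
  group. The obstacle is that \<open>FF\<close>, being invariant under the group and its commutant,
  has noncompact level sets. Hence \<open>FF + \<epsilon> * psi\<close> is minimized instead. If the
  minimizers escaped as \<epsilon> tends to 0, the normalized matrices \<open>x * tp x\<close> and
  their normalized inverses would have limits with traces of sum 1; an equivariant projection onto
  the image of the first limit is a direction in the commutant along which the first-order condition
  makes both traces vanish. Zariski density takes the form of a statement on exponential
  polynomials: an identity valid when the exponents of the elliptic, hyperbolic and unipotent parts
  are the same integer holds for independent exponents. Complex groups are avoided, as Jordan parts
  are real functions \<open>fc\<close> of a real matrix. Conjugating a tuple into \<open>K\<close>
  requires no path, since the orbit is a single point of the quotient.\<close>

text \<open>The type \<open>real^'n^'n\<close> carries the componentwise product; a separate type makes the type
  classes of rings and normed algebras available for matrix multiplication.\<close>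

typedef ('a, 'n::finite) sqm = "UNIV :: ('n \<Rightarrow> 'n \<Rightarrow> 'a) set"
  morphisms ent Sqm ..

setup_lifting type_definition_sqm

lemma sqm_eqI: "(\<And>i j. ent X i j = ent Y i j) \<Longrightarrow> X = Y"
  by (metis (full_types) ent_inject ext)

lemma ent_Sqm [simp]: "ent (Sqm f) = f"
  by (simp add: Sqm_inverse)

instantiation sqm :: (ab_group_add, finite) ab_group_add
begin
lift_definition zero_sqm :: "('a, 'b) sqm" is "\<lambda>i j. 0" .
lift_definition plus_sqm :: "('a, 'b) sqm \<Rightarrow> ('a, 'b) sqm \<Rightarrow> ('a, 'b) sqm" is "\<lambda>x y i j. x i j + y i j" .
lift_definition minus_sqm :: "('a, 'b) sqm \<Rightarrow> ('a, 'b) sqm \<Rightarrow> ('a, 'b) sqm" is "\<lambda>x y i j. x i j - y i j" .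
lift_definition uminus_sqm :: "('a, 'b) sqm \<Rightarrow> ('a, 'b) sqm" is "\<lambda>x i j. - x i j" .
instance
  by standard (transfer; simp add: fun_eq_iff algebra_simps)+
end

instantiation sqm :: (comm_ring_1, finite) ring_1
begin
lift_definition one_sqm :: "('a, 'b) sqm" is "\<lambda>i j. if i = j then 1 else 0" .
lift_definition times_sqm :: "('a, 'b) sqm \<Rightarrow> ('a, 'b) sqm \<Rightarrow> ('a, 'b) sqm"
  is "\<lambda>x y i j. \<Sum>k\<in>UNIV. x i k * y k j" .
instance
proof
  fix a b c :: "('a, 'b) sqm"
  show "a * b * c = a * (b * c)"
  proof (transfer, intro ext)
    fix a b c :: "'b \<Rightarrow> 'b \<Rightarrow> 'a" and i j
    have "(\<Sum>k\<in>UNIV. (\<Sum>l\<in>UNIV. a i l * b l k) * c k j) = (\<Sum>k\<in>UNIV. \<Sum>l\<in>UNIV. a i l * b l k * c k j)"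
      by (simp add: sum_distrib_right)
    also have "\<dots> = (\<Sum>l\<in>UNIV. \<Sum>k\<in>UNIV. a i l * b l k * c k j)"
      by (rule sum.swap)
    finally show "(\<Sum>k\<in>UNIV. (\<Sum>l\<in>UNIV. a i l * b l k) * c k j)
        = (\<Sum>l\<in>UNIV. a i l * (\<Sum>k\<in>UNIV. b l k * c k j))"
      by (simp add: sum_distrib_left mult.assoc)
  qed
  show "1 * a = a"
    by (transfer, intro ext) (simp add: if_distrib if_distribR cong: if_cong)
  show "a * 1 = a"
    by (transfer, intro ext) (simp add: if_distrib if_distribR cong: if_cong)
  show "(a + b) * c = a * c + b * c"
    by (transfer, intro ext) (simp add: algebra_simps sum.distrib)
  show "a * (b + c) = a * b + a * c"
    by (transfer, intro ext) (simp add: algebra_simps sum.distrib)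
  show "(0::('a, 'b) sqm) \<noteq> 1"
    by transfer (metis zero_neq_one)
qed
end

lemma ent_simps [simp]:
  "ent 0 i j = 0" "ent (X + Y) i j = ent X i j + ent Y i j"
  "ent (X - Y) i j = ent X i j - ent Y i j" "ent (- X) i j = - ent X i j"
  by (transfer; simp)+

lemma ent_one: "ent 1 i j = (if i = j then 1 else 0)"
  by transfer simp

lemma ent_times: "ent (X * Y) i j = (\<Sum>k\<in>UNIV. ent X i k * ent Y k j)"
  by transfer simp

lemma ent_sum: "ent (sum f A) i j = (\<Sum>a\<in>A. ent (f a) i j)"
  by (induction A rule: infinite_finite_induct) auto

instantiation sqm :: (real_vector, finite) real_vector
begin
lift_definition scaleR_sqm :: "real \<Rightarrow> ('a, 'b) sqm \<Rightarrow> ('a, 'b) sqm" is "\<lambda>r x i j. r *\<^sub>R x i j" .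
instance
  by standard (transfer; simp add: fun_eq_iff algebra_simps)+
end

lemma ent_scaleR [simp]: "ent (r *\<^sub>R X) i j = r *\<^sub>R ent X i j"
  by transfer simp

instance sqm :: ("{real_algebra_1, comm_ring_1}", finite) real_algebra_1
  by standard (rule sqm_eqI; simp add: ent_times scaleR_sum_right)+

text \<open>The Frobenius inner product. For real entries \<open>norm 1\<close> is the square root
  of the size rather than 1, whence the factor \<open>norm 1\<close> in all estimates on powers and
  exponentials.\<close>

instantiation sqm :: (real_inner, finite) real_inner
begin
definition "inner X Y = (\<Sum>i\<in>UNIV. \<Sum>j\<in>UNIV. ent X i j \<bullet> ent Y i j)"
definition "norm (X :: ('a, 'b) sqm) = sqrt (X \<bullet> X)"
definition "sgn (X :: ('a, 'b) sqm) = X /\<^sub>R norm X"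
definition "dist (X :: ('a, 'b) sqm) Y = norm (X - Y)"
definition "uniformity = (INF e\<in>{0<..}. principal {(x :: ('a, 'b) sqm, y). dist x y < e})"
definition "open U \<longleftrightarrow> (\<forall>x\<in>U. eventually (\<lambda>(x', y). x' = x \<longrightarrow> y \<in> U)
    (uniformity :: (('a, 'b) sqm \<times> ('a, 'b) sqm) filter))"
instance
proof
  fix x y z :: "('a, 'b) sqm" and r :: real and U :: "('a, 'b) sqm set"
  show "dist x y = norm (x - y)" by (rule dist_sqm_def)
  show "sgn x = x /\<^sub>R norm x" by (rule sgn_sqm_def)
  show "uniformity = (INF e\<in>{0<..}. principal {(x :: ('a, 'b) sqm, y). dist x y < e})"
    by (rule uniformity_sqm_def)
  show "open U \<longleftrightarrow> (\<forall>x\<in>U. eventually (\<lambda>(x', y). x' = x \<longrightarrow> y \<in> U) uniformity)"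
    by (rule open_sqm_def)
  show "inner x y = inner y x"
    by (simp add: inner_sqm_def inner_commute)
  show "inner (x + y) z = inner x z + inner y z"
    by (simp add: inner_sqm_def inner_add_left sum.distrib)
  show "inner (r *\<^sub>R x) y = r * inner x y"
    by (simp add: inner_sqm_def sum_distrib_left)
  show "0 \<le> inner x x"
    by (simp add: inner_sqm_def sum_nonneg)
  show "(inner x x = 0) = (x = 0)"
    by (auto simp: inner_sqm_def sum_nonneg_eq_0_iff sum_nonneg intro: sqm_eqI)
  show "norm x = sqrt (inner x x)" by (rule norm_sqm_def)
qed
end

definition unitE :: "'n::finite \<Rightarrow> 'n \<Rightarrow> 'a::zero \<Rightarrow> ('a, 'n) sqm" where
  "unitE i j a = Sqm (\<lambda>k l. if k = i \<and> l = j then a else 0)"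

lemma ent_unitE: "ent (unitE i j a) k l = (if k = i \<and> l = j then a else 0)"
  by (simp add: unitE_def)

lemma inner_unitE: "X \<bullet> unitE i j a = ent X i j \<bullet> a"
proof -
  have "X \<bullet> unitE i j a = (\<Sum>k\<in>UNIV. \<Sum>l\<in>UNIV. if l = j then (if k = i then ent X i j \<bullet> a else 0) else 0)"
    unfolding inner_sqm_def by (intro sum.cong) (auto simp: ent_unitE)
  then show ?thesis by simp
qed

instantiation sqm :: (euclidean_space, finite) euclidean_space
begin
definition "Basis = (\<lambda>(i, j, b). unitE i j b) ` (UNIV \<times> UNIV \<times> Basis)"
instance
proof
  show "(Basis :: ('a, 'b) sqm set) \<noteq> {}" by (simp add: Basis_sqm_def)
  show "finite (Basis :: ('a, 'b) sqm set)" by (simp add: Basis_sqm_def)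
  fix u v x :: "('a, 'b) sqm"
  show "(\<forall>u\<in>Basis. inner x u = 0) = (x = 0)"
  proof
    assume *: "\<forall>u\<in>Basis. inner x u = 0"
    show "x = 0"
    proof (rule sqm_eqI)
      fix i j
      have "ent x i j \<bullet> b = 0" if "b \<in> Basis" for b
        using *[rule_format, of "unitE i j b"] that
        by (force simp: Basis_sqm_def inner_unitE)
      then show "ent x i j = ent 0 i j" using euclidean_all_zero_iff[of "ent x i j"] by simp
    qed
  qed simp
  assume "u \<in> Basis" "v \<in> Basis"
  then obtain i j a k l b where "u = unitE i j a" "v = unitE k l b" "a \<in> Basis" "b \<in> Basis"
    by (auto simp: Basis_sqm_def)
  moreover from this have "a \<noteq> 0" "b \<noteq> 0" by auto
  moreover have "unitE i j a = unitE k l b \<longleftrightarrow> i = k \<and> j = l \<and> a = b"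
    using \<open>a \<noteq> 0\<close> \<open>b \<noteq> 0\<close> by (metis ent_unitE)
  ultimately show "inner u v = (if u = v then 1 else 0)"
    by (auto simp: inner_unitE ent_unitE inner_Basis)
qed
end

lemma norm_sqm_power2: "(norm X)\<^sup>2 = (\<Sum>i\<in>UNIV. \<Sum>j\<in>UNIV. (norm (ent X i j))\<^sup>2)"
  for X :: "('a::real_inner, 'n::finite) sqm"
  by (simp add: power2_norm_eq_inner inner_sqm_def)

text \<open>Cauchy-Schwarz for a row of \<open>X\<close> against a column of \<open>Y\<close> bounds
  each entry of the product, and the double sum of the bounds factors.\<close>

instance sqm :: ("{real_normed_field, real_inner}", finite) real_normed_algebra
proof
  fix X Y :: "('a, 'b) sqm"
  have "(norm (X * Y))\<^sup>2 = (\<Sum>i\<in>UNIV. \<Sum>j\<in>UNIV. (norm (\<Sum>k\<in>UNIV. ent X i k * ent Y k j))\<^sup>2)"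
    by (simp add: norm_sqm_power2 ent_times)
  also have "\<dots> \<le> (\<Sum>i\<in>UNIV. \<Sum>j\<in>UNIV. (\<Sum>k\<in>UNIV. (norm (ent X i k))\<^sup>2) * (\<Sum>k\<in>UNIV. (norm (ent Y k j))\<^sup>2))"
  proof (intro sum_mono)
    fix i j
    have "norm (\<Sum>k\<in>UNIV. ent X i k * ent Y k j) \<le> (\<Sum>k\<in>UNIV. norm (ent X i k) * norm (ent Y k j))"
      by (rule order_trans[OF norm_sum]) (simp add: norm_mult)
    then have "(norm (\<Sum>k\<in>UNIV. ent X i k * ent Y k j))\<^sup>2
        \<le> (\<Sum>k\<in>UNIV. norm (ent X i k) * norm (ent Y k j))\<^sup>2"
      by (intro power_mono) auto
    also have "\<dots> \<le> (\<Sum>k\<in>UNIV. (norm (ent X i k))\<^sup>2) * (\<Sum>k\<in>UNIV. (norm (ent Y k j))\<^sup>2)"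
      by (rule Cauchy_Schwarz_ineq_sum)
    finally show "(norm (\<Sum>k\<in>UNIV. ent X i k * ent Y k j))\<^sup>2
        \<le> (\<Sum>k\<in>UNIV. (norm (ent X i k))\<^sup>2) * (\<Sum>k\<in>UNIV. (norm (ent Y k j))\<^sup>2)" .
  qed
  also have "\<dots> = (\<Sum>i\<in>UNIV. \<Sum>k\<in>UNIV. (norm (ent X i k))\<^sup>2) * (\<Sum>j\<in>UNIV. \<Sum>k\<in>UNIV. (norm (ent Y k j))\<^sup>2)"
    by (simp add: sum_product)
  also have "(\<Sum>j\<in>UNIV. \<Sum>k\<in>UNIV. (norm (ent Y k j))\<^sup>2) = (norm Y)\<^sup>2"
    unfolding norm_sqm_power2 by (rule sum.swap)
  finally have "(norm (X * Y))\<^sup>2 \<le> (norm X * norm Y)\<^sup>2"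
    by (simp add: norm_sqm_power2 power_mult_distrib)
  then show "norm (X * Y) \<le> norm X * norm Y"
    by (rule power2_le_imp_le) simp
qed

type_synonym 'n rsq = "(real, 'n) sqm"
type_synonym 'n csq = "(complex, 'n) sqm"

instance sqm :: (euclidean_space, finite) banach ..

section \<open>Transpose, trace and invertibility\<close>

lift_definition tp :: "('a, 'n::finite) sqm \<Rightarrow> ('a, 'n) sqm" is "\<lambda>x i j. x j i" .

lemma ent_tp [simp]: "ent (tp X) i j = ent X j i"
  by transfer simp

lemma tp_tp [simp]: "tp (tp X) = X"
  by transfer simp

lemma tp_add [simp]: "tp (X + Y) = tp X + tp Y"
  by (rule sqm_eqI) simp

lemma tp_diff [simp]: "tp (X - Y) = tp X - tp Y"
  by (rule sqm_eqI) simp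

lemma tp_minus [simp]: "tp (- X) = - tp X"
  by (rule sqm_eqI) simp

lemma tp_0 [simp]: "tp 0 = 0"
  by (rule sqm_eqI) simp

lemma tp_1 [simp]: "tp 1 = 1"
  by (rule sqm_eqI) (simp add: ent_one)

lemma tp_scaleR [simp]: "tp (r *\<^sub>R X) = r *\<^sub>R tp X"
  by (rule sqm_eqI) simp

lemma tp_mult [simp]: "tp (X * Y) = tp Y * tp X"
  for X :: "('a::comm_ring_1, 'n::finite) sqm"
  by (rule sqm_eqI) (simp add: ent_times mult.commute)

lemma tp_sum: "tp (sum f A) = (\<Sum>a\<in>A. tp (f a))"
  by (rule sqm_eqI) (simp add: ent_sum)

lemma tp_power: "tp (X ^ k) = tp X ^ k" for X :: "('a::comm_ring_1, 'n::finite) sqm"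
  by (induction k) (auto simp: power_commutes)

definition tr :: "('a::comm_monoid_add, 'n::finite) sqm \<Rightarrow> 'a" where
  "tr X = (\<Sum>i\<in>UNIV. ent X i i)"

lemma tr_add [simp]: "tr (X + Y) = tr X + tr Y"
  for X :: "('a::ab_group_add, 'n::finite) sqm"
  by (simp add: tr_def sum.distrib)

lemma tr_diff [simp]: "tr (X - Y) = tr X - tr Y"
  for X :: "('a::ab_group_add, 'n::finite) sqm"
  by (simp add: tr_def sum_subtractf)

lemma tr_0 [simp]: "tr (0 :: ('a::ab_group_add, 'n::finite) sqm) = 0"
  by (simp add: tr_def)

lemma tr_scaleR [simp]: "tr (r *\<^sub>R X) = r *\<^sub>R tr X"
  by (simp add: tr_def scaleR_sum_right)

lemma tr_mult_commute: "tr (X * Y) = tr (Y * X)"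
  for X :: "('a::comm_ring_1, 'n::finite) sqm"
proof -
  have "tr (X * Y) = (\<Sum>i\<in>UNIV. \<Sum>k\<in>UNIV. ent Y k i * ent X i k)"
    by (simp add: tr_def ent_times mult.commute)
  also have "\<dots> = tr (Y * X)"
    unfolding tr_def ent_times by (rule sum.swap)
  finally show ?thesis .
qed

lemma inner_eq_tr: "X \<bullet> Y = tr (tp X * Y)" for X :: "'n::finite rsq"
proof -
  have "tr (tp X * Y) = (\<Sum>i\<in>UNIV. \<Sum>k\<in>UNIV. ent X k i * ent Y k i)"
    by (simp add: tr_def ent_times)
  also have "\<dots> = X \<bullet> Y"
    unfolding inner_sqm_def inner_real_def by (rule sum.swap)
  finally show ?thesis by simp
qed

lemma inner_mult_left: "(A * X) \<bullet> Y = X \<bullet> (tp A * Y)" for X :: "'n::finite rsq"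
  by (simp add: inner_eq_tr mult.assoc)

lemma inner_mult_right: "(X * A) \<bullet> Y = X \<bullet> (Y * tp A)" for X :: "'n::finite rsq"
  by (simp add: inner_eq_tr mult.assoc) (metis mult.assoc tr_mult_commute)

lemma inner_tp: "tp X \<bullet> tp Y = X \<bullet> Y" for X :: "'n::finite rsq"
  unfolding inner_sqm_def by (subst sum.swap) simp

lemma norm_tp: "norm (tp X) = norm X" for X :: "'n::finite rsq"
  by (simp add: norm_eq_sqrt_inner inner_tp)

lemma tp_mult_self_eq_0: "tp X * X = 0 \<Longrightarrow> X = 0" for X :: "'n::finite rsq"
  by (metis inner_eq_tr inner_eq_zero_iff tr_0)

text \<open>For symmetric \<open>X\<close> the power \<open>X ^ (2 * l)\<close> is
  \<open>tp (X ^ l) * X ^ l\<close>, so its vanishing forces \<open>X ^ l = 0\<close>; the exponent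
  can be halved down to 1.\<close>

lemma sym_nilpotent_eq_0:
  fixes X :: "'n::finite rsq"
  assumes s: "tp X = X" and "X ^ m = 0" shows "X = 0"
proof -
  have "X ^ k = 0 \<Longrightarrow> X = 0" if "tp X = X" for k and X :: "'n rsq"
    using that
  proof (induction k arbitrary: X rule: less_induct)
    case (less k X)
    consider "k = 0" | "k = 1" | "k \<ge> 2" by linarith
    then show ?case
    proof cases
      case 3
      define l where "l = (k + 1) div 2"
      have "l < k" "2 * l \<ge> k" using 3 by (auto simp: l_def)
      then have "X ^ (2 * l) = 0" using less.prems(1)
        by (metis le_add_diff_inverse mult_zero_left power_add)
      then have "tp (X ^ l) * X ^ l = 0"
        by (simp add: tp_power less.prems mult_2 power_add)
      then have "X ^ l = 0" by (rule tp_mult_self_eq_0)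
      then show ?thesis using less.IH \<open>l < k\<close> less.prems(2) by blast
    qed (use less.prems in auto)
  qed
  with assms show ?thesis by blast
qed

lemma bounded_linear_ent: "bounded_linear (\<lambda>X :: 'n::finite rsq. ent X i j)"
proof (rule bounded_linear_intro[of _ 1])
  fix X :: "'n rsq"
  have "unitE i j 1 \<bullet> (unitE i j 1 :: 'n rsq) = 1"
    by (simp add: inner_unitE ent_unitE)
  then have "norm (unitE i j 1 :: 'n rsq) = 1" by (simp add: norm_eq_sqrt_inner)
  moreover have "X \<bullet> unitE i j 1 = ent X i j" by (simp add: inner_unitE)
  ultimately show "norm (ent X i j) \<le> norm X * 1"
    using Cauchy_Schwarz_ineq2[of X "unitE i j 1"] by simp
qed auto

lemma bounded_linear_tr: "bounded_linear (tr :: 'n::finite rsq \<Rightarrow> real)"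
  unfolding tr_def by (intro bounded_linear_sum bounded_linear_ent)

lemma bounded_linear_tp: "bounded_linear (tp :: 'n::finite rsq \<Rightarrow> 'n rsq)"
  by (rule bounded_linear_intro[of _ 1]) (auto simp: norm_tp)

lemmas tendsto_tp [tendsto_intros] = bounded_linear.tendsto[OF bounded_linear_tp]
lemma sqm_left_inverse_imp_right:
  fixes X Y :: "'n::finite rsq"
  assumes "X * Y = 1" shows "Y * X = 1"
proof -
  let ?M = "\<lambda>Z. (\<chi> i j. ent Z i j) :: real^'n^'n"
  have mult: "?M (U * V) = ?M U ** ?M V" for U V
    by (simp add: matrix_matrix_mult_def ent_times vec_eq_iff)
  have one: "?M 1 = Finite_Cartesian_Product.mat 1"
    by (simp add: Finite_Cartesian_Product.mat_def ent_one vec_eq_iff)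
  have "?M Y ** ?M X = Finite_Cartesian_Product.mat 1"
    using assms mult one matrix_left_right_inverse by metis
  then have "?M (Y * X) = ?M 1" using mult one by metis
  then show ?thesis by (auto simp: vec_eq_iff intro!: sqm_eqI)
qed

text \<open>A relation instead of an inverse function: points are handled as pairs of a matrix and
  its inverse, so that functions such as \<open>psi\<close> and \<open>FF\<close> are polynomial in
  the pair and continuous everywhere. One equation suffices in finite dimension.\<close>

definition inverses :: "'n::finite rsq \<Rightarrow> 'n rsq \<Rightarrow> bool" where
  "inverses x y \<longleftrightarrow> x * y = 1"

lemma inversesD: assumes "inverses x y"
  shows "x * y = 1" "y * x = 1" "x * (y * z) = z" "y * (x * z) = z" "z * x * y = z" "z * y * x = z"
  using assms sqm_left_inverse_imp_right[of x y] by (auto simp: inverses_def mult.assoc[symmetric])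
     (auto simp: mult.assoc)

lemma inverses_sym: "inverses x y \<Longrightarrow> inverses y x"
  by (simp add: inverses_def sqm_left_inverse_imp_right)

lemma inverses_mult: "inverses x y \<Longrightarrow> inverses x' y' \<Longrightarrow> inverses (x * x') (y' * y)"
  by (metis inverses_def inversesD(3) mult.assoc)

lemma inverses_tp: "inverses x y \<Longrightarrow> inverses (tp x) (tp y)"
  by (metis inverses_def inversesD(2) tp_1 tp_mult)

lemma inverses_unique: "inverses x y \<Longrightarrow> inverses x z \<Longrightarrow> y = z"
  by (metis inversesD(1,4) mult_1_right)

section \<open>The matrix exponential\<close>

definition mexp :: "'n::finite rsq \<Rightarrow> 'n rsq" where
  "mexp X = (\<Sum>k. X ^ k /\<^sub>R fact k)"

lemma norm_power_sqm_le: "norm (X ^ k) \<le> norm (1 :: 'n::finite rsq) * norm X ^ k"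
  for X :: "'n::finite rsq"
proof (induction k)
  case (Suc k)
  have "norm (X ^ Suc k) \<le> norm X * norm (X ^ k)" by (simp add: norm_mult_ineq)
  also have "\<dots> \<le> norm X * (norm (1 :: 'n rsq) * norm X ^ k)"
    using Suc by (intro mult_left_mono) auto
  finally show ?case by (simp add: mult_ac)
qed simp

lemma norm_mexp_term: "norm (X ^ k /\<^sub>R fact k) \<le> norm (1 :: 'n::finite rsq) * (norm X ^ k /\<^sub>R fact k)"
  for X :: "'n::finite rsq"
  using norm_power_sqm_le[of X k] by (simp add: field_simps)

lemma summable_norm_mexp: "summable (\<lambda>k. norm (X ^ k /\<^sub>R fact k))" for X :: "'n::finite rsq"
  by (rule summable_comparison_test'[where g = "\<lambda>k. norm (1 :: 'n rsq) * (norm X ^ k /\<^sub>R fact k)" and N = 0])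
     (auto intro: summable_mult summable_exp norm_mexp_term[simplified])

lemma summable_mexp: "summable (\<lambda>k. X ^ k /\<^sub>R fact k)" for X :: "'n::finite rsq"
  using summable_norm_cancel[OF summable_norm_mexp] .

lemma mexp_sums: "(\<lambda>k. X ^ k /\<^sub>R fact k) sums mexp X" for X :: "'n::finite rsq"
  unfolding mexp_def by (rule summable_sums[OF summable_mexp])

lemma mexp_0 [simp]: "mexp 0 = (1 :: 'n::finite rsq)"
proof -
  have "(\<lambda>k. (0 :: 'n rsq) ^ k /\<^sub>R fact k) sums (\<Sum>k\<in>{0::nat}. (0 :: 'n rsq) ^ k /\<^sub>R fact k)"
    by (rule sums_finite) (auto simp: power_0_left)
  then show ?thesis using mexp_sums[of "0 :: 'n rsq"] sums_unique2 by fastforce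
qed

text \<open>The binomial theorem for two commuting elements of a noncommutative ring, by Pascal's
  rule; division by n! turns it into the n-th term of a Cauchy product.\<close>

lemma mexp_series_add:
  fixes x y :: "'n::finite rsq"
  assumes comm: "x * y = y * x"
  shows "(x + y) ^ n /\<^sub>R fact n = (\<Sum>i\<le>n. (x ^ i /\<^sub>R fact i) * (y ^ (n - i) /\<^sub>R fact (n - i)))"
proof -
  have xy: "x ^ i * y = y * x ^ i" for i
    by (metis comm power_commuting_commutes)
  have "(x + y) ^ n = (\<Sum>i\<le>n. of_nat (n choose i) * (x ^ i * y ^ (n - i)))"
  proof (induction n)
    case (Suc n)
    have 1: "x * (\<Sum>i\<le>n. of_nat (n choose i) * (x ^ i * y ^ (n - i)))
        = (\<Sum>i\<le>n. of_nat (n choose i) * (x ^ Suc i * y ^ (n - i)))"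
      by (simp add: sum_distrib_left mult.assoc[symmetric]) (simp add: mult_of_nat_commute mult.assoc)
    have "y * (of_nat (n choose i) * (x ^ i * y ^ (n - i))) = of_nat (n choose i) * (x ^ i * y ^ (Suc n - i))"
      if "i \<le> n" for i
    proof -
      have "y * (of_nat (n choose i) * (x ^ i * y ^ (n - i))) = of_nat (n choose i) * ((y * x ^ i) * y ^ (n - i))"
        by (simp add: mult.assoc[symmetric]) (simp add: mult_of_nat_commute)
      also have "\<dots> = of_nat (n choose i) * (x ^ i * (y * y ^ (n - i)))"
        by (simp add: xy[symmetric] mult.assoc)
      finally show ?thesis using that by (simp add: Suc_diff_le)
    qed
    then have 2: "y * (\<Sum>i\<le>n. of_nat (n choose i) * (x ^ i * y ^ (n - i)))
        = (\<Sum>i\<le>n. of_nat (n choose i) * (x ^ i * y ^ (Suc n - i)))"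
      by (simp add: sum_distrib_left)
    have "(x + y) ^ Suc n = (\<Sum>i\<le>n. of_nat (n choose i) * (x ^ Suc i * y ^ (n - i)))
        + (\<Sum>i\<le>n. of_nat (n choose i) * (x ^ i * y ^ (Suc n - i)))"
      using Suc.IH 1 2 by (simp add: distrib_right)
    also have "(\<Sum>i\<le>n. of_nat (n choose i) * (x ^ i * y ^ (Suc n - i)))
        = y ^ Suc n + (\<Sum>i\<le>n. of_nat (n choose Suc i) * (x ^ Suc i * y ^ (n - i)))"
    proof -
      have "(\<Sum>i\<le>Suc n. of_nat (n choose i) * (x ^ i * y ^ (Suc n - i)))
          = y ^ Suc n + (\<Sum>i\<le>n. of_nat (n choose Suc i) * (x ^ Suc i * y ^ (n - i)))"
        by (subst sum.atMost_Suc_shift) simp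
      then show ?thesis by (simp add: binomial_eq_0)
    qed
    also have "(\<Sum>i\<le>n. of_nat (n choose i) * (x ^ Suc i * y ^ (n - i)))
        + (y ^ Suc n + (\<Sum>i\<le>n. of_nat (n choose Suc i) * (x ^ Suc i * y ^ (n - i))))
        = y ^ Suc n + (\<Sum>i\<le>n. of_nat (Suc n choose Suc i) * (x ^ Suc i * y ^ (n - i)))"
      by (simp add: sum.distrib distrib_right)
    also have "\<dots> = (\<Sum>i\<le>Suc n. of_nat (Suc n choose i) * (x ^ i * y ^ (Suc n - i)))"
      by (subst sum.atMost_Suc_shift) simp
    finally show ?case .
  qed simp
  also have "(\<Sum>i\<le>n. of_nat (n choose i) * (x ^ i * y ^ (n - i))) /\<^sub>R fact n
      = (\<Sum>i\<le>n. (x ^ i /\<^sub>R fact i) * (y ^ (n - i) /\<^sub>R fact (n - i)))"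
    unfolding scaleR_sum_right
  proof (intro sum.cong refl)
    fix i assume "i \<in> {..n}"
    then have "real (n choose i) = fact n / (fact i * fact (n - i))"
      by (simp add: binomial_fact)
    moreover have "of_nat (n choose i) * (x ^ i * y ^ (n - i)) = real (n choose i) *\<^sub>R (x ^ i * y ^ (n - i))"
      by (metis of_real_of_nat_eq scaleR_conv_of_real)
    ultimately show "(of_nat (n choose i) * (x ^ i * y ^ (n - i))) /\<^sub>R fact n
        = (x ^ i /\<^sub>R fact i) * (y ^ (n - i) /\<^sub>R fact (n - i))"
      by (simp add: field_simps)
  qed
  finally show ?thesis .
qed

lemma mexp_add: "x * y = y * x \<Longrightarrow> mexp (x + y) = mexp x * mexp y"
  unfolding mexp_def
  by (simp only: Cauchy_product[OF summable_norm_mexp summable_norm_mexp] mexp_series_add)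

lemma mexp_scaleR_add: "mexp ((s + t) *\<^sub>R X) = mexp (s *\<^sub>R X) * mexp (t *\<^sub>R X)"
  by (subst mexp_add[symmetric]) (auto simp: scaleR_add_left)

lemma inverses_mexp: "inverses (mexp X) (mexp (- X))"
  by (simp add: inverses_def mexp_add[symmetric])

lemma mexp_of_nat: "mexp (real m *\<^sub>R X) = mexp X ^ m"
proof (induction m)
  case (Suc m)
  have "mexp (real (Suc m) *\<^sub>R X) = mexp ((1 + real m) *\<^sub>R X)" by simp
  also have "\<dots> = mexp X * mexp (real m *\<^sub>R X)" by (subst mexp_scaleR_add) simp
  finally show ?case using Suc by simp
qed simp

lemma mexp_conj:
  assumes "inverses x y" shows "mexp (x * X * y) = x * mexp X * y"
proof -
  have "(x * X * y) ^ k = x * X ^ k * y" for k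
    by (induction k) (use inversesD[OF assms] in \<open>simp_all add: mult.assoc\<close>)
  then have "(\<lambda>k. (x * X * y) ^ k /\<^sub>R fact k) = (\<lambda>k. x * (X ^ k /\<^sub>R fact k) * y)"
    by simp
  moreover have "(\<lambda>k. x * (X ^ k /\<^sub>R fact k) * y) sums (x * mexp X * y)"
    by (intro sums_mult2 sums_mult mexp_sums)
  ultimately show ?thesis using mexp_sums sums_unique2 by metis
qed

lemma tp_mexp: "tp (mexp X) = mexp (tp X)"
  using bounded_linear.sums[OF bounded_linear_tp mexp_sums[of X]] mexp_sums[of "tp X"]
  by (simp add: tp_power sums_unique2)

lemma mexp_commute: "X * Y = Y * X \<Longrightarrow> mexp X * Y = Y * mexp X"
proof -
  assume c: "X * Y = Y * X"
  then have "X ^ k * Y = Y * X ^ k" for k by (metis power_commuting_commutes)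
  then have "(\<lambda>k. X ^ k /\<^sub>R fact k * Y) = (\<lambda>k. Y * (X ^ k /\<^sub>R fact k))" by simp
  moreover have "(\<lambda>k. X ^ k /\<^sub>R fact k * Y) sums (mexp X * Y)"
    by (intro sums_mult2 mexp_sums)
  moreover have "(\<lambda>k. Y * (X ^ k /\<^sub>R fact k)) sums (Y * mexp X)"
    by (intro sums_mult mexp_sums)
  ultimately show ?thesis using sums_unique2 by metis
qed

lemma norm_mexp_le: "norm (mexp X) \<le> norm (1 :: 'n::finite rsq) * exp (norm X)" for X :: "'n::finite rsq"
proof -
  have "norm (mexp X) \<le> (\<Sum>k. norm (X ^ k /\<^sub>R fact k))"
    unfolding mexp_def by (rule summable_norm[OF summable_norm_mexp])
  also have "\<dots> \<le> (\<Sum>k. norm (1 :: 'n rsq) * (norm X ^ k /\<^sub>R fact k))"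
    by (intro suminf_le norm_mexp_term summable_norm_mexp summable_mult summable_exp_generic)
  also have "\<dots> = norm (1 :: 'n rsq) * exp (norm X)"
    unfolding exp_def by (rule suminf_mult[OF summable_exp_generic])
  finally show ?thesis .
qed

lemma norm_mexp_diff_le:
  "norm (mexp X - 1 - X) \<le> norm (1 :: 'n::finite rsq) * ((norm X)\<^sup>2 * exp (norm X))" for X :: "'n::finite rsq"
proof -
  have 1: "(\<lambda>k. X ^ (k + 2) /\<^sub>R fact (k + 2)) sums (mexp X - (\<Sum>k<2. X ^ k /\<^sub>R fact k))"
    using sums_split_initial_segment[OF mexp_sums[of X], of 2] by simp
  have s: "(\<Sum>k<2. X ^ k /\<^sub>R fact k) = 1 + X" by (simp add: numeral_2_eq_2)
  have 2: "summable (\<lambda>k. norm (X ^ (k + 2) /\<^sub>R fact (k + 2)))"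
    using summable_ignore_initial_segment[OF summable_norm_mexp[of X], of 2] by simp
  have "norm (mexp X - 1 - X) = norm (\<Sum>k. X ^ (k + 2) /\<^sub>R fact (k + 2))"
    using sums_unique[OF 1] s by (simp add: algebra_simps)
  also have "\<dots> \<le> (\<Sum>k. norm (X ^ (k + 2) /\<^sub>R fact (k + 2)))"
    by (rule summable_norm[OF 2])
  also have "\<dots> \<le> (\<Sum>k. (norm (1 :: 'n rsq) * (norm X)\<^sup>2) * (norm X ^ k /\<^sub>R fact k))"
  proof (intro suminf_le 2 summable_mult summable_exp_generic)
    fix k
    have "norm (X ^ (k + 2) /\<^sub>R fact (k + 2)) \<le> norm (1 :: 'n rsq) * (norm X ^ (k + 2) /\<^sub>R fact (k + 2))"
      by (rule norm_mexp_term)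
    also have "\<dots> \<le> norm (1 :: 'n rsq) * (norm X ^ (k + 2) /\<^sub>R fact k)"
    proof -
      \<comment> \<open>Lowering (k + 2)! to k! leaves the square of \<open>norm X\<close> times the
        full exponential series.\<close>
      have "fact k \<le> (fact (k + 2) :: real)" by (rule fact_mono) simp
      then have *: "inverse (fact (k + 2)) \<le> (inverse (fact k) :: real)" by (intro le_imp_inverse_le) auto
      show ?thesis unfolding real_scaleR_def by (intro mult_left_mono mult_right_mono *) auto
    qed
    finally show "norm (X ^ (k + 2) /\<^sub>R fact (k + 2)) \<le> (norm (1 :: 'n rsq) * (norm X)\<^sup>2) * (norm X ^ k /\<^sub>R fact k)"
      by (simp add: power_add mult_ac power2_eq_square)
  qed
  also have "\<dots> = (norm (1 :: 'n rsq) * (norm X)\<^sup>2) * exp (norm X)"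
    unfolding exp_def by (rule suminf_mult[OF summable_exp_generic])
  finally show ?thesis by (simp add: mult.assoc)
qed

lemma mexp_has_vector_derivative_0: "((\<lambda>t. mexp (t *\<^sub>R X)) has_vector_derivative X) (at 0)"
  for X :: "'n::finite rsq"
proof -
  have "((\<lambda>t. norm (mexp (t *\<^sub>R X) - 1 - t *\<^sub>R X) / \<bar>t\<bar>) \<longlongrightarrow> 0) (at 0)"
  proof (rule tendsto_sandwich[where f = "\<lambda>_. 0"])
    show "\<forall>\<^sub>F t in at 0. norm (mexp (t *\<^sub>R X) - 1 - t *\<^sub>R X) / \<bar>t\<bar>
        \<le> \<bar>t\<bar> * (norm (1 :: 'n rsq) * (norm X)\<^sup>2 * exp (\<bar>t\<bar> * norm X))"
    proof (rule eventually_mono[OF eventually_neq_at_within[of 0]])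
      fix t :: real assume "t \<noteq> 0"
      then show "norm (mexp (t *\<^sub>R X) - 1 - t *\<^sub>R X) / \<bar>t\<bar>
          \<le> \<bar>t\<bar> * (norm (1 :: 'n rsq) * (norm X)\<^sup>2 * exp (\<bar>t\<bar> * norm X))"
        using norm_mexp_diff_le[of "t *\<^sub>R X"]
        by (simp add: divide_le_eq power_mult_distrib mult_ac power2_eq_square)
    qed
    show "((\<lambda>t. \<bar>t\<bar> * (norm (1 :: 'n rsq) * (norm X)\<^sup>2 * exp (\<bar>t\<bar> * norm X))) \<longlongrightarrow> 0) (at 0)"
      by (rule tendsto_eq_rhs, (rule tendsto_intros)+) auto
  qed auto
  then show ?thesis
    unfolding has_vector_derivative_def has_derivative_at
    by (auto simp: bounded_linear_scaleR_left)
qed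

lemma mexp_has_vector_derivative:
  "((\<lambda>t. mexp (t *\<^sub>R X)) has_vector_derivative (mexp (s *\<^sub>R X) * X)) (at s)"
  for X :: "'n::finite rsq"
proof -
  have "((\<lambda>t. t - s) has_derivative (\<lambda>h. h)) (at s)"
    by (auto intro!: derivative_eq_intros)
  moreover have "((\<lambda>t. mexp (t *\<^sub>R X)) has_derivative (\<lambda>h. h *\<^sub>R X)) (at (s - s))"
    using mexp_has_vector_derivative_0[of X] by (simp add: has_vector_derivative_def)
  ultimately have "((\<lambda>t. mexp ((t - s) *\<^sub>R X)) has_derivative (\<lambda>h. h *\<^sub>R X)) (at s)"
    using has_derivative_compose by blast
  then have "((\<lambda>t. mexp (s *\<^sub>R X) * mexp ((t - s) *\<^sub>R X)) has_derivative (\<lambda>h. mexp (s *\<^sub>R X) * (h *\<^sub>R X))) (at s)"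
    by (rule bounded_linear.has_derivative[OF bounded_linear_mult_right])
  moreover have "mexp (s *\<^sub>R X) * mexp ((t - s) *\<^sub>R X) = mexp (t *\<^sub>R X)" for t
    using mexp_scaleR_add[of s "t - s" X] by simp
  ultimately show ?thesis by (simp add: has_vector_derivative_def)
qed

section \<open>Closed matrix groups and their Lie algebras\<close>

lemma norm_power_diff_sqm_le:
  fixes X Y :: "'n::finite rsq"
  assumes "norm X \<le> M" "norm Y \<le> M"
  shows "norm (X ^ k - Y ^ k) \<le> norm (1 :: 'n rsq) * (real k * M ^ (k - 1)) * norm (X - Y)"
proof (induction k)
  case (Suc k)
  have M: "0 \<le> M" using assms norm_ge_zero order_trans by blast
  let ?c = "norm (1 :: 'n rsq)"
  have "norm (X ^ Suc k - Y ^ Suc k) = norm (X * (X ^ k - Y ^ k) + (X - Y) * Y ^ k)"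
    by (simp add: algebra_simps)
  also have "\<dots> \<le> norm X * norm (X ^ k - Y ^ k) + norm (X - Y) * norm (Y ^ k)"
    by (intro order_trans[OF norm_triangle_ineq] add_mono norm_mult_ineq)
  also have "\<dots> \<le> M * (?c * (real k * M ^ (k - 1)) * norm (X - Y)) + norm (X - Y) * (?c * M ^ k)"
  proof (intro add_mono mult_mono Suc assms mult_left_mono)
    show "norm (Y ^ k) \<le> ?c * M ^ k"
      by (rule order_trans[OF norm_power_sqm_le]) (intro mult_left_mono power_mono assms; simp)
  qed (use M in auto)
  also have "\<dots> = ?c * (real (Suc k) * M ^ (Suc k - 1)) * norm (X - Y)"
    by (cases k) (auto simp: algebra_simps)
  finally show ?case .
qed simp

lemma norm_mexp_lipschitz:
  fixes X Y :: "'n::finite rsq"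
  assumes "norm X \<le> M" "norm Y \<le> M"
  shows "norm (mexp X - mexp Y) \<le> norm (1 :: 'n rsq) * exp M * norm (X - Y)"
proof -
  let ?c = "norm (1 :: 'n rsq)"
  have e: "(\<lambda>k. real k * M ^ (k - 1) / fact k) sums exp M"
  proof -
    have "(\<lambda>k. M ^ k /\<^sub>R fact k) sums exp M" by (rule exp_converges)
    moreover have "real (Suc k) * M ^ (Suc k - 1) / fact (Suc k) = M ^ k /\<^sub>R fact k" for k
      using of_nat_neq_0[of k, where 'a = real] by (simp add: divide_simps)
    ultimately have "(\<lambda>k. real (Suc k) * M ^ (Suc k - 1) / fact (Suc k)) sums exp M" by simp
    from sums_Suc[OF this[unfolded comp_def]] show ?thesis by simp
  qed
  have "(\<lambda>k. X ^ k /\<^sub>R fact k - Y ^ k /\<^sub>R fact k) sums (mexp X - mexp Y)"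
    by (intro sums_diff mexp_sums)
  moreover have "(\<lambda>k. ?c * norm (X - Y) * (real k * M ^ (k - 1) / fact k)) sums (?c * norm (X - Y) * exp M)"
    by (intro sums_mult e)
  moreover have "norm (X ^ k /\<^sub>R fact k - Y ^ k /\<^sub>R fact k) \<le> ?c * norm (X - Y) * (real k * M ^ (k - 1) / fact k)" for k
  proof -
    have "norm (X ^ k /\<^sub>R fact k - Y ^ k /\<^sub>R fact k) = norm (X ^ k - Y ^ k) / fact k"
      unfolding scaleR_diff_right[symmetric] by (simp add: divide_inverse mult.commute)
    also have "\<dots> \<le> ?c * (real k * M ^ (k - 1)) * norm (X - Y) / fact k"
      by (intro divide_right_mono norm_power_diff_sqm_le assms) simp
    finally show ?thesis by (simp add: mult_ac)
  qed
  ultimately have "norm (mexp X - mexp Y) \<le> ?c * norm (X - Y) * exp M"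
    by (rule norm_sums_le)
  then show ?thesis by (simp only: mult_ac)
qed

lemma tendsto_mexp [tendsto_intros]:
  fixes f :: "'a \<Rightarrow> 'n::finite rsq"
  assumes f: "(f \<longlongrightarrow> Z) F" shows "((\<lambda>x. mexp (f x)) \<longlongrightarrow> mexp Z) F"
proof -
  let ?c = "norm (1 :: 'n rsq)" and ?M = "norm Z + 1"
  have "\<forall>\<^sub>F x in F. dist (f x) Z < 1" using tendstoD[OF f, of 1] by simp
  then have "\<forall>\<^sub>F x in F. norm (mexp (f x) - mexp Z) \<le> ?c * exp ?M * norm (f x - Z)"
  proof (rule eventually_mono)
    fix x assume "dist (f x) Z < 1"
    then have 1: "norm (f x) \<le> ?M" using norm_triangle_sub[of "f x" Z] by (simp add: dist_norm)
    show "norm (mexp (f x) - mexp Z) \<le> ?c * exp ?M * norm (f x - Z)"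
      by (rule norm_mexp_lipschitz[OF 1]) simp
  qed
  moreover have "((\<lambda>x. ?c * exp ?M * norm (f x - Z)) \<longlongrightarrow> 0) F"
    by (rule tendsto_eq_rhs, (rule tendsto_intros f)+) simp
  ultimately have "((\<lambda>x. mexp (f x) - mexp Z) \<longlongrightarrow> 0) F" by (rule Lim_null_comparison)
  then show ?thesis by (subst Lim_null)
qed

text \<open>Telescoping bounds the distance of \<open>(1 + B) ^ k\<close> from
  \<open>mexp B ^ k\<close> by k times the one-step error, up to bounded factors. That error is
  quadratic in B, so with B = \<open>A j\<close> and k = \<open>m j\<close> the total is of order
  \<open>norm (m j *\<^sub>R A j) * norm (A j)\<close> and tends to 0.\<close>

lemma power_limit_mexp:
  fixes A :: "nat \<Rightarrow> 'n::finite rsq"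
  assumes A: "A \<longlonglongrightarrow> 0" and mA: "(\<lambda>j. real (m j) *\<^sub>R A j) \<longlonglongrightarrow> Z"
  shows "(\<lambda>j. (1 + A j) ^ m j) \<longlonglongrightarrow> mexp Z"
proof -
  let ?c = "norm (1 :: 'n rsq)"
  have bound: "norm ((1 + B) ^ k - mexp B ^ k) \<le> real k * norm (1 + B - mexp B) * ?c * exp (norm B) ^ k" for B :: "'n rsq" and k
  proof (induction k)
    case (Suc k)
    let ?d = "norm (1 + B - mexp B)" and ?E = "exp (norm B)"
    have E: "1 + norm B \<le> ?E" "1 \<le> ?E" by (simp_all add: exp_ge_add_one_self)
    have "norm ((1 + B) * C) \<le> ?E * norm C" for C
    proof -
      have "norm ((1 + B) * C) \<le> norm C + norm B * norm C"
        by (simp add: distrib_right) (meson norm_triangle_ineq norm_mult_ineq add_left_mono order_trans)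
      also have "\<dots> = (1 + norm B) * norm C" by (simp add: distrib_right)
      also have "\<dots> \<le> ?E * norm C" using E by (intro mult_right_mono) auto
      finally show ?thesis .
    qed
    then have 1: "norm ((1 + B) * ((1 + B) ^ k - mexp B ^ k)) \<le> ?E * (real k * ?d * ?c * ?E ^ k)"
      using Suc by (meson order_trans mult_left_mono exp_ge_zero)
    have "norm (mexp B ^ k) \<le> ?c * ?E ^ k"
      using norm_mexp_le[of "real k *\<^sub>R B"] by (simp add: mexp_of_nat exp_of_nat_mult)
    then have 2: "norm ((1 + B - mexp B) * mexp B ^ k) \<le> ?d * (?c * ?E ^ k)"
      by (meson order_trans norm_mult_ineq mult_left_mono norm_ge_zero)
    have "(1 + B) ^ Suc k - mexp B ^ Suc k
        = (1 + B) * ((1 + B) ^ k - mexp B ^ k) + (1 + B - mexp B) * mexp B ^ k"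
      by (simp add: algebra_simps)
    then have "norm ((1 + B) ^ Suc k - mexp B ^ Suc k) \<le> ?E * (real k * ?d * ?c * ?E ^ k) + ?d * (?c * ?E ^ k)"
      using norm_triangle_mono[OF 1 2] by simp
    also have "\<dots> \<le> ?E * (real k * ?d * ?c * ?E ^ k) + ?E * (?d * (?c * ?E ^ k))"
      using mult_right_mono[OF E(2), of "?d * (?c * ?E ^ k)"] by simp
    also have "\<dots> = real (Suc k) * ?d * ?c * ?E ^ Suc k"
      by (simp add: algebra_simps)
    finally show ?case .
  qed simp
  have "norm ((1 + A j) ^ m j - mexp (real (m j) *\<^sub>R A j))
      \<le> ?c * ?c * norm (real (m j) *\<^sub>R A j) * norm (A j) * exp (norm (A j)) * exp (norm (real (m j) *\<^sub>R A j))" for j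
  proof -
    have "norm ((1 + A j) ^ m j - mexp (real (m j) *\<^sub>R A j))
        \<le> real (m j) * norm (mexp (A j) - 1 - A j) * ?c * exp (norm (A j)) ^ m j"
      using bound[of "A j" "m j"] by (simp add: mexp_of_nat norm_minus_commute algebra_simps)
    also have "\<dots> \<le> real (m j) * (?c * ((norm (A j))\<^sup>2 * exp (norm (A j)))) * ?c * exp (norm (A j)) ^ m j"
      by (intro mult_right_mono mult_left_mono norm_mexp_diff_le) auto
    also have "\<dots> = ?c * ?c * norm (real (m j) *\<^sub>R A j) * norm (A j) * exp (norm (A j)) * exp (norm (real (m j) *\<^sub>R A j))"
      by (simp add: power2_eq_square exp_of_nat_mult)
    finally show ?thesis .
  qed
  moreover have "(\<lambda>j. ?c * ?c * norm (real (m j) *\<^sub>R A j) * norm (A j) * exp (norm (A j)) * exp (norm (real (m j) *\<^sub>R A j)))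
      \<longlonglongrightarrow> ?c * ?c * norm Z * norm (0 :: 'n rsq) * exp (norm (0 :: 'n rsq)) * exp (norm Z)"
    by (intro tendsto_intros A mA)
  then have "(\<lambda>j. ?c * ?c * norm (real (m j) *\<^sub>R A j) * norm (A j) * exp (norm (A j)) * exp (norm (real (m j) *\<^sub>R A j))) \<longlonglongrightarrow> 0"
    by simp
  ultimately have "(\<lambda>j. (1 + A j) ^ m j - mexp (real (m j) *\<^sub>R A j)) \<longlonglongrightarrow> 0"
    by (rule Lim_null_comparison[OF always_eventually[OF allI]])
  from tendsto_add[OF this tendsto_mexp[OF mA]] show ?thesis by simp
qed

text \<open>Left multiplication by \<open>k\<close> is injective, hence surjective in finite
  dimension; a preimage of 1 is an inverse.\<close>

lemma near_one_inverses:
  fixes k :: "'n::finite rsq"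
  assumes "norm (k - 1) < 1" obtains y where "inverses k y"
proof -
  have lin: "linear (\<lambda>x. k * x)"
    by (simp add: linear_iff distrib_left)
  have "inj (\<lambda>x. k * x)"
    unfolding linear_injective_0[OF lin]
  proof (intro allI impI)
    fix x assume "k * x = 0"
    then have "x = - ((k - 1) * x)" by (simp add: algebra_simps)
    then have "norm x \<le> norm (k - 1) * norm x" by (metis norm_minus_cancel norm_mult_ineq)
    then show "x = 0" using assms by (metis mult_le_cancel_right1 norm_eq_zero not_le zero_less_norm_iff)
  qed
  then have "surj (\<lambda>x. k * x)" using lin by (simp add: linear_injective_imp_surjective)
  then show ?thesis using that by (metis inverses_def surjD)
qed

lemma vector_derivative_quotient:
  assumes "(f has_vector_derivative D) (at 0)"
  shows "((\<lambda>h. (f h - f 0) /\<^sub>R h) \<longlongrightarrow> D) (at 0)"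
proof -
  have "((\<lambda>h. norm (f h - f 0 - h *\<^sub>R D) / norm h) \<longlongrightarrow> 0) (at 0)"
    using assms by (simp add: has_vector_derivative_def has_derivative_at)
  then have "((\<lambda>h. norm ((f h - f 0) /\<^sub>R h - D)) \<longlongrightarrow> 0) (at 0)"
  proof (rule Lim_transform_eventually, intro eventually_mono[OF eventually_neq_at_within[of 0]])
    fix h :: real assume "h \<noteq> 0"
    then have "(f h - f 0) /\<^sub>R h - D = (f h - f 0 - h *\<^sub>R D) /\<^sub>R h"
      by (simp add: scaleR_diff_right)
    then show "norm (f h - f 0 - h *\<^sub>R D) / norm h = norm ((f h - f 0) /\<^sub>R h - D)"
      by (simp add: divide_inverse)
  qed
  then show ?thesis using Lim_null tendsto_norm_zero_iff by blast
qed

text \<open>Defined by one-parameter groups, which makes \<open>mexp\<close> available at once;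
  \<open>curve_in_lieal\<close> shows that tangent vectors of arbitrary differentiable curves give
  nothing more.\<close>

definition lieal :: "'n::finite rsq set \<Rightarrow> 'n rsq set" where
  "lieal G = {X. \<forall>t. mexp (t *\<^sub>R X) \<in> G}"

text \<open>The last assumption is closedness relative to the invertible matrices: a limit counts
  only if it has an inverse.\<close>

locale matgroup =
  fixes G :: "'n::finite rsq set"
  assumes one_mem: "1 \<in> G"
    and mult_mem: "\<lbrakk>g \<in> G; h \<in> G\<rbrakk> \<Longrightarrow> g * h \<in> G"
    and inv_mem: "g \<in> G \<Longrightarrow> \<exists>h\<in>G. inverses g h"
    and limit_mem: "\<lbrakk>\<And>k. u k \<in> G; u \<longlonglongrightarrow> x; inverses x y\<rbrakk> \<Longrightarrow> x \<in> G"
begin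

lemma inverses_mem: "g \<in> G \<Longrightarrow> inverses g h \<Longrightarrow> h \<in> G"
  using inv_mem inverses_unique by blast

lemma power_mem: "g \<in> G \<Longrightarrow> g ^ k \<in> G"
  by (induction k) (auto intro: one_mem mult_mem)

text \<open>The power of \<open>k j\<close> with exponent the integer part of \<open>t / r j\<close>
  lies in \<open>G\<close> and converges to \<open>mexp (t *\<^sub>R Z)\<close>, so limiting
  directions of elements tending to 1 generate one-parameter groups in \<open>G\<close>.\<close>

lemma direction_in_lieal:
  assumes k: "\<And>j. k j \<in> G" "k \<longlonglongrightarrow> 1" and r: "\<And>j. r j > 0" "r \<longlonglongrightarrow> 0"
    and Z: "(\<lambda>j. (k j - 1) /\<^sub>R r j) \<longlonglongrightarrow> Z"
  shows "Z \<in> lieal G"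
proof -
  have pos: "mexp (t *\<^sub>R Z) \<in> G" if t: "t \<ge> 0" for t
  proof -
    define m where "m j = nat \<lfloor>t / r j\<rfloor>" for j
    have mr: "\<bar>real (m j) * r j - t\<bar> \<le> r j" for j
    proof -
      have "real (m j) = real_of_int \<lfloor>t / r j\<rfloor>"
        using t r(1)[of j] by (simp add: m_def)
      then have "real (m j) \<le> t / r j" "t / r j < real (m j) + 1" by linarith+
      then show ?thesis using r(1)[of j] by (auto simp: field_simps abs_le_iff)
    qed
    have "(\<lambda>j. real (m j) * r j - t) \<longlonglongrightarrow> 0"
      by (rule Lim_null_comparison[OF always_eventually r(2)]) (use mr in auto)
    then have "(\<lambda>j. real (m j) * r j) \<longlonglongrightarrow> t" by (simp add: Lim_null[symmetric])
    from tendsto_scaleR[OF this Z]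
    have "(\<lambda>j. (real (m j) * r j) *\<^sub>R ((k j - 1) /\<^sub>R r j)) \<longlonglongrightarrow> t *\<^sub>R Z" .
    moreover have "(real (m j) * r j) *\<^sub>R ((k j - 1) /\<^sub>R r j) = real (m j) *\<^sub>R (k j - 1)" for j
      using r(1)[of j] by simp
    ultimately have "(\<lambda>j. real (m j) *\<^sub>R (k j - 1)) \<longlonglongrightarrow> t *\<^sub>R Z" by (simp only:)
    moreover have "(\<lambda>j. k j - 1) \<longlonglongrightarrow> 0" using k(2) by (simp add: Lim_null[symmetric])
    ultimately have "(\<lambda>j. (1 + (k j - 1)) ^ m j) \<longlonglongrightarrow> mexp (t *\<^sub>R Z)"
      by (intro power_limit_mexp)
    then show ?thesis by (intro limit_mem[OF _ _ inverses_mexp]) (auto intro: power_mem k)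
  qed
  show ?thesis
    unfolding lieal_def
  proof safe
    fix t :: real
    show "mexp (t *\<^sub>R Z) \<in> G"
    proof (cases "t \<ge> 0")
      case False
      then have "mexp ((- t) *\<^sub>R Z) \<in> G" by (intro pos) auto
      then show ?thesis using inverses_mexp inverses_mem by fastforce
    qed (rule pos)
  qed
qed

lemma curve_in_lieal:
  assumes g: "\<And>t. g t \<in> G" "g 0 = 1" "(g has_vector_derivative X) (at 0)"
  shows "X \<in> lieal G"
proof -
  define r where "r j = inverse (real (Suc j))" for j
  have r: "r \<longlonglongrightarrow> 0" unfolding r_def by (rule LIMSEQ_inverse_real_of_nat)
  then have "filterlim r (at 0) sequentially"
    by (simp add: filterlim_at r_def)
  moreover have "((\<lambda>t. (g t - g 0) /\<^sub>R t) \<longlongrightarrow> X) (at 0)"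
    by (rule vector_derivative_quotient[OF g(3)])
  ultimately have "(\<lambda>j. (g (r j) - 1) /\<^sub>R r j) \<longlonglongrightarrow> X"
    using g(2) by (auto intro: filterlim_compose)
  moreover have "(\<lambda>j. g (r j)) \<longlonglongrightarrow> 1"
    using isCont_tendsto_compose[OF has_vector_derivative_continuous[OF g(3)] r] g(2) by simp
  ultimately show ?thesis
    using r g(1) by (intro direction_in_lieal[of "\<lambda>j. g (r j)" r]) (auto simp: r_def)
qed

lemma lieal_mexp: "X \<in> lieal G \<Longrightarrow> mexp (t *\<^sub>R X) \<in> G"
  by (simp add: lieal_def)

lemma lieal_Ad:
  assumes "g \<in> G" "inverses g h" "X \<in> lieal G" shows "g * X * h \<in> lieal G"
  unfolding lieal_def
proof safe
  fix t
  have "mexp (t *\<^sub>R (g * X * h)) = g * mexp (t *\<^sub>R X) * h"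
    using mexp_conj[OF assms(2), of "t *\<^sub>R X"] by simp
  then show "mexp (t *\<^sub>R (g * X * h)) \<in> G"
    using assms inverses_mem by (auto intro!: mult_mem lieal_mexp)
qed

lemma subspace_lieal: "subspace (lieal G)"
  unfolding subspace_def
proof safe
  show "0 \<in> lieal G" by (simp add: lieal_def one_mem)
next
  fix X Y assume XY: "X \<in> lieal G" "Y \<in> lieal G"
  have "((\<lambda>t. mexp (t *\<^sub>R X) * mexp (t *\<^sub>R Y)) has_vector_derivative
      (mexp (0 *\<^sub>R X) * Y + X * mexp (0 *\<^sub>R Y))) (at 0)"
    by (intro has_vector_derivative_mult mexp_has_vector_derivative_0)
  then show "X + Y \<in> lieal G"
    using XY by (intro curve_in_lieal[of "\<lambda>t. mexp (t *\<^sub>R X) * mexp (t *\<^sub>R Y)"])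
      (auto intro: mult_mem lieal_mexp simp: add.commute)
next
  fix c X assume "X \<in> lieal G"
  then show "c *\<^sub>R X \<in> lieal G" by (simp add: lieal_def)
qed

end

lemma has_vector_derivative_subspace:
  fixes f :: "real \<Rightarrow> 'a::euclidean_space"
  assumes W: "subspace W" "\<And>t. f t \<in> W" and d: "(f has_vector_derivative D) (at 0)"
  shows "D \<in> W"
proof -
  have "((\<lambda>h. (f h - f 0) /\<^sub>R h) \<longlongrightarrow> D) (at 0)"
    by (rule vector_derivative_quotient[OF d])
  then show ?thesis
    by (rule Lim_in_closed_set[OF closed_subspace[OF W(1)], rotated 2])
       (use W in \<open>auto intro!: always_eventually subspace_scale subspace_diff\<close>)
qed

lemma ad_derivative:
  "((\<lambda>t. mexp (t *\<^sub>R X) * Y * mexp (- (t *\<^sub>R X))) has_vector_derivative (X * Y - Y * X)) (at 0)"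
  for X :: "'n::finite rsq"
proof -
  have "((\<lambda>t. mexp (t *\<^sub>R (- X))) has_vector_derivative - X) (at 0)"
    by (rule mexp_has_vector_derivative_0)
  then have "((\<lambda>t. mexp (t *\<^sub>R X) * (Y * mexp (t *\<^sub>R (- X)))) has_vector_derivative
      (mexp (0 *\<^sub>R X) * (Y * (- X)) + X * (Y * mexp (0 *\<^sub>R (- X))))) (at 0)"
    by (intro has_vector_derivative_mult mexp_has_vector_derivative_0
        bounded_linear.has_vector_derivative[OF bounded_linear_mult_right])
  then show ?thesis by (simp add: mult.assoc)
qed

text \<open>The bracket is the derivative at 0 of conjugation by the one-parameter group of
  \<open>X\<close>, a curve inside the closed subspace \<open>W\<close>.\<close>

lemma (in matgroup) bracket_mem:
  assumes W: "subspace W" "\<And>g h Y. \<lbrakk>g \<in> G; inverses g h; Y \<in> W\<rbrakk> \<Longrightarrow> g * Y * h \<in> W"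
    and "X \<in> lieal G" "Y \<in> W"
  shows "X * Y - Y * X \<in> W"
  by (rule has_vector_derivative_subspace[OF W(1) _ ad_derivative])
     (use assms inverses_mexp lieal_mexp in blast)

text \<open>Only openness of \<open>H\<close> near 1 is at stake. If elements of \<open>G\<close>
  outside \<open>H\<close> tended to 1, the points \<open>k\<close> closest to 1 in their cosets of
  \<open>H\<close> would have a limiting direction \<open>Z\<close> in the Lie algebra, and
  multiplying by an exponential of \<open>- Z\<close>, an element of \<open>H\<close>, would bring
  them closer to 1 than the minimum.\<close>

theorem (in matgroup) connected_generated:
  assumes conn: "connected G" and H: "matgroup H" "H \<subseteq> G" "\<And>X. X \<in> lieal G \<Longrightarrow> mexp X \<in> H"
  shows "H = G"
proof -
  interpret H: matgroup H by fact
  have near: "\<exists>e>0. \<forall>g\<in>G. norm (g - 1) < e \<longrightarrow> g \<in> H"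
  proof (rule ccontr)
    assume "\<not> (\<exists>e>0. \<forall>g\<in>G. norm (g - 1) < e \<longrightarrow> g \<in> H)"
    then have "\<forall>j. \<exists>g. g \<in> G \<and> norm (g - 1) < inverse (real (Suc j)) \<and> g \<notin> H"
      by (metis inverse_positive_iff_positive of_nat_0_less_iff zero_less_Suc)
    then obtain g where g: "\<And>j. g j \<in> G" "\<And>j. norm (g j - 1) < inverse (real (Suc j))" "\<And>j. g j \<notin> H"
      by metis
    have "\<exists>k. (\<exists>h\<in>H. k = h * g j) \<and> norm (k - 1) \<le> norm (g j - 1) \<and>
        (\<forall>h\<in>H. norm (k - 1) \<le> norm (h * g j - 1))" for j
    proof -
      \<comment> \<open>The part of the coset at distance from 1 not above that of
        \<open>g j\<close>. Since that distance is below 1, limits are invertible, so this set is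
        closed although \<open>H\<close> is closed only among invertible matrices.\<close>
      let ?S = "{k. (\<exists>h\<in>H. k = h * g j) \<and> norm (k - 1) \<le> norm (g j - 1)}"
      have lt1: "norm (g j - 1) < 1"
        using g(2)[of j] by (rule order_less_le_trans) (simp add: field_simps)
      obtain gi where gi: "inverses (g j) gi" using near_one_inverses[OF lt1] .
      have "closed ?S"
        unfolding closed_sequential_limits
      proof (intro allI impI, elim conjE)
        fix x l assume x: "\<forall>n. x n \<in> ?S" "x \<longlonglongrightarrow> l"
        have "norm (l - 1) \<le> norm (g j - 1)"
          by (rule LIMSEQ_le_const2[OF tendsto_norm[OF tendsto_diff[OF x(2) tendsto_const]]]) (use x(1) in auto)
        moreover from this obtain li where "inverses l li"
          using near_one_inverses lt1 by (meson order_le_less_trans)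
        moreover have 1: "x n * gi \<in> H" for n
        proof -
          obtain h where "h \<in> H" "x n = h * g j" using x(1) by blast
          then show ?thesis using inversesD[OF gi] by (simp add: mult.assoc)
        qed
        moreover have 2: "(\<lambda>n. x n * gi) \<longlonglongrightarrow> l * gi" by (intro tendsto_intros x)
        ultimately have "l * gi \<in> H"
          by (intro H.limit_mem[OF 1 2 inverses_mult[OF _ inverses_sym[OF gi]]])
        moreover have "l = l * gi * g j" using inversesD[OF gi] by simp
        ultimately show "l \<in> ?S" using \<open>norm (l - 1) \<le> norm (g j - 1)\<close> by blast
      qed
      moreover have "bounded ?S"
      proof (rule boundedI)
        fix x assume "x \<in> ?S"
        then show "norm x \<le> norm (g j - 1) + norm (1 :: 'n rsq)"
          using norm_triangle_sub[of x 1] by simp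
      qed
      ultimately have "compact ?S" by (simp add: compact_eq_bounded_closed)
      moreover have gS: "g j \<in> ?S" by simp (metis H.one_mem mult_1_left)
      moreover have "continuous_on ?S (\<lambda>k. norm (k - 1))" by (intro continuous_intros)
      ultimately obtain k where k: "k \<in> ?S" "\<And>y. y \<in> ?S \<Longrightarrow> norm (k - 1) \<le> norm (y - 1)"
        using continuous_attains_inf[of ?S "\<lambda>k. norm (k - 1)"] by blast
      have "norm (k - 1) \<le> norm (h * g j - 1)" if "h \<in> H" for h
      proof (cases "norm (h * g j - 1) \<le> norm (g j - 1)")
        case True
        then show ?thesis using k(2) that by blast
      next
        case False
        then show ?thesis using k(1) by simp
      qed
      with k(1) show ?thesis by blast
    qed
    then obtain k where k: "\<And>j. \<exists>h\<in>H. k j = h * g j" "\<And>j. norm (k j - 1) \<le> norm (g j - 1)"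
        "\<And>j h. h \<in> H \<Longrightarrow> norm (k j - 1) \<le> norm (h * g j - 1)" by metis
    have kG: "k j \<in> G" for j using k(1)[of j] g(1)[of j] H(2) mult_mem by auto
    have kH: "k j \<notin> H" for j
    proof
      assume "k j \<in> H"
      moreover obtain h where h: "h \<in> H" "k j = h * g j" using k(1) by blast
      moreover obtain hi where "hi \<in> H" "inverses h hi" using h H.inv_mem by blast
      ultimately have "g j \<in> H" by (metis H.mult_mem inversesD(4))
      then show False using g(3) by blast
    qed
    define r where "r j = norm (k j - 1)" for j
    have rpos: "r j > 0" for j using kH[of j] H.one_mem by (auto simp: r_def)
    have r0: "r \<longlonglongrightarrow> 0"
    proof (rule Lim_null_comparison[OF always_eventually LIMSEQ_inverse_real_of_nat], rule allI)
      show "norm (r j) \<le> inverse (real (Suc j))" for j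
        using k(2)[of j] g(2)[of j] by (simp add: r_def)
    qed
    have "\<exists>l\<in>sphere 0 1. \<exists>s. strict_mono s \<and> ((\<lambda>j. (k j - 1) /\<^sub>R r j) \<circ> s) \<longlonglongrightarrow> l"
      using compact_sphere[of "0 :: 'n rsq" 1, unfolded compact_def, rule_format, of "\<lambda>j. (k j - 1) /\<^sub>R r j"]
        rpos by (auto simp: r_def)
    then obtain Z s where Z: "norm Z = 1" and s: "strict_mono s"
      and lim: "(\<lambda>j. (k (s j) - 1) /\<^sub>R r (s j)) \<longlonglongrightarrow> Z" by (auto simp: comp_def)
    have rs: "(\<lambda>j. r (s j)) \<longlonglongrightarrow> 0" using LIMSEQ_subseq_LIMSEQ[OF r0 s] by (simp add: comp_def)
    have "(\<lambda>j. r (s j) *\<^sub>R ((k (s j) - 1) /\<^sub>R r (s j))) \<longlonglongrightarrow> 0 *\<^sub>R Z"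
      by (intro tendsto_intros rs lim)
    then have "(\<lambda>j. k (s j) - 1) \<longlonglongrightarrow> 0" using rpos by (simp add: less_imp_neq[symmetric])
    then have ks: "(\<lambda>j. k (s j)) \<longlonglongrightarrow> 1" by (simp add: Lim_null[symmetric])
    have ZG: "Z \<in> lieal G"
      by (rule direction_in_lieal[OF _ ks _ rs lim]) (use kG rpos in auto)
    have lim1: "(\<lambda>j. mexp ((- r (s j)) *\<^sub>R Z)) \<longlonglongrightarrow> mexp ((- 0) *\<^sub>R Z)"
      by (intro tendsto_intros rs)
    have lim2: "(\<lambda>j. (mexp ((- r (s j)) *\<^sub>R Z) - 1) /\<^sub>R r (s j)) \<longlonglongrightarrow> - Z"
    proof -
      have "((\<lambda>t. (mexp (t *\<^sub>R (- Z)) - mexp (0 *\<^sub>R (- Z))) /\<^sub>R t) \<longlongrightarrow> - Z) (at 0)"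
        by (rule vector_derivative_quotient[OF mexp_has_vector_derivative_0])
      moreover have "filterlim (\<lambda>j. r (s j)) (at 0) sequentially"
        using rs rpos by (simp add: filterlim_at less_imp_neq[symmetric])
      ultimately show ?thesis using filterlim_compose by fastforce
    qed
    \<comment> \<open>First-order cancellation: \<open>k\<close> is 1 + r Z up to o(r), so the
      product with \<open>mexp (- r Z)\<close> differs from 1 by o(r), whereas minimality demands a
      distance of at least r.\<close>
    have "(\<lambda>j. mexp ((- r (s j)) *\<^sub>R Z) * ((k (s j) - 1) /\<^sub>R r (s j)) + (mexp ((- r (s j)) *\<^sub>R Z) - 1) /\<^sub>R r (s j))
        \<longlonglongrightarrow> mexp ((- 0) *\<^sub>R Z) * Z + - Z"
      by (intro tendsto_intros lim1[simplified] lim2[simplified] lim lim1 lim2)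
    moreover have "mexp ((- r (s j)) *\<^sub>R Z) * ((k (s j) - 1) /\<^sub>R r (s j)) + (mexp ((- r (s j)) *\<^sub>R Z) - 1) /\<^sub>R r (s j)
        = (mexp ((- r (s j)) *\<^sub>R Z) * k (s j) - 1) /\<^sub>R r (s j)" for j
      by (simp add: algebra_simps)
    ultimately have "(\<lambda>j. (mexp ((- r (s j)) *\<^sub>R Z) * k (s j) - 1) /\<^sub>R r (s j)) \<longlonglongrightarrow> 0" by simp
    from tendsto_norm_zero[OF this]
    have lim4: "(\<lambda>j. norm ((mexp ((- r (s j)) *\<^sub>R Z) * k (s j) - 1) /\<^sub>R r (s j))) \<longlonglongrightarrow> 0" .
    have ge: "1 \<le> norm ((mexp ((- r (s j)) *\<^sub>R Z) * k (s j) - 1) /\<^sub>R r (s j))" for j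
    proof -
      obtain h where h: "h \<in> H" "k (s j) = h * g (s j)" using k(1) by blast
      have "mexp ((- r (s j)) *\<^sub>R Z) \<in> H" using H(3) subspace_scale[OF subspace_lieal ZG] by blast
      then have "r (s j) \<le> norm (mexp ((- r (s j)) *\<^sub>R Z) * k (s j) - 1)"
        using k(3)[of "mexp ((- r (s j)) *\<^sub>R Z) * h" "s j"] h H.mult_mem by (simp add: r_def mult.assoc)
      moreover have "norm (x /\<^sub>R r (s j)) = norm x / r (s j)" for x :: "'n rsq"
        using rpos[of "s j"] by (simp add: divide_inverse mult.commute)
      ultimately show ?thesis using rpos[of "s j"] by (simp only: le_divide_eq_1_pos)
    qed
    have "1 \<le> (0::real)" by (rule LIMSEQ_le_const[OF lim4]) (use ge in auto)
    then show False by simp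
  qed
  then obtain e where e: "e > 0" "\<And>g. g \<in> G \<Longrightarrow> norm (g - 1) < e \<Longrightarrow> g \<in> H" by blast
  have "openin (top_of_set G) H"
    unfolding openin_euclidean_subtopology_iff
  proof (intro conjI ballI H(2))
    fix h assume h: "h \<in> H"
    obtain hi where hi: "hi \<in> H" "inverses h hi" using h H.inv_mem by blast
    have "norm hi \<noteq> 0" using hi inversesD(1)[OF hi(2)] by auto
    show "\<exists>d>0. \<forall>x'\<in>G. dist x' h < d \<longrightarrow> x' \<in> H"
    proof (intro exI[of _ "e / norm hi"] conjI ballI impI)
      show "e / norm hi > 0" using e \<open>norm hi \<noteq> 0\<close> by simp
      fix x assume x: "x \<in> G" "dist x h < e / norm hi"
      have "norm (hi * x - 1) = norm (hi * (x - h))"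
        using inversesD[OF hi(2)] by (simp add: right_diff_distrib)
      also have "\<dots> \<le> norm hi * norm (x - h)" by (rule norm_mult_ineq)
      also have "\<dots> < e" using x(2) \<open>norm hi \<noteq> 0\<close> by (simp add: dist_norm field_simps)
      finally have "hi * x \<in> H" using e(2) H(2) hi(1) x(1) mult_mem by blast
      then have "h * (hi * x) \<in> H" using h H.mult_mem by blast
      then show "x \<in> H" using inversesD[OF hi(2)] by simp
    qed
  qed
  moreover have "closedin (top_of_set G) H"
    unfolding closedin_limpt
  proof (intro conjI allI impI H(2))
    fix x assume "x islimpt H \<and> x \<in> G"
    then obtain f where "\<And>n. f n \<in> H" "f \<longlonglongrightarrow> x" "x \<in> G"
      by (auto simp: islimpt_sequential)
    then show "x \<in> H" using inv_mem H.limit_mem by blast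
  qed
  ultimately show ?thesis
    using conn H.one_mem unfolding connected_clopen by blast
qed

text \<open>The centralizer of \<open>Y\<close> in \<open>G\<close> is a closed subgroup containing
  all exponentials, hence everything.\<close>

lemma (in matgroup) commute_group:
  assumes conn: "connected G" and Y: "\<And>X. X \<in> lieal G \<Longrightarrow> X * Y = Y * X" and "g \<in> G"
  shows "g * Y = Y * g"
proof -
  let ?H = "{g \<in> G. g * Y = Y * g}"
  have "matgroup ?H"
  proof
    fix g assume g: "g \<in> ?H"
    then obtain h where h: "h \<in> G" "inverses g h" using inv_mem by blast
    have "h * Y = h * (Y * g) * h" using inversesD[OF h(2)] by (simp add: mult.assoc)
    also have "\<dots> = Y * h" using g inversesD[OF h(2)] by (metis (mono_tags, lifting) mem_Collect_eq mult.assoc)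
    finally show "\<exists>h\<in>?H. inverses g h" using h by blast
  next
    fix u x y assume u: "\<And>k. u k \<in> ?H" "u \<longlonglongrightarrow> x" "inverses x y"
    have "(\<lambda>k. u k * Y) \<longlonglongrightarrow> x * Y" "(\<lambda>k. Y * u k) \<longlonglongrightarrow> Y * x" by (intro tendsto_intros u)+
    then have "x * Y = Y * x" using u(1) by (simp add: LIMSEQ_unique)
    then show "x \<in> ?H" using limit_mem[of u x y] u by auto
  next
    fix g h assume "g \<in> ?H" "h \<in> ?H"
    then show "g * h \<in> ?H" by (auto intro: mult_mem) (metis mult.assoc)
  qed (auto intro: one_mem)
  then have "?H = G"
    by (rule connected_generated[OF conn])
       (use lieal_mexp[of _ 1] mexp_commute Y in auto)
  then show ?thesis using \<open>g \<in> G\<close> by blast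
qed

section \<open>Spectral idempotents\<close>

definition scal :: "'a::comm_ring_1 \<Rightarrow> ('a, 'n::finite) sqm" where
  "scal c = Sqm (\<lambda>i j. if i = j then c else 0)"

lemma ent_scal: "ent (scal c) i j = (if i = j then c else 0)"
  by (simp add: scal_def)

lemma ent_scal_mult [simp]: "ent (scal c * X) i j = c * ent X i j"
proof -
  have "ent (scal c * X) i j = (\<Sum>k\<in>UNIV. if i = k then c * ent X k j else 0)"
    unfolding ent_times by (intro sum.cong) (auto simp: ent_scal)
  then show ?thesis by simp
qed

lemma scal_commute: "X * scal c = scal c * X"
proof (rule sqm_eqI)
  fix i j
  have "ent (X * scal c) i j = (\<Sum>k\<in>UNIV. if k = j then c * ent X i k else 0)"
    unfolding ent_times by (intro sum.cong) (auto simp: ent_scal)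
  then show "ent (X * scal c) i j = ent (scal c * X) i j" by simp
qed

lemma scal_simps [simp]: "scal 0 = 0" "scal 1 = 1" "scal (a + b) = scal a + scal b"
  "scal (a - b) = scal a - scal b" "scal (- a) = - scal a" "scal (a * b) = scal a * scal b"
  by (rule sqm_eqI; simp add: ent_scal ent_one)+

lemma scal_left_commute: "X * (scal c * Y) = scal c * (X * Y)"
  by (metis mult.assoc scal_commute)

lemma scal_real: "scal r * X = r *\<^sub>R X" for X :: "'n::finite rsq"
  by (rule sqm_eqI) simp

definition pev :: "'a::comm_ring_1 poly \<Rightarrow> ('a, 'n::finite) sqm \<Rightarrow> ('a, 'n) sqm" where
  "pev p X = fold_coeffs (\<lambda>a b. scal a + X * b) p 0"

lemma pev_0 [simp]: "pev 0 X = 0"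
  by (simp add: pev_def)

lemma pev_pCons [simp]: "pev (pCons a p) X = scal a + X * pev p X"
  by (cases "p = 0 \<and> a = 0") (auto simp: pev_def)

lemma pev_add [simp]: "pev (p + q) X = pev p X + pev q X"
  by (induction p q rule: poly_induct2) (simp_all add: algebra_simps)

lemma scal_scal_left: "scal a * (scal b * X) = scal b * (scal a * X)"
  by (rule scal_left_commute)

lemma pev_smult [simp]: "pev (Polynomial.smult c p) X = scal c * pev p X"
proof (induction p)
  case (pCons a p)
  then show ?case
    by (simp add: distrib_left scal_left_commute[of X] scal_commute[of "scal c" a])
qed simp

lemma pev_mult [simp]: "pev (p * q) X = pev p X * pev q X"
  by (induction p) (simp_all add: algebra_simps)

lemma pev_1 [simp]: "pev 1 X = 1"
  by (simp add: one_pCons)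

lemma pev_minus [simp]: "pev (- p) X = - pev p X"
  by (induction p) simp_all

lemma pev_diff [simp]: "pev (p - q) X = pev p X - pev q X"
  using pev_add[of p "- q" X] by simp

lemma pev_power [simp]: "pev (p ^ k) X = pev p X ^ k"
  by (induction k) simp_all

lemma pev_commute: "X * Y = Y * X \<Longrightarrow> pev p X * Y = Y * pev p X"
proof (induction p)
  case (pCons a p)
  have "X * pev p X * Y = X * (Y * pev p X)" using pCons by (simp add: mult.assoc)
  also have "\<dots> = Y * (X * pev p X)" using pCons.prems by (metis mult.assoc)
  finally show ?case by (simp add: distrib_left distrib_right scal_commute)
qed simp

lemma pev_monom: "pev (Polynomial.monom c i) X = scal c * X ^ i"
  by (induction i) (auto simp: monom_0 monom_Suc scal_left_commute)

lemma pev_sum: "pev (sum f A) X = (\<Sum>a\<in>A. pev (f a) X)"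
  by (induction A rule: infinite_finite_induct) auto

lemma annihilating_poly:
  fixes X :: "'n::finite rsq"
  obtains p where "p \<noteq> 0" "pev p X = 0"
proof -
  let ?N = "DIM('n rsq)"
  \<comment> \<open>Linear dependence is a property of the set of powers; a repeated power, which
    would shrink the set, gives a polynomial directly.\<close>
  have "\<exists>p. p \<noteq> 0 \<and> pev p X = 0"
  proof (cases "inj_on (\<lambda>i. X ^ i) {..?N}")
    case False
    then obtain i j where ij: "i \<noteq> j" "X ^ i = X ^ j" by (auto simp: inj_on_def)
    have "coeff (Polynomial.monom 1 i - Polynomial.monom (1::real) j) i = 1" using ij by simp
    then have "Polynomial.monom 1 i - Polynomial.monom (1::real) j \<noteq> 0" by (metis coeff_0 zero_neq_one)
    moreover have "pev (Polynomial.monom 1 i - Polynomial.monom (1::real) j) X = 0"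
      using ij by (simp add: pev_monom)
    ultimately show ?thesis by blast
  next
    case inj: True
    let ?S = "(\<lambda>i. X ^ i) ` {..?N}"
    have "card ?S = Suc ?N" using inj by (simp add: card_image)
    then have "dependent ?S" using independent_bound[of ?S] by (auto)
    then obtain u where u: "\<exists>v\<in>?S. u v \<noteq> 0" "(\<Sum>v\<in>?S. u v *\<^sub>R v) = 0"
      using dependent_finite[of ?S] by auto
    define p where "p = (\<Sum>i\<le>?N. Polynomial.monom (u (X ^ i)) i)"
    have "pev p X = (\<Sum>i\<le>?N. u (X ^ i) *\<^sub>R X ^ i)"
      by (simp add: p_def pev_sum pev_monom scal_real)
    also have "\<dots> = 0" using u(2) inj by (simp add: sum.reindex)
    finally have "pev p X = 0" .
    moreover have "p \<noteq> 0"
    proof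
      obtain i where i: "i \<le> ?N" "u (X ^ i) \<noteq> 0" using u(1) by auto
      have "coeff p i = (\<Sum>k\<le>?N. if k = i then u (X ^ k) else 0)"
        unfolding p_def by (simp add: coeff_sum)
      then have "coeff p i = u (X ^ i)" using i by simp
      moreover assume "p = 0"
      ultimately show False using i by simp
    qed
    ultimately show ?thesis by blast
  qed
  then show ?thesis using that by blast
qed

section \<open>Complexification: real and imaginary parts, conjugation\<close>

definition cx :: "'n::finite rsq \<Rightarrow> 'n csq" where "cx X = Sqm (\<lambda>i j. of_real (ent X i j))"
definition rp :: "'n::finite csq \<Rightarrow> 'n rsq" where "rp X = Sqm (\<lambda>i j. Re (ent X i j))"
definition ip :: "'n::finite csq \<Rightarrow> 'n rsq" where "ip X = Sqm (\<lambda>i j. Im (ent X i j))"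
definition cj :: "'n::finite csq \<Rightarrow> 'n csq" where "cj X = Sqm (\<lambda>i j. cnj (ent X i j))"

lemma ent_cx [simp]: "ent (cx X) i j = of_real (ent X i j)"
  and ent_rp [simp]: "ent (rp M) i j = Re (ent M i j)"
  and ent_ip [simp]: "ent (ip M) i j = Im (ent M i j)"
  and ent_cj [simp]: "ent (cj M) i j = cnj (ent M i j)"
  by (simp_all add: cx_def rp_def ip_def cj_def)

lemma cx_simps [simp]: "cx 0 = 0" "cx 1 = 1" "cx (X + Y) = cx X + cx Y" "cx (X - Y) = cx X - cx Y"
  "cx (X * Y) = cx X * cx Y" "cx (- X) = - cx X"
  by (rule sqm_eqI; simp add: ent_one ent_times)+

lemma cx_power [simp]: "cx (X ^ k) = cx X ^ k"
  by (induction k) auto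

lemma cx_eq_iff [simp]: "cx X = cx Y \<longleftrightarrow> X = Y"
  by (metis Re_complex_of_real ent_cx sqm_eqI)

lemma cx_eq_0_iff [simp]: "cx X = 0 \<longleftrightarrow> X = 0"
  using cx_eq_iff[of X 0] by simp

lemma cj_simps [simp]: "cj 0 = 0" "cj 1 = 1" "cj (X + Y) = cj X + cj Y" "cj (X - Y) = cj X - cj Y"
  "cj (X * Y) = cj X * cj Y" "cj (- X) = - cj X" "cj (scal c) = scal (cnj c)" "cj (cx A) = cx A"
  "cj (cj X) = X"
  by (rule sqm_eqI; simp add: ent_one ent_times ent_scal)+

lemma cj_power [simp]: "cj (X ^ k) = cj X ^ k"
  by (induction k) auto

lemma cj_sum: "cj (sum f A) = (\<Sum>a\<in>A. cj (f a))"
  by (induction A rule: infinite_finite_induct) auto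

lemma cj_eq_0_iff [simp]: "cj X = 0 \<longleftrightarrow> X = 0"
  by (metis cj_simps(1,9))

lemma rp_ip_simps [simp]: "rp 0 = 0" "ip 0 = 0" "rp 1 = 1" "ip 1 = 0"
  "rp (M + N) = rp M + rp N" "ip (M + N) = ip M + ip N"
  "rp (cx A) = A" "ip (cx A) = 0"
  "rp (cx A * M) = A * rp M" "ip (cx A * M) = A * ip M"
  "rp (M * cx A) = rp M * A" "ip (M * cx A) = ip M * A"
  by (rule sqm_eqI; simp add: ent_one ent_times)+

lemma rp_ip_scal [simp]:
  "rp (scal c * M) = Re c *\<^sub>R rp M - Im c *\<^sub>R ip M"
  "ip (scal c * M) = Im c *\<^sub>R rp M + Re c *\<^sub>R ip M"
  "rp (cj M) = rp M" "ip (cj M) = - ip M"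
  by (rule sqm_eqI; simp)+

lemma rp_ip_mult: "rp (M * N) = rp M * rp N - ip M * ip N" "ip (M * N) = rp M * ip N + ip M * rp N"
  by (rule sqm_eqI; simp add: ent_times sum_subtractf sum.distrib)+

lemma rp_ip_eqI: "rp M = rp N \<Longrightarrow> ip M = ip N \<Longrightarrow> M = N"
  by (metis complex_eqI ent_ip ent_rp sqm_eqI)

lemma rp_sum: "rp (sum f A) = (\<Sum>a\<in>A. rp (f a))"
  by (induction A rule: infinite_finite_induct) auto

lemma cx_rp: "cj M = M \<Longrightarrow> cx (rp M) = M"
proof (rule sqm_eqI)
  fix i j assume "cj M = M"
  then have "cnj (ent M i j) = ent M i j" by (metis ent_cj)
  then show "ent (cx (rp M)) i j = ent M i j" by (simp add: complex_eq_iff)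
qed

lemma tp_cx: "tp (cx X) = cx (tp X)"
  by (rule sqm_eqI) simp

lemma pev_cx: "pev (map_poly of_real p) (cx X) = cx (pev p X)"
proof (induction p)
  case (pCons a p)
  have "scal (of_real a) = cx (scal a)" by (rule sqm_eqI) (simp add: ent_scal)
  then show ?case using pCons by (simp add: map_poly_pCons)
qed simp

text \<open>The projections onto the generalized eigenspaces. Commuting with every matrix that
  commutes with \<open>X\<close> stands for being a polynomial in \<open>X\<close> and is what makes
  the family unique.\<close>

definition spec :: "'n::finite csq \<Rightarrow> (complex \<Rightarrow> 'n csq) \<Rightarrow> bool" where
  "spec X e \<longleftrightarrow> finite {z. e z \<noteq> 0} \<and> (\<Sum>z | e z \<noteq> 0. e z) = 1 \<and>
     (\<forall>z w. z \<noteq> w \<longrightarrow> e z * e w = 0) \<and> (\<forall>z Y. X * Y = Y * X \<longrightarrow> e z * Y = Y * e z) \<and>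
     (\<forall>z. \<exists>k. (X - scal z) ^ k * e z = 0)"

text \<open>The identity for exponent k is multiplied by the one for exponent 1, which is division
  of \<open>q\<close> by the linear factor.\<close>

lemma bezout_linear_power:
  fixes q :: "complex poly"
  assumes "poly q z \<noteq> 0" shows "\<exists>a b. a * q + b * [:- z, 1:] ^ k = 1"
proof (induction k)
  case 0
  show ?case by (rule exI[of _ 0], rule exI[of _ 1]) simp
next
  case (Suc k)
  then obtain a b where ab: "a * q + b * [:- z, 1:] ^ k = 1" by blast
  have "poly (q - [:poly q z:]) z = 0" by simp
  then obtain r where r: "q - [:poly q z:] = [:- z, 1:] * r"
    using poly_eq_0_iff_dvd[THEN iffD1] unfolding dvd_def by blast
  define c where "c = [:inverse (poly q z):]"
  have c: "c * [:poly q z:] = 1" using assms by (simp add: c_def one_pCons)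
  have "c * q + (- c * r) * [:- z, 1:] = c * (q - [:- z, 1:] * r)" by (simp add: algebra_simps)
  also have "\<dots> = 1" using r c by (simp add: algebra_simps)
  finally have 1: "c * q + (- c * r) * [:- z, 1:] = 1" .
  have "1 = (a * q + b * [:- z, 1:] ^ k) * (c * q + (- c * r) * [:- z, 1:])" using ab 1 by simp
  also have "\<dots> = (a * (c * q + (- c * r) * [:- z, 1:]) + b * [:- z, 1:] ^ k * c) * q
      + (b * (- c * r)) * [:- z, 1:] ^ Suc k"
  proof -
    have "(a * q + b * L) * (c * q + (- c * r) * l)
        = (a * (c * q + (- c * r) * l) + b * L * c) * q + (b * (- c * r)) * (l * L)" for l L
      by (simp add: algebra_simps)
    then show ?thesis by (simp only: power_Suc)
  qed
  finally show ?case by metis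
qed

text \<open>A real annihilating polynomial splits over the complex numbers into powers
  \<open>l z\<close> of linear factors. With \<open>q z\<close> the product of the other factors and
  \<open>a z * q z + b z * l z = 1\<close>, the idempotent at z is the value of
  \<open>a z * q z\<close>.\<close>

lemma spec_exists: "\<exists>e. spec (cx X) e"
proof -
  obtain p where p: "p \<noteq> 0" "pev p X = 0" by (rule annihilating_poly)
  define P :: "complex poly" where "P = map_poly of_real p"
  have P0: "P \<noteq> 0" using p by (simp add: P_def map_poly_eq_0_iff)
  have PX: "pev P (cx X) = 0" using p by (simp add: P_def pev_cx)
  define Z where "Z = {z. poly P z = 0}"
  have fin: "finite Z" using P0 poly_roots_finite by (auto simp: Z_def)
  define l where "l w = [:- w, 1:] ^ order w P" for w
  define D where "D = (\<Prod>w\<in>Z. l w)"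
  have "Polynomial.smult (lead_coeff P) D = P"
    using complex_poly_decompose[of P] by (simp add: D_def l_def Z_def)
  then have "scal (lead_coeff P) * pev D (cx X) = 0" using PX by (metis pev_smult)
  then have "scal (inverse (lead_coeff P)) * (scal (lead_coeff P) * pev D (cx X)) = 0" by simp
  then have DX: "pev D (cx X) = 0"
    using P0 unfolding mult.assoc[symmetric] scal_simps(6)[symmetric] by simp
  define q where "q z = (\<Prod>w\<in>Z - {z}. l w)" for z
  have Dq: "D = q z * l z" if "z \<in> Z" for z
    unfolding D_def q_def using fin that by (simp add: prod.remove[of Z z] mult.commute)
  have "poly (q z) z \<noteq> 0" for z
    using fin by (auto simp: q_def poly_prod l_def)
  then have "\<forall>z. \<exists>a b. a * q z + b * l z = 1"
    unfolding l_def using bezout_linear_power by blast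
  then obtain a b where ab: "\<And>z. a z * q z + b z * l z = 1" by metis
  have bl: "1 - a z * q z = b z * l z" for z
    using ab[of z] by (metis add_diff_cancel_left')
  define e where "e z = (if z \<in> Z then pev (a z * q z) (cx X) else 0)" for z
  have comm: "e z * Y = Y * e z" if "cx X * Y = Y * cx X" for z Y
    using that by (simp add: e_def pev_commute del: pev_mult)
  have orth: "e z * e w = 0" if "z \<noteq> w" for z w
  proof (cases "z \<in> Z \<and> w \<in> Z")
    case True
    have "q z = l w * (\<Prod>v\<in>Z - {z} - {w}. l v)"
      unfolding q_def using fin True that by (intro prod.remove) auto
    then have "(a z * q z) * (a w * q w) = (a z * (\<Prod>v\<in>Z - {z} - {w}. l v) * a w) * D"
      using Dq[of w] True by simp
    then show ?thesis using True DX by (metis e_def mult_zero_right pev_mult)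
  qed (auto simp: e_def)
  have idem: "e z * (1 - e z) = 0" for z
  proof (cases "z \<in> Z")
    case True
    have "(a z * q z) * (1 - a z * q z) = (a z * b z) * D"
      unfolding bl Dq[OF True] by (simp only: mult_ac)
    from arg_cong[OF this, of "\<lambda>p. pev p (cx X)"] show ?thesis
      using True DX unfolding e_def pev_mult pev_diff pev_1 by simp
  qed (simp add: e_def)
  \<comment> \<open>Every factor is \<open>b z * l z\<close>, so the product is a multiple of
    \<open>D\<close> and vanishes at \<open>X\<close>; by orthogonality it is also 1 minus the sum
    of the idempotents.\<close>
  have "(\<Prod>z\<in>Z. 1 - a z * q z) = (\<Prod>z\<in>Z. b z) * D"
    unfolding bl D_def prod.distrib ..
  then have "pev (\<Prod>z\<in>Z. 1 - a z * q z) (cx X) = 0" using DX by (simp only: pev_mult mult_zero_right)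
  moreover have "pev (\<Prod>z\<in>S. 1 - a z * q z) (cx X) = 1 - (\<Sum>z\<in>S. e z)" if "S \<subseteq> Z" for S
    using finite_subset[OF that fin] that
  proof (induction S rule: finite_induct)
    case (insert z S)
    have ez: "e z * (\<Sum>w\<in>S. e w) = 0"
      unfolding sum_distrib_left
    proof (intro sum.neutral ballI)
      fix x assume "x \<in> S"
      then have "z \<noteq> x" using insert by blast
      then show "e z * e x = 0" by (rule orth)
    qed
    have "pev (\<Prod>w\<in>insert z S. 1 - a w * q w) (cx X) = (1 - e z) * (1 - (\<Sum>w\<in>S. e w))"
      using insert by (simp add: e_def)
    then show ?case using insert ez by (simp add: algebra_simps)
  qed simp
  ultimately have sum1: "(\<Sum>z\<in>Z. e z) = 1" by auto
  have sub: "{z. e z \<noteq> 0} \<subseteq> Z" by (auto simp: e_def)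
  have "(\<Sum>z | e z \<noteq> 0. e z) = 1"
    unfolding sum1[symmetric] using sub fin by (intro sum.mono_neutral_left) auto
  moreover have "\<exists>k. (cx X - scal z) ^ k * e z = 0" for z
  proof (cases "z \<in> Z")
    case True
    have "l z * (a z * q z) = a z * D" unfolding Dq[OF True] by (simp only: mult_ac)
    from arg_cong[OF this, of "\<lambda>p. pev p (cx X)"]
    have "pev (l z) (cx X) * pev (a z * q z) (cx X) = 0" using DX unfolding pev_mult[of "l z"] by simp
    moreover have "pev (l z) (cx X) = (cx X - scal z) ^ order z P" by (simp add: l_def)
    ultimately show ?thesis using True unfolding e_def by auto
  qed (simp add: e_def)
  ultimately show ?thesis
    unfolding spec_def using comm orth finite_subset[OF sub fin] by blast
qed

text \<open>For different z and w, coprimality of the powers of the linear factors gives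
  \<open>e z * f w = 0\<close>. Inserting either resolution of 1 then shows that both
  \<open>e z\<close> and \<open>f z\<close> equal \<open>e z * f z\<close>.\<close>

lemma spec_unique:
  assumes "spec X e" "spec X f" shows "e = f"
proof -
  have orth: "e z * f w = 0" if zw: "z \<noteq> w" for z w
  proof -
    obtain k where k: "(X - scal z) ^ k * e z = 0" using assms(1) unfolding spec_def by blast
    obtain m where m: "(X - scal w) ^ m * f w = 0" using assms(2) unfolding spec_def by blast
    have "poly ([:- w, 1:] ^ m) z \<noteq> 0" using zw by simp
    then obtain a b where ab: "a * [:- w, 1:] ^ m + b * [:- z, 1:] ^ k = 1"
      using bezout_linear_power by blast
    have pz: "pev [:- c, 1:] X = X - scal c" for c by simp
    have "X * (X - scal w) ^ m = (X - scal w) ^ m * X"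
      using pev_commute[of X X "[:- w, 1:] ^ m"] by (simp only: pev_power pz)
    then have c: "e z * (X - scal w) ^ m = (X - scal w) ^ m * e z"
      using assms(1) unfolding spec_def by blast
    have "e z * f w = pev (a * [:- w, 1:] ^ m + b * [:- z, 1:] ^ k) X * (e z * f w)" using ab by simp
    also have "\<dots> = pev a X * ((X - scal w) ^ m * e z) * f w + pev b X * ((X - scal z) ^ k * e z) * f w"
      by (simp only: pev_add pev_mult pev_power pz distrib_right mult.assoc)
    also have "\<dots> = pev a X * e z * ((X - scal w) ^ m * f w)" by (simp add: k c[symmetric] mult.assoc)
    finally show ?thesis by (simp add: m)
  qed
  have fin: "finite {z. e z \<noteq> 0}" "finite {z. f z \<noteq> 0}" using assms by (simp_all add: spec_def)
  show ?thesis
  proof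
    fix z
    have "e z = e z * (\<Sum>w | f w \<noteq> 0. f w)" using assms(2) by (simp add: spec_def)
    also have "\<dots> = (\<Sum>w | f w \<noteq> 0. if w = z then e z * f z else 0)"
      unfolding sum_distrib_left by (intro sum.cong) (auto simp: orth)
    also have "\<dots> = e z * f z" using fin by simp
    finally have 1: "e z = e z * f z" .
    have "f z = (\<Sum>w | e w \<noteq> 0. e w) * f z" using assms(1) by (simp add: spec_def)
    also have "\<dots> = (\<Sum>w | e w \<noteq> 0. if w = z then e z * f z else 0)"
      unfolding sum_distrib_right by (intro sum.cong) (auto simp: orth)
    also have "\<dots> = e z * f z" using fin by simp
    finally show "e z = f z" using 1 by simp
  qed
qed

section \<open>Eigenprojections and functions of a real matrix\<close>

definition eig :: "'n::finite rsq \<Rightarrow> complex \<Rightarrow> 'n csq" where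
  "eig X = (SOME e. spec (cx X) e)"

definition sp :: "'n::finite rsq \<Rightarrow> complex set" where
  "sp X = {z. eig X z \<noteq> 0}"

lemma spec_eig: "spec (cx X) (eig X)"
  unfolding eig_def using someI_ex[OF spec_exists] .

lemma finite_sp: "finite (sp X)"
  and sum_eig: "(\<Sum>z\<in>sp X. eig X z) = 1"
  and eig_orth: "z \<noteq> w \<Longrightarrow> eig X z * eig X w = 0"
  and eig_commute: "cx X * M = M * cx X \<Longrightarrow> eig X z * M = M * eig X z"
  and eig_nilpotent: "\<exists>k. (cx X - scal z) ^ k * eig X z = 0"
  using spec_eig[of X] unfolding spec_def sp_def by blast+

lemma eig_commute_real: "X * Y = Y * X \<Longrightarrow> eig X z * cx Y = cx Y * eig X z"
  by (intro eig_commute) (metis cx_simps(5))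

lemma eig_idem: "eig X z * eig X z = eig X z"
proof -
  have "eig X z = eig X z * (\<Sum>w\<in>sp X. eig X w)" by (simp add: sum_eig)
  also have "\<dots> = (\<Sum>w\<in>sp X. if w = z then eig X z * eig X z else 0)"
    unfolding sum_distrib_left by (intro sum.cong) (auto simp: eig_orth)
  also have "\<dots> = eig X z * eig X z" using finite_sp[of X] by (simp add: sp_def)
  finally show ?thesis by simp
qed

text \<open>The conjugated and reindexed family is again a spectral resolution of the real matrix
  \<open>X\<close>, so uniqueness applies.\<close>

lemma cj_eig: "cj (eig X z) = eig X (cnj z)"
proof -
  define f where "f z = cj (eig X (cnj z))" for z
  have set: "{z. f z \<noteq> 0} = cnj ` sp X"
    by (auto simp: f_def sp_def image_iff) (metis complex_cnj_cnj)
  have "spec (cx X) f"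
    unfolding spec_def
  proof (intro conjI allI impI)
    show "finite {z. f z \<noteq> 0}" by (simp add: set finite_sp)
    have "(\<Sum>z | f z \<noteq> 0. f z) = (\<Sum>z\<in>sp X. f (cnj z))"
      unfolding set by (rule sum.reindex_cong[of cnj]) (auto simp: inj_on_def)
    also have "\<dots> = cj (\<Sum>z\<in>sp X. eig X z)" by (simp add: f_def cj_sum)
    finally show "(\<Sum>z | f z \<noteq> 0. f z) = 1" by (simp add: sum_eig)
    show "f z * f w = 0" if "z \<noteq> w" for z w
      using eig_orth[of "cnj z" "cnj w" X] that by (simp add: f_def flip: cj_simps(5))
    show "f z * Y = Y * f z" if "cx X * Y = Y * cx X" for z Y
    proof -
      have "cx X * cj Y = cj Y * cx X" using that by (metis cj_simps(5,8))
      from eig_commute[OF this, of "cnj z"] show ?thesis by (metis cj_simps(5,9) f_def)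
    qed
    show "\<exists>k. (cx X - scal z) ^ k * f z = 0" for z
    proof -
      obtain k where "(cx X - scal (cnj z)) ^ k * eig X (cnj z) = 0" using eig_nilpotent by blast
      then have "cj ((cx X - scal (cnj z)) ^ k * eig X (cnj z)) = 0" by simp
      then show ?thesis by (auto simp: f_def)
    qed
  qed
  then have "f = eig X" using spec_eig spec_unique by blast
  then show ?thesis by (metis complex_cnj_cnj f_def)
qed

lemma cnj_in_sp: "z \<in> sp X \<Longrightarrow> cnj z \<in> sp X"
  by (auto simp: sp_def simp flip: cj_eig)

lemma sp_inverses: assumes "inverses X Y" shows "0 \<notin> sp X"
proof
  assume "0 \<in> sp X"
  then have ne: "eig X 0 \<noteq> 0" by (simp add: sp_def)
  obtain k where "(cx X - scal 0) ^ k * eig X 0 = 0" using eig_nilpotent by blast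
  then have "cx X ^ k * eig X 0 = 0" by simp
  moreover have "cx Y ^ k * (cx X ^ k * M) = M" for k M
  proof (induction k arbitrary: M)
    case (Suc k)
    have "cx Y * cx X = 1" using assms by (metis cx_simps(2,5) inversesD(2))
    have "cx Y ^ Suc k * (cx X ^ Suc k * M) = cx Y ^ k * (cx Y * cx X) * (cx X ^ k * M)"
      by (simp only: power_Suc power_Suc2 mult.assoc) (simp add: power_commutes[symmetric] mult.assoc[symmetric])
    then show ?case using Suc \<open>cx Y * cx X = 1\<close> by simp
  qed simp
  ultimately show False using ne by (metis mult_zero_right)
qed

text \<open>The function \<open>\<phi>\<close> of the semisimple part of \<open>X\<close>; it is real when \<open>\<phi>\<close> commutes with conjugation.\<close>

definition fc :: "(complex \<Rightarrow> complex) \<Rightarrow> 'n::finite rsq \<Rightarrow> 'n rsq" where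
  "fc \<phi> X = rp (\<Sum>z\<in>sp X. scal (\<phi> z) * eig X z)"

definition csym :: "(complex \<Rightarrow> complex) \<Rightarrow> bool" where
  "csym \<phi> \<longleftrightarrow> (\<forall>z. \<phi> (cnj z) = cnj (\<phi> z))"

lemma cx_fc: assumes "csym \<phi>" shows "cx (fc \<phi> X) = (\<Sum>z\<in>sp X. scal (\<phi> z) * eig X z)"
  unfolding fc_def
proof (rule cx_rp)
  have "cj (\<Sum>z\<in>sp X. scal (\<phi> z) * eig X z) = (\<Sum>z\<in>sp X. scal (\<phi> (cnj z)) * eig X (cnj z))"
    using assms by (simp add: cj_sum cj_eig csym_def)
  also have "\<dots> = (\<Sum>z\<in>sp X. scal (\<phi> z) * eig X z)"
    by (rule sum.reindex_bij_witness[of _ cnj cnj]) (auto simp: cnj_in_sp)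
  finally show "cj (\<Sum>z\<in>sp X. scal (\<phi> z) * eig X z) = (\<Sum>z\<in>sp X. scal (\<phi> z) * eig X z)" .
qed

lemma fc_eig:
  assumes "csym \<phi>" shows "z \<in> sp X \<Longrightarrow> cx (fc \<phi> X) * eig X z = scal (\<phi> z) * eig X z"
    and "z \<in> sp X \<Longrightarrow> eig X z * cx (fc \<phi> X) = scal (\<phi> z) * eig X z"
proof -
  assume z: "z \<in> sp X"
  have "cx (fc \<phi> X) * eig X z = (\<Sum>w\<in>sp X. if w = z then scal (\<phi> z) * eig X z else 0)"
    unfolding cx_fc[OF assms] sum_distrib_right
    by (intro sum.cong) (auto simp: mult.assoc eig_idem eig_orth)
  then show "cx (fc \<phi> X) * eig X z = scal (\<phi> z) * eig X z" using z by (simp add: finite_sp)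
  have "eig X z * cx (fc \<phi> X) = (\<Sum>w\<in>sp X. if w = z then scal (\<phi> z) * eig X z else 0)"
    unfolding cx_fc[OF assms] sum_distrib_left
    by (intro sum.cong) (auto simp: scal_left_commute eig_idem eig_orth)
  then show "eig X z * cx (fc \<phi> X) = scal (\<phi> z) * eig X z" using z by (simp add: finite_sp)
qed

lemma eig_separate: "(\<And>z. z \<in> sp X \<Longrightarrow> M * eig X z = N * eig X z) \<Longrightarrow> M = N"
proof -
  assume "\<And>z. z \<in> sp X \<Longrightarrow> M * eig X z = N * eig X z"
  then have "M * (\<Sum>z\<in>sp X. eig X z) = N * (\<Sum>z\<in>sp X. eig X z)"
    by (simp add: sum_distrib_left)
  then show "M = N" by (simp add: sum_eig)
qed

lemma fc_mult: assumes "csym \<phi>" "csym \<psi>" shows "fc \<phi> X * fc \<psi> X = fc (\<lambda>z. \<phi> z * \<psi> z) X"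
proof -
  have c: "csym (\<lambda>z. \<phi> z * \<psi> z)" using assms by (simp add: csym_def)
  have "cx (fc \<phi> X) * cx (fc \<psi> X) = cx (fc (\<lambda>z. \<phi> z * \<psi> z) X)"
  proof (rule eig_separate[of X])
    fix z assume z: "z \<in> sp X"
    have "cx (fc \<phi> X) * cx (fc \<psi> X) * eig X z = scal (\<psi> z) * (scal (\<phi> z) * eig X z)"
      by (simp add: mult.assoc fc_eig assms z scal_left_commute[of "cx _"])
    also have "\<dots> = cx (fc (\<lambda>z. \<phi> z * \<psi> z) X) * eig X z"
      by (simp add: fc_eig c z mult.assoc scal_scal_left[of "\<psi> z"])
    finally show "cx (fc \<phi> X) * cx (fc \<psi> X) * eig X z = cx (fc (\<lambda>z. \<phi> z * \<psi> z) X) * eig X z" .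
  qed
  then show ?thesis by (metis cx_eq_iff cx_simps(5))
qed

lemma fc_add: assumes "csym \<phi>" "csym \<psi>" shows "fc \<phi> X + fc \<psi> X = fc (\<lambda>z. \<phi> z + \<psi> z) X"
proof -
  have c: "csym (\<lambda>z. \<phi> z + \<psi> z)" using assms by (simp add: csym_def)
  have "cx (fc \<phi> X) + cx (fc \<psi> X) = cx (fc (\<lambda>z. \<phi> z + \<psi> z) X)"
    by (rule eig_separate[of X]) (simp add: fc_eig assms c distrib_right)
  then show ?thesis by (metis cx_eq_iff cx_simps(3))
qed

lemma fc_cong: "(\<And>z. z \<in> sp X \<Longrightarrow> \<phi> z = \<psi> z) \<Longrightarrow> fc \<phi> X = fc \<psi> X"
  by (simp add: fc_def)

lemma fc_1: "fc (\<lambda>_. 1) X = 1"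
  by (simp add: fc_def sum_eig)

lemma fc_commute: "X * Y = Y * X \<Longrightarrow> fc \<phi> X * Y = Y * fc \<phi> X"
proof -
  assume "X * Y = Y * X"
  then have "(\<Sum>z\<in>sp X. scal (\<phi> z) * eig X z) * cx Y = cx Y * (\<Sum>z\<in>sp X. scal (\<phi> z) * eig X z)"
    by (simp add: sum_distrib_left sum_distrib_right mult.assoc scal_left_commute eig_commute_real)
  from arg_cong[OF this, of rp] show ?thesis by (simp add: fc_def)
qed

lemma fc_inverses:
  assumes "csym \<phi>" "csym \<psi>" "\<And>z. z \<in> sp X \<Longrightarrow> \<phi> z * \<psi> z = 1"
  shows "inverses (fc \<phi> X) (fc \<psi> X)"
proof -
  have "fc (\<lambda>z. \<phi> z * \<psi> z) X = fc (\<lambda>_. 1) X" by (rule fc_cong) (rule assms)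
  then show ?thesis by (simp add: inverses_def fc_mult[OF assms(1,2)] fc_1)
qed

text \<open>On the image of \<open>eig X z\<close> the semisimple part is the scalar z, so there the
  difference acts like \<open>X\<close> minus z, which is nilpotent. The sum of the individual
  exponents serves all z at once.\<close>

lemma nilpotent_part:
  obtains k where "(X - fc (\<lambda>z. z) X) ^ k = 0"
proof -
  have id: "csym (\<lambda>z. z)" by (simp add: csym_def)
  define S where "S = cx (fc (\<lambda>z. z) X)"
  let ?N = "cx X - S"
  have e: "?N ^ k * eig X z = (cx X - scal z) ^ k * eig X z" if "z \<in> sp X" for k z
  proof (induction k)
    case (Suc k)
    have c: "eig X z * (cx X - scal z) ^ k = (cx X - scal z) ^ k * eig X z"
    proof (rule eig_commute)
      show "cx X * (cx X - scal z) ^ k = (cx X - scal z) ^ k * cx X"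
        by (rule power_commuting_commutes[symmetric]) (simp add: algebra_simps scal_commute)
    qed
    have "?N ^ Suc k * eig X z = ?N * (eig X z * (cx X - scal z) ^ k)"
      using Suc by (simp add: mult.assoc c)
    also have "\<dots> = (?N * eig X z) * (cx X - scal z) ^ k" by (simp add: mult.assoc)
    also have "?N * eig X z = (cx X - scal z) * eig X z"
      using fc_eig(1)[OF id that] by (simp add: algebra_simps S_def)
    also have "\<dots> * (cx X - scal z) ^ k = (cx X - scal z) ^ Suc k * eig X z"
      by (simp add: mult.assoc c)
    finally show ?case .
  qed simp
  have "\<forall>z. \<exists>k. (cx X - scal z) ^ k * eig X z = 0" using eig_nilpotent by blast
  then obtain kf where kf: "\<And>z. (cx X - scal z) ^ kf z * eig X z = 0" by metis
  define K where "K = (\<Sum>z\<in>sp X. kf z)"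
  have "?N ^ K * eig X z = 0 * eig X z" if z: "z \<in> sp X" for z
  proof -
    have "kf z \<le> K" unfolding K_def using finite_sp z by (intro member_le_sum) auto
    then have "?N ^ K * eig X z = ?N ^ (K - kf z) * (?N ^ kf z * eig X z)"
      by (simp add: mult.assoc[symmetric] power_add[symmetric])
    then show ?thesis using e[OF z] kf by simp
  qed
  then have "?N ^ K = 0" by (rule eig_separate)
  then have "cx ((X - fc (\<lambda>z. z) X) ^ K) = 0" unfolding S_def by (simp only: cx_power cx_simps)
  then have "(X - fc (\<lambda>z. z) X) ^ K = 0" by (simp only: cx_eq_0_iff)
  then show ?thesis by (rule that)
qed

section \<open>Exponential polynomials and Jordan components\<close>

text \<open>The operator sending f to f(m + 1) - \<mu> j f(m) cancels the leading coefficient of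
  \<open>p j\<close> and does not raise the other degrees. The induction runs over the sum of the
  weights \<open>w\<close>, in which a nonzero constant weighs more than 0.\<close>

lemma exp_poly_indep:
  fixes \<mu> :: "'i \<Rightarrow> complex" and p :: "'i \<Rightarrow> complex poly"
  assumes "finite I" "inj_on \<mu> I" "\<And>i. i \<in> I \<Longrightarrow> \<mu> i \<noteq> 0"
    and "\<And>m. (\<Sum>i\<in>I. \<mu> i ^ m * poly (p i) (of_nat m)) = 0" and "i \<in> I"
  shows "p i = 0"
proof -
  define w where "w q = (if q = 0 then 0 else Suc (degree q))" for q :: "complex poly"
  have "(\<forall>m. (\<Sum>i\<in>I. \<mu> i ^ m * poly (p i) (of_nat m)) = 0) \<Longrightarrow> \<forall>i\<in>I. p i = 0"
  proof (induction "\<Sum>i\<in>I. w (p i)" arbitrary: p rule: less_induct)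
    case (less p)
    show ?case
    proof (rule ccontr)
      assume "\<not> (\<forall>i\<in>I. p i = 0)"
      then obtain j where j: "j \<in> I" "p j \<noteq> 0" by blast
      define q where "q i = Polynomial.smult (\<mu> i) (p i \<circ>\<^sub>p [:1, 1:]) - Polynomial.smult (\<mu> j) (p i)" for i
      have dq: "degree (q i) \<le> degree (p i)" for i
        unfolding q_def by (intro degree_diff_le order_trans[OF degree_smult_le]) (auto simp: degree_pcompose)
      have q0: "q i = 0" if "p i = 0" for i using that by (simp add: q_def)
      have lc: "coeff (p i \<circ>\<^sub>p [:1, 1:]) (degree (p i)) = lead_coeff (p i)" for i
        using lead_coeff_comp[of "[:1, 1::complex:]" "p i"] by (simp add: degree_pcompose)
      have cq: "coeff (q i) (degree (p i)) = (\<mu> i - \<mu> j) * lead_coeff (p i)" for i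
        by (simp add: q_def lc left_diff_distrib)
      have "w (q i) \<le> w (p i)" for i using dq[of i] q0[of i] by (auto simp: w_def)
      moreover have "w (q j) < w (p j)"
        using eq_zero_or_degree_less[OF dq[of j]] cq[of j] j by (auto simp: w_def)
      ultimately have "(\<Sum>i\<in>I. w (q i)) < (\<Sum>i\<in>I. w (p i))"
        using j assms(1) by (intro sum_strict_mono_ex1) auto
      moreover have "\<forall>m. (\<Sum>i\<in>I. \<mu> i ^ m * poly (q i) (of_nat m)) = 0"
      proof
        fix m
        have "(\<Sum>i\<in>I. \<mu> i ^ m * poly (q i) (of_nat m))
            = (\<Sum>i\<in>I. \<mu> i ^ Suc m * poly (p i) (of_nat (Suc m))) - \<mu> j * (\<Sum>i\<in>I. \<mu> i ^ m * poly (p i) (of_nat m))"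
          unfolding sum_distrib_left sum_subtractf[symmetric]
          by (intro sum.cong) (auto simp: q_def poly_pcompose algebra_simps)
        also have "\<dots> = 0 - \<mu> j * 0" by (simp only: less.prems[rule_format])
        finally show "(\<Sum>i\<in>I. \<mu> i ^ m * poly (q i) (of_nat m)) = 0" by simp
      qed
      ultimately have qz: "\<forall>i\<in>I. q i = 0" using less.hyps by blast
      have pz: "p i = 0" if "i \<in> I" "i \<noteq> j" for i
      proof -
        have "\<mu> i \<noteq> \<mu> j" using that j assms(2) by (auto simp: inj_on_def)
        then show ?thesis using cq[of i] qz that by auto
      qed
      have "poly (p j) (of_nat m) = 0" for m
      proof -
        have "0 = (\<Sum>i\<in>I. \<mu> i ^ m * poly (p i) (of_nat m))" using less.prems by simp
        also have "\<dots> = (\<Sum>i\<in>I. if i = j then \<mu> j ^ m * poly (p j) (of_nat m) else 0)"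
          by (intro sum.cong) (auto simp: pz)
        finally show ?thesis using j assms(1,3) by simp
      qed
      then have "range (of_nat :: nat \<Rightarrow> complex) \<subseteq> {x. poly (p j) x = 0}" by auto
      moreover have "infinite (range (of_nat :: nat \<Rightarrow> complex))"
        by (simp add: finite_image_iff inj_of_nat)
      ultimately show False using poly_roots_finite[OF j(2)] finite_subset by blast
    qed
  qed
  with assms(4,5) show ?thesis by blast
qed

text \<open>Exponential polynomials with the variables kept apart: the integer m carries numbers of
  modulus 1, the real a positive exponentials and the real c polynomials. These are the kinds of
  dependence of the powers of an elliptic, a hyperbolic and a unipotent matrix on the
  exponent.\<close>

inductive expol :: "(nat \<Rightarrow> real \<Rightarrow> real \<Rightarrow> complex) \<Rightarrow> bool" where
  base: "cmod \<omega> = 1 \<Longrightarrow> expol (\<lambda>m a c. \<omega> ^ m * of_real (exp (\<alpha> * a)) * of_real c ^ k)"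
| zero: "expol (\<lambda>m a c. 0)"
| add: "expol f \<Longrightarrow> expol g \<Longrightarrow> expol (\<lambda>m a c. f m a c + g m a c)"
| scale: "expol f \<Longrightarrow> expol (\<lambda>m a c. x * f m a c)"

lemma expol_mult: "expol f \<Longrightarrow> expol g \<Longrightarrow> expol (\<lambda>m a c. f m a c * g m a c)"
proof (induction rule: expol.induct)
  case (base \<omega> \<alpha> k)
  from base(2,1) show ?case
  proof (induction rule: expol.induct)
    case (base \<omega>' \<alpha>' k')
    have "expol (\<lambda>m a c. (\<omega> * \<omega>') ^ m * of_real (exp ((\<alpha> + \<alpha>') * a)) * of_real c ^ (k + k'))"
      using base by (intro expol.base) (simp add: norm_mult)
    then show ?case by (simp add: power_mult_distrib power_add ring_distribs exp_add mult_ac)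
  next
    case zero show ?case using expol.zero by simp
  next
    case (add f g) then show ?case using expol.add by (fastforce simp: distrib_left)
  next
    case (scale f x) then show ?case using expol.scale by (fastforce simp: mult.left_commute)
  qed
next
  case zero show ?case using expol.zero by simp
next
  case (add f g') then show ?case using expol.add by (fastforce simp: distrib_right)
next
  case (scale f x) then show ?case using expol.scale by (fastforce simp: mult.assoc)
qed

lemma expol_const: "expol (\<lambda>m a c. x)"
  using expol.scale[OF expol.base[of 1 0 0], of x] by simp

lemma expol_unit_power: "cmod \<omega> = 1 \<Longrightarrow> expol (\<lambda>m a c. \<omega> ^ m)"
  using expol.base[of \<omega> 0 0] by simp

lemma expol_exp: "expol (\<lambda>m a c. of_real (exp (\<alpha> * a)))"
  using expol.base[of 1 \<alpha> 0] by simp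

lemma expol_c: "expol (\<lambda>m a c. of_real c)"
  using expol.base[of 1 0 1] by simp

lemma expol_sum: "(\<And>i. i \<in> A \<Longrightarrow> expol (f i)) \<Longrightarrow> expol (\<lambda>m a c. \<Sum>i\<in>A. f i m a c)"
  by (induction A rule: infinite_finite_induct) (auto intro: expol.intros)

lemma expol_power: "expol f \<Longrightarrow> expol (\<lambda>m a c. f m a c ^ k)"
  by (induction k) (auto intro: expol_mult expol_const)

lemma expol_prod: "(\<And>i. i \<in> A \<Longrightarrow> expol (f i)) \<Longrightarrow> expol (\<lambda>m a c. \<Prod>i\<in>A. f i m a c)"
  by (induction A rule: infinite_finite_induct) (auto intro: expol_mult expol_const)

lemma expol_representation:
  "expol f \<Longrightarrow> \<exists>I p. finite I \<and> (\<forall>i\<in>I. cmod (fst i) = 1) \<and> (\<forall>i. i \<notin> I \<longrightarrow> p i = 0) \<and>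
     (\<forall>m a c. f m a c = (\<Sum>i\<in>I. fst i ^ m * of_real (exp (snd i * a)) * poly (p i) (of_real c)))"
proof (induction rule: expol.induct)
  case (base \<omega> \<alpha> k)
  show ?case
    by (rule exI[of _ "{(\<omega>, \<alpha>)}"], rule exI[of _ "\<lambda>i. if i = (\<omega>, \<alpha>) then Polynomial.monom 1 k else 0"])
       (use base in \<open>auto simp: poly_monom\<close>)
next
  case zero
  show ?case by (rule exI[of _ "{}"], rule exI[of _ "\<lambda>_. 0"]) auto
next
  case (add f g)
  let ?t = "\<lambda>p m a c i. fst i ^ m * of_real (exp (snd i * a)) * poly (p i) (of_real c) :: complex"
  from add obtain I p J q where I: "finite I" "\<forall>i\<in>I. cmod (fst i) = 1" "\<forall>i. i \<notin> I \<longrightarrow> p i = 0"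
      "\<And>m a c. f m a c = sum (?t p m a c) I"
    and J: "finite J" "\<forall>i\<in>J. cmod (fst i) = 1" "\<forall>i. i \<notin> J \<longrightarrow> q i = 0"
      "\<And>m a c. g m a c = sum (?t q m a c) J" by blast
  have "sum (?t p m a c) I = sum (?t p m a c) (I \<union> J)" "sum (?t q m a c) J = sum (?t q m a c) (I \<union> J)" for m a c
    using I J by (auto intro!: sum.mono_neutral_left)
  then have "f m a c + g m a c = sum (?t (\<lambda>i. p i + q i) m a c) (I \<union> J)" for m a c
    by (simp add: I(4) J(4) sum.distrib distrib_left)
  with I J show ?case
    by (intro exI[of _ "I \<union> J"] exI[of _ "\<lambda>i. p i + q i"]) auto
next
  case (scale f x)
  then obtain I p where I: "finite I" "\<forall>i\<in>I. cmod (fst i) = 1" "\<forall>i. i \<notin> I \<longrightarrow> p i = 0"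
      "\<And>m a c. f m a c = (\<Sum>i\<in>I. fst i ^ m * of_real (exp (snd i * a)) * poly (p i) (of_real c))" by blast
  then show ?case
    by (intro exI[of _ I] exI[of _ "\<lambda>i. Polynomial.smult x (p i)"]) (auto simp: sum_distrib_left mult_ac)
qed

text \<open>On the diagonal the bases become \<omega> exp \<alpha>. They stay distinct, because the
  modulus recovers \<alpha> and then \<omega>; independence of exponential polynomials makes all
  coefficients vanish, and hence \<open>f\<close> everywhere.\<close>

theorem expol_density:
  assumes f: "expol f" and z: "\<And>m. f m (real m) (real m) = 0" shows "f m a c = 0"
proof -
  obtain I p where *: "finite I \<and> (\<forall>i\<in>I. cmod (fst i) = 1) \<and> (\<forall>i. i \<notin> I \<longrightarrow> p i = 0) \<and>
      (\<forall>m a c. f m a c = (\<Sum>i\<in>I. fst i ^ m * of_real (exp (snd i * a)) * poly (p i) (of_real c)))"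
    using expol_representation[OF f] by (elim exE) (rule that)
  then have I: "finite I" "i \<in> I \<Longrightarrow> cmod (fst i) = 1"
      "f m a c = (\<Sum>i\<in>I. fst i ^ m * of_real (exp (snd i * a)) * poly (p i) (of_real c))" for i m a c by simp_all
  define \<mu> :: "complex \<times> real \<Rightarrow> complex" where "\<mu> i = fst i * of_real (exp (snd i))" for i
  have inj: "inj_on \<mu> I"
  proof (rule inj_onI)
    fix i j assume ij: "i \<in> I" "j \<in> I" "\<mu> i = \<mu> j"
    then have "cmod (\<mu> i) = cmod (\<mu> j)" by simp
    then have "snd i = snd j" using ij I(2) by (simp add: \<mu>_def norm_mult)
    then show "i = j" using ij by (simp add: \<mu>_def prod_eq_iff)
  qed
  have nz: "\<mu> i \<noteq> 0" if "i \<in> I" for i using I(2)[OF that] by (auto simp: \<mu>_def)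
  have zero: "(\<Sum>i\<in>I. \<mu> i ^ m * poly (p i) (of_nat m)) = 0" for m
  proof -
    have "\<mu> i ^ m = fst i ^ m * of_real (exp (snd i * real m))" for i
      by (simp add: \<mu>_def power_mult_distrib exp_of_nat2_mult of_real_power[symmetric] del: of_real_power)
    then show ?thesis using z[of m] by (simp add: I(3))
  qed
  have "p i = 0" if "i \<in> I" for i by (rule exp_poly_indep[OF I(1) inj nz zero that])
  then show ?thesis by (simp add: I(3))
qed

section \<open>Matrices of exponential polynomials and Zariski density\<close>

definition mexpol :: "(nat \<Rightarrow> real \<Rightarrow> real \<Rightarrow> 'n::finite rsq) \<Rightarrow> bool" where
  "mexpol M \<longleftrightarrow> (\<forall>i j. expol (\<lambda>m a c. of_real (ent (M m a c) i j)))"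

lemma mexpol_const: "mexpol (\<lambda>m a c. X)"
  by (simp add: mexpol_def expol_const)

lemma mexpol_mult: "mexpol M \<Longrightarrow> mexpol N \<Longrightarrow> mexpol (\<lambda>m a c. M m a c * N m a c)"
  by (auto simp: mexpol_def ent_times intro!: expol_sum expol_mult)

lemma mexpol_diff: "mexpol M \<Longrightarrow> mexpol N \<Longrightarrow> mexpol (\<lambda>m a c. M m a c - N m a c)"
  unfolding mexpol_def
proof safe
  fix i j assume *: "\<forall>i j. expol (\<lambda>m a c. of_real (ent (M m a c) i j))" "\<forall>i j. expol (\<lambda>m a c. of_real (ent (N m a c) i j))"
  have "expol (\<lambda>m a c. of_real (ent (M m a c) i j) + (- 1) * of_real (ent (N m a c) i j))"
    by (intro expol.add expol.scale *[rule_format])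
  then show "expol (\<lambda>m a c. of_real (ent (M m a c - N m a c) i j))" by simp
qed

lemma mexpol_sum: "(\<And>k. k \<in> A \<Longrightarrow> mexpol (M k)) \<Longrightarrow> mexpol (\<lambda>m a c. \<Sum>k\<in>A. M k m a c)"
  by (simp add: mexpol_def ent_sum expol_sum)

lemma mexpol_scaleR: "expol (\<lambda>m a c. of_real (r m a c)) \<Longrightarrow> mexpol M \<Longrightarrow> mexpol (\<lambda>m a c. r m a c *\<^sub>R M m a c)"
  by (simp add: mexpol_def expol_mult)

lemma mexpol_fc:
  assumes "\<And>m a c. csym (\<phi> m a c)" "\<And>z. z \<in> sp X \<Longrightarrow> expol (\<lambda>m a c. \<phi> m a c z)"
  shows "mexpol (\<lambda>m a c. fc (\<phi> m a c) X)"
  unfolding mexpol_def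
proof safe
  fix i j
  have "expol (\<lambda>m a c. \<Sum>z\<in>sp X. \<phi> m a c z * ent (eig X z) i j)"
    by (intro expol_sum expol_mult assms expol_const)
  moreover have "of_real (ent (fc (\<phi> m a c) X) i j) = (\<Sum>z\<in>sp X. \<phi> m a c z * ent (eig X z) i j)" for m a c
    unfolding ent_cx[symmetric] cx_fc[OF assms(1)] by (simp add: ent_sum)
  ultimately show "expol (\<lambda>m a c. of_real (ent (fc (\<phi> m a c) X) i j))" by simp
qed

lemma sqm_unitE_expansion: "X = (\<Sum>i\<in>UNIV. \<Sum>j\<in>UNIV. ent X i j *\<^sub>R unitE i j 1)" for X :: "'n::finite rsq"
proof (rule sqm_eqI)
  fix k l
  have "ent (\<Sum>i\<in>UNIV. \<Sum>j\<in>UNIV. ent X i j *\<^sub>R unitE i j 1) k l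
      = (\<Sum>i\<in>UNIV. \<Sum>j\<in>UNIV. if j = l then (if i = k then ent X k l else 0) else 0)"
    unfolding ent_sum by (intro sum.cong) (auto simp: ent_unitE)
  then show "ent X k l = ent (\<Sum>i\<in>UNIV. \<Sum>j\<in>UNIV. ent X i j *\<^sub>R unitE i j 1) k l" by simp
qed

lemma expol_polynomial:
  fixes p :: "'n::finite rsq \<Rightarrow> real"
  shows "real_polynomial_function p \<Longrightarrow> mexpol M \<Longrightarrow> expol (\<lambda>m a c. of_real (p (M m a c)))"
proof (induction rule: real_polynomial_function.induct)
  case (linear f)
  have "f X = (\<Sum>i\<in>UNIV. \<Sum>j\<in>UNIV. ent X i j * f (unitE i j 1))" for X
    by (subst sqm_unitE_expansion[of X])
       (simp add: linear_sum[OF bounded_linear.linear[OF linear(1)]] linear_cmul[OF bounded_linear.linear[OF linear(1)]])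
  then have f: "f = (\<lambda>X. \<Sum>i\<in>UNIV. \<Sum>j\<in>UNIV. ent X i j * f (unitE i j 1))" by blast
  have "expol (\<lambda>m a c. \<Sum>i\<in>UNIV. \<Sum>j\<in>UNIV. of_real (ent (M m a c) i j) * of_real (f (unitE i j 1)))"
    using linear(2) by (intro expol_sum expol_mult expol_const) (simp add: mexpol_def)
  then show ?case by (subst f) simp
qed (auto intro: expol_const expol.add expol_mult)

theorem mexpol_density: "mexpol M \<Longrightarrow> (\<And>m. M m (real m) (real m) = 0) \<Longrightarrow> M m a c = 0"
proof (rule sqm_eqI)
  fix i j assume M: "mexpol M" "\<And>m. M m (real m) (real m) = 0"
  have "of_real (ent (M m a c) i j) = (0 :: complex)"
    by (rule expol_density[of "\<lambda>m a c. of_real (ent (M m a c) i j)"]) (use M in \<open>auto simp: mexpol_def\<close>)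
  then show "ent (M m a c) i j = ent 0 i j" by simp
qed

definition zar :: "'n::finite rsq set \<Rightarrow> bool" where
  "zar S \<longleftrightarrow> (\<exists>P. (\<forall>p\<in>P. real_polynomial_function p) \<and> S = {x. (\<exists>y. inverses x y) \<and> (\<forall>p\<in>P. p x = 0)})"

text \<open>A defining polynomial composed with \<open>M\<close> is an exponential polynomial, so
  its vanishing on the diagonal spreads to independent m, a, c.\<close>

theorem zar_density:
  assumes "zar S" "mexpol M" "\<And>m. M m (real m) (real m) \<in> S" "inverses (M m a c) y"
  shows "M m a c \<in> S"
proof -
  obtain P where P: "\<forall>p\<in>P. real_polynomial_function p" "S = {x. (\<exists>y. inverses x y) \<and> (\<forall>p\<in>P. p x = 0)}"
    using assms(1) by (auto simp: zar_def)
  have "p (M m a c) = 0" if p: "p \<in> P" for p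
  proof -
    have "of_real (p (M m a c)) = (0 :: complex)"
      by (rule expol_density[of "\<lambda>m a c. of_real (p (M m a c))"])
         (use P p assms(3) expol_polynomial[OF _ assms(2)] in auto)
    then show ?thesis by simp
  qed
  then show ?thesis using P assms(4) by blast
qed

text \<open>Powers of the unipotent matrix \<open>1 + N\<close>, for \<open>N\<close> nilpotent, by the binomial series.\<close>

definition upow :: "'n::finite rsq \<Rightarrow> real \<Rightarrow> 'n rsq" where
  "upow N c = (\<Sum>k<(LEAST k. N ^ k = 0). (c gchoose k) *\<^sub>R N ^ k)"

lemma power_eq_0_mono: "N ^ k = 0 \<Longrightarrow> k \<le> l \<Longrightarrow> N ^ l = (0 :: 'a::semiring_1)"
  by (metis le_add_diff_inverse mult_zero_left power_add)

lemma upow_eq: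
  assumes "N ^ K = 0" shows "upow N c = (\<Sum>k<K. (c gchoose k) *\<^sub>R N ^ k)"
  unfolding upow_def
proof (rule sum.mono_neutral_left)
  have "N ^ (LEAST k. N ^ k = 0) = 0" using assms by (rule LeastI)
  then have "N ^ i = 0" if "(LEAST k. N ^ k = 0) \<le> i" for i using power_eq_0_mono that by blast
  then show "\<forall>i\<in>{..<K} - {..<LEAST k. N ^ k = 0}. (c gchoose i) *\<^sub>R N ^ i = 0" by simp
  show "{..<LEAST k. N ^ k = 0} \<subseteq> {..<K}" using Least_le[of "\<lambda>k. N ^ k = 0", OF assms] by auto
qed simp

lemma expol_gchoose: "expol (\<lambda>m a c. of_real ((s * c) gchoose k))"
proof -
  have "expol (\<lambda>m a c. (\<Prod>i = 0..<k. of_real s * of_real c + (- of_nat i)) * inverse (of_nat (fact k)))"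
    by (intro expol_mult expol_prod expol.add expol.scale expol_c expol_const)
  then show ?thesis by (simp add: gbinomial_prod_rev divide_inverse)
qed

lemma mexpol_upow: "N ^ K = 0 \<Longrightarrow> mexpol (\<lambda>m a c. upow N (s * c))"
  unfolding upow_def by (intro mexpol_sum mexpol_scaleR mexpol_const expol_gchoose)

lemma upow_0: "N ^ K = 0 \<Longrightarrow> upow N 0 = 1"
proof -
  assume N: "N ^ K = 0"
  then have N': "N ^ Suc K = 0" by simp
  have "upow N 0 = (\<Sum>k<Suc K. if k = 0 then 1 else 0)"
    unfolding upow_eq[OF N'] by (intro sum.cong) (auto simp: gbinomial_0_left)
  then show ?thesis by simp
qed

lemma upow_add_1: assumes "N ^ K = 0" shows "upow N (c + 1) = upow N c * (1 + N)"
proof -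
  have N': "N ^ Suc K = 0" using assms by simp
  have "upow N (c + 1) = 1 + (\<Sum>k<K. ((c + 1) gchoose Suc k) *\<^sub>R N ^ Suc k)"
    unfolding upow_eq[OF N'] by (subst sum.lessThan_Suc_shift) simp
  also have "\<dots> = (1 + (\<Sum>k<K. (c gchoose Suc k) *\<^sub>R N ^ Suc k)) + (\<Sum>k<K. (c gchoose k) *\<^sub>R N ^ Suc k)"
    unfolding gbinomial_Suc_Suc scaleR_add_left sum.distrib by (simp only: ac_simps)
  also have "1 + (\<Sum>k<K. (c gchoose Suc k) *\<^sub>R N ^ Suc k) = upow N c"
  proof -
    have "upow N c = 1 + (\<Sum>k<K. (c gchoose Suc k) *\<^sub>R N ^ Suc k)"
      unfolding upow_eq[OF N'] by (subst sum.lessThan_Suc_shift) simp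
    then show ?thesis by simp
  qed
  also have "(\<Sum>k<K. (c gchoose k) *\<^sub>R N ^ Suc k) = upow N c * N"
    unfolding upow_eq[OF assms] by (simp add: sum_distrib_right power_commutes)
  finally show ?thesis by (simp add: distrib_left)
qed

lemma upow_add_nat: assumes "N ^ K = 0" shows "upow N (c + real m) = upow N c * (1 + N) ^ m"
proof (induction m)
  case (Suc m)
  have "upow N (c + real (Suc m)) = upow N ((c + real m) + 1)" by (simp add: algebra_simps)
  then show ?case using Suc by (simp add: upow_add_1[OF assms] mult.assoc power_commutes del: of_nat_Suc)
qed simp

lemma upow_nat: assumes "N ^ K = 0" shows "upow N (real m) = (1 + N) ^ m"
  using upow_add_nat[OF assms, of 0 m] upow_0[OF assms] by simp

lemma upow_1: assumes "N ^ K = 0" shows "upow N 1 = 1 + N"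
  using upow_nat[OF assms, of 1] by simp

text \<open>For natural \<open>d\<close> this is repeated use of Pascal's rule; both sides are
  polynomial in \<open>d\<close>, so density extends it to real exponents.\<close>

lemma upow_add: assumes "N ^ K = 0" shows "upow N (c + d) = upow N c * upow N d"
proof -
  have "upow N (c + d') = (\<Sum>j<K. \<Sum>k<K. 0) + upow N (c + d')" for d' by simp
  have 1: "mexpol (\<lambda>m a d. upow N (c + d))"
    unfolding upow_eq[OF assms]
  proof (intro mexpol_sum mexpol_scaleR mexpol_const)
    fix k
    have "expol (\<lambda>m a d. (\<Prod>i = 0..<k. (of_real c + of_real d) + (- of_nat i)) * inverse (of_nat (fact k)))"
      by (intro expol_mult expol_prod expol.add expol.scale expol_c expol_const)
    then show "expol (\<lambda>m a d. of_real ((c + d) gchoose k))"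
      by (simp add: gbinomial_prod_rev divide_inverse)
  qed
  have "mexpol (\<lambda>m a d. upow N (c + d) - upow N c * upow N (1 * d))"
    by (intro mexpol_diff mexpol_mult mexpol_const mexpol_upow[OF assms] 1)
  from mexpol_density[OF this, where c = d] show ?thesis
    by (simp add: upow_add_nat[OF assms] upow_nat[OF assms])
qed

lemma inverses_upow: "N ^ K = 0 \<Longrightarrow> inverses (upow N c) (upow N (- c))"
  unfolding inverses_def by (subst upow_add[symmetric]) (auto simp: upow_0)

lemma upow_commute: "N * Y = Y * N \<Longrightarrow> upow N c * Y = Y * upow N c"
  unfolding upow_def by (simp add: sum_distrib_left sum_distrib_right power_commuting_commutes)

lemma continuous_upow: "continuous_on UNIV (\<lambda>c. upow N c)"
  unfolding upow_def gbinomial_prod_rev by (intro continuous_intros) auto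

text \<open>With S the semisimple part of an invertible \<open>g\<close>, this is the inverse of S
  times g - S; the unipotent factor of \<open>g\<close> is therefore
  \<open>1 + nilpart g\<close>.\<close>

definition nilpart :: "'n::finite rsq \<Rightarrow> 'n rsq" where
  "nilpart g = fc inverse g * (g - fc (\<lambda>z. z) g)"

lemma csym_simps: "csym inverse" "csym (\<lambda>z. z)" "csym sgn" "csym (\<lambda>z. of_real (cmod z powr a))"
  "csym \<phi> \<Longrightarrow> csym (\<lambda>z. \<phi> z ^ m)" "csym \<phi> \<Longrightarrow> csym \<psi> \<Longrightarrow> csym (\<lambda>z. \<phi> z * \<psi> z)"
  by (auto simp: csym_def sgn_eq)

lemma fc_self_commute: "fc \<phi> g * g = g * fc \<phi> g"
  by (rule fc_commute) simp

lemma nilpart_nilpotent: obtains K where "nilpart g ^ K = 0"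
proof -
  obtain K where K: "(g - fc (\<lambda>z. z) g) ^ K = 0" by (rule nilpotent_part)
  have c: "fc inverse g * (g - fc (\<lambda>z. z) g) = (g - fc (\<lambda>z. z) g) * fc inverse g"
    by (simp add: algebra_simps fc_self_commute fc_mult csym_simps mult.commute)
  have "nilpart g ^ k = fc inverse g ^ k * (g - fc (\<lambda>z. z) g) ^ k" for k
  proof (induction k)
    case (Suc k)
    have "nilpart g ^ Suc k = fc inverse g * ((g - fc (\<lambda>z. z) g) * fc inverse g ^ k) * (g - fc (\<lambda>z. z) g) ^ k"
      using Suc by (simp add: nilpart_def mult.assoc)
    also have "(g - fc (\<lambda>z. z) g) * fc inverse g ^ k = fc inverse g ^ k * (g - fc (\<lambda>z. z) g)"
      using power_commuting_commutes[OF c] by simp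
    finally show ?case by (simp add: mult.assoc)
  qed simp
  then show ?thesis using K that by (metis mult_zero_right)
qed

lemma nilpart_decomposition:
  assumes "inverses g h" shows "g = fc (\<lambda>z. z) g * (1 + nilpart g)"
proof -
  have "z \<noteq> 0" if "z \<in> sp g" for z using sp_inverses[OF assms] that by metis
  then have "inverses (fc (\<lambda>z. z) g) (fc inverse g)" by (intro fc_inverses csym_simps) simp
  then have "fc (\<lambda>z. z) g * nilpart g = g - fc (\<lambda>z. z) g" unfolding nilpart_def by (rule inversesD(3))
  then show ?thesis by (simp add: distrib_left)
qed

lemma nilpart_commute: "g * Y = Y * g \<Longrightarrow> nilpart g * Y = Y * nilpart g"
proof -
  assume c: "g * Y = Y * g"
  have "(g - fc (\<lambda>z. z) g) * Y = Y * (g - fc (\<lambda>z. z) g)" by (simp add: algebra_simps c fc_commute)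
  then show ?thesis unfolding nilpart_def using fc_commute[OF c, of inverse] by (metis mult.assoc)
qed

text \<open>\<open>jord g m a c\<close> is \<open>E\<^sup>m H\<^sup>a U\<^sup>c\<close>, where \<open>E\<close>, \<open>H\<close>, \<open>U\<close> are the elliptic, hyperbolic and unipotent
  parts of \<open>g\<close>.\<close>

definition jord :: "'n::finite rsq \<Rightarrow> nat \<Rightarrow> real \<Rightarrow> real \<Rightarrow> 'n rsq" where
  "jord g m a c = fc (\<lambda>z. sgn z ^ m * of_real (cmod z powr a)) g * upow (nilpart g) c"

definition jordi :: "'n::finite rsq \<Rightarrow> nat \<Rightarrow> real \<Rightarrow> real \<Rightarrow> 'n rsq" where
  "jordi g m a c = fc (\<lambda>z. inverse (sgn z) ^ m * of_real (cmod z powr (- a))) g * upow (nilpart g) (- c)"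

lemma csym_jord: "csym (\<lambda>z. sgn z ^ m * of_real (cmod z powr a))"
  "csym (\<lambda>z. inverse (sgn z) ^ m * of_real (cmod z powr a))"
  by (auto simp: csym_def sgn_eq)

lemma fc_upow_commute: "fc \<phi> g * upow (nilpart g) c = upow (nilpart g) c * fc \<phi> g"
  by (rule upow_commute[symmetric]) (rule nilpart_commute, rule fc_self_commute[symmetric])

lemma inverses_jord: assumes "inverses g h" shows "inverses (jord g m a c) (jordi g m a c)"
proof -
  obtain K where K: "nilpart g ^ K = 0" by (rule nilpart_nilpotent)
  have 0: "z \<noteq> 0" if "z \<in> sp g" for z using sp_inverses[OF assms] that by metis
  have "inverses (fc (\<lambda>z. sgn z ^ m * of_real (cmod z powr a)) g) (fc (\<lambda>z. inverse (sgn z) ^ m * of_real (cmod z powr (- a))) g)"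
  proof (rule fc_inverses[OF csym_jord])
    fix z assume "z \<in> sp g"
    then have z: "z \<noteq> 0" by (rule 0)
    have "sgn z ^ m * inverse (sgn z) ^ m = 1"
      using z by (simp add: power_mult_distrib[symmetric] sgn_zero_iff)
    moreover have "of_real (cmod z powr a) * of_real (cmod z powr (- a)) = (1 :: complex)"
      using z by (simp add: of_real_mult[symmetric] powr_add[symmetric] del: of_real_mult)
    ultimately show "sgn z ^ m * of_real (cmod z powr a) * (inverse (sgn z) ^ m * of_real (cmod z powr (- a))) = 1"
      by (metis (no_types, opaque_lifting) mult.commute mult.left_commute mult_1_right)
  qed
  from inverses_mult[OF this inverses_upow[OF K, of c]] show ?thesis
    unfolding jord_def jordi_def fc_upow_commute .
qed

lemma mexpol_jord:
  assumes "inverses g h" shows "mexpol (\<lambda>m a c. jord g m (s * a) (s * c))"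
    and "mexpol (\<lambda>m a c. jordi g m (s * a) (s * c))"
proof -
  obtain K where K: "nilpart g ^ K = 0" by (rule nilpart_nilpotent)
  have 0: "z \<noteq> 0" if "z \<in> sp g" for z using sp_inverses[OF assms] that by metis
  show "mexpol (\<lambda>m a c. jord g m (s * a) (s * c))"
    unfolding jord_def
  proof (intro mexpol_mult mexpol_fc csym_jord mexpol_upow[OF K] expol_mult expol_unit_power)
    fix z assume "z \<in> sp g"
    then have z: "z \<noteq> 0" by (rule 0)
    show "cmod (sgn z) = 1" using z by (simp add: norm_sgn)
    have "of_real (cmod z powr (s * a)) = (of_real (exp ((s * ln (cmod z)) * a)) :: complex)" for a
      using z by (simp add: powr_def mult_ac)
    then show "expol (\<lambda>m a c. of_real (cmod z powr (s * a)))" by (simp only: expol_exp)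
  qed
  show "mexpol (\<lambda>m a c. jordi g m (s * a) (s * c))"
    unfolding jordi_def minus_mult_left
  proof (intro mexpol_mult mexpol_fc csym_jord mexpol_upow[OF K] expol_mult expol_unit_power)
    fix z assume "z \<in> sp g"
    then have z: "z \<noteq> 0" by (rule 0)
    show "cmod (inverse (sgn z)) = 1" using z by (simp add: norm_sgn norm_inverse)
    have "of_real (cmod z powr (- s * a)) = (of_real (exp ((- s * ln (cmod z)) * a)) :: complex)" for a
      using z by (simp add: powr_def mult_ac)
    then show "expol (\<lambda>m a c. of_real (cmod z powr (- s * a)))" by (simp only: expol_exp)
  qed
qed

lemma jord_power: assumes "inverses g h" shows "jord g m (s * real m) (s * real m) = jord g 1 s s ^ m"
proof -
  obtain K where K: "nilpart g ^ K = 0" by (rule nilpart_nilpotent)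
  have 0: "z \<noteq> 0" if "z \<in> sp g" for z using sp_inverses[OF assms] that by metis
  have step: "jord g (Suc m) (a + s) (c + s) = jord g 1 s s * jord g m a c" for m a c
  proof -
    have A: "fc (\<lambda>z. sgn z ^ 1 * of_real (cmod z powr s)) g * fc (\<lambda>z. sgn z ^ m * of_real (cmod z powr a)) g
        = fc (\<lambda>z. sgn z ^ Suc m * of_real (cmod z powr (a + s))) g"
      unfolding fc_mult[OF csym_jord(1) csym_jord(1)]
      by (rule fc_cong) (use 0 in \<open>auto simp: powr_add\<close>)
    have B: "upow (nilpart g) (c + s) = upow (nilpart g) s * upow (nilpart g) c"
      by (simp add: upow_add[OF K, symmetric] add.commute)
    have "jord g (Suc m) (a + s) (c + s) = fc (\<lambda>z. sgn z ^ 1 * of_real (cmod z powr s)) g *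
        (fc (\<lambda>z. sgn z ^ m * of_real (cmod z powr a)) g * upow (nilpart g) s) * upow (nilpart g) c"
      by (simp only: jord_def B A[symmetric] mult.assoc)
    then show ?thesis unfolding fc_upow_commute by (simp add: jord_def mult.assoc)
  qed
  show ?thesis
  proof (induction m)
    case 0
    have "fc (\<lambda>z. sgn z ^ 0 * of_real (cmod z powr (s * real 0))) g = fc (\<lambda>_. 1) g"
      by (rule fc_cong) (use sp_inverses[OF assms] in auto)
    then show ?case by (simp add: jord_def fc_1 upow_0[OF K])
  next
    case (Suc m)
    have "s * real (Suc m) = s * real m + s" by (simp add: algebra_simps)
    then show ?case using Suc step by (simp only: power_Suc)
  qed
qed

lemma jord_111: assumes "inverses g h" shows "jord g 1 1 1 = g"
proof -
  obtain K where K: "nilpart g ^ K = 0" by (rule nilpart_nilpotent)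
  have "fc (\<lambda>z. sgn z ^ 1 * of_real (cmod z powr 1)) g = fc (\<lambda>z. z) g"
    by (rule fc_cong) (auto simp: sgn_eq)
  then show ?thesis using nilpart_decomposition[OF assms] by (simp add: jord_def upow_1[OF K])
qed

lemma jord_100: assumes "inverses g h" shows "jord g 1 0 0 = fc sgn g"
proof -
  obtain K where K: "nilpart g ^ K = 0" by (rule nilpart_nilpotent)
  have "fc (\<lambda>z. sgn z ^ 1 * of_real (cmod z powr 0)) g = fc sgn g"
    by (rule fc_cong) (use sp_inverses[OF assms] in auto)
  then show ?thesis by (simp add: jord_def upow_0[OF K])
qed

text \<open>The diagonal values are the powers of \<open>jord g 1 s s\<close>, which lie in
  \<open>S\<close> by hypothesis; density then allows independent exponents.\<close>

theorem jord_mem: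
  assumes S: "zar S" and g: "inverses g h" "\<And>m. jord g 1 s s ^ m \<in> S"
  shows "jord g m (s * a) (s * c) \<in> S"
  by (rule zar_density[OF S mexpol_jord(1)[OF g(1)]])
     (use jord_power[OF g(1)] g(2) inverses_jord[OF g(1)] in auto)

lemma jord_commute: "g * Y = Y * g \<Longrightarrow> jord g m a c * Y = Y * jord g m a c"
proof -
  assume c: "g * Y = Y * g"
  note 1 = fc_commute[OF c] and 2 = upow_commute[OF nilpart_commute[OF c]]
  show ?thesis unfolding jord_def by (simp add: mult.assoc 2) (simp add: 1 mult.assoc[symmetric])
qed

lemma jord_commute2: "g * g' = g' * g \<Longrightarrow> jord g m a c * jord g' m' a' c' = jord g' m' a' c' * jord g m a c"
  by (metis jord_commute)

lemma fc_explicit: "fc \<phi> X = (\<Sum>z\<in>sp X. Re (\<phi> z) *\<^sub>R rp (eig X z) - Im (\<phi> z) *\<^sub>R ip (eig X z))"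
  by (simp add: fc_def rp_sum)

lemma continuous_jord: assumes "inverses g h" shows "continuous_on UNIV (\<lambda>s. jord g m s s)"
proof -
  have "continuous_on UNIV (\<lambda>s. fc (\<lambda>z. sgn z ^ m * of_real (cmod z powr s)) g)"
    unfolding fc_explicit
  proof (intro continuous_on_sum continuous_on_diff continuous_on_scaleR continuous_on_Re continuous_on_Im
      continuous_on_mult continuous_on_const continuous_on_of_real)
    fix z assume "z \<in> sp g"
    then have "z \<noteq> 0" using sp_inverses[OF assms] by metis
    then have "(\<lambda>s. cmod z powr s) = (\<lambda>s. exp (s * ln (cmod z)))" by (simp add: powr_def)
    moreover have "continuous_on UNIV (\<lambda>s. exp (s * ln (cmod z)))" by (intro continuous_intros)
    ultimately show "continuous_on UNIV (\<lambda>s. cmod z powr s)" "continuous_on UNIV (\<lambda>s. cmod z powr s)"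
      by (simp_all only:)
  qed
  then show ?thesis unfolding jord_def by (intro continuous_intros continuous_upow)
qed

section \<open>Replicas, invariant forms and the polar decomposition\<close>

lemma fc_scaleR: "r *\<^sub>R fc \<phi> X = fc (\<lambda>z. of_real r * \<phi> z) X"
  by (simp add: fc_explicit scaleR_sum_right scaleR_diff_right)

lemma fc_diff: assumes "csym \<phi>" "csym \<psi>" shows "fc \<phi> X - fc \<psi> X = fc (\<lambda>z. \<phi> z - \<psi> z) X"
proof -
  have m: "csym (\<lambda>z. of_real (- 1) * \<psi> z)" using assms by (simp add: csym_def)
  have "fc \<phi> X - fc \<psi> X = fc \<phi> X + (- 1) *\<^sub>R fc \<psi> X" by simp
  also have "\<dots> = fc (\<lambda>z. \<phi> z + of_real (- 1) * \<psi> z) X"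
    unfolding fc_scaleR by (rule fc_add[OF assms(1) m])
  finally show ?thesis by simp
qed

lemma fc_power: "csym \<phi> \<Longrightarrow> fc \<phi> X ^ k = fc (\<lambda>z. \<phi> z ^ k) X"
  by (induction k) (simp_all add: fc_1 fc_mult csym_simps)

lemma tp_fc: "tp (fc \<phi> X) = (\<Sum>z\<in>sp X. Re (\<phi> z) *\<^sub>R tp (rp (eig X z)) - Im (\<phi> z) *\<^sub>R tp (ip (eig X z)))"
  by (simp add: fc_explicit tp_sum)

lemma mexp_fc:
  assumes "csym \<phi>" shows "mexp (t *\<^sub>R fc \<phi> X) = fc (\<lambda>z. exp (of_real t * \<phi> z)) X"
proof -
  have c: "csym (\<lambda>z. of_real t * \<phi> z)" using assms by (simp add: csym_def)
  have "(\<lambda>k. fc (\<lambda>z. (of_real t * \<phi> z) ^ k /\<^sub>R fact k) X) sums fc (\<lambda>z. exp (of_real t * \<phi> z)) X"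
    unfolding fc_explicit
    by (intro sums_sum sums_diff bounded_linear.sums[OF bounded_linear_scaleR_left]
        bounded_linear.sums[OF bounded_linear_Re] bounded_linear.sums[OF bounded_linear_Im] exp_converges)
  moreover have "fc (\<lambda>z. (of_real t * \<phi> z) ^ k /\<^sub>R fact k) X = (t *\<^sub>R fc \<phi> X) ^ k /\<^sub>R fact k" for k
    unfolding fc_scaleR fc_power[OF c] by (simp add: scaleR_conv_of_real)
  ultimately show ?thesis using mexp_sums[of "t *\<^sub>R fc \<phi> X"] sums_unique2 by simp
qed

lemma mexp_jordan:
  "mexp (t *\<^sub>R X) = fc (\<lambda>z. exp (of_real t * z)) X * mexp (t *\<^sub>R (X - fc (\<lambda>z. z) X))"
proof -
  have "mexp (t *\<^sub>R X) = mexp (t *\<^sub>R fc (\<lambda>z. z) X + t *\<^sub>R (X - fc (\<lambda>z. z) X))"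
    by (simp add: scaleR_diff_right)
  also have "\<dots> = mexp (t *\<^sub>R fc (\<lambda>z. z) X) * mexp (t *\<^sub>R (X - fc (\<lambda>z. z) X))"
    by (rule mexp_add) (simp add: algebra_simps fc_self_commute)
  finally show ?thesis by (simp add: mexp_fc csym_simps)
qed

lemma power_scaleR_sqm: "(c *\<^sub>R N) ^ k = c ^ k *\<^sub>R N ^ k" for N :: "'n::finite rsq"
  by (induction k) auto

lemma mexp_nilpotent: assumes "N ^ K = 0" shows "mexp (c *\<^sub>R N) = (\<Sum>k<K. (c ^ k / fact k) *\<^sub>R N ^ k)"
proof -
  have "(\<lambda>k. (c *\<^sub>R N) ^ k /\<^sub>R fact k) sums (\<Sum>k<K. (c *\<^sub>R N) ^ k /\<^sub>R fact k)"
  proof (rule sums_finite)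
    fix k assume "k \<notin> {..<K}"
    then have "N ^ k = 0" using power_eq_0_mono[OF assms] by simp
    then show "(c *\<^sub>R N) ^ k /\<^sub>R fact k = 0" unfolding power_scaleR_sqm by simp
  qed simp
  then have "mexp (c *\<^sub>R N) = (\<Sum>k<K. (c *\<^sub>R N) ^ k /\<^sub>R fact k)"
    using mexp_sums[of "c *\<^sub>R N"] sums_unique2 by blast
  also have "\<dots> = (\<Sum>k<K. (c ^ k / fact k) *\<^sub>R N ^ k)"
    by (intro sum.cong refl) (simp add: power_scaleR_sqm divide_inverse mult.commute)
  finally show ?thesis .
qed

locale zgroup = matgroup + assumes zar: "zar G"
begin

text \<open>The one-parameter group of \<open>X\<close> is a product of a rotation, a growth factor
  and a unipotent factor, all governed by the same time. Density decouples the three, so the real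
  and the imaginary parts of the eigenvalues separately give elements of the Lie algebra.\<close>

theorem lieal_jordan:
  assumes X: "X \<in> lieal G"
  shows "fc (\<lambda>z. of_real (Re z)) X \<in> lieal G" "fc (\<lambda>z. \<i> * of_real (Im z)) X \<in> lieal G"
proof -
  define N where "N = X - fc (\<lambda>z. z) X"
  obtain K where K: "N ^ K = 0" unfolding N_def by (rule nilpotent_part)
  \<comment> \<open>The exponent m runs the imaginary parts, a the real parts and c the nilpotent
    part; (m, a, c) = (0, 1, 0) and (1, 0, 0) are the cases used below.\<close>
  have key: "fc (\<lambda>z. exp (\<i> * of_real (t * Im z)) ^ m * of_real (exp ((t * Re z) * a))) X * mexp ((t * c) *\<^sub>R N) \<in> G" for t a c m
  proof -
    let ?\<phi> = "\<lambda>m a z. exp (\<i> * of_real (t * Im z)) ^ m * of_real (exp ((t * Re z) * a))"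
    have cs: "csym (?\<phi> m a)" for m a
      by (auto simp: csym_def exp_cnj)
    have "mexpol (\<lambda>m a c. fc (?\<phi> m a) X * mexp ((t * c) *\<^sub>R N))"
      unfolding mexp_nilpotent[OF K]
    proof (intro mexpol_mult mexpol_fc[of "\<lambda>m a c. ?\<phi> m a", OF cs] expol_mult expol_unit_power expol_exp mexpol_sum mexpol_scaleR mexpol_const)
      show "expol (\<lambda>m a c. of_real ((t * c) ^ k / fact k))" for k
        using expol_mult[OF expol_power[OF expol_mult[OF expol_const[of "of_real t"] expol_c], of k] expol_const[of "inverse (fact k)"]]
        by (simp add: divide_inverse)
    qed (simp add: norm_exp_i_times)
    then show ?thesis
    proof (rule zar_density[OF zar])
      fix m
      have "fc (?\<phi> m (real m)) X = fc (\<lambda>z. exp (of_real (t * real m) * z)) X"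
      proof (rule fc_cong)
        fix z
        have "exp (of_real (t * real m) * z) = exp (of_nat m * (\<i> * of_real (t * Im z))) * exp (of_real ((t * Re z) * real m))"
          unfolding exp_add[symmetric] by (rule arg_cong[of _ _ exp]) (simp add: complex_eq_iff algebra_simps)
        then show "?\<phi> m (real m) z = exp (of_real (t * real m) * z)"
          by (simp add: exp_of_nat_mult exp_of_real[symmetric])
      qed
      then have "fc (?\<phi> m (real m)) X * mexp ((t * real m) *\<^sub>R N) = mexp ((t * real m) *\<^sub>R X)"
        unfolding N_def by (simp only: mexp_jordan[of "t * real m" X])
      then show "fc (?\<phi> m (real m)) X * mexp ((t * real m) *\<^sub>R N) \<in> G" using X lieal_mexp by simp
      have cs': "csym (\<lambda>z. inverse (?\<phi> m a z))" for m a
        by (auto simp: csym_def exp_cnj)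
      show "inverses (fc (?\<phi> m a) X * mexp ((t * c) *\<^sub>R N)) (mexp (- ((t * c) *\<^sub>R N)) * fc (\<lambda>z. inverse (?\<phi> m a z)) X)"
        by (intro inverses_mult inverses_mexp fc_inverses cs cs') (rule right_inverse, simp)
    qed
  qed
  show "fc (\<lambda>z. of_real (Re z)) X \<in> lieal G"
    unfolding lieal_def
  proof safe
    fix t
    have "mexp (t *\<^sub>R fc (\<lambda>z. of_real (Re z)) X) = fc (\<lambda>z. exp (of_real t * of_real (Re z))) X"
      by (rule mexp_fc) (simp add: csym_def)
    also have "\<dots> = fc (\<lambda>z. exp (\<i> * of_real (t * Im z)) ^ 0 * of_real (exp ((t * Re z) * 1))) X"
      by (rule fc_cong) (simp add: exp_of_real[symmetric])
    finally show "mexp (t *\<^sub>R fc (\<lambda>z. of_real (Re z)) X) \<in> G" using key[of t 0 1 0] by simp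
  qed
  show "fc (\<lambda>z. \<i> * of_real (Im z)) X \<in> lieal G"
    unfolding lieal_def
  proof safe
    fix t
    have "mexp (t *\<^sub>R fc (\<lambda>z. \<i> * of_real (Im z)) X) = fc (\<lambda>z. exp (of_real t * (\<i> * of_real (Im z)))) X"
      by (rule mexp_fc) (simp add: csym_def)
    also have "\<dots> = fc (\<lambda>z. exp (\<i> * of_real (t * Im z)) ^ 1 * of_real (exp ((t * Re z) * 0))) X"
      by (rule fc_cong) (simp add: mult_ac)
    finally show "mexp (t *\<^sub>R fc (\<lambda>z. \<i> * of_real (Im z)) X) \<in> G" using key[of t 1 0 0] by simp
  qed
qed

text \<open>Conjugating the eigenvalues yields a substitute for the adjoint of \<open>X\<close> that
  exists inside the Lie algebra without any inner product: the trace of its product with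
  \<open>X\<close> is a sum of squared moduli of eigenvalues.\<close>

lemma lieal_replica: assumes "X \<in> lieal G" shows "fc cnj X \<in> lieal G"
proof -
  have "fc (\<lambda>z. of_real (Re z)) X - fc (\<lambda>z. \<i> * of_real (Im z)) X = fc (\<lambda>z. of_real (Re z) - \<i> * of_real (Im z)) X"
    by (rule fc_diff) (auto simp: csym_def)
  also have "\<dots> = fc cnj X" by (rule fc_cong) (simp add: complex_eq_iff)
  finally show ?thesis using subspace_diff[OF subspace_lieal lieal_jordan[OF assms]] by simp
qed

end

text \<open>Ordinary positive definiteness: testing on a square matrix \<phi> tests on all of its
  columns and adds up the values.\<close>

definition pd :: "'n::finite rsq \<Rightarrow> bool" where
  "pd H \<longleftrightarrow> tp H = H \<and> (\<forall>\<phi>. \<phi> \<noteq> 0 \<longrightarrow> (H * \<phi>) \<bullet> \<phi> > 0)"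

text \<open>The real part of the sum of the Hermitian pullbacks of \<open>H\<close> along the
  eigenprojections. It makes different generalized eigenspaces of \<open>X\<close> orthogonal, so
  that each real function \<open>fc \<phi> X\<close> is normal for it, with adjoint the function
  with conjugated values.\<close>

definition HH :: "'n::finite rsq \<Rightarrow> 'n rsq \<Rightarrow> 'n rsq" where
  "HH X H = (\<Sum>z\<in>sp X. tp (rp (eig X z)) * H * rp (eig X z) + tp (ip (eig X z)) * H * ip (eig X z))"

lemma pd_1: "pd 1"
  by (simp add: pd_def)

lemma pd_nonneg: "pd H \<Longrightarrow> (H * \<phi>) \<bullet> \<phi> \<ge> 0"
  unfolding pd_def by (cases "\<phi> = 0") (auto intro: less_imp_le)

lemma pd_HH: assumes H: "pd H" shows "pd (HH X H)"
  unfolding pd_def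
proof (intro conjI allI impI)
  have "tp H = H" using H by (simp add: pd_def)
  then show "tp (HH X H) = HH X H" by (simp add: HH_def tp_sum mult.assoc)
  fix \<phi> :: "'a rsq" assume "\<phi> \<noteq> 0"
  let ?a = "\<lambda>z. rp (eig X z) * \<phi>" and ?b = "\<lambda>z. ip (eig X z) * \<phi>"
  have eq: "(HH X H * \<phi>) \<bullet> \<phi> = (\<Sum>z\<in>sp X. (H * ?a z) \<bullet> ?a z + (H * ?b z) \<bullet> ?b z)"
    by (simp add: HH_def sum_distrib_right distrib_right inner_sum_left inner_add_left mult.assoc inner_mult_left)
  have nn: "(H * ?a z) \<bullet> ?a z + (H * ?b z) \<bullet> ?b z \<ge> 0" for z
    by (intro add_nonneg_nonneg pd_nonneg H)
  have "(HH X H * \<phi>) \<bullet> \<phi> \<noteq> 0"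
  proof
    assume "(HH X H * \<phi>) \<bullet> \<phi> = 0"
    then have z: "(H * ?a z) \<bullet> ?a z + (H * ?b z) \<bullet> ?b z = 0" if "z \<in> sp X" for z
      unfolding eq by (rule sum_nonneg_0[OF finite_sp nn _ that])
    have "?a z = 0" if "z \<in> sp X" for z
    proof (rule ccontr)
      assume "?a z \<noteq> 0"
      then have "(H * ?a z) \<bullet> ?a z > 0" using H by (simp add: pd_def)
      then show False using z[OF that] pd_nonneg[OF H, of "?b z"] by linarith
    qed
    then have "(\<Sum>z\<in>sp X. ?a z) = 0" by simp
    moreover have "(\<Sum>z\<in>sp X. ?a z) = rp (\<Sum>z\<in>sp X. eig X z) * \<phi>"
      by (simp add: rp_sum sum_distrib_right)
    ultimately show False using \<open>\<phi> \<noteq> 0\<close> by (simp add: sum_eig)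
  qed
  moreover have "(HH X H * \<phi>) \<bullet> \<phi> \<ge> 0" unfolding eq using nn by (intro sum_nonneg)
  ultimately show "(HH X H * \<phi>) \<bullet> \<phi> > 0" by linarith
qed

lemma rp_ip_eig_fc:
  assumes "csym \<phi>" "z \<in> sp X"
  shows "rp (eig X z) * fc \<phi> X = Re (\<phi> z) *\<^sub>R rp (eig X z) - Im (\<phi> z) *\<^sub>R ip (eig X z)"
    and "ip (eig X z) * fc \<phi> X = Im (\<phi> z) *\<^sub>R rp (eig X z) + Re (\<phi> z) *\<^sub>R ip (eig X z)"
  using arg_cong[OF fc_eig(2)[OF assms], of rp] arg_cong[OF fc_eig(2)[OF assms], of ip] by simp_all

text \<open>Multiplying \<open>eig X z\<close> by a number of modulus 1 rotates the pair of its real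
  and imaginary parts, and the sum of the two squares is unchanged.\<close>

lemma HH_unitary:
  assumes c: "csym \<phi>" and u: "\<And>z. z \<in> sp X \<Longrightarrow> cmod (\<phi> z) = 1"
  shows "tp (fc \<phi> X) * HH X H * fc \<phi> X = HH X H"
proof -
  have "tp (fc \<phi> X) * HH X H * fc \<phi> X = (\<Sum>z\<in>sp X. tp (rp (eig X z) * fc \<phi> X) * H * (rp (eig X z) * fc \<phi> X)
      + tp (ip (eig X z) * fc \<phi> X) * H * (ip (eig X z) * fc \<phi> X))"
    by (simp add: HH_def sum_distrib_left sum_distrib_right distrib_left distrib_right mult.assoc)
  also have "\<dots> = HH X H"
    unfolding HH_def
  proof (rule sum.cong[OF refl])
    fix z assume z: "z \<in> sp X"
    define x y a b where "x = Re (\<phi> z)" and "y = Im (\<phi> z)" and "a = rp (eig X z)" and "b = ip (eig X z)"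
    have xy: "x * x + y * y = 1"
      using u[OF z] by (simp add: x_def y_def cmod_def power2_eq_square)
    have "tp (x *\<^sub>R a - y *\<^sub>R b) * H * (x *\<^sub>R a - y *\<^sub>R b) + tp (y *\<^sub>R a + x *\<^sub>R b) * H * (y *\<^sub>R a + x *\<^sub>R b)
        = (x * x + y * y) *\<^sub>R (tp a * H * a) + (x * x + y * y) *\<^sub>R (tp b * H * b)"
      by (simp add: algebra_simps)
    then show "tp (rp (eig X z) * fc \<phi> X) * H * (rp (eig X z) * fc \<phi> X) + tp (ip (eig X z) * fc \<phi> X) * H * (ip (eig X z) * fc \<phi> X)
        = tp (rp (eig X z)) * H * rp (eig X z) + tp (ip (eig X z)) * H * ip (eig X z)"
      unfolding rp_ip_eig_fc[OF c z] xy by (simp add: x_def y_def a_def b_def)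
  qed
  finally show ?thesis .
qed

lemma HH_adjoint:
  assumes c: "csym \<phi>" and H: "tp H = H"
  shows "HH X H * fc (\<lambda>z. cnj (\<phi> z)) X = tp (HH X H * fc \<phi> X)"
proof -
  have c': "csym (\<lambda>z. cnj (\<phi> z))" using c by (simp add: csym_def)
  have 1: "HH X H * fc \<psi> X = (\<Sum>z\<in>sp X. tp (rp (eig X z)) * H * (rp (eig X z) * fc \<psi> X)
      + tp (ip (eig X z)) * H * (ip (eig X z) * fc \<psi> X))" for \<psi>
    by (simp add: HH_def sum_distrib_right distrib_right mult.assoc)
  show ?thesis
    unfolding 1 tp_sum by (rule sum.cong[OF refl]) (simp add: rp_ip_eig_fc c c' H algebra_simps)
qed

lemma rp_ip_eig_commute:
  assumes "X * Y = Y * X" shows "rp (eig X z) * Y = Y * rp (eig X z)" "ip (eig X z) * Y = Y * ip (eig X z)"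
  using arg_cong[OF eig_commute_real[OF assms, of z], of rp] arg_cong[OF eig_commute_real[OF assms, of z], of ip] by simp_all

text \<open>Needed to treat a commuting tuple one member at a time: adapting the form to
  \<open>X\<close> does not destroy its invariance under matrices commuting with
  \<open>X\<close>.\<close>

lemma HH_commute:
  assumes c: "X * Y = Y * X" and Y: "tp Y * H * Y = H" shows "tp Y * HH X H * Y = HH X H"
proof -
  have 1: "tp Y * (tp a * (H * (Y * a))) = tp a * (H * a)" if "a * Y = Y * a" for a
  proof -
    have "tp Y * (tp a * (H * (Y * a))) = tp (a * Y) * H * (Y * a)" by (simp add: mult.assoc)
    also have "\<dots> = tp (Y * a) * H * (Y * a)" by (simp only: that)
    also have "\<dots> = tp a * (tp Y * H * Y) * a" by (simp add: mult.assoc)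
    also have "\<dots> = tp a * H * a" unfolding Y ..
    finally show ?thesis by (simp only: mult.assoc)
  qed
  show ?thesis
    by (simp add: HH_def sum_distrib_left sum_distrib_right distrib_left distrib_right mult.assoc 1 rp_ip_eig_commute[OF c])
qed

section \<open>Symmetric matrices, logarithm and polar decomposition\<close>

lemma tp_scal [simp]: "tp (scal c) = scal c"
  by (rule sqm_eqI) (simp add: ent_scal)

lemma tp_eq_0_iff [simp]: "tp X = 0 \<longleftrightarrow> X = (0 :: ('a::ab_group_add, 'n::finite) sqm)"
  by (metis tp_0 tp_tp)

lemma tp_eig: "tp (eig X z) = eig (tp X) z"
proof -
  have "spec (cx (tp X)) (\<lambda>z. tp (eig X z))"
    unfolding spec_def
  proof (intro conjI allI impI)
    show "finite {z. tp (eig X z) \<noteq> 0}" using finite_sp[of X] by (simp add: sp_def)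
    show "(\<Sum>z | tp (eig X z) \<noteq> 0. tp (eig X z)) = 1"
      using arg_cong[OF sum_eig[of X], of tp] by (simp add: tp_sum sp_def)
    show "tp (eig X z) * tp (eig X w) = 0" if "z \<noteq> w" for z w
      using eig_orth[of w z X] that by (simp flip: tp_mult)
    show "tp (eig X z) * Y = Y * tp (eig X z)" if "cx (tp X) * Y = Y * cx (tp X)" for z Y
    proof -
      have "cx X * tp Y = tp Y * cx X" using arg_cong[OF that, of tp] by (simp add: tp_cx)
      from arg_cong[OF eig_commute[OF this, of z], of tp] show ?thesis by simp
    qed
    show "\<exists>k. (cx (tp X) - scal z) ^ k * tp (eig X z) = 0" for z
    proof -
      obtain k where k: "(cx X - scal z) ^ k * eig X z = 0" using eig_nilpotent by blast
      have "cx X * (cx X - scal z) ^ k = (cx X - scal z) ^ k * cx X"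
        by (rule power_commuting_commutes[symmetric]) (simp add: algebra_simps scal_commute)
      then have "eig X z * (cx X - scal z) ^ k = 0" using eig_commute k by metis
      from arg_cong[OF this, of tp] show ?thesis by (auto simp: tp_power tp_cx)
    qed
  qed
  then show ?thesis using spec_eig[of "tp X"] spec_unique by metis
qed

lemma tp_rp: "tp (rp M) = rp (tp M)" and tp_ip: "tp (ip M) = ip (tp M)"
  by (rule sqm_eqI; simp)+

lemma tp_fc_sym: "tp S = S \<Longrightarrow> tp (fc \<phi> S) = fc \<phi> S"
  by (simp add: tp_fc tp_rp tp_ip tp_eig) (simp add: fc_explicit)

text \<open>The projections for z and its conjugate are themselves symmetric. If z is not real their
  product is 0, and the real part of the trace of this product is the sum of the squared norms of
  the real and imaginary parts.\<close>

lemma sym_real_spectrum: assumes S: "tp S = S" and z: "z \<in> sp S"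
  shows "Im z = 0" "ip (eig S z) = 0"
proof -
  show Im: "Im z = 0"
  proof (rule ccontr)
    assume "Im z \<noteq> 0"
    then have "z \<noteq> cnj z" by (simp add: complex_eq_iff)
    then have "eig S z * cj (eig S z) = 0" unfolding cj_eig by (rule eig_orth)
    from arg_cong[OF this, of rp] have 0: "rp (eig S z) * rp (eig S z) + ip (eig S z) * ip (eig S z) = 0"
      by (simp add: rp_ip_mult)
    have sym: "tp (rp (eig S z)) = rp (eig S z)" "tp (ip (eig S z)) = ip (eig S z)"
      by (simp_all add: tp_rp tp_ip tp_eig S)
    have "rp (eig S z) \<bullet> rp (eig S z) + ip (eig S z) \<bullet> ip (eig S z) = 0"
      using arg_cong[OF 0, of tr] by (simp add: inner_eq_tr sym)
    then have "rp (eig S z) = 0 \<and> ip (eig S z) = 0"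
      by (metis add_nonneg_eq_0_iff inner_eq_zero_iff inner_ge_zero)
    then have "eig S z = 0" by (intro rp_ip_eqI) auto
    then show False using z by (simp add: sp_def)
  qed
  then have "cnj z = z" by (simp add: complex_eq_iff)
  then have "cj (eig S z) = eig S z" by (simp add: cj_eig)
  from arg_cong[OF this, of ip] have "- ip (eig S z) = ip (eig S z)" by (simp only: rp_ip_scal)
  then have "ip (eig S z) + ip (eig S z) = ip (eig S z) + - ip (eig S z)" by (simp only:)
  then have "2 *\<^sub>R ip (eig S z) = 0" by (simp only: scaleR_2 add.right_inverse)
  then show "ip (eig S z) = 0" by simp
qed

lemma sym_semisimple: assumes S: "tp S = S" shows "fc (\<lambda>z. z) S = S"
proof -
  obtain k where "(S - fc (\<lambda>z. z) S) ^ k = 0" by (rule nilpotent_part)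
  then have "S - fc (\<lambda>z. z) S = 0"
    by (rule sym_nilpotent_eq_0[rotated]) (simp add: S tp_fc_sym)
  then show ?thesis by simp
qed

lemma pd_spectrum: assumes H: "pd H" and z: "z \<in> sp H" shows "Re z > 0"
proof -
  have S: "tp H = H" using H by (simp add: pd_def)
  have "eig H z \<noteq> 0" using z by (simp add: sp_def)
  then have q: "rp (eig H z) \<noteq> 0" using sym_real_spectrum(2)[OF S z] rp_ip_eqI[of "eig H z" 0] by auto
  have "H * rp (eig H z) = Re z *\<^sub>R rp (eig H z)"
    using arg_cong[OF fc_eig(1)[OF csym_simps(2) z], of rp] sym_real_spectrum(1)[OF S z] sym_semisimple[OF S] by simp
  then have "Re z * (rp (eig H z) \<bullet> rp (eig H z)) > 0"
    using H q unfolding pd_def by (metis inner_scaleR_left)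
  then show ?thesis by (rule zero_less_mult_pos2) (simp add: q)
qed

lemma pd_log: assumes H: "pd H" obtains S where "tp S = S" "mexp S = H"
proof -
  have S: "tp H = H" using H by (simp add: pd_def)
  define L where "L = fc (\<lambda>z. of_real (ln (Re z))) H"
  have "mexp L = fc (\<lambda>z. exp (of_real 1 * of_real (ln (Re z)))) H"
    unfolding L_def using mexp_fc[of "\<lambda>z. of_real (ln (Re z))" 1 H] by (simp add: csym_def)
  also have "\<dots> = fc (\<lambda>z. z) H"
  proof (rule fc_cong)
    fix z assume z: "z \<in> sp H"
    have "exp (of_real (ln (Re z))) = (of_real (exp (ln (Re z))) :: complex)" by (simp add: exp_of_real)
    then show "exp (of_real 1 * of_real (ln (Re z))) = z"
      using pd_spectrum[OF H z] sym_real_spectrum(1)[OF S z] by (simp add: complex_eq_iff)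
  qed
  finally show ?thesis using that sym_semisimple[OF S] tp_fc_sym[OF S] L_def by metis
qed

lemma pd_gram: assumes "inverses x y" shows "pd (tp x * x)"
  unfolding pd_def
proof (intro conjI allI impI)
  fix \<phi> :: "'a rsq" assume "\<phi> \<noteq> 0"
  then have "x * \<phi> \<noteq> 0" using inversesD(4)[OF assms, of \<phi>] by auto
  then have "0 < (x * \<phi>) \<bullet> (x * \<phi>)" by simp
  then show "0 < (tp x * x * \<phi>) \<bullet> \<phi>" by (simp add: mult.assoc inner_mult_left)
qed simp

lemma pd_square_root: assumes "pd H" obtains x y where "inverses x y" "tp x * x = H"
proof -
  obtain S where S: "tp S = S" "mexp S = H" using pd_log[OF assms] .
  have "tp (mexp ((1/2) *\<^sub>R S)) * mexp ((1/2) *\<^sub>R S) = mexp ((1/2 + 1/2) *\<^sub>R S)"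
    unfolding mexp_scaleR_add by (simp add: tp_mexp S)
  then show ?thesis using that[OF inverses_mexp[of "(1/2) *\<^sub>R S"]] S by simp
qed

text \<open>Polar decomposition of \<open>y * w\<close>. Geometrically
  \<open>x * mexp (t *\<^sub>R S)\<close> is the geodesic from \<open>x\<close> to \<open>w\<close>
  in GL modulo orthogonal matrices acting on the right.\<close>

theorem polar:
  assumes x: "inverses x y" and w: "inverses w v"
  obtains S k where "tp S = S" "tp k * k = 1" "k * tp k = 1" "w = x * mexp S * k"
proof -
  define u where "u = y * w"
  have u: "inverses u (v * x)" unfolding u_def by (intro inverses_mult inverses_sym[OF x] w)
  have "pd (u * tp u)" using pd_gram[OF inverses_tp[OF u]] by simp
  then obtain L where L: "tp L = L" "mexp L = u * tp u" using pd_log by blast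
  define S where "S = (1/2) *\<^sub>R L"
  have S: "tp S = S" "mexp L = mexp S * mexp S"
    unfolding S_def by (simp_all add: L mexp_scaleR_add[symmetric])
  have i: "inverses (mexp S) (mexp (- S))" by (rule inverses_mexp)
  define k where "k = mexp (- S) * u"
  have "k * tp k = mexp (- S) * (u * tp u) * mexp (- S)"
    unfolding k_def by (simp add: tp_mexp S mult.assoc)
  also have "\<dots> = 1" unfolding L(2)[symmetric] S(2) using inversesD[OF i] by (simp add: mult.assoc)
  finally have k: "k * tp k = 1" .
  have "w = x * mexp S * k"
    unfolding k_def u_def using inversesD[OF i] inversesD[OF x] by (simp add: mult.assoc)
  then show ?thesis using that S k sqm_left_inverse_imp_right by blast
qed

no_notation Matrix.scalar_prod (infix "\<bullet>" 70)

section \<open>Traces on subspaces\<close>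

definition is_onb :: "'a::euclidean_space set \<Rightarrow> 'a set \<Rightarrow> bool" where
  "is_onb U B \<longleftrightarrow> finite B \<and> span B = U \<and> (\<forall>b\<in>B. \<forall>c\<in>B. b \<bullet> c = (if b = c then 1 else 0))"

definition onb :: "'a::euclidean_space set \<Rightarrow> 'a set" where
  "onb U = (SOME B. is_onb U B)"

text \<open>The trace of an endomorphism of \<open>U\<close>; the chosen basis is immaterial by
  \<open>tron_eq\<close>.\<close>

definition tron :: "'a::euclidean_space set \<Rightarrow> ('a \<Rightarrow> 'a) \<Rightarrow> real" where
  "tron U T = (\<Sum>b\<in>onb U. T b \<bullet> b)"

lemma is_onb_onb: assumes "subspace U" shows "is_onb U (onb U)"
proof -
  obtain B where B: "B \<subseteq> U" "pairwise orthogonal B" "\<And>x. x \<in> B \<Longrightarrow> norm x = 1" "independent B" "span B = U"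
    using orthonormal_basis_subspace[OF assms] by metis
  have "is_onb U B"
    unfolding is_onb_def using B
    by (auto simp: pairwise_def orthogonal_def norm_eq_1 independent_imp_finite)
  then show ?thesis unfolding onb_def by (rule someI)
qed

lemma is_onbD:
  assumes "is_onb U B" shows "finite B" "b \<in> B \<Longrightarrow> b \<in> U" "subspace U" "b \<in> B \<Longrightarrow> b \<bullet> b = 1"
  using assms span_superset[of B] unfolding is_onb_def by auto

lemma onb_expansion: assumes B: "is_onb U B" and x: "x \<in> U" shows "x = (\<Sum>b\<in>B. (x \<bullet> b) *\<^sub>R b)"
proof -
  define y where "y = x - (\<Sum>b\<in>B. (x \<bullet> b) *\<^sub>R b)"
  have y: "y \<in> U" unfolding y_def using is_onbD[OF B]
    by (intro subspace_diff subspace_sum subspace_scale x) auto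
  have "orthogonal y c" if "c \<in> B" for c
  proof -
    have "(\<Sum>b\<in>B. (x \<bullet> b) * (b \<bullet> c)) = (\<Sum>b\<in>B. if b = c then x \<bullet> c else 0)"
      using B that by (intro sum.cong) (auto simp: is_onb_def)
    then show ?thesis using that is_onbD(1)[OF B]
      by (simp add: y_def orthogonal_def inner_diff_left inner_sum_left)
  qed
  then have "orthogonal y y" using orthogonal_to_span[of y B y] y B by (simp add: is_onb_def)
  then have "y = 0" by (simp add: orthogonal_self)
  then show ?thesis by (simp add: y_def)
qed

text \<open>The rule tr (f h) = tr (h f) for maps between two subspaces. Basis independence,
  restriction to the image and conjugation invariance of traces are all instances of it.\<close>

lemma trace_exchange:
  assumes f: "linear f" "\<And>x. x \<in> U \<Longrightarrow> f x \<in> V" and h: "linear h" "\<And>x. x \<in> V \<Longrightarrow> h x \<in> U"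
    and B: "is_onb U B" and C: "is_onb V C"
  shows "(\<Sum>c\<in>C. f (h c) \<bullet> c) = (\<Sum>b\<in>B. h (f b) \<bullet> b)"
proof -
  have "f (h c) \<bullet> c = (\<Sum>b\<in>B. (h c \<bullet> b) * (f b \<bullet> c))" if "c \<in> C" for c
    by (subst onb_expansion[OF B h(2)[OF is_onbD(2)[OF C that]]])
       (simp add: linear_sum[OF f(1)] linear_cmul[OF f(1)] inner_sum_left)
  moreover have "h (f b) \<bullet> b = (\<Sum>c\<in>C. (f b \<bullet> c) * (h c \<bullet> b))" if "b \<in> B" for b
    by (subst onb_expansion[OF C f(2)[OF is_onbD(2)[OF B that]]])
       (simp add: linear_sum[OF h(1)] linear_cmul[OF h(1)] inner_sum_left)
  ultimately show ?thesis by (simp add: mult.commute sum.swap[of _ C B])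
qed

lemma tron_eq: assumes "is_onb U B" "linear T" "\<And>x. x \<in> U \<Longrightarrow> T x \<in> U"
  shows "tron U T = (\<Sum>b\<in>B. T b \<bullet> b)"
  unfolding tron_def
  using trace_exchange[OF assms(2,3) linear_id _ assms(1) is_onb_onb[OF is_onbD(3)[OF assms(1)]]] by simp

lemma tron_exchange:
  assumes "subspace U" "subspace V" "linear f" "\<And>x. x \<in> U \<Longrightarrow> f x \<in> V" "linear h" "\<And>x. x \<in> V \<Longrightarrow> h x \<in> U"
  shows "tron V (\<lambda>x. f (h x)) = tron U (\<lambda>x. h (f x))"
  unfolding tron_def by (rule trace_exchange[OF assms(3-6)]) (assumption | intro is_onb_onb assms)+

lemma tron_image:
  assumes "subspace U" "subspace V" "V \<subseteq> U" "linear T" "\<And>x. x \<in> U \<Longrightarrow> T x \<in> V"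
  shows "tron U T = tron V T"
  using tron_exchange[OF assms(1,2,4,5) linear_id] assms(3) by (simp add: subset_iff)

lemma tron_cong: assumes "subspace U" "\<And>x. x \<in> U \<Longrightarrow> S x = T x" shows "tron U S = tron U T"
  unfolding tron_def using is_onbD(2)[OF is_onb_onb[OF assms(1)]] assms(2) by (intro sum.cong refl) simp

lemma tron_add: "tron U (\<lambda>x. S x + T x) = tron U S + tron U T"
  by (simp add: tron_def inner_add_left sum.distrib)

lemma tron_scaleR: "tron U (\<lambda>x. r *\<^sub>R T x) = r * tron U T"
  by (simp add: tron_def sum_distrib_left)

lemma tron_sum: "tron U (\<lambda>x. \<Sum>i\<in>A. T i x) = (\<Sum>i\<in>A. tron U (T i))"
  by (simp add: tron_def inner_sum_left sum.swap[of _ A])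

text \<open>The trace on \<open>U\<close> equals the trace on the image of \<open>U\<close> under
  \<open>T\<close>, where one power fewer already annihilates.\<close>

lemma tron_nilpotent:
  assumes "linear T"
  shows "subspace U \<Longrightarrow> (\<And>x. x \<in> U \<Longrightarrow> T x \<in> U) \<Longrightarrow> (\<And>x. x \<in> U \<Longrightarrow> (T ^^ m) x = 0) \<Longrightarrow> tron U T = 0"
proof (induction m arbitrary: U)
  case 0
  then have "b = 0" if "b \<in> onb U" for b using is_onbD(2)[OF is_onb_onb] that by force
  then show ?case unfolding tron_def by (metis (no_types, lifting) inner_zero_right sum.neutral)
next
  case (Suc m)
  have "subspace (T ` U)" using assms Suc.prems(1) by (rule linear_subspace_image)
  moreover have "tron (T ` U) T = 0"
    by (rule Suc.IH) (use Suc.prems calculation in \<open>auto simp: funpow_swap1\<close>)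
  ultimately show ?case using tron_image[of U "T ` U" T] Suc.prems assms by auto
qed

lemma is_onb_Basis: "is_onb UNIV Basis"
  by (simp add: is_onb_def inner_Basis)

lemma tron_left_mult: "tron UNIV (\<lambda>x. N * x) = real CARD('n) * tr N" for N :: "'n::finite rsq"
proof -
  have "linear (\<lambda>x. N * x)" by (simp add: linear_iff distrib_left)
  then have "tron UNIV (\<lambda>x. N * x) = (\<Sum>b\<in>Basis. (N * b) \<bullet> b)"
    by (intro tron_eq is_onb_Basis) auto
  also have "(Basis :: 'n rsq set) = (\<lambda>(i, j). unitE i j 1) ` (UNIV \<times> UNIV)"
    by (force simp: Basis_sqm_def)
  also have "(\<Sum>b\<in>(\<lambda>(i, j). unitE i j 1) ` (UNIV \<times> UNIV). (N * b) \<bullet> b)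
      = (\<Sum>(i, j)\<in>UNIV \<times> UNIV. (N * unitE i j 1) \<bullet> unitE i j 1)"
  proof (subst sum.reindex)
    show "inj_on (\<lambda>(i, j). unitE i j 1 :: 'n rsq) (UNIV \<times> UNIV)"
      by (auto simp: inj_on_def) (metis ent_unitE zero_neq_one)+
  qed (simp add: case_prod_unfold)
  also have "\<dots> = (\<Sum>i\<in>UNIV. \<Sum>j\<in>(UNIV :: 'n set). ent N i i)"
    unfolding sum.cartesian_product[symmetric]
  proof (intro sum.cong refl)
    fix i j :: 'n
    have "ent (N * unitE i j 1) i j = (\<Sum>k\<in>UNIV. if k = i then ent N i i else 0)"
      unfolding ent_times by (intro sum.cong) (auto simp: ent_unitE)
    then show "(N * unitE i j 1) \<bullet> unitE i j 1 = ent N i i" by (simp add: inner_unitE)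
  qed
  finally show ?thesis by (simp add: tr_def sum_distrib_left)
qed

lemma tr_nilpotent:
  fixes N :: "'n::finite rsq"
  assumes "N ^ m = 0" shows "tr N = 0"
proof -
  have l: "linear (\<lambda>x. N * x)" by (simp add: linear_iff distrib_left)
  have "((\<lambda>x. N * x) ^^ m) x = N ^ m * x" for x m by (induction m) (simp_all add: mult.assoc)
  then have "tron UNIV (\<lambda>x. N * x) = 0"
    by (intro tron_nilpotent[OF l, of _ m]) (simp_all add: assms)
  then show ?thesis by (simp add: tron_left_mult)
qed

text \<open>The trace of left multiplication by \<open>e\<close> is the dimension of the space it
  fixes, and also the matrix size times \<open>tr e\<close>.\<close>

lemma tr_idempotent_eq_0:
  fixes e :: "'n::finite rsq"
  assumes "e * e = e" "tr e = 0" shows "e = 0"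
proof -
  have l: "linear (\<lambda>x. e * x)" by (simp add: linear_iff distrib_left)
  let ?U = "{x. e * x = x}"
  have U: "subspace ?U" by (simp add: subspace_def distrib_left)
  have "tron UNIV (\<lambda>x. e * x) = tron ?U (\<lambda>x. e * x)"
    by (rule tron_image[OF _ U _ l]) (auto simp: mult.assoc[symmetric] assms)
  also have "\<dots> = tron ?U (\<lambda>x. x)" by (rule tron_cong[OF U]) simp
  also have "\<dots> = real (card (onb ?U))"
    unfolding tron_def using is_onbD(4)[OF is_onb_onb[OF U]] by simp
  finally have "card (onb ?U) = 0" using assms(2) by (simp add: tron_left_mult)
  then have "onb ?U = {}" using is_onbD(1)[OF is_onb_onb[OF U]] by simp
  then have "?U = {0}" using is_onb_onb[OF U] unfolding is_onb_def by (metis span_empty)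
  then show ?thesis using assms(1) by blast
qed

text \<open>Write an annihilating polynomial as a power x^m times a factor q with q(0) nonzero.
  Solving for the constant term of q gives a polynomial \<open>w\<close> in \<open>a\<close> without
  constant term such that \<open>a ^ m = a ^ m * w\<close>. Then \<open>e = w ^ Suc m\<close> is
  idempotent, has trace 0 by the hypothesis, and is therefore 0.\<close>

lemma nilpotent_from_traces:
  fixes a :: "'n::finite rsq"
  assumes "\<And>k. tr (a ^ Suc k) = 0" obtains m where "a ^ m = 0"
proof -
  have tr0: "tr (a ^ Suc k * pev s a) = 0" for k s
  proof (induction s arbitrary: k)
    case (pCons c s)
    have "a ^ Suc k * pev (pCons c s) a = c *\<^sub>R a ^ Suc k + a ^ Suc (Suc k) * pev s a"
      by (simp only: pev_pCons distrib_left scal_commute scal_real power_Suc2[of a "Suc k"] mult.assoc)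
    then show ?case using assms pCons.IH by (simp only: tr_add tr_scaleR) simp
  qed simp
  obtain p where p: "p \<noteq> 0" "pev p a = 0" by (rule annihilating_poly)
  obtain q where q: "p = [:- 0, 1:] ^ order 0 p * q" "\<not> [:- 0, 1:] dvd q"
    using order_decomp[OF p(1), of 0] by blast
  define m where "m = order 0 p"
  obtain c q' where c: "q = pCons c q'" by (rule pCons_cases)
  have "c \<noteq> 0" using q(2) poly_eq_0_iff_dvd[of q 0] by (auto simp: c)
  define R where "R = pev (Polynomial.smult (- inverse c) q') a"
  define w where "w = a * R"
  have aR: "R * a = a * R" unfolding R_def by (rule pev_commute) simp
  have "pev p a = a ^ m * pev q a"
    by (subst q(1)) (simp add: m_def)
  then have "a ^ m * (scal c + a * pev q' a) = 0" using p(2) by (simp add: c)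
  moreover have "scal c + a * pev q' a = c *\<^sub>R (1 - w)"
    using \<open>c \<noteq> 0\<close> by (simp add: w_def R_def scal_real scaleR_diff_right scaleR_add_right scal_real[of c 1, simplified])
  ultimately have "a ^ m = a ^ m * w" using \<open>c \<noteq> 0\<close> by (simp add: algebra_simps)
  then have step: "a ^ Suc m = a ^ Suc m * w" by (simp add: mult.assoc)
  have stepk: "a ^ Suc m = a ^ Suc m * w ^ k" for k
    by (induction k) (use step in \<open>simp_all del: power_Suc add: power_Suc2 mult.assoc[symmetric]\<close>)
  have wk: "w ^ k = a ^ k * R ^ k" for k
  proof (induction k)
    case (Suc k)
    have "w ^ Suc k = a * (R * a ^ k) * R ^ k" using Suc by (simp add: w_def mult.assoc)
    also have "R * a ^ k = a ^ k * R" using power_commuting_commutes[of a R] aR by metis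
    finally show ?case by (simp add: mult.assoc)
  qed simp
  have aRk: "R ^ k * a ^ l = a ^ l * R ^ k" for k l
    by (metis aR power_commuting_commutes)
  define e where "e = w ^ Suc m"
  have "e * e = (a ^ Suc m * w ^ Suc m) * R ^ Suc m"
  proof -
    have "e * e = w ^ Suc m * (a ^ Suc m * R ^ Suc m)" unfolding e_def wk[of "Suc m"] ..
    also have "\<dots> = (a ^ Suc m * R ^ Suc m) * a ^ Suc m * R ^ Suc m" by (simp only: wk mult.assoc)
    also have "\<dots> = a ^ Suc m * (a ^ Suc m * R ^ Suc m) * R ^ Suc m" by (simp only: mult.assoc aRk)
    finally show ?thesis by (simp only: wk)
  qed
  also have "\<dots> = a ^ Suc m * R ^ Suc m" by (simp only: stepk[symmetric])
  also have "\<dots> = e" by (simp only: e_def wk)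
  finally have "e * e = e" .
  moreover have "tr e = 0"
    unfolding e_def wk R_def pev_power[symmetric] by (rule tr0)
  ultimately have "e = 0" by (rule tr_idempotent_eq_0)
  then have "a ^ Suc m = 0" using stepk[of "Suc m"] by (simp add: e_def)
  then show ?thesis by (rule that)
qed

section \<open>Nilpotent ideals of the Lie algebra\<close>

text \<open>By polarization of \<open>tr (X ^ k) = 0\<close>: modulo shorter words the factors of a word commute.\<close>

lemma tr_word_eq_0:
  fixes r :: "'n::finite rsq set"
  assumes r: "subspace r" and br: "\<And>X Y. X \<in> r \<Longrightarrow> Y \<in> r \<Longrightarrow> X * Y - Y * X \<in> r"
    and nil: "\<And>X. X \<in> r \<Longrightarrow> \<exists>m. X ^ m = 0"
  shows "Zs \<noteq> [] \<Longrightarrow> set Zs \<subseteq> r \<Longrightarrow> tr (prod_list Zs) = 0"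
proof (induction "length Zs" arbitrary: Zs rule: less_induct)
  case (less Zs)
  let ?k = "length Zs"
  have swap: "tr (X ^ i * Y * X ^ m * prod_list Ws) = tr (X ^ (i + m) * Y * prod_list Ws)"
    if "X \<in> r" "Y \<in> r" "set Ws \<subseteq> r" "i + m + 1 + length Ws = ?k" for X Y Ws i m
    using that(4)
  proof (induction m arbitrary: i)
    case (Suc m)
    have "tr (prod_list (replicate i X @ [X * Y - Y * X] @ replicate m X @ Ws)) = 0"
      by (rule less.hyps) (use Suc.prems that br in auto)
    then have 0: "tr (X ^ i * (X * Y - Y * X) * X ^ m * prod_list Ws) = 0"
      by (simp add: mult.assoc)
    have "X ^ i * Y * X ^ Suc m * prod_list Ws
        = X ^ Suc i * Y * X ^ m * prod_list Ws - X ^ i * (X * Y - Y * X) * X ^ m * prod_list Ws"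
      by (simp add: algebra_simps power_commutes) (simp add: mult.assoc[symmetric] power_commutes)
    then have "tr (X ^ i * Y * X ^ Suc m * prod_list Ws) = tr (X ^ Suc i * Y * X ^ m * prod_list Ws)"
      using 0 by simp
    also have "\<dots> = tr (X ^ (Suc i + m) * Y * prod_list Ws)" by (rule Suc.IH) (use Suc.prems in auto)
    finally show ?case by simp
  qed simp
  \<comment> \<open>Here j counts the arbitrary factors behind a power of one element. For j = 0 the
    word is a nilpotent power; each further factor is released by differentiating along
    \<open>X + t *\<^sub>R Y\<close>.\<close>
  have main: "tr (X ^ (?k - j) * prod_list Ws) = 0"
    if "X \<in> r" "set Ws \<subseteq> r" "length Ws = j" "j \<le> ?k" for X Ws j
    using that
  proof (induction j arbitrary: X Ws)
    case 0
    obtain m where "X ^ m = 0" using nil 0 by blast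
    then have "(X ^ ?k) ^ m = 0" using less.prems(1)
      by (simp add: power_mult[symmetric] mult.commute[of ?k]) (simp add: power_mult power_0_left)
    then show ?case using 0 tr_nilpotent by simp
  next
    case (Suc j)
    then obtain Y Vs where Ws: "Ws = Y # Vs" by (cases Ws) auto
    define P where "P = prod_list Vs"
    \<comment> \<open>The derivative of \<open>(X + t *\<^sub>R Y) ^ m\<close> at t = 0, that is the
      sum of all words with one \<open>Y\<close> among m - 1 factors \<open>X\<close>.\<close>
    define D where "D = rec_nat 0 (\<lambda>m d. X * d + Y * X ^ m)"
    have D: "D 0 = 0" "D (Suc m) = X * D m + Y * X ^ m" for m by (simp_all add: D_def)
    have der: "((\<lambda>t. (X + t *\<^sub>R Y) ^ m) has_vector_derivative D m) (at 0)" for m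
    proof (induction m)
      case (Suc m)
      have "((\<lambda>t. X + t *\<^sub>R Y) has_vector_derivative Y) (at 0)"
        by (auto intro!: derivative_eq_intros)
      from has_vector_derivative_mult[OF this Suc] show ?case by (simp add: D)
    qed (simp add: D)
    have zero: "tr ((X + t *\<^sub>R Y) ^ (?k - j) * P) = 0" for t
      unfolding P_def by (rule Suc.IH) (use Suc.prems r Ws in \<open>auto intro: subspace_add subspace_scale\<close>)
    have "((\<lambda>t. tr ((X + t *\<^sub>R Y) ^ (?k - j) * P)) has_vector_derivative tr (D (?k - j) * P)) (at 0)"
      by (intro bounded_linear.has_vector_derivative[OF bounded_linear_tr]
          bounded_linear.has_vector_derivative[OF bounded_linear_mult_left] der)
    then have "((\<lambda>t. 0) has_vector_derivative tr (D (?k - j) * P)) (at (0::real))" by (simp add: zero)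
    then have tD: "tr (D (?k - j) * P) = 0" using vector_derivative_unique_at has_vector_derivative_const by blast
    have sum: "tr (X ^ i * D m * P) = real m * tr (X ^ (i + m - 1) * Y * P)" if "i + m + j = ?k" for i m
      using that
    proof (induction m arbitrary: i)
      case (Suc m)
      have "tr (X ^ i * D (Suc m) * P) = tr (X ^ Suc i * D m * P) + tr (X ^ i * Y * X ^ m * P)"
        by (simp add: D distrib_left distrib_right mult.assoc power_commutes) (simp add: mult.assoc[symmetric] power_commutes)
      also have "tr (X ^ i * Y * X ^ m * P) = tr (X ^ (i + m) * Y * P)"
        unfolding P_def by (rule swap) (use Suc.prems \<open>X \<in> r\<close> \<open>set Ws \<subseteq> r\<close> \<open>length Ws = Suc j\<close> Ws in auto)
      also have "tr (X ^ Suc i * D m * P) = real m * tr (X ^ (Suc i + m - 1) * Y * P)"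
        by (rule Suc.IH) (use Suc.prems in auto)
      finally show ?case by (simp add: algebra_simps)
    qed (simp add: D)
    have "?k - j = Suc (?k - Suc j)" using Suc.prems by simp
    then have "tr (X ^ (?k - Suc j) * Y * P) = 0"
      using sum[of 0 "?k - j"] tD Suc.prems by simp
    then show ?case by (simp add: Ws P_def mult.assoc)
  qed
  have "hd Zs \<in> r" using less.prems by (cases Zs) auto
  from main[OF this less.prems(2) refl] show ?case by simp
qed

lemma span_mult_closed:
  fixes W :: "'a::real_algebra set"
  assumes W: "\<And>x y. x \<in> W \<Longrightarrow> y \<in> W \<Longrightarrow> x * y \<in> W" and "x \<in> span W" "y \<in> span W"
  shows "x * y \<in> span W"
proof -
  have 1: "x * y \<in> span W" if x: "x \<in> W" for x
    using assms(3)
  proof (induction rule: span_induct)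
    case base
    show ?case by (simp add: subspace_def distrib_left span_add span_scale span_zero)
  next
    case (step y) then show ?case using W x by (intro span_base)
  qed
  show ?thesis
    using assms(2)
  proof (induction rule: span_induct)
    case base
    show ?case by (simp add: subspace_def distrib_right span_add span_scale span_zero)
  next
    case (step x) then show ?case by (rule 1)
  qed
qed

locale rgroup = zgroup G for G :: "'n::finite rsq set" +
  assumes conn: "connected G"
    and red: "\<And>N. \<lbrakk>matgroup N; zar N; N \<subseteq> G; connected N; \<And>x. x \<in> N \<Longrightarrow> \<exists>m. (x - 1) ^ m = 0;
      \<And>g h x. \<lbrakk>g \<in> G; inverses g h; x \<in> N\<rbrakk> \<Longrightarrow> g * x * h \<in> N\<rbrakk> \<Longrightarrow> N = {1}"
begin

definition Adinv :: "'n rsq set \<Rightarrow> bool" where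
  "Adinv W \<longleftrightarrow> subspace W \<and> (\<forall>g h X. g \<in> G \<longrightarrow> inverses g h \<longrightarrow> X \<in> W \<longrightarrow> g * X * h \<in> W)"

lemma Adinv_bracket: "Adinv W \<Longrightarrow> X \<in> lieal G \<Longrightarrow> Y \<in> W \<Longrightarrow> X * Y - Y * X \<in> W"
  unfolding Adinv_def by (rule bracket_mem) auto

text \<open>All words in \<open>r\<close> have trace 0, so every element of the algebra
  \<open>A\<close> they span is nilpotent. The elements of \<open>G\<close> in 1 + \<open>A\<close>
  thus form a normal connected unipotent algebraic subgroup, which must be trivial; but it contains
  the exponentials of multiples of \<open>X\<close>.\<close>

theorem nilpotent_ideal_trivial:
  assumes r: "Adinv r" "r \<subseteq> lieal G" and nil: "\<And>X. X \<in> r \<Longrightarrow> \<exists>m. X ^ m = 0" and "X \<in> r"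
  shows "X = 0"
proof -
  define W where "W = {prod_list Zs |Zs. Zs \<noteq> [] \<and> set Zs \<subseteq> r}"
  define A where "A = span W"
  have sub: "subspace r" using r by (simp add: Adinv_def)
  have sA: "subspace A" by (simp add: A_def)
  have rA: "r \<subseteq> A"
  proof
    fix X assume "X \<in> r"
    then have "X \<in> W" unfolding W_def by (intro CollectI exI[of _ "[X]"]) simp
    then show "X \<in> A" unfolding A_def by (rule span_base)
  qed
  have mult: "x * y \<in> A" if "x \<in> A" "y \<in> A" for x y
    using that unfolding A_def
  proof (rule span_mult_closed[rotated])
    fix x y assume "x \<in> W" "y \<in> W"
    then obtain Zs Zs' where "x = prod_list Zs" "Zs \<noteq> []" "set Zs \<subseteq> r" "y = prod_list Zs'" "set Zs' \<subseteq> r"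
      by (auto simp: W_def)
    then show "x * y \<in> W" unfolding W_def by (intro CollectI exI[of _ "Zs @ Zs'"]) auto
  qed
  have pow: "x ^ Suc k \<in> A" if "x \<in> A" for x k
    by (induction k) (use that mult in auto)
  have tr0: "tr x = 0" if "x \<in> A" for x
    using that unfolding A_def
  proof (induction rule: span_induct)
    case base show ?case by (simp add: subspace_def)
  next
    case (step x)
    then obtain Zs where Zs: "x = prod_list Zs" "Zs \<noteq> []" "set Zs \<subseteq> r" by (auto simp: W_def)
    show ?case unfolding Zs(1)
      by (rule tr_word_eq_0[OF sub _ nil Zs(2,3)]) (use Adinv_bracket[OF r(1)] r(2) in auto)
  qed
  have nilA: "\<exists>m. x ^ m = 0" if "x \<in> A" for x
    using nilpotent_from_traces[of x] tr0[OF pow[OF that]] by metis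
  have AdA: "g * x * h \<in> A" if g: "g \<in> G" "inverses g h" and x: "x \<in> A" for g h x
    using x unfolding A_def
  proof (induction rule: span_induct)
    case base
    show ?case by (simp add: subspace_def distrib_left distrib_right span_add span_scale span_zero)
  next
    case (step x)
    then obtain Zs where Zs: "x = prod_list Zs" "Zs \<noteq> []" "set Zs \<subseteq> r" by (auto simp: W_def)
    have "g * prod_list Zs * h = prod_list (map (\<lambda>Z. g * Z * h) Zs)"
      by (induction Zs) (use inversesD[OF g(2)] in \<open>simp_all add: mult.assoc\<close>, metis mult.assoc)
    moreover have "set (map (\<lambda>Z. g * Z * h) Zs) \<subseteq> r" using Zs(3) g r(1) by (auto simp: Adinv_def)
    ultimately have "g * x * h \<in> W" unfolding W_def Zs(1)
      using Zs(2) by (intro CollectI exI[of _ "map (\<lambda>Z. g * Z * h) Zs"]) auto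
    then show ?case by (rule span_base)
  qed
  have upA: "upow a c - 1 \<in> A" if a: "a \<in> A" for a c
  proof -
    obtain m where "a ^ m = 0" using nilA a by blast
    then have m: "a ^ Suc m = 0" by simp
    have "upow a c - 1 = (\<Sum>k<m. (c gchoose Suc k) *\<^sub>R a ^ Suc k)"
      unfolding upow_eq[OF m] by (subst sum.lessThan_Suc_shift) simp
    also have "\<dots> \<in> A" by (intro subspace_sum[OF sA] subspace_scale[OF sA] pow a)
    finally show ?thesis .
  qed
  have up1: "upow (x - 1) 1 = x" if "x - 1 \<in> A" for x
    using nilA[OF that] upow_1 by force
  define N where "N = {x \<in> G. x - 1 \<in> A}"
  \<comment> \<open>Integer powers of \<open>x\<close> lie in \<open>G\<close>, hence by density so
    do the real powers. This provides inverses in \<open>N\<close> and the paths that make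
    \<open>N\<close> connected.\<close>
  have upN: "upow (x - 1) c \<in> N" if x: "x \<in> N" for x c
  proof -
    have a: "x - 1 \<in> A" using x by (simp add: N_def)
    obtain K where K: "(x - 1) ^ K = 0" using nilA a by blast
    have "upow (x - 1) (1 * c) \<in> G"
      by (rule zar_density[OF zar mexpol_upow[OF K]])
         (use x in \<open>auto simp: N_def upow_nat[OF K] intro!: power_mem inverses_upow[OF K]\<close>)
    then show ?thesis using upA[OF a] by (simp add: N_def)
  qed
  have N1: "1 \<in> N" using one_mem subspace_0[OF sA] by (simp add: N_def)
  have "N = {1}"
  proof (rule red)
    show "matgroup N"
    proof
      show "1 \<in> N" by (rule N1)
      fix g h assume gh: "g \<in> N" "h \<in> N"
      have "g * h - 1 = (g - 1) * (h - 1) + (g - 1) + (h - 1)" by (simp add: algebra_simps)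
      also have "\<dots> \<in> A" using gh by (intro subspace_add[OF sA] mult) (auto simp: N_def)
      finally show "g * h \<in> N" using gh mult_mem by (auto simp: N_def)
    next
      fix g assume g: "g \<in> N"
      then have a: "g - 1 \<in> A" by (simp add: N_def)
      obtain K where K: "(g - 1) ^ K = 0" using nilA a by blast
      show "\<exists>h\<in>N. inverses g h"
        using inverses_upow[OF K, of 1] upN[OF g, of "- 1"] up1[OF a] by auto
    next
      fix u x y assume u: "\<And>k. u k \<in> N" "u \<longlonglongrightarrow> x" "inverses x y"
      have "x - 1 \<in> A"
        by (rule closed_sequentially[OF closed_subspace[OF sA], of "\<lambda>k. u k - 1"])
           (use u in \<open>auto simp: N_def intro!: tendsto_intros\<close>)
      then show "x \<in> N" using limit_mem[of u x y] u by (auto simp: N_def)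
    qed
    obtain P where P: "\<forall>p\<in>P. real_polynomial_function p" "G = {x. (\<exists>y. inverses x y) \<and> (\<forall>p\<in>P. p x = 0)}"
      using zar by (auto simp: zar_def)
    \<comment> \<open>The linear equations cutting out 1 + \<open>A\<close>, one for each vector
      orthogonal to \<open>A\<close>.\<close>
    define Q where "Q = (\<lambda>v x. v \<bullet> (x - 1)) ` {v. \<forall>a\<in>A. v \<bullet> a = 0}"
    have Qp: "real_polynomial_function q" if q: "q \<in> Q" for q
    proof -
      obtain v where v: "q = (\<lambda>x. v \<bullet> (x - 1))" using q unfolding Q_def by blast
      have "q = (\<lambda>x. v \<bullet> x + - (v \<bullet> 1))" by (simp add: v inner_diff_right fun_eq_iff)
      moreover have "real_polynomial_function (\<lambda>x. v \<bullet> x + - (v \<bullet> 1))"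
        by (intro real_polynomial_function.intros bounded_linear_inner_right)
      ultimately show ?thesis by simp
    qed
    have Neq: "N = {x. (\<exists>y. inverses x y) \<and> (\<forall>p\<in>P \<union> Q. p x = 0)}"
    proof -
      have Q1: "x - 1 \<in> A" if x: "\<forall>q\<in>Q. q x = 0" for x
      proof -
        obtain y z where yz: "y \<in> span A" "\<And>w. w \<in> span A \<Longrightarrow> orthogonal z w" "x - 1 = y + z"
          using orthogonal_subspace_decomp_exists[of A "x - 1"] by metis
        have "\<forall>a\<in>A. z \<bullet> a = 0" using yz(2) span_base[of _ A] by (simp add: orthogonal_def)
        then have "(\<lambda>x. z \<bullet> (x - 1)) \<in> Q" unfolding Q_def by (intro imageI CollectI)
        from bspec[OF x this] have "z \<bullet> (x - 1) = 0" by simp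
        then have "z \<bullet> (y + z) = 0" using yz(3) by simp
        then have "z = 0" using yz(1,2) by (simp add: inner_add_right orthogonal_def)
        then show ?thesis using yz(1,3) span_eq_iff[THEN iffD2, OF sA] by simp
      qed
      have Q2: "q x = 0" if "q \<in> Q" "x - 1 \<in> A" for q x using that unfolding Q_def by (elim imageE) simp
      have A_iff: "x - 1 \<in> A \<longleftrightarrow> (\<forall>q\<in>Q. q x = 0)" for x
        by (intro iffI ballI) (assumption | rule Q1 Q2)+
      have G_iff: "x \<in> G \<longleftrightarrow> (\<exists>y. inverses x y) \<and> (\<forall>p\<in>P. p x = 0)" for x by (subst P(2)) simp
      show ?thesis by (simp only: N_def A_iff G_iff ball_Un conj_assoc)
    qed
    show "zar N"
      unfolding zar_def by (rule exI[of _ "P \<union> Q"], rule conjI[OF _ Neq]) (use P(1) Qp in blast)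
    show "N \<subseteq> G" by (auto simp: N_def)
    have "connected ((\<lambda>c. upow (x - 1) c) ` {0..1})" for x
      by (intro connected_continuous_image continuous_on_subset[OF continuous_upow]) auto
    moreover have "N = (\<Union>x\<in>N. (\<lambda>c. upow (x - 1) c) ` {0..1})"
    proof (intro equalityI subsetI)
      fix x assume "x \<in> N"
      then show "x \<in> (\<Union>x\<in>N. (\<lambda>c. upow (x - 1) c) ` {0..1})"
        by (intro UN_I[of x] image_eqI[of _ _ 1]) (auto simp: N_def up1)
    qed (use upN in auto)
    moreover have "1 \<in> (\<Inter>x\<in>N. (\<lambda>c. upow (x - 1) c) ` {0..1})"
    proof
      fix x assume "x \<in> N"
      then obtain K where "(x - 1) ^ K = 0" using nilA by (auto simp: N_def)
      then show "1 \<in> (\<lambda>c. upow (x - 1) c) ` {0..1}" by (intro image_eqI[of _ _ 0]) (auto simp: upow_0)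
    qed
    ultimately show "connected N" using connected_Union[of "(\<lambda>x. (\<lambda>c. upow (x - 1) c) ` {0..1}) ` N"]
      by (metis (no_types, lifting) empty_iff image_iff)
    show "\<exists>m. (x - 1) ^ m = 0" if "x \<in> N" for x using that nilA by (simp add: N_def)
    fix g h x assume g: "g \<in> G" "inverses g h" "x \<in> N"
    have "g * x * h - 1 = g * (x - 1) * h" using inversesD[OF g(2)] by (simp add: algebra_simps)
    then show "g * x * h \<in> N"
      using g AdA inverses_mem mult_mem by (auto simp: N_def)
  qed
  have "mexp (t *\<^sub>R X) = 1" for t
  proof -
    have XA: "X \<in> A" using \<open>X \<in> r\<close> rA by blast
    obtain m where "X ^ m = 0" using nil \<open>X \<in> r\<close> by blast
    then have m: "X ^ Suc m = 0" by simp
    have "mexp (t *\<^sub>R X) - 1 = (\<Sum>k<m. (t ^ Suc k / fact (Suc k)) *\<^sub>R X ^ Suc k)"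
      unfolding mexp_nilpotent[OF m] by (subst sum.lessThan_Suc_shift) simp
    also have "\<dots> \<in> A" by (intro subspace_sum[OF sA] subspace_scale[OF sA] pow XA)
    finally have "mexp (t *\<^sub>R X) - 1 \<in> A" .
    moreover have "mexp (t *\<^sub>R X) \<in> G" using \<open>X \<in> r\<close> r(2) lieal_mexp by blast
    ultimately show ?thesis using \<open>N = {1}\<close> by (auto simp: N_def)
  qed
  then have "((\<lambda>t::real. 1) has_vector_derivative X) (at 0)"
    using mexp_has_vector_derivative_0[of X] by simp
  then show ?thesis using vector_derivative_unique_at has_vector_derivative_const by blast
qed

end

text \<open>A square root \<open>x\<close> of the form \<open>HH X 1\<close> turns that form into
  the standard one, for which the adjoint of the semisimple part is its transpose.\<close>

lemma adapted_transpose: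
  fixes X :: "'n::finite rsq"
  obtains x y where "inverses x y" "x * fc cnj X * y = tp (x * fc (\<lambda>z. z) X * y)"
proof -
  obtain x y where x: "inverses x y" "tp x * x = HH X 1" using pd_square_root[OF pd_HH[OF pd_1]] .
  have "tp x * x * fc cnj X = tp (tp x * x * fc (\<lambda>z. z) X)"
    unfolding x(2) using HH_adjoint[OF csym_simps(2), of 1 X] by simp
  then have "tp y * (tp x * x * fc cnj X) * y = tp y * (tp (fc (\<lambda>z. z) X) * tp x * x) * y"
    by (simp add: mult.assoc)
  then have "x * fc cnj X * y = tp (x * fc (\<lambda>z. z) X * y)"
    using inversesD[OF inverses_tp[OF x(1)]] inversesD[OF x(1)] by (simp add: mult.assoc)
  then show ?thesis using x that by blast
qed

lemma nilpotent_mult_commute: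
  assumes "N ^ m = 0" "N * Y = Y * N" shows "(N * Y) ^ m = (0 :: 'a::ring_1)"
proof -
  have "(N * Y) ^ k = N ^ k * Y ^ k" for k
  proof (induction k)
    case (Suc k)
    have "(N * Y) ^ Suc k = N * (Y * N ^ k) * Y ^ k" using Suc by (simp add: mult.assoc)
    also have "Y * N ^ k = N ^ k * Y" using power_commuting_commutes[OF assms(2)] by simp
    finally show ?case by (simp add: mult.assoc)
  qed simp
  then show ?thesis using assms(1) by simp
qed

text \<open>The nilpotent part of \<open>X\<close> commutes with the replica and contributes a
  nilpotent product of trace 0. In adapted coordinates the remaining trace is the squared norm of
  the semisimple part, so that part is 0.\<close>

lemma replica_trace:
  assumes "tr (X * fc cnj X) = 0" shows "\<exists>m. X ^ m = (0 :: 'n::finite rsq)"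
proof -
  define S N Y where "S = fc (\<lambda>z. z) X" and "N = X - S" and "Y = fc cnj X"
  obtain m where m: "N ^ m = 0" unfolding N_def S_def by (rule nilpotent_part)
  have XY: "Y * X = X * Y" unfolding Y_def by (rule fc_self_commute)
  have SY: "S * Y = Y * S" unfolding S_def by (rule fc_commute) (rule XY[symmetric])
  have "N * Y = Y * N" by (simp add: N_def algebra_simps XY SY)
  then have "tr (N * Y) = 0" using tr_nilpotent nilpotent_mult_commute[OF m] by blast
  then have 0: "tr (S * Y) = 0" using assms by (simp add: N_def Y_def algebra_simps)
  obtain x y where x: "inverses x y" "x * Y * y = tp (x * S * y)"
    unfolding S_def Y_def by (rule adapted_transpose)
  have "tr (S * Y) = tr ((x * S * y) * (x * Y * y))"
  proof -
    have "(x * S * y) * (x * Y * y) = x * (S * Y * y)" using inversesD[OF x(1)] by (simp add: mult.assoc)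
    then have "tr ((x * S * y) * (x * Y * y)) = tr ((S * Y * y) * x)" by (metis tr_mult_commute)
    then show ?thesis using inversesD[OF x(1)] by (simp add: mult.assoc)
  qed
  also have "\<dots> = (x * S * y) \<bullet> (x * S * y)" unfolding x(2) by (metis inner_eq_tr tr_mult_commute)
  finally have "x * S * y = 0" using 0 by simp
  then have "y * (x * S * y) * x = 0" by simp
  then have "S = 0" using inversesD[OF x(1)] by (simp add: mult.assoc)
  then show ?thesis using m by (auto simp: N_def)
qed

lemma (in rgroup) Adinv_lieal: "Adinv (lieal G)"
  unfolding Adinv_def using subspace_lieal lieal_Ad by blast

lemma tr_conj: "inverses g h \<Longrightarrow> tr (g * X * h * Y) = tr (X * (h * Y * g))"
  by (metis mult.assoc tr_mult_commute)

theorem (in rgroup) trace_form_nondegenerate: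
  assumes "X \<in> lieal G" "\<And>Y. Y \<in> lieal G \<Longrightarrow> tr (X * Y) = 0" shows "X = 0"
proof -
  let ?r = "{X \<in> lieal G. \<forall>Y\<in>lieal G. tr (X * Y) = 0}"
  have Ad: "Adinv ?r"
    unfolding Adinv_def
  proof (intro conjI allI impI)
    show "subspace ?r"
      using subspace_lieal unfolding subspace_def by (auto simp: distrib_right)
    fix g h X assume g: "g \<in> G" "inverses g h" "X \<in> ?r"
    have "tr (g * X * h * Y) = 0" if "Y \<in> lieal G" for Y
      using lieal_Ad[OF inverses_mem[OF g(1,2)] inverses_sym[OF g(2)] that] g(3)
      by (simp add: tr_conj[OF g(2)])
    then show "g * X * h \<in> ?r" using lieal_Ad[OF g(1,2)] g(3) by simp
  qed
  show ?thesis
  proof (rule nilpotent_ideal_trivial[OF Ad])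
    show "\<exists>m. X ^ m = 0" if "X \<in> ?r" for X
      using that lieal_replica[of X] by (intro replica_trace) auto
  qed (use assms in auto)
qed

section \<open>Complete reducibility\<close>

text \<open>Nondegeneracy makes the map from \<open>L\<close> to its dual injective, hence bijective
  by dimension; the dual is written in coordinates of an orthonormal basis.\<close>

lemma nondegenerate_represents:
  fixes L :: "'a::euclidean_space set"
  assumes L: "subspace L" and \<beta>: "\<And>Y. linear (\<lambda>X. \<beta> X Y)" "\<And>X. linear (\<beta> X)"
    and nd: "\<And>X. X \<in> L \<Longrightarrow> (\<And>Y. Y \<in> L \<Longrightarrow> \<beta> X Y = 0) \<Longrightarrow> X = 0" and l: "linear (l :: 'a \<Rightarrow> real)"
  obtains X where "X \<in> L" "\<And>Y. Y \<in> L \<Longrightarrow> \<beta> X Y = l Y"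
proof -
  let ?B = "onb L"
  note B = is_onb_onb[OF L]
  define T where "T X = (\<Sum>b\<in>?B. \<beta> X b *\<^sub>R b)" for X
  have TL: "T X \<in> L" for X
    unfolding T_def by (intro subspace_sum[OF L] subspace_scale[OF L] is_onbD(2)[OF B])
  have linT: "linear T"
    unfolding T_def by (intro linear_compose_sum ballI)
      (simp add: linear_iff linear_add[OF \<beta>(1)] linear_cmul[OF \<beta>(1)] scaleR_add_left)
  have coeff: "(\<Sum>b\<in>?B. f b *\<^sub>R b) \<bullet> c = f c" if "c \<in> ?B" for f c
  proof -
    have "(\<Sum>b\<in>?B. f b *\<^sub>R b) \<bullet> c = (\<Sum>b\<in>?B. if b = c then f c else 0)"
      unfolding inner_sum_left using B that by (intro sum.cong) (auto simp: is_onb_def)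
    then show ?thesis using is_onbD(1)[OF B] that by simp
  qed
  have expand: "g Y = (\<Sum>b\<in>?B. (Y \<bullet> b) * g b)" if "linear (g :: 'a \<Rightarrow> real)" "Y \<in> L" for g Y
    by (subst onb_expansion[OF B that(2)]) (simp add: linear_sum[OF that(1)] linear_cmul[OF that(1)])
  have "X = 0" if "X \<in> L" "T X = 0" for X
  proof (rule nd[OF that(1)])
    fix Y assume "Y \<in> L"
    have "\<beta> X b = 0" if "b \<in> ?B" for b using coeff[OF that, of "\<beta> X"] \<open>T X = 0\<close> by (simp add: T_def)
    then show "\<beta> X Y = 0" by (subst expand[OF \<beta>(2) \<open>Y \<in> L\<close>]) simp
  qed
  then have "inj_on T L" using linear_inj_on_iff_eq_0[OF linT L] by blast
  then have "dim (T ` L) = dim L"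
    using dim_image_eq[OF linT, of L] span_eq_iff[THEN iffD2, OF L] by simp
  then have "T ` L = L" using TL L linT
    by (intro subspace_dim_equal linear_subspace_image) auto
  moreover have "(\<Sum>b\<in>?B. l b *\<^sub>R b) \<in> L"
    by (intro subspace_sum[OF L] subspace_scale[OF L] is_onbD(2)[OF B])
  ultimately have "(\<Sum>b\<in>?B. l b *\<^sub>R b) \<in> T ` L" by simp
  then obtain X where X: "(\<Sum>b\<in>?B. l b *\<^sub>R b) = T X" "X \<in> L" by (rule imageE)
  have "\<beta> X Y = l Y" if "Y \<in> L" for Y
  proof -
    have "\<beta> X b = l b" if "b \<in> ?B" for b
      using coeff[OF that, of l] coeff[OF that, of "\<beta> X"] X(1) by (simp add: T_def)
    then show ?thesis by (subst expand[OF \<beta>(2) that], subst expand[OF l that]) simp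
  qed
  then show ?thesis using X(2) that by blast
qed

section \<open>The adjoint action on matrices and invariant projections\<close>

definition ad :: "'n::finite rsq \<Rightarrow> 'n rsq \<Rightarrow> 'n rsq" where
  "ad X \<phi> = X * \<phi> - \<phi> * X"

lemma linear_ad: "linear (ad X)" and linear_ad_left: "linear (\<lambda>X. ad X \<phi>)"
  by (simp_all add: linear_iff ad_def algebra_simps)

lemmas ad_simps = linear_0[OF linear_ad] linear_add[OF linear_ad] linear_diff[OF linear_ad] linear_cmul[OF linear_ad]
  linear_sum[OF linear_ad] linear_0[OF linear_ad_left] linear_add[OF linear_ad_left]
  linear_diff[OF linear_ad_left] linear_cmul[OF linear_ad_left] linear_sum[OF linear_ad_left]

lemma linear_ad_ad: "linear (\<lambda>\<phi>. ad X (ad Y \<phi>))"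
  using linear_compose[OF linear_ad linear_ad] by (simp add: comp_def)

lemma ad_commute: "X * Y = Y * X \<Longrightarrow> ad X (ad Y \<phi>) = ad Y (ad X \<phi>)"
proof -
  assume c: "X * Y = Y * X"
  have 1: "X * (Y * \<phi>) = Y * (X * \<phi>)" "\<phi> * (X * Y) = \<phi> * (Y * X)" using c by (metis mult.assoc)+
  show ?thesis by (simp add: ad_def algebra_simps 1)
qed

lemma ad_conj: "inverses g h \<Longrightarrow> ad (g * X * h) (g * \<phi> * h) = g * ad X \<phi> * h"
  using inversesD[of g h] by (simp add: ad_def algebra_simps)

lemma ad_conj': "inverses g h \<Longrightarrow> ad X (g * \<phi> * h) = g * ad (h * X * g) \<phi> * h"
  using inversesD[of g h] by (simp add: ad_def algebra_simps)

lemma inner_ad: "ad X \<phi> \<bullet> \<psi> = \<phi> \<bullet> ad (tp X) \<psi>"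
  by (simp add: ad_def inner_diff_left inner_diff_right inner_mult_left[of X \<phi> \<psi>] inner_mult_right[of \<phi> X \<psi>])

text \<open>Each application of \<open>ad N\<close> adds one factor N on the left or on the right;
  after 2 m of them one side has collected at least m.\<close>

lemma ad_nilpotent:
  assumes "N ^ m = 0" shows "(ad N ^^ (2 * m)) \<phi> = (0 :: 'n::finite rsq)"
proof -
  have "N ^ p * (ad N ^^ j) \<phi> * N ^ q = 0" if "2 * m \<le> p + q + j" for p q j
    using that
  proof (induction j arbitrary: p q)
    case 0
    then have "m \<le> p \<or> m \<le> q" by auto
    then show ?case using power_eq_0_mono[OF assms] by auto
  next
    case (Suc j)
    have "N ^ p * (ad N ^^ Suc j) \<phi> * N ^ q = N ^ Suc p * (ad N ^^ j) \<phi> * N ^ q - N ^ p * (ad N ^^ j) \<phi> * N ^ Suc q"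
      by (simp add: ad_def right_diff_distrib left_diff_distrib mult.assoc) (simp add: mult.assoc[symmetric] power_commutes)
    then show ?case using Suc.IH[of "Suc p" q] Suc.IH[of p "Suc q"] Suc.prems by simp
  qed
  from this[of 0 0 "2 * m"] show ?thesis by simp
qed

lemma funpow_comp_commute:
  assumes "\<And>x. f (g x) = g (f x)" shows "((\<lambda>x. f (g x)) ^^ j) x = (f ^^ j) ((g ^^ j) x)"
proof (induction j)
  case (Suc j)
  have "g ((f ^^ i) z) = (f ^^ i) (g z)" for i z by (induction i) (simp_all add: assms[symmetric])
  then show ?case using Suc by simp
qed simp

lemma funpow_mem: "(\<And>x. x \<in> U \<Longrightarrow> f x \<in> U) \<Longrightarrow> x \<in> U \<Longrightarrow> (f ^^ j) x \<in> U"
  by (induction j) auto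

lemma linear_funpow: "linear f \<Longrightarrow> linear (f ^^ j)" for f :: "'a::real_vector \<Rightarrow> 'a"
proof (induction j)
  case 0
  show ?case by (simp add: linear_iff)
next
  case (Suc j)
  then show ?case by (simp add: linear_iff)
qed

text \<open>The argument of \<open>replica_trace\<close> for the operators induced on
  \<open>U\<close>: the nilpotent part drops out of the trace, and what is left is a sum of squared
  norms of the action of the replica on an orthonormal basis.\<close>

lemma replica_ad_trace:
  assumes U: "subspace U" and S: "\<And>\<phi>. \<phi> \<in> U \<Longrightarrow> ad (fc (\<lambda>z. z) X) \<phi> \<in> U" "\<And>\<phi>. \<phi> \<in> U \<Longrightarrow> ad X \<phi> \<in> U"
    "\<And>\<phi>. \<phi> \<in> U \<Longrightarrow> ad (fc cnj X) \<phi> \<in> U"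
    and t: "tron U (\<lambda>\<phi>. ad X (ad (fc cnj X) \<phi>)) = 0" and "\<phi> \<in> U"
  shows "ad (fc cnj X) \<phi> = 0"
proof -
  define S N Y where "S = fc (\<lambda>z. z) X" and "N = X - S" and "Y = fc cnj X"
  obtain m where m: "N ^ m = 0" unfolding N_def S_def by (rule nilpotent_part)
  have XY: "Y * X = X * Y" unfolding Y_def by (rule fc_self_commute)
  have SY: "S * Y = Y * S" unfolding S_def by (rule fc_commute) (rule XY[symmetric])
  have NY: "N * Y = Y * N" by (simp add: N_def algebra_simps XY SY)
  have NU: "ad N \<psi> \<in> U" if "\<psi> \<in> U" for \<psi>
    using S(1,2)[OF that] by (simp add: N_def S_def ad_simps subspace_diff[OF U])
  have YU: "ad Y \<psi> \<in> U" if "\<psi> \<in> U" for \<psi> using S(3)[OF that] by (simp add: Y_def)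
  have SU: "ad S \<psi> \<in> U" if "\<psi> \<in> U" for \<psi> using S(1)[OF that] by (simp add: S_def)
  have "tron U (\<lambda>\<phi>. ad N (ad Y \<phi>)) = 0"
  proof (rule tron_nilpotent[OF linear_ad_ad U, of _ _ "2 * m"])
    show "((\<lambda>\<phi>. ad N (ad Y \<phi>)) ^^ (2 * m)) x = 0" for x
      by (simp add: funpow_comp_commute[of "ad N" "ad Y", OF ad_commute[OF NY]] ad_nilpotent[OF m])
  qed (use NU YU in auto)
  moreover have "tron U (\<lambda>\<phi>. ad X (ad Y \<phi>)) = tron U (\<lambda>\<phi>. ad N (ad Y \<phi>) + ad S (ad Y \<phi>))"
    by (simp add: N_def ad_simps)
  ultimately have tS: "tron U (\<lambda>\<phi>. ad S (ad Y \<phi>)) = 0" using t by (simp add: tron_add Y_def)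
  obtain x y where x: "inverses x y" "x * Y * y = tp (x * S * y)"
    unfolding S_def Y_def by (rule adapted_transpose)
  \<comment> \<open>Conjugation into coordinates where the replica is the transpose of the
    semisimple part, so that the two induced operators are adjoint to each other.\<close>
  define c where "c \<psi> = x * \<psi> * y" for \<psi>
  define c' where "c' \<psi> = y * \<psi> * x" for \<psi>
  have cc: "c' (c \<psi>) = \<psi>" "c (c' \<psi>) = \<psi>" for \<psi>
    using inversesD[OF x(1)] by (simp_all add: c_def c'_def mult.assoc)
  have lc: "linear c" "linear c'" by (simp_all add: linear_iff c_def c'_def algebra_simps)
  have V: "subspace (c ` U)" using lc(1) U by (rule linear_subspace_image)
  have adc: "c (ad Z \<psi>) = ad (c Z) (c \<psi>)" for Z \<psi> using ad_conj[OF x(1)] by (simp add: c_def)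
  have cY: "c Y = tp (c S)" using x(2) by (simp add: c_def)
  have "tron (c ` U) (\<lambda>\<psi>. ad (c S) (ad (c Y) \<psi>)) = tron (c ` U) (\<lambda>\<psi>. c (ad S (ad Y (c' \<psi>))))"
    by (simp add: adc cc)
  also have "\<dots> = tron U (\<lambda>\<phi>. ad S (ad Y (c' (c \<phi>))))"
    by (rule tron_exchange[OF U V lc(1) _ linear_compose[OF lc(2) linear_ad_ad, unfolded comp_def]])
       (use SU YU in \<open>auto simp: cc\<close>)
  finally have "(\<Sum>b\<in>onb (c ` U). ad (c S) (ad (c Y) b) \<bullet> b) = 0"
    using tS by (simp add: cc tron_def)
  moreover have "ad (c S) (ad (c Y) b) \<bullet> b = ad (c Y) b \<bullet> ad (c Y) b" for b
    by (simp add: inner_ad cY)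
  ultimately have "(\<Sum>b\<in>onb (c ` U). ad (c Y) b \<bullet> ad (c Y) b) = 0" by simp
  then have b0: "ad (c Y) b = 0" if "b \<in> onb (c ` U)" for b
    using that is_onbD(1)[OF is_onb_onb[OF V]] by (simp add: sum_nonneg_eq_0_iff)
  have "ad (c Y) (c \<phi>) = 0"
    by (subst onb_expansion[OF is_onb_onb[OF V] imageI[OF \<open>\<phi> \<in> U\<close>]]) (simp add: ad_simps b0)
  then have "c (ad Y \<phi>) = 0" by (simp add: adc)
  then show ?thesis using cc(1)[of "ad Y \<phi>"] linear_0[OF lc(2)] by (simp add: Y_def)
qed

context rgroup
begin

lemma Adinv_subspace: "Adinv W \<Longrightarrow> subspace W"
  and Adinv_mem: "Adinv W \<Longrightarrow> g \<in> G \<Longrightarrow> inverses g h \<Longrightarrow> X \<in> W \<Longrightarrow> g * X * h \<in> W"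
  and Adinv_ad: "Adinv W \<Longrightarrow> X \<in> lieal G \<Longrightarrow> Y \<in> W \<Longrightarrow> ad X Y \<in> W"
  using Adinv_bracket by (auto simp: Adinv_def ad_def)

lemma lieal_semisimple: "X \<in> lieal G \<Longrightarrow> fc (\<lambda>z. z) X \<in> lieal G"
proof -
  assume X: "X \<in> lieal G"
  have "fc (\<lambda>z. of_real (Re z)) X + fc (\<lambda>z. \<i> * of_real (Im z)) X = fc (\<lambda>z. of_real (Re z) + \<i> * of_real (Im z)) X"
    by (rule fc_add) (auto simp: csym_def)
  also have "\<dots> = fc (\<lambda>z. z) X" by (rule fc_cong) (simp add: complex_eq_iff)
  finally show ?thesis using subspace_add[OF subspace_lieal lieal_jordan[OF X]] by simp
qed

text \<open>Weyl's argument with the Casimir operator: in an invariant space \<open>U\<close> of matrices without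
  proper invariant subspaces outside \<open>M\<close>, on which the Lie algebra acts with values in \<open>M\<close>, it acts
  trivially, since the Casimir operator is nilpotent while its trace is the dimension of the
  effectively acting part of the Lie algebra.\<close>

lemma casimir_trivial_action:
  assumes U: "Adinv U" and M: "subspace M" "\<not> U \<subseteq> M"
    and UM: "\<And>X \<phi>. X \<in> lieal G \<Longrightarrow> \<phi> \<in> U \<Longrightarrow> ad X \<phi> \<in> M"
    and minimal: "\<And>V. Adinv V \<Longrightarrow> V \<subseteq> U \<Longrightarrow> \<not> V \<subseteq> M \<Longrightarrow> V = U"
    and X: "X \<in> lieal G" and "\<phi> \<in> U"
  shows "ad X \<phi> = 0"
proof -
  note sU = Adinv_subspace[OF U]
  note adU = Adinv_ad[OF U]
  \<comment> \<open>\<open>k\<close> is the kernel of the action on \<open>U\<close>, and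
    \<open>a\<close> its orthogonal complement for the trace form, meant to be the part that acts
    effectively.\<close>
  define k where "k = {X \<in> lieal G. \<forall>\<phi>\<in>U. ad X \<phi> = 0}"
  define a where "a = {X \<in> lieal G. \<forall>Y\<in>k. tr (X * Y) = 0}"
  have k: "Adinv k"
    unfolding Adinv_def
  proof (intro conjI allI impI)
    show "subspace k" using subspace_lieal unfolding subspace_def k_def by (auto simp: ad_simps)
    fix g h X assume g: "g \<in> G" "inverses g h" "X \<in> k"
    have "ad (g * X * h) \<phi> = 0" if "\<phi> \<in> U" for \<phi>
    proof -
      have "h * \<phi> * g \<in> U" using Adinv_mem[OF U inverses_mem[OF g(1,2)] inverses_sym[OF g(2)] that] .
      then have "ad (g * X * h) (g * (h * \<phi> * g) * h) = 0" using g(3) by (simp add: ad_conj[OF g(2)] k_def)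
      then show ?thesis using inversesD[OF g(2)] by (simp add: mult.assoc)
    qed
    then show "g * X * h \<in> k" using lieal_Ad[OF g(1,2)] g(3) by (simp add: k_def)
  qed
  have a: "Adinv a"
    unfolding Adinv_def
  proof (intro conjI allI impI)
    show "subspace a" using subspace_lieal unfolding subspace_def a_def by (auto simp: distrib_right)
    fix g h X assume g: "g \<in> G" "inverses g h" "X \<in> a"
    have "tr (g * X * h * Y) = 0" if "Y \<in> k" for Y
      using Adinv_mem[OF k inverses_mem[OF g(1,2)] inverses_sym[OF g(2)] that] g(3)
      by (simp add: tr_conj[OF g(2)] a_def)
    then show "g * X * h \<in> a" using lieal_Ad[OF g(1,2)] g(3) by (simp add: a_def)
  qed
  note sk = Adinv_subspace[OF k] and sa = Adinv_subspace[OF a]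
  have aL: "X \<in> lieal G" if "X \<in> a" for X using that by (simp add: a_def)
  \<comment> \<open>The replica of an element of \<open>k\<close> is again in \<open>k\<close>,
    because it commutes with everything that element commutes with; an element of \<open>a\<close>
    in \<open>k\<close> is thus trace-orthogonal to its own replica.\<close>
  have ka0: "X = 0" if "X \<in> k" "X \<in> a" for X
  proof (rule nilpotent_ideal_trivial[of "k \<inter> a"])
    show "Adinv (k \<inter> a)" using k a by (auto simp: Adinv_def intro: subspace_inter)
    show "\<exists>m. X ^ m = 0" if X: "X \<in> k \<inter> a" for X
    proof (rule replica_trace)
      have "X * \<phi> = \<phi> * X" if "\<phi> \<in> U" for \<phi> using X that by (simp add: k_def ad_def)
      then have "fc cnj X \<in> k" using X lieal_replica by (simp add: k_def ad_def fc_commute)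
      then show "tr (X * fc cnj X) = 0" using X by (simp add: a_def)
    qed
  qed (use that in \<open>auto simp: k_def\<close>)
  have decomp: "\<exists>X1\<in>k. \<exists>X2\<in>a. X = X1 + X2" if X: "X \<in> lieal G" for X
  proof -
    have nd: "Z = 0" if "Z \<in> k" "\<And>Y. Y \<in> k \<Longrightarrow> tr (Z * Y) = 0" for Z
      using ka0[of Z] that by (simp add: a_def k_def)
    obtain X1 where X1: "X1 \<in> k" "\<And>Y. Y \<in> k \<Longrightarrow> tr (X1 * Y) = tr (X * Y)"
      by (rule nondegenerate_represents[of k "\<lambda>X Y. tr (X * Y)" "\<lambda>Y. tr (X * Y)"])
         (use sk nd in \<open>auto simp: linear_iff algebra_simps\<close>)
    have "X - X1 \<in> lieal G" using X X1(1) subspace_diff[OF subspace_lieal] by (simp add: k_def)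
    then have "X - X1 \<in> a" using X1(2) by (simp add: a_def left_diff_distrib)
    then show ?thesis using X1(1) by (intro bexI[of _ X1] bexI[of _ "X - X1"]) auto
  qed
  \<comment> \<open>The trace form of the action on \<open>U\<close>. It is invariant, and its
    restriction to \<open>a\<close> turns out nondegenerate, which provides dual bases.\<close>
  define \<beta> where "\<beta> X Y = tron U (\<lambda>\<phi>. ad X (ad Y \<phi>))" for X Y
  have lin1: "linear (\<lambda>X. \<beta> X Y)" for Y
    by (simp add: linear_iff \<beta>_def ad_simps tron_add tron_scaleR)
  have lin2: "linear (\<beta> X)" for X
    by (simp add: linear_iff \<beta>_def ad_simps tron_add tron_scaleR)
  have sym: "\<beta> X Y = \<beta> Y X" if "X \<in> lieal G" "Y \<in> lieal G" for X Y
    unfolding \<beta>_def by (rule tron_exchange[OF sU sU linear_ad _ linear_ad]) (use adU that in auto)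
  have inv: "\<beta> (g * X * h) (g * Y * h) = \<beta> X Y" if g: "g \<in> G" "inverses g h" and XY: "X \<in> lieal G" "Y \<in> lieal G" for g h X Y
  proof -
    have "\<beta> (g * X * h) (g * Y * h) = tron U (\<lambda>\<phi>. g * ad X (ad Y (h * \<phi> * g)) * h)"
    proof -
      have "ad (g * X * h) (ad (g * Y * h) \<phi>) = g * ad X (ad Y (h * \<phi> * g)) * h" for \<phi>
        using ad_conj[OF g(2), of Y "h * \<phi> * g"] ad_conj[OF g(2), of X] inversesD[OF g(2)] by (simp add: mult.assoc)
      then show ?thesis by (simp add: \<beta>_def)
    qed
    also have "\<dots> = tron U (\<lambda>\<phi>. ad X (ad Y (h * (g * \<phi> * h) * g)))"
    proof (rule tron_exchange[OF sU sU, of "\<lambda>\<phi>. g * \<phi> * h" "\<lambda>\<phi>. ad X (ad Y (h * \<phi> * g))"])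
      show "linear (\<lambda>\<phi>. ad X (ad Y (h * \<phi> * g)))" by (simp add: linear_iff algebra_simps ad_simps)
      show "ad X (ad Y (h * \<phi> * g)) \<in> U" if "\<phi> \<in> U" for \<phi>
        by (intro adU XY Adinv_mem[OF U inverses_mem[OF g] inverses_sym[OF g(2)] that])
    qed (auto simp: linear_iff algebra_simps intro: Adinv_mem[OF U g, unfolded mult.assoc])
    finally show ?thesis using inversesD[OF g(2)] by (simp add: \<beta>_def mult.assoc)
  qed
  have nda: "X = 0" if X: "X \<in> a" "\<And>Y. Y \<in> a \<Longrightarrow> \<beta> X Y = 0" for X
  proof (rule nilpotent_ideal_trivial[of "{X \<in> a. \<forall>Y\<in>a. \<beta> X Y = 0}"])
    show "Adinv {X \<in> a. \<forall>Y\<in>a. \<beta> X Y = 0}"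
      unfolding Adinv_def
    proof (intro conjI allI impI)
      show "subspace {X \<in> a. \<forall>Y\<in>a. \<beta> X Y = 0}"
        using sa unfolding subspace_def
        by (auto simp: linear_0[OF lin1] linear_add[OF lin1] linear_cmul[OF lin1])
      fix g h X assume g: "g \<in> G" "inverses g h" "X \<in> {X \<in> a. \<forall>Y\<in>a. \<beta> X Y = 0}"
      have "\<beta> (g * X * h) Y = 0" if Y: "Y \<in> a" for Y
      proof -
        have hY: "h * Y * g \<in> a" using Adinv_mem[OF a inverses_mem[OF g(1,2)] inverses_sym[OF g(2)] Y] .
        have "\<beta> (g * X * h) Y = \<beta> (g * X * h) (g * (h * Y * g) * h)"
          using inversesD[OF g(2)] by (simp add: mult.assoc)
        also have "\<dots> = \<beta> X (h * Y * g)" by (rule inv) (use g hY aL in auto)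
        finally show ?thesis using g(3) hY by simp
      qed
      then show "g * X * h \<in> {X \<in> a. \<forall>Y\<in>a. \<beta> X Y = 0}" using Adinv_mem[OF a g(1,2)] g(3) by simp
    qed
    show "\<exists>m. X ^ m = 0" if X: "X \<in> {X \<in> a. \<forall>Y\<in>a. \<beta> X Y = 0}" for X
    proof (rule replica_trace)
      have XL: "X \<in> lieal G" using X aL by simp
      have "\<beta> X (fc cnj X) = 0"
      proof -
        \<comment> \<open>The replica of \<open>X\<close> need not lie in \<open>a\<close>, but its
          component in \<open>k\<close> acts as 0 and does not affect
          \<open>\<beta>\<close>.\<close>
        obtain Y1 Y2 where Y: "Y1 \<in> k" "Y2 \<in> a" "fc cnj X = Y1 + Y2" using decomp[OF lieal_replica[OF XL]] by blast
        have "\<beta> X Y1 = tron U (\<lambda>\<phi>. 0)"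
          unfolding \<beta>_def by (rule tron_cong[OF sU]) (use Y(1) in \<open>simp add: k_def ad_simps\<close>)
        then have "\<beta> X Y1 = 0" by (simp add: tron_def)
        then show ?thesis using X Y by (simp add: linear_add[OF lin2])
      qed
      then have "ad (fc cnj X) \<phi> = 0" if "\<phi> \<in> U" for \<phi>
        using replica_ad_trace[OF sU adU[OF lieal_semisimple[OF XL]] adU[OF XL] adU[OF lieal_replica[OF XL]] _ that]
        by (simp add: \<beta>_def)
      then have "fc cnj X \<in> k" using lieal_replica[OF XL] by (simp add: k_def)
      then show "tr (X * fc cnj X) = 0" using X by (simp add: a_def)
    qed
  qed (use X aL in auto)
  let ?B = "onb a"
  note B = is_onb_onb[OF sa]
  \<comment> \<open>The vectors \<open>d b\<close> will form the basis dual to the orthonormal basis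
    of \<open>a\<close> with respect to \<open>\<beta>\<close>.\<close>
  have "\<exists>d. d \<in> a \<and> (\<forall>Y\<in>a. \<beta> d Y = b \<bullet> Y)" for b
    by (rule nondegenerate_represents[OF sa lin1 lin2 nda bounded_linear.linear[OF bounded_linear_inner_right]]) auto
  then obtain d where d: "\<And>b. d b \<in> a" "\<And>b Y. Y \<in> a \<Longrightarrow> \<beta> (d b) Y = b \<bullet> Y" by metis
  \<comment> \<open>The Casimir operator of \<open>\<beta>\<close>. Each summand has trace
    \<open>\<beta> b (d b) = 1\<close>, so its trace on \<open>U\<close> is the dimension of
    \<open>a\<close>.\<close>
  define C where "C \<phi> = (\<Sum>b\<in>?B. ad b (ad (d b) \<phi>))" for \<phi>
  have Ba: "b \<in> a" if "b \<in> ?B" for b using is_onbD(2)[OF B that] .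
  have linC: "linear C" unfolding C_def by (intro linear_compose_sum ballI linear_ad_ad)
  have CU: "C \<phi> \<in> U" if "\<phi> \<in> U" for \<phi>
    unfolding C_def by (intro subspace_sum[OF sU] adU that aL Ba d)
  have CM: "C \<phi> \<in> M" if "\<phi> \<in> U" for \<phi>
    unfolding C_def by (intro subspace_sum[OF M(1)] UM adU that aL Ba d)
  have trC: "tron U C = real (card ?B)"
  proof -
    have "tron U C = (\<Sum>b\<in>?B. \<beta> b (d b))" unfolding C_def \<beta>_def by (rule tron_sum)
    also have "\<dots> = (\<Sum>b\<in>?B. 1)"
    proof (intro sum.cong refl)
      fix b assume b: "b \<in> ?B"
      have "\<beta> b (d b) = \<beta> (d b) b" by (rule sym[OF aL[OF Ba[OF b]] aL[OF d(1)]])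
      then show "\<beta> b (d b) = 1" using d(2)[OF Ba[OF b]] is_onbD(4)[OF B b] by simp
    qed
    finally show ?thesis by simp
  qed
  have exp1: "X = (\<Sum>c\<in>?B. \<beta> (d c) X *\<^sub>R c)" if "X \<in> a" for X
    using onb_expansion[OF B that] that by (simp add: d inner_commute)
  have exp2: "X = (\<Sum>c\<in>?B. \<beta> X c *\<^sub>R d c)" if "X \<in> a" for X
  proof -
    have Z: "(\<Sum>c\<in>?B. \<beta> X c *\<^sub>R d c) \<in> a" by (intro subspace_sum[OF sa] subspace_scale[OF sa] d)
    have "X - (\<Sum>c\<in>?B. \<beta> X c *\<^sub>R d c) = 0"
    proof (rule nda)
      show "X - (\<Sum>c\<in>?B. \<beta> X c *\<^sub>R d c) \<in> a" by (intro subspace_diff[OF sa] that Z)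
      fix Y assume Y: "Y \<in> a"
      have "\<beta> (\<Sum>c\<in>?B. \<beta> X c *\<^sub>R d c) Y = (\<Sum>c\<in>?B. \<beta> X c * (c \<bullet> Y))"
        by (simp add: linear_sum[OF lin1] linear_cmul[OF lin1] d Y)
      also have "\<dots> = \<beta> X (\<Sum>c\<in>?B. (Y \<bullet> c) *\<^sub>R c)"
        by (simp add: linear_sum[OF lin2] linear_cmul[OF lin2] mult.commute inner_commute)
      also have "\<dots> = \<beta> X Y" using onb_expansion[OF B Y] by simp
      finally show "\<beta> (X - (\<Sum>c\<in>?B. \<beta> X c *\<^sub>R d c)) Y = 0" by (simp add: linear_diff[OF lin1])
    qed
    then show ?thesis by simp
  qed
  have Cinv: "C (g * \<phi> * h) = g * C \<phi> * h" if g: "g \<in> G" "inverses g h" for g h \<phi>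
  proof -
    have hG: "h \<in> G" "inverses h g" using inverses_mem[OF g] inverses_sym[OF g(2)] .
    define A where "A X = h * X * g" for X
    have Aa: "A X \<in> a" if "X \<in> a" for X unfolding A_def using Adinv_mem[OF a hG that] .
    define A' where "A' X = g * X * h" for X
    have A'a: "A' X \<in> a" if "X \<in> a" for X unfolding A'_def using Adinv_mem[OF a g that] .
    have AA': "A (A' X) = X" for X using inversesD[OF g(2)] by (simp add: A_def A'_def mult.assoc)
    have \<beta>A: "\<beta> X (A Y) = \<beta> (A' X) Y" if "X \<in> a" "Y \<in> a" for X Y
      using inv[OF hG aL[OF A'a[OF that(1)]] aL[OF that(2)]] AA'[of X] unfolding A_def by simp
    have \<beta>A2: "\<beta> (A X) Y = \<beta> X (A' Y)" if "X \<in> a" "Y \<in> a" for X Y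
      using inv[OF hG aL[OF that(1)] aL[OF A'a[OF that(2)]]] AA'[of Y] unfolding A_def by simp
    \<comment> \<open>Conjugation changes the basis and its dual by coefficient matrices that are
      inverse to each other; this is why the Casimir operator commutes with the group.\<close>
    have delta: "(\<Sum>b\<in>?B. \<beta> (d c) (A b) * \<beta> (A (d b)) e) = (if c = e then 1 else 0)" if ce: "c \<in> ?B" "e \<in> ?B" for c e
    proof -
      have "(\<Sum>b\<in>?B. \<beta> (d c) (A b) * \<beta> (A (d b)) e) = (\<Sum>b\<in>?B. \<beta> (A' (d c)) b * (b \<bullet> A' e))"
        by (intro sum.cong refl) (simp add: \<beta>A \<beta>A2 d Ba ce A'a)
      also have "\<dots> = \<beta> (A' (d c)) (\<Sum>b\<in>?B. (A' e \<bullet> b) *\<^sub>R b)"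
        by (simp add: linear_sum[OF lin2] linear_cmul[OF lin2] mult.commute inner_commute)
      also have "\<dots> = \<beta> (A' (d c)) (A' e)" using onb_expansion[OF B A'a[OF Ba[OF ce(2)]]] by simp
      also have "\<dots> = \<beta> (d c) e" unfolding A'_def by (rule inv) (use g aL d Ba ce in auto)
      also have "\<dots> = c \<bullet> e" by (simp add: d Ba ce)
      finally show ?thesis using B ce by (simp add: is_onb_def)
    qed
    have "C (g * \<phi> * h) = g * (\<Sum>b\<in>?B. ad (A b) (ad (A (d b)) \<phi>)) * h"
      unfolding C_def A_def by (simp add: ad_conj'[OF g(2)] sum_distrib_left sum_distrib_right)
    also have "(\<Sum>b\<in>?B. ad (A b) (ad (A (d b)) \<phi>))
        = (\<Sum>b\<in>?B. \<Sum>c\<in>?B. \<Sum>e\<in>?B. (\<beta> (d c) (A b) * \<beta> (A (d b)) e) *\<^sub>R ad c (ad (d e) \<phi>))"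
    proof (intro sum.cong refl)
      fix b assume b: "b \<in> ?B"
      have "ad (A b) (ad (A (d b)) \<phi>) = ad (\<Sum>c\<in>?B. \<beta> (d c) (A b) *\<^sub>R c) (ad (\<Sum>e\<in>?B. \<beta> (A (d b)) e *\<^sub>R d e) \<phi>)"
        using exp1[OF Aa[OF Ba[OF b]]] exp2[OF Aa[OF d(1)]] by simp
      then show "ad (A b) (ad (A (d b)) \<phi>)
          = (\<Sum>c\<in>?B. \<Sum>e\<in>?B. (\<beta> (d c) (A b) * \<beta> (A (d b)) e) *\<^sub>R ad c (ad (d e) \<phi>))"
        by (simp add: ad_simps scaleR_sum_right) (subst sum.swap, simp add: mult.commute)
    qed
    also have "\<dots> = (\<Sum>c\<in>?B. \<Sum>b\<in>?B. \<Sum>e\<in>?B. (\<beta> (d c) (A b) * \<beta> (A (d b)) e) *\<^sub>R ad c (ad (d e) \<phi>))"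
      by (rule sum.swap)
    also have "\<dots> = (\<Sum>c\<in>?B. \<Sum>e\<in>?B. \<Sum>b\<in>?B. (\<beta> (d c) (A b) * \<beta> (A (d b)) e) *\<^sub>R ad c (ad (d e) \<phi>))"
      by (rule sum.cong[OF refl], rule sum.swap)
    also have "\<dots> = (\<Sum>c\<in>?B. \<Sum>e\<in>?B. if c = e then ad c (ad (d c) \<phi>) else 0)"
      unfolding scaleR_sum_left[symmetric] by (intro sum.cong refl) (simp add: delta)
    also have "\<dots> = C \<phi>" unfolding C_def using is_onbD(1)[OF B] by simp
    finally show ?thesis .
  qed
  \<comment> \<open>A Fitting argument: at a power of least image dimension the images are stable,
    so \<open>U\<close> is the sum of kernel and image. The exponent is a successor in order that
    the image lie in \<open>M\<close>.\<close>
  obtain n where n: "\<And>j. dim ((C ^^ Suc n) ` U) \<le> dim ((C ^^ Suc j) ` U)"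
    using ex_has_least_nat[of "\<lambda>_. True" 0 "\<lambda>j. dim ((C ^^ Suc j) ` U)"] by auto
  let ?D = "C ^^ Suc n"
  have linD: "linear ?D" using linC by (rule linear_funpow)
  have DU: "?D \<phi> \<in> U" if "\<phi> \<in> U" for \<phi> using CU that by (rule funpow_mem)
  have DD: "(C ^^ Suc (n + Suc n)) \<phi> = ?D (?D \<phi>)" for \<phi>
    by (simp only: add_Suc[symmetric] funpow_add comp_apply)
  have "(C ^^ Suc (n + Suc n)) ` U = ?D ` U"
  proof (rule subspace_dim_equal)
    show "subspace ((C ^^ Suc (n + Suc n)) ` U)" using linear_funpow[OF linC] sU by (rule linear_subspace_image)
    show "subspace (?D ` U)" using linD sU by (rule linear_subspace_image)
    show "(C ^^ Suc (n + Suc n)) ` U \<subseteq> ?D ` U" using DU by (auto simp only: DD)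
    show "dim (?D ` U) \<le> dim ((C ^^ Suc (n + Suc n)) ` U)" by (rule n)
  qed
  then have fit: "\<exists>\<psi>\<in>U. ?D \<phi> = ?D (?D \<psi>)" if "\<phi> \<in> U" for \<phi>
    using that by (metis (no_types, lifting) DD imageE imageI)
  define V where "V = {\<phi> \<in> U. ?D \<phi> = 0}"
  have DM: "?D \<phi> \<in> M" if "\<phi> \<in> U" for \<phi>
    using CM[OF funpow_mem[of U C \<phi> n]] CU that by simp
  have "V = U"
  proof (rule minimal)
    have Dinv: "(C ^^ j) (g * \<phi> * h) = g * (C ^^ j) \<phi> * h" if "g \<in> G" "inverses g h" for g h j \<phi>
      by (induction j) (simp_all add: Cinv[OF that])
    show "Adinv V"
      unfolding Adinv_def
    proof (intro conjI allI impI)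
      show "subspace V" using sU unfolding subspace_def V_def
        by (auto simp del: funpow.simps simp: linear_0[OF linD] linear_add[OF linD] linear_cmul[OF linD])
      fix g h X assume "g \<in> G" "inverses g h" "X \<in> V"
      then show "g * X * h \<in> V"
        using Adinv_mem[OF U] Dinv[of g h "Suc n" X] by (simp del: funpow.simps add: V_def)
    qed
    obtain \<phi>0 where \<phi>0: "\<phi>0 \<in> U" "\<phi>0 \<notin> M" using M(2) by blast
    \<comment> \<open>Subtracting an element of the image, which lies in \<open>M\<close>, moves
      \<phi>0 into the kernel without bringing it into \<open>M\<close>; by minimality the kernel is
      all of \<open>U\<close>.\<close>
    obtain \<psi> where \<psi>: "\<psi> \<in> U" "?D \<phi>0 = ?D (?D \<psi>)" using fit[OF \<phi>0(1)] by blast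
    have "\<phi>0 - ?D \<psi> \<in> V" unfolding V_def using \<phi>0 \<psi> DU[OF \<psi>(1)]
      by (simp del: funpow.simps add: subspace_diff[OF sU] linear_diff[OF linD])
    moreover have "\<phi>0 - ?D \<psi> \<notin> M" using \<phi>0(2) DM[OF \<psi>(1)] subspace_add[OF M(1)] by fastforce
    ultimately show "\<not> V \<subseteq> M" by blast
  qed (auto simp: V_def)
  then have "(C ^^ Suc n) \<phi> = 0" if "\<phi> \<in> U" for \<phi> using that by (auto simp: V_def)
  then have "tron U C = 0" using tron_nilpotent[OF linC sU CU] by blast
  then have "?B = {}" using trC is_onbD(1)[OF B] by simp
  then have a0: "a = {0}" using B unfolding is_onb_def by (metis span_empty)
  obtain X1 X2 where "X1 \<in> k" "X2 \<in> a" "X = X1 + X2" using decomp[OF X] by blast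
  then show ?thesis using a0 \<open>\<phi> \<in> U\<close> by (simp add: k_def)
qed

text \<open>\<open>A\<close> projects onto an invariant subspace, but not equivariantly. By the
  usual reduction to codimension 1, it suffices to find a commuting matrix with the same image that
  is a nonzero multiple of the identity there. A smallest invariant space of candidates outside
  \<open>M\<close> consists of such matrices by the Casimir argument.\<close>

theorem equivariant_projection:
  assumes A: "A * A = A" and inv: "\<And>g. g \<in> G \<Longrightarrow> g * A = A * g * A"
  obtains Y where "A * Y = Y" "Y * A = A" "\<And>g. g \<in> G \<Longrightarrow> g * Y = Y * g"
proof (cases "A = 0")
  case True
  then show ?thesis using that[of 0] by simp
next
  case False
  \<comment> \<open>Matrices with values in the image of \<open>A\<close> that act on this image as
    a scalar c; the space \<open>M\<close> below imposes c = 0. The group does not change c, so it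
    acts trivially on \<open>E\<close> modulo \<open>M\<close>.\<close>
  define E where "E = {\<phi>. A * \<phi> = \<phi> \<and> (\<exists>c. \<phi> * A = c *\<^sub>R A)}"
  define M where "M = {\<phi>. \<phi> * A = 0}"
  have sM: "subspace M" by (simp add: subspace_def M_def distrib_right)
  have "subspace E"
    unfolding subspace_def
  proof safe
    show "0 \<in> E" by (auto simp: E_def intro: exI[of _ 0])
  next
    fix x y assume "x \<in> E" "y \<in> E"
    then obtain c d where "A * x = x" "x * A = c *\<^sub>R A" "A * y = y" "y * A = d *\<^sub>R A" by (auto simp: E_def)
    then show "x + y \<in> E"
      unfolding E_def by (intro CollectI conjI exI[of _ "c + d"]) (simp_all add: distrib_left distrib_right scaleR_add_left)
  next
    fix r x assume "x \<in> E"
    then obtain c where "A * x = x" "x * A = c *\<^sub>R A" by (auto simp: E_def)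
    then show "r *\<^sub>R x \<in> E" unfolding E_def by (intro CollectI conjI exI[of _ "r * c"]) simp_all
  qed
  then have "Adinv E"
    unfolding Adinv_def
  proof (intro conjI allI impI)
    fix g h \<phi> assume g: "g \<in> G" "inverses g h" "\<phi> \<in> E"
    then obtain c where c: "A * \<phi> = \<phi>" "\<phi> * A = c *\<^sub>R A" by (auto simp: E_def)
    have "A * (g * \<phi> * h) = (A * g * A) * \<phi> * h" using c by (simp add: mult.assoc)
    also have "\<dots> = g * (A * \<phi>) * h" unfolding inv[OF g(1), symmetric] by (simp add: mult.assoc)
    finally have 1: "A * (g * \<phi> * h) = g * \<phi> * h" using c by simp
    have "g * \<phi> * h * A = g * (\<phi> * A) * h * A"
      using inv[OF inverses_mem[OF g(1,2)]] by (metis mult.assoc)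
    also have "\<dots> = c *\<^sub>R (g * (A * h * A))" by (simp add: c mult.assoc)
    also have "A * h * A = h * A" using inv[OF inverses_mem[OF g(1,2)]] by simp
    finally have "g * \<phi> * h * A = c *\<^sub>R A" using inversesD[OF g(2)] by simp
    then show "g * \<phi> * h \<in> E" using 1 by (auto simp: E_def)
  qed
  moreover have "A \<in> E" using A by (auto simp: E_def intro: exI[of _ 1])
  moreover have "A \<notin> M" using A False by (simp add: M_def)
  ultimately have "Adinv E \<and> E \<subseteq> E \<and> \<not> E \<subseteq> M" by blast
  from ex_has_least_nat[of "\<lambda>U. Adinv U \<and> U \<subseteq> E \<and> \<not> U \<subseteq> M" _ dim, OF this]
  obtain U where U: "Adinv U" "U \<subseteq> E" "\<not> U \<subseteq> M"
    and least: "\<And>V. Adinv V \<Longrightarrow> V \<subseteq> E \<Longrightarrow> \<not> V \<subseteq> M \<Longrightarrow> dim U \<le> dim V" by blast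
  have lieA: "X * A = A * X * A" if X: "X \<in> lieal G" for X
  proof -
    let ?W = "{Z. Z * A = A * Z * A}"
    have "subspace ?W" by (simp add: subspace_def algebra_simps)
    moreover have "mexp (t *\<^sub>R X) \<in> ?W" for t using inv[OF lieal_mexp[OF X]] by simp
    ultimately have "X \<in> ?W" using mexp_has_vector_derivative_0 by (rule has_vector_derivative_subspace)
    then show ?thesis by simp
  qed
  obtain \<phi> where \<phi>: "\<phi> \<in> U" "\<phi> \<notin> M" using U(3) by blast
  have triv: "ad X \<phi> = 0" if X: "X \<in> lieal G" for X
  proof (rule casimir_trivial_action[OF U(1) sM U(3) _ _ X \<phi>(1)])
    fix X \<psi> assume X: "X \<in> lieal G" and "\<psi> \<in> U"
    then obtain c where c: "A * \<psi> = \<psi>" "\<psi> * A = c *\<^sub>R A" using U(2) by (auto simp: E_def)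
    have "\<psi> * X * A = \<psi> * (A * X * A)" using lieA[OF X] by (simp add: mult.assoc)
    also have "\<dots> = (\<psi> * A) * (X * A)" by (simp add: mult.assoc)
    also have "\<dots> = c *\<^sub>R (A * X * A)" by (simp add: c mult.assoc)
    finally have "\<psi> * X * A = c *\<^sub>R (X * A)" by (simp only: lieA[OF X, symmetric])
    moreover have "X * \<psi> * A = c *\<^sub>R (X * A)" by (simp add: c mult.assoc)
    ultimately show "ad X \<psi> \<in> M" by (simp add: M_def ad_def left_diff_distrib)
  next
    fix V assume V: "Adinv V" "V \<subseteq> U" "\<not> V \<subseteq> M"
    then have "dim U \<le> dim V" using least U(2) by blast
    then show "V = U" using V U(1) by (intro subspace_dim_equal Adinv_subspace) auto
  qed
  obtain c where c: "A * \<phi> = \<phi>" "\<phi> * A = c *\<^sub>R A" using U(2) \<phi>(1) by (auto simp: E_def)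
  have "c \<noteq> 0" using c \<phi>(2) by (auto simp: M_def)
  show ?thesis
  proof (rule that[of "\<phi> /\<^sub>R c"])
    show "A * (\<phi> /\<^sub>R c) = \<phi> /\<^sub>R c" "\<phi> /\<^sub>R c * A = A" using c \<open>c \<noteq> 0\<close> by simp_all
    show "g * (\<phi> /\<^sub>R c) = \<phi> /\<^sub>R c * g" if "g \<in> G" for g
      using triv by (intro commute_group[OF conn _ that]) (simp add: ad_def)
  qed
qed

end

section \<open>A convex function on the symmetric space\<close>

text \<open>The Hilbert-Schmidt inner product of two linear maps.\<close>

definition hs2 :: "('a::euclidean_space \<Rightarrow> 'b::real_inner) \<Rightarrow> ('a \<Rightarrow> 'b) \<Rightarrow> real" where
  "hs2 A B = (\<Sum>b\<in>Basis. A b \<bullet> B b)"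

lemma hs2_adjoint:
  fixes A B :: "'a::euclidean_space \<Rightarrow> 'b::real_inner" and P P' :: "'a \<Rightarrow> 'a"
  assumes A: "linear A" and B: "linear B" and P: "\<And>x y. P x \<bullet> y = x \<bullet> P' y"
  shows "hs2 (\<lambda>x. A (P x)) B = hs2 A (\<lambda>x. B (P' x))"
proof -
  have ex: "f v = (\<Sum>c\<in>Basis. (v \<bullet> c) *\<^sub>R f c)" if "linear f" for f :: "'a \<Rightarrow> 'b" and v
    by (subst euclidean_representation[of v, symmetric]) (simp add: linear_sum[OF that] linear_cmul[OF that])
  have "hs2 (\<lambda>x. A (P x)) B = (\<Sum>b\<in>Basis. \<Sum>c\<in>Basis. (P b \<bullet> c) * (A c \<bullet> B b))"
    unfolding hs2_def by (subst ex[OF A]) (simp add: inner_sum_left)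
  also have "\<dots> = (\<Sum>c\<in>Basis. \<Sum>b\<in>Basis. (P' c \<bullet> b) * (A c \<bullet> B b))"
    by (subst sum.swap) (simp add: P inner_commute[of "P' _"])
  also have "\<dots> = hs2 A (\<lambda>x. B (P' x))"
    unfolding hs2_def by (subst (2) ex[OF B]) (simp add: inner_sum_right)
  finally show ?thesis .
qed

lemma hs2_nonneg: "hs2 A A \<ge> 0"
  by (simp add: hs2_def sum_nonneg)

lemma hs2_diff: "hs2 (\<lambda>x. A x - B x) (\<lambda>x. A x - B x) = hs2 A A - 2 * hs2 A B + hs2 B B"
  by (simp add: hs2_def inner_diff_left inner_diff_right inner_commute sum.distrib sum_subtractf sum_distrib_left)

lemma hs2_eq_0: assumes "linear A" "hs2 A A = 0" shows "A x = 0"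
proof -
  have "A b = 0" if "b \<in> Basis" for b
    using assms(2) that by (simp add: hs2_def sum_nonneg_eq_0_iff)
  then show ?thesis
    by (subst euclidean_representation[of x, symmetric]) (simp add: linear_sum[OF assms(1)] linear_cmul[OF assms(1)])
qed

text \<open>For inverse matrices this is the trace of \<open>x * tp x\<close> plus the trace of its
  inverse, a function on the symmetric space. A bound on it keeps both \<open>x\<close> and its
  inverse bounded, so limits remain invertible.\<close>

definition psi :: "'n::finite rsq \<Rightarrow> 'n rsq \<Rightarrow> real" where
  "psi x y = x \<bullet> x + y \<bullet> y"

lemma psi_nonneg: "psi x y \<ge> 0"
  by (simp add: psi_def)

lemma inner_self_mult_le: "(A * B) \<bullet> (A * B) \<le> (A \<bullet> A) * (B \<bullet> B)" for A :: "'n::finite rsq"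
  unfolding power2_norm_eq_inner[symmetric] power_mult_distrib[symmetric]
  by (intro power_mono norm_mult_ineq) simp

lemma psi_left_le: "psi (g * x) (y * h) \<le> (g \<bullet> g + h \<bullet> h) * psi x y"
proof -
  have "psi (g * x) (y * h) \<le> (g \<bullet> g) * (x \<bullet> x) + (y \<bullet> y) * (h \<bullet> h)"
    unfolding psi_def by (intro add_mono inner_self_mult_le)
  also have "\<dots> \<le> (g \<bullet> g + h \<bullet> h) * psi x y"
    by (simp add: psi_def algebra_simps)
  finally show ?thesis .
qed

lemma orth_inner: "k * tp k = 1 \<Longrightarrow> (x * k) \<bullet> (x * k) = x \<bullet> x" "k * tp k = 1 \<Longrightarrow> (tp k * x) \<bullet> (tp k * x) = x \<bullet> x"
  for k :: "'n::finite rsq"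
  by (simp_all add: inner_mult_right[of x k] inner_mult_left[of "tp k" x] mult.assoc) (simp add: mult.assoc[symmetric])

lemma psi_orth: "k * tp k = 1 \<Longrightarrow> psi (x * k) (tp k * y) = psi x y"
  by (simp add: psi_def orth_inner)

text \<open>Here \<open>x * h\<close> is the midpoint of the geodesic from \<open>x\<close> to
  \<open>x * h * h\<close>. The two extra squares are the exact convexity gap, later used for
  uniqueness of a circumcenter.\<close>

lemma psi_midpoint:
  assumes "tp h = h" "tp h' = h'"
  shows "2 * psi (x * h) (h' * y) + (x * h * h - x) \<bullet> (x * h * h - x) + (h' * h' * y - y) \<bullet> (h' * h' * y - y)
    = psi x y + psi (x * h * h) (h' * h' * y)"
proof -
  have "(x * h * h) \<bullet> x = (x * h) \<bullet> (x * h)" using inner_mult_right[of "x * h" h x] assms by simp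
  moreover have "(h' * h' * y) \<bullet> y = (h' * y) \<bullet> (h' * y)"
    using inner_mult_left[of h' "h' * y" y] assms by (simp add: mult.assoc)
  ultimately show ?thesis
    by (simp add: psi_def inner_diff_left inner_diff_right inner_commute)
qed

lemma deriv_inner_self:
  assumes "(f has_vector_derivative D) (at (0::real))"
  shows "((\<lambda>t. f t \<bullet> f t) has_real_derivative 2 * (D \<bullet> f 0)) (at 0)"
  using bounded_bilinear.has_vector_derivative[OF bounded_bilinear_inner assms assms]
  by (simp add: has_real_derivative_iff_has_vector_derivative inner_commute)

lemma psi_deriv_right:
  "((\<lambda>t. psi (x * mexp (t *\<^sub>R S)) (mexp (- (t *\<^sub>R S)) * y)) has_real_derivative 2 * ((x * S) \<bullet> x) - 2 * ((S * y) \<bullet> y)) (at 0)"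
proof -
  have "((\<lambda>t. x * mexp (t *\<^sub>R S)) has_vector_derivative x * S) (at 0)"
    by (intro bounded_linear.has_vector_derivative[OF bounded_linear_mult_right] mexp_has_vector_derivative_0)
  moreover have "((\<lambda>t. mexp (t *\<^sub>R (- S)) * y) has_vector_derivative (- S) * y) (at 0)"
    by (intro bounded_linear.has_vector_derivative[OF bounded_linear_mult_left] mexp_has_vector_derivative_0)
  ultimately show ?thesis
    using DERIV_add[OF deriv_inner_self deriv_inner_self] unfolding psi_def by fastforce
qed

lemma psi_deriv_left:
  "((\<lambda>t. psi (mexp (t *\<^sub>R S) * x) (y * mexp (- (t *\<^sub>R S)))) has_real_derivative 2 * ((S * x) \<bullet> x) - 2 * ((y * S) \<bullet> y)) (at 0)"
proof -
  have "((\<lambda>t. mexp (t *\<^sub>R S) * x) has_vector_derivative S * x) (at 0)"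
    by (intro bounded_linear.has_vector_derivative[OF bounded_linear_mult_left] mexp_has_vector_derivative_0)
  moreover have "((\<lambda>t. y * mexp (t *\<^sub>R (- S))) has_vector_derivative y * (- S)) (at 0)"
    by (intro bounded_linear.has_vector_derivative[OF bounded_linear_mult_right] mexp_has_vector_derivative_0)
  ultimately show ?thesis
    using DERIV_add[OF deriv_inner_self deriv_inner_self] unfolding psi_def by fastforce
qed

text \<open>The spectral theorem in the form used for estimates: the real eigenprojections are
  orthogonal, so squared norms split over the spectrum.\<close>

lemma sym_resolution:
  fixes S :: "'n::finite rsq"
  assumes S: "tp S = S"
  obtains Z :: "complex set" and q where "finite Z" "\<And>z. z \<in> Z \<Longrightarrow> tp (q z) = q z"
    "\<And>w :: 'n rsq. w \<bullet> w = (\<Sum>z\<in>Z. (w * q z) \<bullet> (w * q z))"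
    "\<And>t z. z \<in> Z \<Longrightarrow> mexp (t *\<^sub>R S) * q z = exp (t * Re z) *\<^sub>R q z"
    "\<And>w. (w * S) \<bullet> w = (\<Sum>z\<in>Z. Re z * ((w * q z) \<bullet> (w * q z)))"
    "\<And>(w :: 'n rsq) z. z \<in> Z \<Longrightarrow> (w * q z) \<bullet> (w * q z) \<le> w \<bullet> w"
proof -
  define q where "q z = rp (eig S z)" for z
  have sym: "tp (q z) = q z" for z by (simp add: q_def tp_rp tp_eig S)
  have idem: "q z * q z = q z" if "z \<in> sp S" for z
    using arg_cong[OF eig_idem[of S z], of rp] sym_real_spectrum(2)[OF S that] by (simp add: q_def rp_ip_mult)
  have sum1: "(\<Sum>z\<in>sp S. q z) = 1"
    using arg_cong[OF sum_eig[of S], of rp] by (simp add: q_def rp_sum)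
  have fq: "fc \<phi> S * q z = Re (\<phi> z) *\<^sub>R q z" if "csym \<phi>" "z \<in> sp S" for \<phi> z
    using arg_cong[OF fc_eig(1)[OF that], of rp] sym_real_spectrum(2)[OF S that(2)] by (simp add: q_def)
  have split: "u \<bullet> v = (\<Sum>z\<in>sp S. (u * q z) \<bullet> (v * q z))" for u v :: "'n rsq"
  proof -
    have "u \<bullet> v = (u * (\<Sum>z\<in>sp S. q z)) \<bullet> v" by (simp add: sum1)
    also have "\<dots> = (\<Sum>z\<in>sp S. (u * q z) \<bullet> v)" by (simp add: sum_distrib_left inner_sum_left)
    also have "\<dots> = (\<Sum>z\<in>sp S. (u * q z) \<bullet> (v * q z))"
    proof (intro sum.cong refl)
      fix z assume z: "z \<in> sp S"
      have "(u * q z) \<bullet> v = (u * q z * q z) \<bullet> v" by (simp add: idem z mult.assoc)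
      then show "(u * q z) \<bullet> v = (u * q z) \<bullet> (v * q z)" by (simp add: inner_mult_right[of "u * q z"] sym)
    qed
    finally show ?thesis .
  qed
  show ?thesis
  proof (rule that[OF finite_sp sym split])
    fix t z assume z: "z \<in> sp S"
    have c: "csym (\<lambda>z. exp (of_real t * z))" by (simp add: csym_def exp_cnj)
    have "mexp (t *\<^sub>R S) = fc (\<lambda>z. exp (of_real t * z)) S"
      using mexp_fc[OF csym_simps(2), of t S] sym_semisimple[OF S] by simp
    then show "mexp (t *\<^sub>R S) * q z = exp (t * Re z) *\<^sub>R q z"
      using fq[OF c z] sym_real_spectrum(1)[OF S z] by (simp add: Re_exp)
  next
    fix w :: "'n rsq"
    have "S * q z = Re z *\<^sub>R q z" if "z \<in> sp S" for z
      using fq[OF csym_simps(2) that] sym_semisimple[OF S] by simp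
    then show "(w * S) \<bullet> w = (\<Sum>z\<in>sp S. Re z * ((w * q z) \<bullet> (w * q z)))"
      unfolding split[of "w * S" w] by (intro sum.cong refl) (simp add: mult.assoc)
  next
    fix w :: "'n rsq" and z assume "z \<in> sp S"
    then show "(w * q z) \<bullet> (w * q z) \<le> w \<bullet> w"
      unfolding split[of w w] by (intro member_le_sum finite_sp) auto
  qed
qed

text \<open>The inequality forcing the limit of the normalized minimizers to have invariant image: a
  direction \<open>S\<close> in which \<open>psi\<close> does not decrease cannot contract \<open>x\<close> much.\<close>

lemma contraction_bound:
  fixes S x y v :: "'n::finite rsq"
  assumes S: "tp S = S" and d: "(S * y) \<bullet> y \<le> (x * S) \<bullet> x" and \<tau>: "\<tau> > 0"
  shows "(v * x) \<bullet> (v * x) \<le> exp (2 * \<tau>) * ((v * x * mexp S) \<bullet> (v * x * mexp S))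
    + (v \<bullet> v) / \<tau> * psi (x * mexp S) (mexp (- S) * y)"
proof -
  obtain Z :: "complex set" and q where Z: "finite Z" "\<And>z. z \<in> Z \<Longrightarrow> tp (q z) = q z"
    "\<And>w :: 'n rsq. w \<bullet> w = (\<Sum>z\<in>Z. (w * q z) \<bullet> (w * q z))"
    "\<And>t z. z \<in> Z \<Longrightarrow> mexp (t *\<^sub>R S) * q z = exp (t * Re z) *\<^sub>R q z"
    "\<And>w. (w * S) \<bullet> w = (\<Sum>z\<in>Z. Re z * ((w * q z) \<bullet> (w * q z)))"
    "\<And>(w :: 'n rsq) z. z \<in> Z \<Longrightarrow> (w * q z) \<bullet> (w * q z) \<le> w \<bullet> w"
    by (rule sym_resolution[OF S]) blast
  define a b where "a z = (x * q z) \<bullet> (x * q z)" and "b z = (tp y * q z) \<bullet> (tp y * q z)" for z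
  have nn: "a z \<ge> 0" "b z \<ge> 0" for z by (simp_all add: a_def b_def)
  have e1: "(w * mexp (t *\<^sub>R S)) \<bullet> (w * mexp (t *\<^sub>R S)) = (\<Sum>z\<in>Z. exp (t * Re z) * exp (t * Re z) * ((w * q z) \<bullet> (w * q z)))" for w t
    unfolding Z(3)[of "w * mexp (t *\<^sub>R S)"] by (intro sum.cong refl) (simp add: mult.assoc Z(4))
  have "(S * y) \<bullet> y = (tp y * S) \<bullet> tp y"
    using inner_tp[of "S * y" y] by (simp add: S)
  then have d': "(\<Sum>z\<in>Z. Re z * b z) \<le> (\<Sum>z\<in>Z. Re z * a z)"
    using d by (simp add: Z(5) a_def b_def)
  have "(mexp (- S) * y) \<bullet> (mexp (- S) * y) = (tp y * mexp ((- 1) *\<^sub>R S)) \<bullet> (tp y * mexp ((- 1) *\<^sub>R S))"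
    using inner_tp[of "mexp (- S) * y" "mexp (- S) * y"] by (simp add: tp_mexp S)
  then have psi: "psi (x * mexp S) (mexp (- S) * y) = (\<Sum>z\<in>Z. exp (Re z) * exp (Re z) * a z + exp (- Re z) * exp (- Re z) * b z)"
    unfolding psi_def using e1[of x 1] e1[of "tp y" "- 1"] by (simp add: a_def b_def sum.distrib)
  \<comment> \<open>From s \<le> exp (2 s), the \<open>psi\<close> value at the end of the segment
    bounds both positive and negative exponents linearly, up to the difference of the first moments;
    the latter has the right sign by \<open>d'\<close>. This bounds the total weight of contracted
    directions.\<close>
  have neg: "(\<Sum>z\<in>Z. max (- Re z) 0 * a z) \<le> psi (x * mexp S) (mexp (- S) * y)"
  proof -
    have "max (- Re z) 0 * a z \<le> (exp (Re z) * exp (Re z) * a z + exp (- Re z) * exp (- Re z) * b z) + (Re z * b z - Re z * a z)" for z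
    proof -
      have e: "s \<le> exp s * exp s" for s :: real
      proof -
        have "exp s * exp s = exp (2 * s)" by (simp add: exp_add[symmetric])
        then show ?thesis
          using exp_ge_add_one_self[of "2 * s"] exp_gt_zero[of "2 * s"] by (cases "s \<ge> 0") linarith+
      qed
      show ?thesis
      proof (cases "Re z \<ge> 0")
        case True
        have "Re z * a z \<le> exp (Re z) * exp (Re z) * a z" by (intro mult_right_mono e nn)
        moreover have "0 \<le> exp (- Re z) * exp (- Re z) * b z" "0 \<le> Re z * b z" using True nn by simp_all
        ultimately show ?thesis using True by simp
      next
        case False
        have "- Re z * b z \<le> exp (- Re z) * exp (- Re z) * b z" by (intro mult_right_mono e nn)
        moreover have "0 \<le> exp (Re z) * exp (Re z) * a z" using nn by simp
        ultimately show ?thesis using False by simp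
      qed
    qed
    then have "(\<Sum>z\<in>Z. max (- Re z) 0 * a z) \<le> (\<Sum>z\<in>Z. (exp (Re z) * exp (Re z) * a z + exp (- Re z) * exp (- Re z) * b z) + (Re z * b z - Re z * a z))"
      by (intro sum_mono)
    also have "\<dots> = psi (x * mexp S) (mexp (- S) * y) + ((\<Sum>z\<in>Z. Re z * b z) - (\<Sum>z\<in>Z. Re z * a z))"
      by (simp add: psi sum.distrib sum_subtractf)
    finally show ?thesis using d' by linarith
  qed
  have "(v * x) \<bullet> (v * x) = (\<Sum>z\<in>Z. (v * x * q z) \<bullet> (v * x * q z))" by (rule Z(3))
  also have "\<dots> \<le> (\<Sum>z\<in>Z. exp (2 * \<tau>) * (exp (Re z) * exp (Re z) * ((v * x * q z) \<bullet> (v * x * q z))) + (v \<bullet> v) / \<tau> * (max (- Re z) 0 * a z))"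
  proof (intro sum_mono)
    fix z assume "z \<in> Z"
    let ?c = "(v * x * q z) \<bullet> (v * x * q z)"
    have c: "?c \<ge> 0" by simp
    \<comment> \<open>Directions contracted by at most exp (- \<tau>) are recovered by the factor
      exp (2 \<tau>); for those contracted more, the weight is bounded by \<open>neg\<close> divided
      by \<tau>.\<close>
    show "?c \<le> exp (2 * \<tau>) * (exp (Re z) * exp (Re z) * ?c) + (v \<bullet> v) / \<tau> * (max (- Re z) 0 * a z)"
    proof (cases "Re z \<ge> - \<tau>")
      case True
      then have "1 \<le> exp (2 * \<tau> + (Re z + Re z))" by simp
      then have "1 \<le> exp (2 * \<tau>) * (exp (Re z) * exp (Re z))" by (simp only: exp_add)
      from mult_right_mono[OF this c] have "?c \<le> exp (2 * \<tau>) * (exp (Re z) * exp (Re z) * ?c)" by (simp add: mult.assoc)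
      moreover have "0 \<le> (v \<bullet> v) / \<tau> * (max (- Re z) 0 * a z)" using \<tau> nn by simp
      ultimately show ?thesis by linarith
    next
      case False
      have "?c \<le> (v \<bullet> v) * a z" unfolding a_def mult.assoc by (rule inner_self_mult_le)
      also have "\<dots> \<le> (v \<bullet> v) / \<tau> * (max (- Re z) 0 * a z)"
      proof -
        have "\<tau> \<le> max (- Re z) 0" using False by simp
        then have "1 \<le> max (- Re z) 0 / \<tau>" using \<tau> by (simp only: le_divide_eq_1_pos)
        from mult_left_mono[OF this, of "(v \<bullet> v) * a z"] show ?thesis using nn by (simp add: mult_ac)
      qed
      also have "\<dots> \<le> exp (2 * \<tau>) * (exp (Re z) * exp (Re z) * ?c) + (v \<bullet> v) / \<tau> * (max (- Re z) 0 * a z)"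
        using c by simp
      finally show ?thesis .
    qed
  qed
  also have "\<dots> = exp (2 * \<tau>) * ((v * x * mexp S) \<bullet> (v * x * mexp S)) + (v \<bullet> v) / \<tau> * (\<Sum>z\<in>Z. max (- Re z) 0 * a z)"
    using e1[of "v * x" 1] by (simp add: sum.distrib sum_distrib_left)
  also have "\<dots> \<le> exp (2 * \<tau>) * ((v * x * mexp S) \<bullet> (v * x * mexp S)) + (v \<bullet> v) / \<tau> * psi (x * mexp S) (mexp (- S) * y)"
    using neg \<tau> by (intro add_left_mono mult_left_mono) auto
  finally show ?thesis .
qed

section \<open>Projection onto the Lie algebra and the function \<open>FF\<close>\<close>

context rgroup
begin

definition prj :: "'n rsq \<Rightarrow> 'n rsq" where
  "prj b = (SOME X. X \<in> lieal G \<and> (\<forall>Y\<in>lieal G. tr (X * Y) = tr (b * Y)))"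

lemma prj: "prj b \<in> lieal G" "Y \<in> lieal G \<Longrightarrow> tr (prj b * Y) = tr (b * Y)"
proof -
  have "\<exists>X. X \<in> lieal G \<and> (\<forall>Y\<in>lieal G. tr (X * Y) = tr (b * Y))"
    by (rule nondegenerate_represents[of "lieal G" "\<lambda>X Y. tr (X * Y)" "\<lambda>Y. tr (b * Y)"])
       (use subspace_lieal trace_form_nondegenerate in \<open>auto simp: linear_iff algebra_simps\<close>)
  from someI_ex[OF this] show "prj b \<in> lieal G" "Y \<in> lieal G \<Longrightarrow> tr (prj b * Y) = tr (b * Y)"
    by (auto simp: prj_def)
qed

lemma prj_unique: assumes "X \<in> lieal G" "\<And>Y. Y \<in> lieal G \<Longrightarrow> tr (X * Y) = tr (b * Y)" shows "prj b = X"
proof -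
  have "prj b - X = 0"
    by (rule trace_form_nondegenerate) (use assms prj in \<open>auto simp: left_diff_distrib intro: subspace_diff[OF subspace_lieal]\<close>)
  then show ?thesis by simp
qed

lemma linear_prj: "linear prj"
proof (rule linearI)
  show "prj (a + b) = prj a + prj b" for a b
    by (rule prj_unique) (use prj in \<open>auto simp: distrib_right intro: subspace_add[OF subspace_lieal]\<close>)
  show "prj (r *\<^sub>R b) = r *\<^sub>R prj b" for r b
    by (rule prj_unique) (use prj in \<open>auto intro: subspace_scale[OF subspace_lieal]\<close>)
qed

lemma prj_id: "X \<in> lieal G \<Longrightarrow> prj X = X"
  by (rule prj_unique) auto

lemma prj_conj: assumes g: "g \<in> G" "inverses g h" shows "prj (g * b * h) = g * prj b * h"
proof (rule prj_unique)
  show "g * prj b * h \<in> lieal G" using lieal_Ad[OF g prj(1)] .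
  fix Y assume "Y \<in> lieal G"
  then have "h * Y * g \<in> lieal G" using lieal_Ad[OF inverses_mem[OF g] inverses_sym[OF g(2)]] by blast
  then show "tr (g * prj b * h * Y) = tr (g * b * h * Y)" by (simp add: tr_conj[OF g(2)] prj)
qed

text \<open>By cyclicity of the trace, a matrix and its conjugate by \<open>z\<close> have the same
  traces against the Lie algebra, since \<open>z\<close> commutes with the latter.\<close>

lemma prj_commutant:
  assumes z: "inverses z w" "\<And>X. X \<in> lieal G \<Longrightarrow> z * X = X * z"
  shows "prj (z * b * w) = prj b" "w * prj b * z = prj b"
proof -
  have w: "w * X = X * w" if "X \<in> lieal G" for X
  proof -
    have "w * X = w * (X * z) * w" using inversesD[OF z(1)] by (simp add: mult.assoc)
    also have "\<dots> = X * w" unfolding z(2)[OF that, symmetric] using inversesD[OF z(1)] by (simp add: mult.assoc)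
    finally show ?thesis .
  qed
  show "prj (z * b * w) = prj b"
  proof (rule prj_unique[OF prj(1)])
    fix Y assume Y: "Y \<in> lieal G"
    have "tr (z * b * w * Y) = tr (b * (w * Y * z))" by (rule tr_conj[OF z(1)])
    also have "w * Y * z = Y" using w[OF Y] inversesD[OF z(1)] by (simp add: mult.assoc)
    finally show "tr (prj b * Y) = tr (z * b * w * Y)" using prj(2)[OF Y] by simp
  qed
  show "w * prj b * z = prj b" using w[OF prj(1)] inversesD[OF z(1)] by (simp add: mult.assoc)
qed

text \<open>The trace projection onto the Lie algebra of the group conjugated by the inverse of
  \<open>x\<close>.\<close>

definition TT :: "'n rsq \<Rightarrow> 'n rsq \<Rightarrow> 'n rsq \<Rightarrow> 'n rsq" where
  "TT x y b = y * prj (x * b * y) * x"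

definition FF :: "'n rsq \<Rightarrow> 'n rsq \<Rightarrow> real" where
  "FF x y = hs2 (TT x y) (TT x y)"

lemma linear_TT: "linear (TT x y)"
  by (simp add: linear_iff TT_def distrib_left distrib_right linear_add[OF linear_prj] linear_cmul[OF linear_prj])

lemma FF_left: assumes "g \<in> G" "inverses g h" shows "FF (g * x) (y * h) = FF x y"
proof -
  have "TT (g * x) (y * h) b = TT x y b" for b
    using prj_conj[OF assms, of "x * b * y"] inversesD[OF assms(2)] by (simp add: TT_def mult.assoc)
  then have "TT (g * x) (y * h) = TT x y" by blast
  then show ?thesis by (simp add: FF_def)
qed

lemma FF_commutant:
  assumes z: "inverses z w" "\<And>X. X \<in> lieal G \<Longrightarrow> z * X = X * z" shows "FF (z * x) (y * w) = FF x y"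
proof -
  have "TT (z * x) (y * w) b = TT x y b" for b
    using prj_commutant[OF z, of "x * b * y"] by (simp add: TT_def mult.assoc) (simp add: mult.assoc[symmetric])
  then have "TT (z * x) (y * w) = TT x y" by blast
  then show ?thesis by (simp add: FF_def)
qed

text \<open>The Hilbert-Schmidt norm is unchanged by orthogonal conjugation in source and target.
  Hence \<open>FF\<close> descends to GL modulo orthogonal matrices.\<close>

lemma FF_right: assumes k: "k * tp k = 1" shows "FF (x * k) (tp k * y) = FF x y"
proof -
  have k': "tp k * k = 1" using k sqm_left_inverse_imp_right by blast
  have 1: "TT (x * k) (tp k * y) b = tp k * TT x y (k * b * tp k) * k" for b
    by (simp add: TT_def mult.assoc)
  have "FF (x * k) (tp k * y) = hs2 (\<lambda>b. TT x y (k * b * tp k)) (\<lambda>b. TT x y (k * b * tp k))"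
    unfolding FF_def hs2_def 1
  proof (intro sum.cong refl)
    fix b
    show "(tp k * TT x y (k * b * tp k) * k) \<bullet> (tp k * TT x y (k * b * tp k) * k) = TT x y (k * b * tp k) \<bullet> TT x y (k * b * tp k)"
      using orth_inner[OF k] by (simp add: mult.assoc)
  qed
  also have "\<dots> = hs2 (TT x y) (\<lambda>b. TT x y (k * (tp k * b * k) * tp k))"
  proof (rule hs2_adjoint[OF linear_TT, of "\<lambda>b. TT x y (k * b * tp k)" "\<lambda>b. k * b * tp k" "\<lambda>b. tp k * b * k"])
    show "linear (\<lambda>b. TT x y (k * b * tp k))"
      by (simp add: linear_iff distrib_left distrib_right linear_add[OF linear_TT] linear_cmul[OF linear_TT])
    show "(k * u * tp k) \<bullet> v = u \<bullet> (tp k * v * k)" for u v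
      using inner_mult_right[of "k * u" "tp k" v] inner_mult_left[of k u "v * k"] by (simp add: mult.assoc)
  qed
  also have "(\<lambda>b. TT x y (k * (tp k * b * k) * tp k)) = TT x y"
  proof
    fix b
    have "k * (tp k * b * k) * tp k = (k * tp k) * b * (k * tp k)" by (simp only: mult.assoc)
    then show "TT x y (k * (tp k * b * k) * tp k) = TT x y b" by (simp add: k)
  qed
  finally show ?thesis by (simp add: FF_def)
qed

lemma FF_nonneg: "FF x y \<ge> 0"
  unfolding FF_def by (rule hs2_nonneg)

text \<open>By symmetry of \<open>h\<close> and \<open>h'\<close>, half of the factors move across
  the inner product, and the cross term of the two endpoints becomes \<open>FF\<close> at the
  midpoint. The convexity gap is therefore an exact square, which vanishes only if \<open>TT\<close>
  agrees at both ends.\<close>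

lemma FF_midpoint:
  assumes h: "tp h = h" "tp h' = h'"
  shows "FF x y + FF (x * h * h) (h' * h' * y) - 2 * FF (x * h) (h' * y)
    = hs2 (\<lambda>b. TT (x * h * h) (h' * h' * y) b - TT x y b) (\<lambda>b. TT (x * h * h) (h' * h' * y) b - TT x y b)"
proof -
  have adj: "(h * u * h') \<bullet> v = u \<bullet> (h * v * h')" "(h' * u * h) \<bullet> v = u \<bullet> (h' * v * h)" for u v
    using inner_mult_right[of "h * u" h' v] inner_mult_left[of h u "v * h'"]
      inner_mult_right[of "h' * u" h v] inner_mult_left[of h' u "v * h"] by (simp_all add: h mult.assoc)
  have "hs2 (TT (x * h * h) (h' * h' * y)) (TT x y) = hs2 (\<lambda>b. TT (x * h) (h' * y) (h * b * h')) (\<lambda>b. h' * TT x y b * h)"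
  proof -
    have "TT (x * h * h) (h' * h' * y) b = h' * TT (x * h) (h' * y) (h * b * h') * h" for b
      by (simp add: TT_def mult.assoc)
    then show ?thesis by (simp add: hs2_def adj)
  qed
  also have "\<dots> = hs2 (TT (x * h) (h' * y)) (\<lambda>b. h' * TT x y (h * b * h') * h)"
    by (rule hs2_adjoint[OF linear_TT _ adj(1), of "\<lambda>b. h' * TT x y b * h"])
       (simp add: linear_iff distrib_left distrib_right linear_add[OF linear_TT] linear_cmul[OF linear_TT])
  also have "(\<lambda>b. h' * TT x y (h * b * h') * h) = TT (x * h) (h' * y)"
    by (simp add: TT_def mult.assoc fun_eq_iff)
  finally show ?thesis unfolding hs2_diff FF_def by simp
qed

text \<open>Repeated halving; dyadic points suffice later, since they already determine the sign of
  the one-sided derivative.\<close>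

lemma FF_convex:
  assumes S: "tp S = S" and F: "FF (x * mexp S) (mexp (- S) * y) \<le> FF x y"
  shows "FF (x * mexp ((1 / 2 ^ j) *\<^sub>R S)) (mexp (- ((1 / 2 ^ j) *\<^sub>R S)) * y) \<le> FF x y"
proof (induction j)
  case 0
  then show ?case using F by simp
next
  case (Suc j)
  let ?s = "1 / 2 ^ Suc j :: real"
  let ?h = "mexp (?s *\<^sub>R S)" and ?h' = "mexp (- (?s *\<^sub>R S))"
  have "?s + ?s = 1 / 2 ^ j" by simp
  then have hh: "?h * ?h = mexp ((1 / 2 ^ j) *\<^sub>R S)"
    using mexp_scaleR_add[of ?s ?s S] by simp
  have "- ?s + - ?s = - (1 / 2 ^ j)" by simp
  then have hh': "?h' * ?h' = mexp (- ((1 / 2 ^ j) *\<^sub>R S))"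
    using mexp_scaleR_add[of "- ?s" "- ?s" S] by simp
  have t: "tp ?h = ?h" "tp ?h' = ?h'" by (simp_all add: tp_mexp S)
  have "x * ?h * ?h = x * mexp ((1 / 2 ^ j) *\<^sub>R S)" using hh by (simp add: mult.assoc)
  then show ?case
    using FF_midpoint[OF t, of x y] hs2_nonneg[of "\<lambda>b. TT (x * ?h * ?h) (?h' * ?h' * y) b - TT x y b"] Suc
    unfolding hh' by simp
qed

lemma continuous_FF: "continuous_on UNIV (\<lambda>p. FF (fst p) (snd p))"
proof -
  have "continuous_on UNIV (\<lambda>p. prj (fst p * b * snd p))" for b
    by (rule linear_continuous_on_compose[OF _ linear_prj]) (intro continuous_intros)
  then show ?thesis unfolding FF_def hs2_def TT_def by (intro continuous_intros)
qed

lemma tendsto_FF: "u \<longlonglongrightarrow> x \<Longrightarrow> v \<longlonglongrightarrow> y \<Longrightarrow> (\<lambda>n. FF (u n) (v n)) \<longlonglongrightarrow> FF x y"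
  using continuous_on_tendsto_compose[OF continuous_FF tendsto_Pair, of u x sequentially v y] by simp

end

lemma psi_bounded_subseq:
  fixes u v :: "nat \<Rightarrow> 'n::finite rsq"
  assumes "\<And>n. psi (u n) (v n) \<le> c"
  obtains s x y where "strict_mono s" "(\<lambda>n. u (s n)) \<longlonglongrightarrow> x" "(\<lambda>n. v (s n)) \<longlonglongrightarrow> y"
proof -
  have "bounded (range (\<lambda>n. (u n, v n)))"
  proof (rule boundedI)
    fix p assume "p \<in> range (\<lambda>n. (u n, v n))"
    then obtain n where p: "p = (u n, v n)" by blast
    have "(norm p)\<^sup>2 \<le> c" using assms[of n] by (simp add: p norm_Pair psi_def power2_norm_eq_inner)
    then show "norm p \<le> sqrt c" by (rule real_le_rsqrt)
  qed
  then obtain l s where "strict_mono s" "((\<lambda>n. (u n, v n)) \<circ> s) \<longlonglongrightarrow> l"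
    using bounded_imp_convergent_subsequence by blast
  then show ?thesis
    using that[of s "fst l" "snd l"] tendsto_fst[of _ l] tendsto_snd[of _ l] by (fastforce simp: comp_def)
qed

section \<open>Existence of a minimum\<close>

context rgroup
begin

text \<open>The penalty bounds \<open>x\<close> and its inverse together, so a sublevel set in the
  closed set of inverse pairs is compact.\<close>

lemma penalized_minimum:
  assumes "\<epsilon> > 0"
  obtains x y where "inverses x y" "\<And>x' y'. inverses x' y' \<Longrightarrow> FF x y + \<epsilon> * psi x y \<le> FF x' y' + \<epsilon> * psi x' y'"
proof -
  define \<Phi> where "\<Phi> p = FF (fst p) (snd p) + \<epsilon> * psi (fst p) (snd p)" for p
  have cont: "continuous_on UNIV \<Phi>"
    unfolding \<Phi>_def psi_def by (intro continuous_intros continuous_FF)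
  let ?K = "{p. fst p * snd p = 1 \<and> \<Phi> p \<le> \<Phi> (1, 1)}"
  have "closed ?K"
    by (intro closed_Collect_conj closed_Collect_eq closed_Collect_le cont continuous_intros)
  moreover have "bounded ?K"
  proof (rule boundedI)
    fix p assume p: "p \<in> ?K"
    have "\<epsilon> * (norm p)\<^sup>2 \<le> \<Phi> p"
      using FF_nonneg[of "fst p" "snd p"] norm_Pair[of "fst p" "snd p"] by (simp add: \<Phi>_def psi_def power2_norm_eq_inner)
    then have "(norm p)\<^sup>2 \<le> \<Phi> (1, 1) / \<epsilon>" using p assms by (simp add: field_simps)
    then show "norm p \<le> sqrt (\<Phi> (1, 1) / \<epsilon>)" by (rule real_le_rsqrt)
  qed
  ultimately have "compact ?K" by (simp add: compact_eq_bounded_closed)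
  moreover have "(1, 1) \<in> ?K" by simp
  ultimately obtain p where p: "p \<in> ?K" "\<And>q. q \<in> ?K \<Longrightarrow> \<Phi> p \<le> \<Phi> q"
    using continuous_attains_inf[of ?K \<Phi>] continuous_on_subset[OF cont] by blast
  show ?thesis
  proof (rule that[of "fst p" "snd p"])
    show "inverses (fst p) (snd p)" using p by (simp add: inverses_def)
    fix x' y' :: "'n rsq" assume "inverses x' y'"
    then have "\<Phi> p \<le> \<Phi> (x', y')"
      using p(2)[of "(x', y')"] p(1) by (cases "\<Phi> (x', y') \<le> \<Phi> (1, 1)") (auto simp: inverses_def)
    then show "FF (fst p) (snd p) + \<epsilon> * psi (fst p) (snd p) \<le> FF x' y' + \<epsilon> * psi x' y'" by (simp add: \<Phi>_def)
  qed
qed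

lemma commutant_lieal:
  assumes Y: "\<And>g. g \<in> G \<Longrightarrow> g * Y = Y * g" and X: "X \<in> lieal G" shows "X * Y = Y * X"
proof -
  have "subspace {Z. Z * Y = Y * Z}" by (simp add: subspace_def algebra_simps)
  moreover have "mexp (t *\<^sub>R X) \<in> {Z. Z * Y = Y * Z}" for t using Y[OF lieal_mexp[OF X]] by simp
  ultimately have "X \<in> {Z. Z * Y = Y * Z}" using mexp_has_vector_derivative_0 by (rule has_vector_derivative_subspace)
  then show ?thesis by simp
qed

lemma deriv_dyadic_nonneg:
  fixes f :: "real \<Rightarrow> real"
  assumes "(f has_real_derivative D) (at 0)" "\<And>j. f 0 \<le> f (1 / 2 ^ j)" shows "D \<ge> 0"
proof -
  have lim: "(\<lambda>j. 1 / 2 ^ j :: real) \<longlonglongrightarrow> 0"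
    using LIMSEQ_realpow_zero[of "1 / 2"] by (simp add: power_one_over)
  then have "filterlim (\<lambda>j. 1 / 2 ^ j :: real) (at 0) sequentially" by (simp add: filterlim_at)
  moreover have "((\<lambda>h. (f h - f 0) / h) \<longlongrightarrow> D) (at 0)"
    using assms(1) by (simp add: has_field_derivative_iff)
  ultimately have "(\<lambda>j. (f (1 / 2 ^ j) - f 0) / (1 / 2 ^ j)) \<longlonglongrightarrow> D"
    by (rule filterlim_compose[rotated])
  then show ?thesis by (rule LIMSEQ_le_const) (use assms(2) in auto)
qed

text \<open>In commutant directions \<open>FF\<close> is constant, so \<open>psi\<close> is
  stationary: the first condition. Along the geodesic from \<open>x\<close> to \<open>g * x\<close>
  the function \<open>FF\<close> has equal ends and by convexity does not exceed its initial value,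
  so \<open>psi\<close> cannot decrease initially; \<open>contraction_bound\<close> turns this into
  the second.\<close>

lemma penalized_minimum_conditions:
  assumes xy: "inverses x y" and \<epsilon>: "\<epsilon> > 0"
    and m: "\<And>x' y'. inverses x' y' \<Longrightarrow> FF x y + \<epsilon> * psi x y \<le> FF x' y' + \<epsilon> * psi x' y'"
  shows "\<And>Y. (\<And>g. g \<in> G \<Longrightarrow> g * Y = Y * g) \<Longrightarrow> Y \<bullet> (x * tp x) = Y \<bullet> (tp y * y)"
    and "\<And>g h v \<tau>. \<lbrakk>g \<in> G; inverses g h; \<tau> > 0\<rbrakk> \<Longrightarrow> (v * x) \<bullet> (v * x) \<le>
      exp (2 * \<tau>) * ((v * (g * x)) \<bullet> (v * (g * x))) + (v \<bullet> v) / \<tau> * ((g \<bullet> g + h \<bullet> h) * psi x y)"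
proof -
  fix Y assume Y: "\<And>g. g \<in> G \<Longrightarrow> g * Y = Y * g"
  let ?f = "\<lambda>t. psi (mexp (t *\<^sub>R Y) * x) (y * mexp (- (t *\<^sub>R Y)))"
  have "?f 0 \<le> ?f t" for t
  proof -
    have "mexp (t *\<^sub>R Y) * X = X * mexp (t *\<^sub>R Y)" if "X \<in> lieal G" for X
      using commutant_lieal[OF Y that] by (intro mexp_commute) simp
    then have "FF (mexp (t *\<^sub>R Y) * x) (y * mexp (- (t *\<^sub>R Y))) = FF x y"
      by (intro FF_commutant inverses_mexp)
    then have "psi x y \<le> ?f t"
      using m[OF inverses_mult[OF inverses_mexp[of "t *\<^sub>R Y"] xy]] \<epsilon> by simp
    then show ?thesis by simp
  qed
  then have "2 * ((Y * x) \<bullet> x) - 2 * ((y * Y) \<bullet> y) = 0"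
    by (intro DERIV_local_min[OF psi_deriv_left, of 1]) auto
  then show "Y \<bullet> (x * tp x) = Y \<bullet> (tp y * y)"
    by (simp add: inner_mult_right[of Y x] inner_mult_left[of y Y])
next
  fix g h v and \<tau> :: real assume g: "g \<in> G" "inverses g h" and \<tau>: "\<tau> > 0"
  obtain S k where S: "tp S = S" "tp k * k = 1" "k * tp k = 1" "g * x = x * mexp S * k"
    by (rule polar[OF xy inverses_mult[OF g(2) xy]])
  have xS: "g * x * tp k = x * mexp S" using S(3) by (simp add: S(4) mult.assoc)
  have yS: "k * (y * h) = mexp (- S) * y"
  proof (rule inverses_unique)
    show "inverses (g * x * tp k) (k * (y * h))"
      by (intro inverses_mult g xy) (simp add: inverses_def S(2))
    show "inverses (g * x * tp k) (mexp (- S) * y)"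
      unfolding xS by (intro inverses_mult xy inverses_mexp)
  qed
  have k: "tp k * tp (tp k) = 1" using S(2) by simp
  have "FF (x * mexp S) (mexp (- S) * y) = FF x y"
    using FF_right[OF k, of "g * x" "y * h"] FF_left[OF g] by (simp add: xS yS)
  then have F: "FF (x * mexp ((1 / 2 ^ j) *\<^sub>R S)) (mexp (- ((1 / 2 ^ j) *\<^sub>R S)) * y) \<le> FF x y" for j
    by (intro FF_convex S(1)) simp
  have psi_eq: "psi (x * mexp S) (mexp (- S) * y) = psi (g * x) (y * h)"
    using psi_orth[OF k, of "g * x" "y * h"] by (simp add: xS yS)
  have "0 \<le> 2 * ((x * S) \<bullet> x) - 2 * ((S * y) \<bullet> y)"
  proof (rule deriv_dyadic_nonneg[OF psi_deriv_right])
    fix j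
    let ?t = "1 / 2 ^ j :: real"
    have le: "FF x y + \<epsilon> * psi x y \<le> FF (x * mexp (?t *\<^sub>R S)) (mexp (- (?t *\<^sub>R S)) * y) + \<epsilon> * psi (x * mexp (?t *\<^sub>R S)) (mexp (- (?t *\<^sub>R S)) * y)"
      by (rule m[OF inverses_mult[OF xy inverses_mexp]])
    have "psi x y \<le> psi (x * mexp (?t *\<^sub>R S)) (mexp (- (?t *\<^sub>R S)) * y)"
    proof -
      have "\<epsilon> * psi x y \<le> \<epsilon> * psi (x * mexp (?t *\<^sub>R S)) (mexp (- (?t *\<^sub>R S)) * y)"
        using F[of j] le by linarith
      then show ?thesis using \<epsilon> by (simp only: mult_le_cancel_left_pos)
    qed
    then show "psi (x * mexp (0 *\<^sub>R S)) (mexp (- (0 *\<^sub>R S)) * y) \<le> psi (x * mexp (?t *\<^sub>R S)) (mexp (- (?t *\<^sub>R S)) * y)"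
      by simp
  qed
  then have d: "(S * y) \<bullet> y \<le> (x * S) \<bullet> x" by simp
  have "(v * x * mexp S) \<bullet> (v * x * mexp S) = (v * (g * x)) \<bullet> (v * (g * x))"
    using orth_inner(1)[OF k, of "v * (g * x)"] by (simp add: xS[symmetric] mult.assoc)
  then have "(v * x) \<bullet> (v * x) \<le> exp (2 * \<tau>) * ((v * (g * x)) \<bullet> (v * (g * x))) + (v \<bullet> v) / \<tau> * psi (g * x) (y * h)"
    using contraction_bound[OF S(1) d \<tau>, of v] by (simp add: psi_eq)
  also have "\<dots> \<le> exp (2 * \<tau>) * ((v * (g * x)) \<bullet> (v * (g * x))) + (v \<bullet> v) / \<tau> * ((g \<bullet> g + h \<bullet> h) * psi x y)"
    using \<tau> by (intro add_left_mono mult_left_mono psi_left_le) auto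
  finally show "(v * x) \<bullet> (v * x) \<le> exp (2 * \<tau>) * ((v * (g * x)) \<bullet> (v * (g * x))) + (v \<bullet> v) / \<tau> * ((g \<bullet> g + h \<bullet> h) * psi x y)" .
qed

text \<open>\<open>A\<close> and \<open>B\<close> are \<open>x * tp x\<close> and its inverse,
  divided by \<open>psi\<close>. Their limits satisfy \<open>B0 * A0 = 0\<close>, and their traces
  sum to 1. The image of \<open>A0\<close> is invariant, and an equivariant projection
  \<open>Y\<close> onto it has \<open>Y * A0 = A0\<close> and \<open>B0 * Y = 0\<close>.
  Stationarity in direction \<open>Y\<close> gives trace 0 for \<open>A0\<close>, and in direction 1
  equality of both traces: a contradiction.\<close>

lemma no_escape:
  assumes xy: "\<And>m. inverses (x m) (y m)" and \<epsilon>: "\<And>m. \<epsilon> m > 0"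
    and mi: "\<And>m x' y'. inverses x' y' \<Longrightarrow> FF (x m) (y m) + \<epsilon> m * psi (x m) (y m) \<le> FF x' y' + \<epsilon> m * psi x' y'"
    and R: "\<And>m. real m < psi (x m) (y m)"
  shows False
proof -
  define r where "r m = psi (x m) (y m)" for m
  have rpos: "r m > 0" for m using R[of m] by (simp add: r_def)
  have "filterlim r at_top sequentially"
    by (rule filterlim_at_top_mono[OF filterlim_real_sequentially]) (use R in \<open>auto simp: r_def intro!: always_eventually less_imp_le\<close>)
  then have r0: "(\<lambda>m. inverse (r m)) \<longlonglongrightarrow> 0" by (rule tendsto_inverse_0_at_top)
  define A B where "A m = (x m * tp (x m)) /\<^sub>R r m" and "B m = (tp (y m) * y m) /\<^sub>R r m" for m
  have bA: "norm (A m) \<le> 1" and bB: "norm (B m) \<le> 1" for m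
  proof -
    have "norm (x m * tp (x m)) \<le> norm (x m) * norm (x m)"
      using norm_mult_ineq[of "x m" "tp (x m)"] by (simp add: norm_tp)
    also have "\<dots> \<le> r m" by (simp add: r_def psi_def power2_norm_eq_inner[symmetric] power2_eq_square)
    finally show "norm (A m) \<le> 1" using rpos[of m] by (simp add: A_def divide_simps)
    have "norm (tp (y m) * y m) \<le> norm (y m) * norm (y m)"
      using norm_mult_ineq[of "tp (y m)" "y m"] by (simp add: norm_tp)
    also have "\<dots> \<le> r m" by (simp add: r_def psi_def power2_norm_eq_inner[symmetric] power2_eq_square)
    finally show "norm (B m) \<le> 1" using rpos[of m] by (simp add: B_def divide_simps)
  qed
  have "psi (A m) (B m) \<le> 2" for m
    using power_mono[OF bA[of m], of 2] power_mono[OF bB[of m], of 2] by (simp add: psi_def power2_norm_eq_inner)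
  then obtain s A0 B0 where s: "strict_mono s" "(\<lambda>m. A (s m)) \<longlonglongrightarrow> A0" "(\<lambda>m. B (s m)) \<longlonglongrightarrow> B0"
    using psi_bounded_subseq[of A B 2] by blast
  have rs: "(\<lambda>m. inverse (r (s m))) \<longlonglongrightarrow> 0" using LIMSEQ_subseq_LIMSEQ[OF r0 s(1)] by (simp add: comp_def)
  have cond: "Y \<bullet> A0 = Y \<bullet> B0" if "\<And>g. g \<in> G \<Longrightarrow> g * Y = Y * g" for Y
  proof -
    have "Y \<bullet> A (s m) = Y \<bullet> B (s m)" for m
      using penalized_minimum_conditions(1)[OF xy \<epsilon> mi that, of "s m"] by (simp add: A_def B_def)
    moreover have "(\<lambda>m. Y \<bullet> A (s m)) \<longlonglongrightarrow> Y \<bullet> A0" "(\<lambda>m. Y \<bullet> B (s m)) \<longlonglongrightarrow> Y \<bullet> B0"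
      by (intro tendsto_intros s)+
    ultimately show ?thesis by (simp add: LIMSEQ_unique)
  qed
  have "1 \<bullet> A m + 1 \<bullet> B m = 1" for m
  proof -
    have "1 \<bullet> (x m * tp (x m)) + 1 \<bullet> (tp (y m) * y m) = r m"
      by (simp add: r_def psi_def inner_eq_tr tr_mult_commute[of "x m"])
    then have "(1 \<bullet> (x m * tp (x m)) + 1 \<bullet> (tp (y m) * y m)) / r m = 1" using rpos[of m] by simp
    then show ?thesis by (simp add: A_def B_def divide_inverse distrib_left mult.commute)
  qed
  moreover have "(\<lambda>m. 1 \<bullet> A (s m) + 1 \<bullet> B (s m)) \<longlonglongrightarrow> 1 \<bullet> A0 + 1 \<bullet> B0" by (intro tendsto_intros s)
  ultimately have tr1: "1 \<bullet> A0 + 1 \<bullet> B0 = 1" by (simp add: LIMSEQ_const_iff)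
  have "B m * A m = inverse (r m) *\<^sub>R (inverse (r m) *\<^sub>R 1)" for m
  proof -
    have "tp (y m) * y m * (x m * tp (x m)) = 1"
      using inversesD[OF xy[of m]] inversesD[OF inverses_tp[OF xy[of m]]] by (simp add: mult.assoc)
    then show ?thesis by (simp add: A_def B_def)
  qed
  moreover have "(\<lambda>m. inverse (r (s m)) *\<^sub>R (inverse (r (s m)) *\<^sub>R (1 :: 'n rsq))) \<longlonglongrightarrow> 0 *\<^sub>R (0 *\<^sub>R 1)"
    by (intro tendsto_intros rs)
  moreover have "(\<lambda>m. B (s m) * A (s m)) \<longlonglongrightarrow> B0 * A0" by (intro tendsto_intros s)
  ultimately have BA: "B0 * A0 = 0" by (simp add: LIMSEQ_unique)
  have symA: "tp A0 = A0"
  proof -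
    have "tp (A m) = A m" for m by (simp add: A_def)
    then show ?thesis using LIMSEQ_unique[OF tendsto_tp[OF s(2)]] s(2) by simp
  qed
  \<comment> \<open>The rows annihilating \<open>A0\<close> form a stable set; equivalently its
    image is invariant.\<close>
  have ker: "v * A0 = 0" if g: "g \<in> G" and v: "v * g * A0 = 0" for g v
  proof -
    obtain h where h: "inverses g h" using inv_mem[OF g] by blast
    define \<delta> where "\<delta> m = ((v * (g * x m)) \<bullet> (v * (g * x m))) / r m" for m
    define \<eta> where "\<eta> m = ((v * x m) \<bullet> (v * x m)) / r m" for m
    define c where "c = (v \<bullet> v) * (g \<bullet> g + h \<bullet> h)"
    have quad: "((w * x m) \<bullet> (w * x m)) / r m = (w * A m) \<bullet> w" for w m
    proof -
      have "(w * A m) \<bullet> w = inverse (r m) * ((w * x m * tp (x m)) \<bullet> w)" by (simp add: A_def mult.assoc)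
      then show ?thesis by (simp add: inner_mult_right[of "w * x m" "tp (x m)" w] divide_inverse mult.commute)
    qed
    have "(\<lambda>m. (v * g * A (s m)) \<bullet> (v * g)) \<longlonglongrightarrow> (v * g * A0) \<bullet> (v * g)" by (intro tendsto_intros s)
    moreover have "(v * g * A m) \<bullet> (v * g) = \<delta> m" for m
      using quad[of "v * g" m] by (simp add: \<delta>_def mult.assoc)
    ultimately have \<delta>0: "(\<lambda>m. \<delta> (s m)) \<longlonglongrightarrow> 0" by (simp add: v)
    have est: "\<eta> m \<le> exp (2 * \<tau>) * \<delta> m + c / \<tau>" if \<tau>: "\<tau> > 0" for \<tau> m
    proof -
      have "\<eta> m \<le> (exp (2 * \<tau>) * ((v * (g * x m)) \<bullet> (v * (g * x m))) + (v \<bullet> v) / \<tau> * ((g \<bullet> g + h \<bullet> h) * r m)) / r m"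
        unfolding \<eta>_def using penalized_minimum_conditions(2)[OF xy[of m] \<epsilon>[of m] mi[where m = m] g h \<tau>, of v] rpos[of m]
        by (intro divide_right_mono) (simp_all only: r_def less_imp_le)
      also have "\<dots> = exp (2 * \<tau>) * \<delta> m + c / \<tau>"
        using rpos[of m] by (simp add: \<delta>_def c_def add_divide_distrib)
      finally show ?thesis .
    qed
    have lim\<eta>: "(\<lambda>m. \<eta> (s m)) \<longlonglongrightarrow> (v * A0) \<bullet> v"
    proof -
      have "(\<lambda>m. (v * A (s m)) \<bullet> v) \<longlonglongrightarrow> (v * A0) \<bullet> v" by (intro tendsto_intros s)
      then show ?thesis by (simp add: \<eta>_def quad)
    qed
    \<comment> \<open>For fixed \<tau> the term with \<open>\<delta>\<close> disappears in the limit
      over m; only afterwards \<tau> tends to infinity.\<close>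
    have "(v * A0) \<bullet> v \<le> c / \<tau>" if \<tau>: "\<tau> > 0" for \<tau>
    proof -
      have "(\<lambda>m. exp (2 * \<tau>) * \<delta> (s m) + c / \<tau>) \<longlonglongrightarrow> exp (2 * \<tau>) * 0 + c / \<tau>"
        by (intro tendsto_intros \<delta>0)
      then show ?thesis using LIMSEQ_le[OF lim\<eta>] est[OF \<tau>] by auto
    qed
    moreover have "((\<lambda>\<tau>. c / \<tau>) \<longlongrightarrow> 0) at_top"
      by (rule tendsto_divide_0[OF tendsto_const]) (simp add: filterlim_at_top_imp_at_infinity filterlim_ident)
    ultimately have "(v * A0) \<bullet> v \<le> 0"
      by (intro tendsto_lowerbound[of "\<lambda>\<tau>. c / \<tau>" 0 at_top]) (auto intro: eventually_mono[OF eventually_gt_at_top[of 0]])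
    moreover have "norm (v * A m) \<le> sqrt (\<eta> m)" for m
    proof -
      have "(norm (v * A m))\<^sup>2 = (norm (v * x m * tp (x m)))\<^sup>2 / (r m * r m)"
        using rpos[of m] by (simp add: A_def mult.assoc power_mult_distrib power2_eq_square divide_inverse)
      also have "\<dots> \<le> (norm (v * x m) * norm (x m))\<^sup>2 / (r m * r m)"
        using norm_mult_ineq[of "v * x m" "tp (x m)"] rpos[of m]
        by (intro divide_right_mono power_mono) (auto simp: norm_tp)
      also have "\<dots> = \<eta> m * ((x m \<bullet> x m) / r m)"
        by (simp add: \<eta>_def power_mult_distrib power2_norm_eq_inner)
      also have "\<dots> \<le> \<eta> m * 1"
        using rpos[of m] by (intro mult_left_mono) (auto simp: \<eta>_def r_def psi_def)
      finally show ?thesis by (intro real_le_rsqrt) simp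
    qed
    moreover have "(\<lambda>m. sqrt (\<eta> (s m))) \<longlonglongrightarrow> sqrt ((v * A0) \<bullet> v)" by (intro tendsto_intros lim\<eta>)
    moreover have "(\<lambda>m. norm (v * A (s m))) \<longlonglongrightarrow> norm (v * A0)" by (intro tendsto_intros s)
    ultimately have "norm (v * A0) \<le> sqrt ((v * A0) \<bullet> v)" using LIMSEQ_le by blast
    then show ?thesis using \<open>(v * A0) \<bullet> v \<le> 0\<close> by (metis norm_le_zero_iff order_trans real_sqrt_le_0_iff)
  qed
  \<comment> \<open>The orthogonal projection onto the image of the symmetric matrix
    \<open>A0\<close>, with \<open>Z\<close> its pseudo-inverse.\<close>
  define P where "P = fc (\<lambda>z. if z = 0 then 0 else 1) A0"
  define Z where "Z = fc (\<lambda>z. if z = 0 then 0 else inverse z) A0"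
  have cs: "csym (\<lambda>z. if z = 0 then 0 else 1)" "csym (\<lambda>z. if z = 0 then 0 else inverse z)"
    by (auto simp: csym_def)
  have fA: "fc (\<lambda>z. z) A0 = A0" by (rule sym_semisimple[OF symA])
  have PZ: "P = A0 * Z"
    unfolding P_def Z_def using fc_mult[OF csym_simps(2) cs(2), of A0] fA by (auto intro: fc_cong)
  have PA: "P * A0 = A0"
  proof -
    have "P * fc (\<lambda>z. z) A0 = fc (\<lambda>z. (if z = 0 then 0 else 1) * z) A0"
      unfolding P_def by (rule fc_mult[OF cs(1) csym_simps(2)])
    also have "\<dots> = fc (\<lambda>z. z) A0" by (rule fc_cong) simp
    finally show ?thesis unfolding fA .
  qed
  have PP: "P * P = P" by (metis PA PZ mult.assoc)
  have inv: "g * P = P * g * P" if g: "g \<in> G" for g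
  proof -
    obtain h where h: "h \<in> G" "inverses g h" using inv_mem[OF g] by blast
    have "((1 - P) * g) * h * A0 = (1 - P) * A0" using inversesD[OF h(2)] by (simp add: mult.assoc)
    also have "\<dots> = 0" using PA by (simp add: left_diff_distrib)
    finally have "(1 - P) * g * A0 = 0" using ker[OF h(1)] by blast
    then have "(1 - P) * g * P = 0" unfolding PZ by (metis mult.assoc mult_zero_left)
    then show ?thesis by (simp add: left_diff_distrib)
  qed
  obtain Y where Y: "P * Y = Y" "Y * P = P" "\<And>g. g \<in> G \<Longrightarrow> g * Y = Y * g"
    using equivariant_projection[OF PP inv] by blast
  have "Y * A0 = A0" using Y(2) PA by (metis mult.assoc)
  then have "A0 * tp Y = A0" using symA by (metis tp_mult)
  moreover have "Y \<bullet> A0 = tr (A0 * tp Y)" unfolding inner_eq_tr by (rule tr_mult_commute)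
  ultimately have "Y \<bullet> A0 = 1 \<bullet> A0" by (simp add: inner_eq_tr)
  moreover have "B0 * Y = 0" using BA Y(1) by (metis PZ mult.assoc mult_zero_left)
  moreover have "tp B0 = B0"
  proof -
    have "tp (B m) = B m" for m by (simp add: B_def)
    then show ?thesis using LIMSEQ_unique[OF tendsto_tp[OF s(3)]] s(3) by simp
  qed
  ultimately have "1 \<bullet> A0 = 0" using cond[OF Y(3)]
    by (simp add: inner_commute[of Y B0] inner_eq_tr[of B0 Y])
  moreover have "1 \<bullet> A0 = 1 \<bullet> B0" by (rule cond) simp
  ultimately show False using tr1 by simp
qed

text \<open>With escape excluded, the penalized minimizers have a convergent subsequence, and the
  penalty of any fixed competitor tends to 0.\<close>

theorem minimum_exists:
  obtains x y where "inverses x y" "\<And>x' y'. inverses x' y' \<Longrightarrow> FF x y \<le> FF x' y'"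
proof -
  define \<epsilon> where "\<epsilon> n = inverse (real (Suc n))" for n
  have \<epsilon>: "\<epsilon> n > 0" for n by (simp add: \<epsilon>_def)
  have "\<exists>x y. inverses x y \<and> (\<forall>x' y'. inverses x' y' \<longrightarrow> FF x y + \<epsilon> n * psi x y \<le> FF x' y' + \<epsilon> n * psi x' y')" for n
    using penalized_minimum[OF \<epsilon>[of n]] by metis
  then obtain x y where xy: "\<And>n. inverses (x n) (y n)"
    and m: "\<And>n x' y'. inverses x' y' \<Longrightarrow> FF (x n) (y n) + \<epsilon> n * psi (x n) (y n) \<le> FF x' y' + \<epsilon> n * psi x' y'" by metis
  have "\<exists>c. \<forall>n. psi (x n) (y n) \<le> c"
  proof (rule ccontr)
    assume "\<nexists>c. \<forall>n. psi (x n) (y n) \<le> c"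
    then have "\<forall>k. \<exists>n. real k < psi (x n) (y n)" by (meson not_le)
    then obtain s where s: "\<And>k. real k < psi (x (s k)) (y (s k))" by metis
    show False
      by (rule no_escape[of "\<lambda>k. x (s k)" "\<lambda>k. y (s k)" "\<lambda>k. \<epsilon> (s k)"]) (use xy \<epsilon> m s in auto)
  qed
  then obtain c where "\<And>n. psi (x n) (y n) \<le> c" by blast
  then obtain s X Y where s: "strict_mono s" "(\<lambda>n. x (s n)) \<longlonglongrightarrow> X" "(\<lambda>n. y (s n)) \<longlonglongrightarrow> Y"
    using psi_bounded_subseq by metis
  show ?thesis
  proof (rule that[of X Y])
    have "(\<lambda>n. x (s n) * y (s n)) \<longlonglongrightarrow> X * Y" by (intro tendsto_intros s)
    moreover have "x (s n) * y (s n) = 1" for n using xy inversesD(1) by blast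
    ultimately show "inverses X Y" by (simp add: inverses_def LIMSEQ_const_iff)
    fix x' y' :: "'n rsq" assume i: "inverses x' y'"
    have "\<epsilon> \<longlonglongrightarrow> 0" unfolding \<epsilon>_def by (rule LIMSEQ_inverse_real_of_nat)
    then have "(\<lambda>n. \<epsilon> (s n)) \<longlonglongrightarrow> 0" using LIMSEQ_subseq_LIMSEQ[OF _ s(1)] by (fastforce simp: comp_def)
    then have 1: "(\<lambda>n. FF x' y' + \<epsilon> (s n) * psi x' y') \<longlonglongrightarrow> FF x' y' + 0 * psi x' y'"
      by (intro tendsto_intros)
    have "FF (x n) (y n) \<le> FF x' y' + \<epsilon> n * psi x' y'" for n
      using m[OF i, of n] mult_nonneg_nonneg[OF less_imp_le[OF \<epsilon>[of n]] psi_nonneg[of "x n" "y n"]] by linarith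
    then show "FF X Y \<le> FF x' y'" using LIMSEQ_le[OF tendsto_FF[OF s(2,3)] 1] by simp
  qed
qed

end

section \<open>Conjugacy of compact subgroups\<close>

context rgroup
begin

definition minp :: "'n rsq \<Rightarrow> 'n rsq \<Rightarrow> bool" where
  "minp x y \<longleftrightarrow> inverses x y \<and> (\<forall>x' y'. inverses x' y' \<longrightarrow> FF x y \<le> FF x' y')"

lemma minp_eq: "minp x y \<Longrightarrow> inverses x' y' \<Longrightarrow> FF x' y' \<le> FF x y \<Longrightarrow> minp x' y'"
  unfolding minp_def by (meson order_trans)

lemma minp_inverses: "minp x y \<Longrightarrow> inverses x y"
  by (simp add: minp_def)

lemma minp_FF: "minp x y \<Longrightarrow> minp x' y' \<Longrightarrow> FF x y = FF x' y'"
  unfolding minp_def by (meson order_antisym)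

lemma minp_left:
  assumes "minp x y" "g \<in> G" "inverses g h" shows "minp (g * x) (y * h)"
  by (rule minp_eq[OF assms(1) inverses_mult[OF assms(3) minp_inverses[OF assms(1)]]]) (simp add: FF_left[OF assms(2,3)])

lemma minp_right:
  assumes "minp x y" "k * tp k = 1" shows "minp (x * k) (tp k * y)"
proof (rule minp_eq[OF assms(1) inverses_mult[OF minp_inverses[OF assms(1)]]])
  show "inverses k (tp k)" using assms(2) by (simp add: inverses_def)
qed (simp add: FF_right[OF assms(2)])

lemma minp_segment:
  assumes "minp x y" "tp S = S" "minp (x * mexp S) (mexp (- S) * y)"
  shows "minp (x * mexp ((1 / 2 ^ j) *\<^sub>R S)) (mexp (- ((1 / 2 ^ j) *\<^sub>R S)) * y)"
proof (rule minp_eq[OF assms(1)])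
  show "inverses (x * mexp ((1 / 2 ^ j) *\<^sub>R S)) (mexp (- ((1 / 2 ^ j) *\<^sub>R S)) * y)"
    by (intro inverses_mult inverses_mexp minp_inverses assms)
  show "FF (x * mexp ((1 / 2 ^ j) *\<^sub>R S)) (mexp (- ((1 / 2 ^ j) *\<^sub>R S)) * y) \<le> FF x y"
    by (rule FF_convex[OF assms(2)]) (simp add: minp_FF[OF assms(1,3)])
qed

lemma tendsto_TT: "(f \<longlongrightarrow> l) F \<Longrightarrow> ((\<lambda>j. TT x y (f j)) \<longlongrightarrow> TT x y l) F"
  by (rule bounded_linear.tendsto[OF linear_conv_bounded_linear[THEN iffD1, OF linear_TT]])

text \<open>A geodesic between two minima has convexity gap 0, so \<open>TT\<close> commutes with
  conjugation along it. Differentiating, \<open>prj\<close> commutes with the bracket by Q =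
  \<open>x * S * y\<close>, and then Q minus its projection centralizes the Lie algebra.\<close>

lemma flat_direction:
  assumes m: "minp x y" and S: "tp S = S" and m': "minp (x * mexp S) (mexp (- S) * y)"
  obtains X0 Z0 where "X0 \<in> lieal G" "\<And>X. X \<in> lieal G \<Longrightarrow> Z0 * X = X * Z0" "x * S * y = X0 + Z0"
proof -
  have xy: "inverses x y" using m by (rule minp_inverses)
  define t where "t j = (1 / 2 ^ j :: real)" for j
  define u u' where "u j = mexp (t j *\<^sub>R S)" and "u' j = mexp (- (t j *\<^sub>R S))" for j
  have ui: "inverses (u j) (u' j)" for j unfolding u_def u'_def by (rule inverses_mexp)
  have t0: "t \<longlonglongrightarrow> 0" unfolding t_def using LIMSEQ_realpow_zero[of "1 / 2"] by (simp add: power_one_over)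
  have tpos: "t j \<noteq> 0" for j by (simp add: t_def)
  have comm: "TT x y (u j * b * u' j) * u j = u j * TT x y b" for j b
  proof -
    let ?h = "u (Suc j)" and ?h' = "u' (Suc j)"
    have tt: "t (Suc j) + t (Suc j) = t j" by (simp add: t_def)
    have hh: "?h * ?h = u j" unfolding u_def using mexp_scaleR_add[of "t (Suc j)" "t (Suc j)" S] tt by simp
    have tt': "- t (Suc j) + - t (Suc j) = - t j" using tt by simp
    have hh': "?h' * ?h' = u' j" unfolding u'_def using mexp_scaleR_add[of "- t (Suc j)" "- t (Suc j)" S] tt' by simp
    have h: "tp ?h = ?h" "tp ?h' = ?h'" by (simp_all add: u_def u'_def tp_mexp S)
    have mh: "minp (x * u i) (u' i * y)" for i
      unfolding u_def u'_def t_def by (rule minp_segment[OF m S m'])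
    have xx: "x * ?h * ?h = x * u j" using hh by (simp add: mult.assoc)
    have "hs2 (\<lambda>b. TT (x * u j) (u' j * y) b - TT x y b) (\<lambda>b. TT (x * u j) (u' j * y) b - TT x y b) = 0"
      using FF_midpoint[OF h, of x y] minp_FF[OF m mh] unfolding xx hh' by simp
    moreover have "linear (\<lambda>b. TT (x * u j) (u' j * y) b - TT x y b)"
      by (intro linear_compose_sub linear_TT)
    ultimately have "TT (x * u j) (u' j * y) b - TT x y b = 0" using hs2_eq_0 by blast
    then have "u' j * TT x y (u j * b * u' j) * u j = TT x y b"
      by (simp add: TT_def mult.assoc)
    then have "u j * (u' j * TT x y (u j * b * u' j) * u j) = u j * TT x y b" by simp
    then show ?thesis using inversesD[OF ui[of j]] by (simp add: mult.assoc)
  qed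
  have quot: "(\<lambda>j. (u j - 1) /\<^sub>R t j) \<longlonglongrightarrow> S"
  proof -
    have "((\<lambda>h. (mexp (h *\<^sub>R S) - mexp (0 *\<^sub>R S)) /\<^sub>R h) \<longlongrightarrow> S) (at 0)"
      by (rule vector_derivative_quotient[OF mexp_has_vector_derivative_0])
    moreover have "filterlim t (at 0) sequentially" using t0 tpos by (simp add: filterlim_at)
    ultimately have "(\<lambda>j. (mexp (t j *\<^sub>R S) - mexp (0 *\<^sub>R S)) /\<^sub>R t j) \<longlonglongrightarrow> S"
      by (rule filterlim_compose)
    then show ?thesis by (simp add: u_def)
  qed
  have u1: "u \<longlonglongrightarrow> 1"
  proof -
    have "(\<lambda>j. mexp (t j *\<^sub>R S)) \<longlonglongrightarrow> mexp (0 *\<^sub>R S)" by (intro tendsto_intros t0)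
    then show ?thesis by (simp add: u_def[abs_def])
  qed
  have u1': "u' \<longlonglongrightarrow> 1"
  proof -
    have "(\<lambda>j. mexp (- (t j *\<^sub>R S))) \<longlonglongrightarrow> mexp (- (0 *\<^sub>R S))" by (intro tendsto_intros t0)
    then show ?thesis by (simp add: u'_def[abs_def])
  qed
  \<comment> \<open>The derivative of \<open>comm\<close> at t = 0, taken as a limit of difference
    quotients along the dyadic sequence.\<close>
  have br: "TT x y (S * b - b * S) = S * TT x y b - TT x y b * S" for b
  proof -
    define q where "q j = (u j - 1) /\<^sub>R t j" for j
    have uq: "u j = 1 + t j *\<^sub>R q j" for j using tpos by (simp add: q_def)
    have "TT x y ((q j * b - b * q j) * u' j) * u j = q j * TT x y b - TT x y b * q j" for j
    proof -
      have "t j *\<^sub>R ((q j * b - b * q j) * u' j) = (u j * b - b * u j) * u' j"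
        unfolding uq by (simp add: algebra_simps)
      also have "\<dots> = u j * b * u' j - b" using inversesD[OF ui[of j]] by (simp add: left_diff_distrib mult.assoc)
      finally have "t j *\<^sub>R (TT x y ((q j * b - b * q j) * u' j) * u j) = TT x y (u j * b * u' j - b) * u j"
        using linear_cmul[OF linear_TT[of x y], of "t j" "(q j * b - b * q j) * u' j"] by simp
      also have "\<dots> = u j * TT x y b - TT x y b * u j"
        by (simp add: linear_diff[OF linear_TT] left_diff_distrib comm)
      also have "\<dots> = t j *\<^sub>R (q j * TT x y b - TT x y b * q j)"
        unfolding uq by (simp add: algebra_simps)
      finally show ?thesis using tpos by simp
    qed
    moreover have "(\<lambda>j. TT x y ((q j * b - b * q j) * u' j) * u j) \<longlonglongrightarrow> TT x y ((S * b - b * S) * 1) * 1"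
      unfolding q_def by (intro tendsto_mult tendsto_TT tendsto_diff tendsto_const quot u1 u1')
    moreover have "(\<lambda>j. q j * TT x y b - TT x y b * q j) \<longlonglongrightarrow> S * TT x y b - TT x y b * S"
      unfolding q_def by (intro tendsto_mult tendsto_diff tendsto_const quot)
    ultimately show ?thesis by (simp add: LIMSEQ_unique)
  qed
  define Q where "Q = x * S * y"
  have prQ: "prj (Q * b - b * Q) = Q * prj b - prj b * Q" for b
  proof -
    have "TT x y (S * (y * b * x) - (y * b * x) * S) = S * TT x y (y * b * x) - TT x y (y * b * x) * S" by (rule br)
    then have "x * (y * prj (x * (S * (y * b * x) - (y * b * x) * S) * y) * x) * y
        = x * (S * (y * prj (x * (y * b * x) * y) * x) - (y * prj (x * (y * b * x) * y) * x) * S) * y"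
      by (simp add: TT_def)
    then show ?thesis
      using inversesD[OF xy] by (simp add: Q_def left_diff_distrib right_diff_distrib mult.assoc)
  qed
  show ?thesis
  proof (rule that[of "prj Q" "Q - prj Q"])
    show "prj Q \<in> lieal G" by (rule prj(1))
    show "x * S * y = prj Q + (Q - prj Q)" by (simp add: Q_def)
    fix X assume X: "X \<in> lieal G"
    note br_mem = Adinv_bracket[OF Adinv_lieal]
    have "Q * X - X * Q = prj (Q * X - X * Q)" using prQ[of X] prj_id[OF X] by simp
    then have "Q * X - X * Q \<in> lieal G" using prj(1) by metis
    moreover have "prj Q * X - X * prj Q \<in> lieal G" by (rule br_mem[OF prj(1) X])
    ultimately have "(Q * X - X * Q) - (prj Q * X - X * prj Q) \<in> lieal G" by (rule subspace_diff[OF subspace_lieal])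
    then have mem: "(Q - prj Q) * X - X * (Q - prj Q) \<in> lieal G" by (simp add: algebra_simps)
    \<comment> \<open>The bracket lies in the Lie algebra and, moving it onto the other factor under
      the trace, pairs to 0 with all of it, because \<open>Q - prj Q\<close> is trace-orthogonal to
      brackets.\<close>
    have "(Q - prj Q) * X - X * (Q - prj Q) = 0"
    proof (rule trace_form_nondegenerate[OF mem])
      fix Y assume Y: "Y \<in> lieal G"
      have "tr (((Q - prj Q) * X - X * (Q - prj Q)) * Y) = tr ((Q - prj Q) * (X * Y - Y * X))"
        using tr_mult_commute[of X "(Q - prj Q) * Y"] by (simp add: left_diff_distrib right_diff_distrib mult.assoc)
      also have "\<dots> = 0" using prj(2)[OF br_mem[OF X Y], of Q] by (simp add: left_diff_distrib)
      finally show "tr (((Q - prj Q) * X - X * (Q - prj Q)) * Y) = 0" .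
    qed
    then show "(Q - prj Q) * X = X * (Q - prj Q)" by simp
  qed
qed

text \<open>Orthogonality in the coordinates given by \<open>x\<close>; equivalently
  \<open>g\<close> fixes the point \<open>x\<close> of the symmetric space.\<close>

definition orth_at :: "'n rsq \<Rightarrow> 'n rsq \<Rightarrow> 'n rsq \<Rightarrow> bool" where
  "orth_at x y g \<longleftrightarrow> tp (y * g * x) * (y * g * x) = 1"

definition csubgroup :: "'n rsq set \<Rightarrow> bool" where
  "csubgroup L \<longleftrightarrow> L \<subseteq> G \<and> compact L \<and> 1 \<in> L \<and> (\<forall>g\<in>L. \<forall>h\<in>L. g * h \<in> L) \<and> (\<forall>g\<in>L. \<exists>h\<in>L. inverses g h)"

text \<open>A circumcenter argument on the set of minima of \<open>FF\<close>: take the least bound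
  \<mu> for \<open>psi\<close> on an orbit of \<open>L\<close>, attained at \<open>X\<close>. If
  some \<open>l\<close> moved \<open>X\<close>, the midpoint of \<open>X\<close> and
  \<open>l * X\<close> would have a strictly smaller bound.\<close>

theorem compact_fixed_point:
  assumes L: "csubgroup L"
  obtains x y where "minp x y" "\<And>l. l \<in> L \<Longrightarrow> orth_at x y l"
proof -
  obtain D where D: "\<And>l. l \<in> L \<Longrightarrow> l \<bullet> l \<le> D"
  proof -
    obtain b where "\<forall>l\<in>L. norm l \<le> b" using L compact_imp_bounded bounded_iff by (metis csubgroup_def)
    then have "l \<bullet> l \<le> b\<^sup>2" if "l \<in> L" for l
      using that by (simp add: power2_norm_eq_inner[symmetric] power_mono)
    then show ?thesis using that by blast
  qed
  have one: "1 \<in> L" and mulL: "\<And>g h. g \<in> L \<Longrightarrow> h \<in> L \<Longrightarrow> g * h \<in> L" and LG: "\<And>l. l \<in> L \<Longrightarrow> l \<in> G"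
    using L by (auto simp: csubgroup_def)
  have invL: "h \<in> L" if "g \<in> L" "inverses g h" for g h
    using that L inverses_unique unfolding csubgroup_def by blast
  have D0: "D > 0"
  proof -
    have "0 < (1 :: 'n rsq) \<bullet> 1" by (simp only: inner_gt_zero_iff) simp
    then show ?thesis using D[OF one] by linarith
  qed
  define ok where "ok c x y \<longleftrightarrow> minp x y \<and> (\<forall>l l'. l \<in> L \<longrightarrow> inverses l l' \<longrightarrow> psi (l * x) (y * l') \<le> c)" for c x y
  define \<Phi> where "\<Phi> = {c. \<exists>x y. ok c x y}"
  have ne: "\<Phi> \<noteq> {}"
  proof -
    obtain x y where xy: "inverses x y" "\<And>x' y'. inverses x' y' \<Longrightarrow> FF x y \<le> FF x' y'"
      by (rule minimum_exists) blast
    have "psi (l * x) (y * l') \<le> (D + D) * psi x y" if "l \<in> L" "inverses l l'" for l l'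
      using psi_left_le[of l x y l'] mult_right_mono[OF add_mono[OF D[OF that(1)] D[OF invL[OF that]]] psi_nonneg[of x y]]
      by linarith
    then have "ok ((D + D) * psi x y) x y" using xy by (auto simp: ok_def minp_def)
    then show ?thesis by (auto simp: \<Phi>_def)
  qed
  have lb: "0 \<le> c" if "c \<in> \<Phi>" for c
  proof -
    obtain x y where "ok c x y" using \<open>c \<in> \<Phi>\<close> by (auto simp: \<Phi>_def)
    then have "psi (1 * x) (y * 1) \<le> c" using one unfolding ok_def by (meson inverses_def mult_1_left)
    then show ?thesis using psi_nonneg[of x y] by simp
  qed
  then have bdd: "bdd_below \<Phi>" by (meson bdd_belowI)
  define \<mu> where "\<mu> = Inf \<Phi>"
  have "\<exists>c\<in>\<Phi>. c < \<mu> + inverse (real (Suc n))" for n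
    using cInf_lessD[OF ne, of "\<mu> + inverse (real (Suc n))"] by (auto simp: \<mu>_def)
  then have "\<exists>c x y. ok c x y \<and> c < \<mu> + inverse (real (Suc n))" for n unfolding \<Phi>_def by blast
  then obtain c x y where ok: "\<And>n. ok (c n) (x n) (y n)" and c: "\<And>n. c n < \<mu> + inverse (real (Suc n))" by metis
  have "psi (x n) (y n) \<le> \<mu> + 1" for n
  proof -
    have "psi (1 * x n) (y n * 1) \<le> c n" using ok[of n] one unfolding ok_def by (meson inverses_def mult_1_left)
    moreover have "inverse (real (Suc n)) \<le> 1" by (simp add: field_simps)
    ultimately show ?thesis using c[of n] by simp
  qed
  then obtain s X Y where s: "strict_mono s" "(\<lambda>n. x (s n)) \<longlonglongrightarrow> X" "(\<lambda>n. y (s n)) \<longlonglongrightarrow> Y"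
    using psi_bounded_subseq by metis
  have mx: "minp (x n) (y n)" for n using ok by (simp add: ok_def)
  have XY: "inverses X Y"
  proof -
    have "(\<lambda>n. x (s n) * y (s n)) \<longlonglongrightarrow> X * Y" by (intro tendsto_intros s)
    moreover have "x (s n) * y (s n) = 1" for n using minp_inverses[OF mx] inversesD(1) by blast
    ultimately show ?thesis by (simp add: inverses_def LIMSEQ_const_iff)
  qed
  have mXY: "minp X Y"
  proof (rule minp_eq[OF mx[of 0] XY])
    have "FF (x (s n)) (y (s n)) = FF (x 0) (y 0)" for n by (rule minp_FF[OF mx mx])
    then show "FF X Y \<le> FF (x 0) (y 0)" using tendsto_FF[OF s(2,3)] by (simp add: LIMSEQ_const_iff)
  qed
  have le\<mu>: "psi (l * X) (Y * l') \<le> \<mu>" if l: "l \<in> L" "inverses l l'" for l l'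
  proof -
    have 1: "(\<lambda>n. psi (l * x (s n)) (y (s n) * l')) \<longlonglongrightarrow> psi (l * X) (Y * l')"
      unfolding psi_def by (intro tendsto_intros s)
    have "(\<lambda>n. \<mu> + inverse (real (Suc n))) \<longlonglongrightarrow> \<mu> + 0" by (intro tendsto_intros LIMSEQ_inverse_real_of_nat)
    from LIMSEQ_subseq_LIMSEQ[OF this s(1)]
    have 2: "(\<lambda>n. \<mu> + inverse (real (Suc (s n)))) \<longlonglongrightarrow> \<mu>" by (simp add: comp_def)
    have "psi (l * x (s n)) (y (s n) * l') \<le> \<mu> + inverse (real (Suc (s n)))" for n
      using ok[of "s n"] c[of "s n"] l unfolding ok_def by (meson less_imp_le order_trans)
    then show ?thesis using LIMSEQ_le[OF 1 2] by blast
  qed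
  show ?thesis
  proof (rule that[OF mXY])
    fix l assume l: "l \<in> L"
    obtain l' where l': "inverses l l'" "l' \<in> L" using L l by (auto simp: csubgroup_def)
    obtain S k where S: "tp S = S" "tp k * k = 1" "k * tp k = 1" "l * X = X * mexp S * k"
      by (rule polar[OF XY inverses_mult[OF l'(1) XY]])
    have k: "tp k * tp (tp k) = 1" using S(2) by simp
    have xS: "l * X * tp k = X * mexp S" using S(3) by (simp add: S(4) mult.assoc)
    have yS: "k * (Y * l') = mexp (- S) * Y"
    proof (rule inverses_unique)
      show "inverses (l * X * tp k) (k * (Y * l'))"
        by (intro inverses_mult l' XY) (simp add: inverses_def S(2))
      show "inverses (l * X * tp k) (mexp (- S) * Y)"
        unfolding xS by (intro inverses_mult XY inverses_mexp)
    qed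
    have mS: "minp (X * mexp S) (mexp (- S) * Y)"
      using minp_right[OF minp_left[OF mXY LG[OF l] l'(1)] k] by (simp add: xS yS)
    define h h' where "h = mexp ((1/2) *\<^sub>R S)" and "h' = mexp (- ((1/2) *\<^sub>R S))"
    have hh: "h * h = mexp S" unfolding h_def using mexp_scaleR_add[of "1/2" "1/2" S] by simp
    have hh': "h' * h' = mexp (- S)" unfolding h'_def using mexp_scaleR_add[of "- (1/2)" "- (1/2)" S] by simp
    have th: "tp h = h" "tp h' = h'" by (simp_all add: h_def h'_def tp_mexp S)
    have mh: "minp (X * h) (h' * Y)"
      using minp_segment[OF mXY S(1) mS, of 1] by (simp add: h_def h'_def)
    \<comment> \<open>A lower bound for the gap of \<open>psi_midpoint\<close> after translation by
      any element of \<open>L\<close>; it is uniform because \<open>D\<close> bounds the inverses of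
      these elements.\<close>
    define \<delta> where "\<delta> = ((X * mexp S - X) \<bullet> (X * mexp S - X)) / D"
    have "psi (m * (X * h)) (h' * Y * m') \<le> \<mu> - \<delta> / 2" if m: "m \<in> L" "inverses m m'" for m m'
    proof -
      have m': "m' \<in> L" by (rule invL[OF m])
      have "psi (m * X * h * h) (h' * h' * (Y * m')) = psi (m * (l * X)) (Y * l' * m')"
      proof -
        have "m * X * h * h = m * (l * X) * tp k" "h' * h' * (Y * m') = k * (Y * l' * m')"
          unfolding hh' using hh xS yS by (simp_all add: mult.assoc) (metis mult.assoc)
        then show ?thesis using psi_orth[OF k, of "m * (l * X)" "Y * l' * m'"] by simp
      qed
      also have "\<dots> \<le> \<mu>"
        using le\<mu>[OF mulL[OF m(1) l] inverses_mult[OF m(2) l'(1)]] by (simp add: mult.assoc)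
      finally have 1: "psi (m * X * h * h) (h' * h' * (Y * m')) \<le> \<mu>" .
      have 2: "psi (m * X) (Y * m') \<le> \<mu>" by (rule le\<mu>[OF m])
      have "(X * mexp S - X) \<bullet> (X * mexp S - X) \<le> (m' \<bullet> m') * ((m * X * h * h - m * X) \<bullet> (m * X * h * h - m * X))"
      proof -
        have "X * mexp S - X = m' * (m * X * h * h - m * X)"
          using inversesD[OF m(2)] hh by (simp add: right_diff_distrib mult.assoc)
        then show ?thesis using inner_self_mult_le[of m' "m * X * h * h - m * X"] by simp
      qed
      also have "\<dots> \<le> D * ((m * X * h * h - m * X) \<bullet> (m * X * h * h - m * X))"
        by (intro mult_right_mono D m') simp
      finally have 3: "\<delta> \<le> (m * X * h * h - m * X) \<bullet> (m * X * h * h - m * X)"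
        using D0 by (simp add: \<delta>_def divide_le_eq mult.commute)
      have 4: "0 \<le> (h' * h' * (Y * m') - Y * m') \<bullet> (h' * h' * (Y * m') - Y * m')" by simp
      have "2 * psi (m * X * h) (h' * (Y * m')) \<le> 2 * \<mu> - \<delta>"
        using psi_midpoint[OF th, of "m * X" "Y * m'"] 1 2 3 4 by linarith
      then show ?thesis by (simp add: mult.assoc)
    qed
    then have "ok (\<mu> - \<delta> / 2) (X * h) (h' * Y)" using mh by (simp add: ok_def)
    then have "\<mu> - \<delta> / 2 \<in> \<Phi>" by (auto simp: \<Phi>_def)
    then have "\<mu> \<le> \<mu> - \<delta> / 2" unfolding \<mu>_def by (intro cInf_lower bdd)
    then have "(X * mexp S - X) \<bullet> (X * mexp S - X) \<le> 0" using D0 by (simp add: \<delta>_def divide_le_0_iff)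
    then have "X * mexp S = X" by (metis eq_iff_diff_eq_0 inner_eq_zero_iff inner_ge_zero order_antisym)
    then have "l * X = X * k" using S(4) by simp
    then have "Y * l * X = k" using inversesD[OF XY] by (simp add: mult.assoc)
    then show "orth_at X Y l" using S(2) by (simp add: orth_at_def)
  qed
qed

lemma orth_at_mult: assumes xy: "inverses x y" and g: "orth_at x y g" "orth_at x y h" shows "orth_at x y (g * h)"
proof -
  have "y * (g * h) * x = (y * g * x) * (y * h * x)" using inversesD[OF xy] by (simp add: mult.assoc)
  then have "tp (y * (g * h) * x) * (y * (g * h) * x) = tp (y * h * x) * (tp (y * g * x) * (y * g * x)) * (y * h * x)"
    by (simp only: tp_mult mult.assoc)
  then show ?thesis using g unfolding orth_at_def by simp
qed

lemma orth_at_inv: assumes xy: "inverses x y" and g: "orth_at x y g" "inverses g h" shows "orth_at x y h"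
proof -
  let ?k = "y * g * x"
  have k: "inverses (tp ?k) ?k" using g(1) by (simp add: orth_at_def inverses_def)
  have "inverses ?k (y * h * x)"
    using inversesD[OF xy] inversesD[OF g(2)] by (simp add: inverses_def mult.assoc)
  then have "y * h * x = tp ?k" using inverses_sym[OF k] inverses_unique by blast
  then show ?thesis using inversesD(2)[OF k] by (simp add: orth_at_def del: tp_mult)
qed

lemma csubgroup_orth: assumes xy: "inverses x y" shows "csubgroup {g \<in> G. orth_at x y g}"
  unfolding csubgroup_def
proof (intro conjI ballI)
  show "1 \<in> {g \<in> G. orth_at x y g}"
    using one_mem inversesD[OF xy] by (simp add: orth_at_def mult.assoc flip: tp_mult)
  show "compact {g \<in> G. orth_at x y g}"
    unfolding compact_eq_bounded_closed
  proof
    show "bounded {g \<in> G. orth_at x y g}"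
    proof (rule boundedI)
      fix g assume "g \<in> {g \<in> G. orth_at x y g}"
      then have k: "tp (y * g * x) * (y * g * x) = 1" by (simp add: orth_at_def)
      have "norm (y * g * x) = norm (1 :: 'n rsq)"
        using inner_eq_tr[of "y * g * x" "y * g * x"] inner_eq_tr[of 1 "1 :: 'n rsq"] unfolding k norm_eq_sqrt_inner by simp
      then have "norm (x * (y * g * x)) \<le> norm x * norm (1 :: 'n rsq)"
        using norm_mult_ineq[of x "y * g * x"] by simp
      from mult_right_mono[OF this norm_ge_zero[of y]]
      have "norm (x * (y * g * x) * y) \<le> norm x * norm (1 :: 'n rsq) * norm y"
        using norm_mult_ineq[of "x * (y * g * x)" y] by linarith
      moreover have "g = x * (y * g * x) * y" using inversesD[OF xy] by (simp add: mult.assoc)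
      ultimately show "norm g \<le> norm x * norm (1 :: 'n rsq) * norm y" by simp
    qed
    show "closed {g \<in> G. orth_at x y g}"
      unfolding closed_sequential_limits
    proof (intro allI impI, elim conjE)
      fix f l assume f: "\<forall>n. f n \<in> {g \<in> G. orth_at x y g}" "f \<longlonglongrightarrow> l"
      have "(\<lambda>n. tp (y * f n * x) * (y * f n * x)) \<longlonglongrightarrow> tp (y * l * x) * (y * l * x)" by (intro tendsto_intros f)
      moreover have "tp (y * f n * x) * (y * f n * x) = 1" for n using f(1) by (simp add: orth_at_def)
      ultimately have o: "orth_at x y l" by (simp add: orth_at_def LIMSEQ_const_iff)
      then have "inverses (y * l * x) (tp (y * l * x))" unfolding orth_at_def inverses_def by (rule sqm_left_inverse_imp_right)
      then have "inverses (x * (y * l * x) * y) (x * (tp (y * l * x) * y))" by (intro inverses_mult xy inverses_sym[OF xy])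
      then have "inverses l (x * (tp (y * l * x) * y))" using inversesD[OF xy] by (simp add: mult.assoc)
      then show "l \<in> {g \<in> G. orth_at x y g}" using limit_mem[of f l] f o by blast
    qed
  qed
  fix g assume g: "g \<in> {g \<in> G. orth_at x y g}"
  show "g * h \<in> {g \<in> G. orth_at x y g}" if "h \<in> {g \<in> G. orth_at x y g}" for h
    using g that mult_mem orth_at_mult[OF xy] by blast
  show "\<exists>h\<in>{g \<in> G. orth_at x y g}. inverses g h"
    using g inv_mem orth_at_inv[OF xy] by blast
qed auto

text \<open>The groups fix minima \<open>x1\<close> and \<open>x2\<close>. By
  \<open>flat_direction\<close> one has \<open>x2 = u * z * x1 * k\<close> with \<open>u\<close> in
  the group, \<open>z\<close> in its commutant and \<open>k\<close> orthogonal. Since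
  \<open>z\<close> does not affect conjugation, \<open>u\<close> carries \<open>L\<close> into the
  compact stabilizer of \<open>x2\<close>, which is \<open>K\<close> by maximality.\<close>

theorem conjugate_into_maximal_compact:
  assumes K: "csubgroup K" "\<And>M. csubgroup M \<Longrightarrow> K \<subseteq> M \<Longrightarrow> M = K" and L: "csubgroup L"
  obtains u u' where "u \<in> G" "inverses u u'" "\<And>l. l \<in> L \<Longrightarrow> u * l * u' \<in> K"
proof -
  obtain x1 y1 where 1: "minp x1 y1" "\<And>l. l \<in> L \<Longrightarrow> orth_at x1 y1 l" using compact_fixed_point[OF L] by blast
  obtain x2 y2 where 2: "minp x2 y2" "\<And>l. l \<in> K \<Longrightarrow> orth_at x2 y2 l" using compact_fixed_point[OF K(1)] by blast
  note i1 = minp_inverses[OF 1(1)] and i2 = minp_inverses[OF 2(1)]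
  obtain S k where S: "tp S = S" "tp k * k = 1" "k * tp k = 1" "x2 = x1 * mexp S * k" by (rule polar[OF i1 i2])
  have k: "tp k * tp (tp k) = 1" using S(2) by simp
  have ik: "inverses k (tp k)" using S(3) by (simp add: inverses_def)
  have xS: "x2 * tp k = x1 * mexp S" using S(3) by (simp add: S(4) mult.assoc)
  have yS: "k * y2 = mexp (- S) * y1"
  proof (rule inverses_unique)
    show "inverses (x2 * tp k) (k * y2)" by (intro inverses_mult i2 inverses_sym[OF ik])
    show "inverses (x2 * tp k) (mexp (- S) * y1)" unfolding xS by (intro inverses_mult i1 inverses_mexp)
  qed
  have "minp (x1 * mexp S) (mexp (- S) * y1)" using minp_right[OF 2(1) k] by (simp add: xS yS)
  then obtain X0 Z0 where X0: "X0 \<in> lieal G" "\<And>X. X \<in> lieal G \<Longrightarrow> Z0 * X = X * Z0" "x1 * S * y1 = X0 + Z0"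
    using flat_direction[OF 1(1) S(1)] by blast
  define u z where "u = mexp X0" and "z = mexp Z0"
  have uG: "u \<in> G" using lieal_mexp[OF X0(1), of 1] by (simp add: u_def)
  have zG: "g * z = z * g" if "g \<in> G" for g
    by (rule commute_group[OF conn _ that]) (simp add: z_def X0(2) mexp_commute)
  have "x1 * mexp S * y1 = u * z"
    using mexp_conj[OF i1, of S] mexp_add[of X0 Z0] X0 by (simp add: u_def z_def)
  then have xu: "x1 * mexp S = u * z * x1" using inversesD[OF i1] by (metis mult.assoc mult_1_right)
  have ui: "inverses u (mexp (- X0))" "inverses z (mexp (- Z0))" unfolding u_def z_def by (rule inverses_mexp)+
  let ?u = "mexp (- X0)" and ?z = "mexp (- Z0)"
  have x2: "x2 = u * z * x1 * k" using S(4) xu by simp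
  have y2: "y2 = tp k * (y1 * (?z * ?u))"
    by (rule inverses_unique[OF i2]) (unfold x2, intro inverses_mult ui i1 ik)
  have orth: "orth_at x2 y2 (u * l * ?u)" if l: "l \<in> L" for l
  proof -
    have lG: "l \<in> G" using l L by (auto simp: csubgroup_def)
    have "y2 * (u * l * ?u) * x2 = tp k * (y1 * (?z * (l * (z * (x1 * k)))))"
      unfolding x2 y2 using inversesD[OF ui(1)] by (simp add: mult.assoc)
    also have "l * (z * (x1 * k)) = z * (l * (x1 * k))" using zG[OF lG] by (metis mult.assoc)
    also have "tp k * (y1 * (?z * (z * (l * (x1 * k))))) = tp k * (y1 * l * x1) * k"
      using inversesD[OF ui(2)] by (simp add: mult.assoc)
    finally have e: "y2 * (u * l * ?u) * x2 = tp k * (y1 * l * x1) * k" .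
    have "tp (tp k * (y1 * l * x1) * k) * (tp k * (y1 * l * x1) * k)
        = tp k * (tp (y1 * l * x1) * (k * tp k) * (y1 * l * x1)) * k"
      by (simp only: tp_mult tp_tp mult.assoc)
    also have "\<dots> = 1" using 1(2)[OF l] S(2,3) by (simp add: orth_at_def del: tp_mult)
    finally show ?thesis unfolding orth_at_def e .
  qed
  have "K \<subseteq> {g \<in> G. orth_at x2 y2 g}" using 2(2) K(1) by (auto simp: csubgroup_def)
  then have Keq: "{g \<in> G. orth_at x2 y2 g} = K" by (rule K(2)[OF csubgroup_orth[OF i2]])
  have "u * l * ?u \<in> K" if "l \<in> L" for l
  proof -
    have "l \<in> G" using that L by (auto simp: csubgroup_def)
    then have "u * l * ?u \<in> G" using uG ui inverses_mem mult_mem by blast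
    then show ?thesis using orth[OF that] Keq by blast
  qed
  then show ?thesis using that uG ui by blast
qed

end

section \<open>Commuting tuples in special unitary and compact symplectic groups\<close>

text \<open>Vectors of length \<open>n\<close> are represented by functions that vanish from \<open>n\<close> on.\<close>

definition fv :: "nat \<Rightarrow> (nat \<Rightarrow> complex) set" where
  "fv n = {f. \<forall>i\<ge>n. f i = 0}"

definition mv :: "nat \<Rightarrow> complex mat \<Rightarrow> (nat \<Rightarrow> complex) \<Rightarrow> nat \<Rightarrow> complex" where
  "mv n A f = (\<lambda>i. if i < n then \<Sum>j<n. A $$ (i, j) * f j else 0)"

definition ipr :: "nat \<Rightarrow> (nat \<Rightarrow> complex) \<Rightarrow> (nat \<Rightarrow> complex) \<Rightarrow> complex" where
  "ipr n f g = (\<Sum>i<n. f i * cnj (g i))"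

definition fsub :: "nat \<Rightarrow> (nat \<Rightarrow> complex) set \<Rightarrow> bool" where
  "fsub n W \<longleftrightarrow> W \<subseteq> fv n \<and> (\<forall>f\<in>W. \<forall>g\<in>W. (\<lambda>i. f i + g i) \<in> W) \<and> (\<forall>c. \<forall>f\<in>W. (\<lambda>i. c * f i) \<in> W)"

lemma mv_fv: "mv n A f \<in> fv n"
  by (simp add: mv_def fv_def)

lemma mv_add: "mv n A (\<lambda>i. f i + g i) = (\<lambda>i. mv n A f i + mv n A g i)"
  by (auto simp: mv_def distrib_left sum.distrib)

lemma mv_scale: "mv n A (\<lambda>i. c * f i) = (\<lambda>i. c * mv n A f i)"
  by (auto simp: mv_def sum_distrib_left mult_ac)

lemma mv_mult:
  assumes "A \<in> carrier_mat n n" "B \<in> carrier_mat n n" shows "mv n (A * B) f = mv n A (mv n B f)"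
proof
  fix i
  have "(A * B) $$ (i, j) = (\<Sum>k<n. A $$ (i, k) * B $$ (k, j))" if "i < n" "j < n" for j
    using assms that by (auto simp: scalar_prod_def atLeast0LessThan)
  then have "i < n \<Longrightarrow> mv n (A * B) f i = (\<Sum>j<n. \<Sum>k<n. A $$ (i, k) * B $$ (k, j) * f j)"
    by (simp add: mv_def sum_distrib_right)
  moreover have "(\<Sum>j<n. \<Sum>k<n. A $$ (i, k) * B $$ (k, j) * f j) = (\<Sum>k<n. A $$ (i, k) * mv n B f k)"
    by (subst sum.swap) (simp add: mv_def sum_distrib_left mult.assoc)
  ultimately show "mv n (A * B) f i = mv n A (mv n B f) i" by (auto simp: mv_def)
qed

lemma ipr_simps: "ipr n (\<lambda>i. f i + g i) h = ipr n f h + ipr n g h" "ipr n (\<lambda>i. c * f i) h = c * ipr n f h"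
  "ipr n h (\<lambda>i. f i + g i) = ipr n h f + ipr n h g" "ipr n h (\<lambda>i. c * f i) = cnj c * ipr n h f"
  by (simp_all add: ipr_def distrib_left distrib_right sum.distrib sum_distrib_left mult_ac)

lemma ipr_cnj: "cnj (ipr n f g) = ipr n g f"
  by (simp add: ipr_def mult.commute)

lemma ipr_self: "ipr n f f = of_real (\<Sum>i<n. (cmod (f i))\<^sup>2)"
  by (simp add: ipr_def complex_norm_square del: of_real_power)

lemma ipr_self_eq_0: "f \<in> fv n \<Longrightarrow> ipr n f f = 0 \<Longrightarrow> f = (\<lambda>_. 0)"
proof
  fix i assume f: "f \<in> fv n" "ipr n f f = 0"
  then have "(\<Sum>i<n. (cmod (f i))\<^sup>2) = 0" unfolding ipr_self by (simp only: of_real_eq_0_iff)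
  then show "f i = 0" using f(1) by (cases "i < n") (auto simp: sum_nonneg_eq_0_iff fv_def)
qed

text \<open>In the Leibniz formula every summand contains an entry of the zero row. This expresses
  that fewer than n linear equations in n unknowns have a nontrivial solution, after padding with
  zero rows.\<close>

lemma zero_row_kernel:
  fixes M :: "nat \<Rightarrow> nat \<Rightarrow> complex"
  assumes "r < n" "\<And>j. j < n \<Longrightarrow> M r j = 0"
  obtains v where "v \<in> fv n" "v \<noteq> (\<lambda>_. 0)" "\<And>i. i < n \<Longrightarrow> (\<Sum>j<n. M i j * v j) = 0"
proof -
  let ?M = "Matrix.mat n n (\<lambda>(i, j). M i j)"
  have M: "?M \<in> carrier_mat n n" by simp
  have "Determinant.det ?M = 0"
  proof -
    have "(\<Prod>i = 0..<n. ?M $$ (i, p i)) = 0" if "p permutes {0..<n}" for p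
    proof (rule prod_zero)
      have "p r < n" using permutes_in_image[OF that, of r] assms(1) by simp
      then show "\<exists>i\<in>{0..<n}. ?M $$ (i, p i) = 0" using assms by (intro bexI[of _ r]) auto
    qed simp
    then show ?thesis unfolding Determinant.det_def'[OF M] by (intro sum.neutral) auto
  qed
  then obtain v where v: "v \<in> carrier_vec n" "v \<noteq> 0\<^sub>v n" "?M *\<^sub>v v = 0\<^sub>v n"
    using det_0_iff_vec_prod_zero_field[OF M] by auto
  define f where "f i = (if i < n then vec_index v i else 0)" for i
  show ?thesis
  proof (rule that[of f])
    show "f \<in> fv n" by (simp add: fv_def f_def)
    show "f \<noteq> (\<lambda>_. 0)"
    proof
      assume "f = (\<lambda>_. 0)"
      then have "vec_index v i = 0" if "i < n" for i using that by (metis f_def)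
      then have "v = 0\<^sub>v n" using v(1) by (intro eq_vecI) auto
      then show False using v(2) by simp
    qed
    fix i assume i: "i < n"
    have "vec_index (?M *\<^sub>v v) i = (\<Sum>j<n. M i j * f j)"
      using i v(1) by (simp add: scalar_prod_def f_def atLeast0LessThan)
    then show "(\<Sum>j<n. M i j * f j) = 0" using i by (simp add: v(3))
  qed
qed

definition pvec :: "(('a \<Rightarrow> complex) \<Rightarrow> 'a \<Rightarrow> complex) \<Rightarrow> complex poly \<Rightarrow> ('a \<Rightarrow> complex) \<Rightarrow> 'a \<Rightarrow> complex" where
  "pvec T p f = fold_coeffs (\<lambda>a g i. a * f i + T g i) p (\<lambda>_. 0)"

text \<open>A dependence among f, T f, ..., T^n f is a polynomial annihilating \<open>f\<close>.
  Linear factors are split off until the cofactor no longer annihilates \<open>f\<close>; its value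
  is an eigenvector, and it stays in \<open>W\<close>.\<close>

lemma eigenvector_in_invariant:
  assumes W: "fsub n W" and A: "\<And>f. f \<in> W \<Longrightarrow> mv n A f \<in> W" and f: "f \<in> W" "f \<noteq> (\<lambda>_. 0)"
  obtains u z where "u \<in> W" "u \<noteq> (\<lambda>_. 0)" "mv n A u = (\<lambda>i. z * u i)"
proof -
  let ?T = "mv n A"
  have T0: "?T (\<lambda>_. 0) = (\<lambda>_. 0)" using mv_scale[of n A 0 "\<lambda>_. 0"] by simp
  have pC: "pvec ?T (pCons a p) f = (\<lambda>i. a * f i + ?T (pvec ?T p f) i)" for a p
    by (cases "p = 0 \<and> a = 0") (auto simp: pvec_def T0)
  have p0: "pvec ?T 0 f = (\<lambda>_. 0)" by (simp add: pvec_def)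
  have padd: "pvec ?T (p + q) f = (\<lambda>i. pvec ?T p f i + pvec ?T q f i)" for p q
    by (induction p q rule: poly_induct2) (auto simp: p0 pC mv_add algebra_simps)
  have psm: "pvec ?T (Polynomial.smult c p) f = (\<lambda>i. c * pvec ?T p f i)" for c p
    by (induction p) (auto simp: p0 pC mv_scale algebra_simps)
  have zW: "(\<lambda>_. 0) \<in> W"
  proof -
    have "(\<lambda>i. 0 * f i) \<in> W" using W f(1) unfolding fsub_def by blast
    then show ?thesis by simp
  qed
  have pW: "pvec ?T p f \<in> W" for p
  proof (induction p)
    case (pCons a p)
    have "(\<lambda>i. a * f i) \<in> W" "?T (pvec ?T p f) \<in> W" using W f(1) A[OF pCons(2)] unfolding fsub_def by blast+
    moreover have "\<And>f g. f \<in> W \<Longrightarrow> g \<in> W \<Longrightarrow> (\<lambda>i. f i + g i) \<in> W" using W unfolding fsub_def by blast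
    ultimately show ?case unfolding pC by simp
  qed (simp add: p0 zW)
  have main: "\<exists>u\<in>W. u \<noteq> (\<lambda>_. 0) \<and> (\<exists>z. ?T u = (\<lambda>i. z * u i))" if "p \<noteq> 0" "pvec ?T p f = (\<lambda>_. 0)" for p
    using that
  proof (induction "degree p" arbitrary: p rule: less_induct)
    case (less p)
    show ?case
    proof (cases "degree p = 0")
      case True
      then obtain c where c: "p = [:c:]" by (metis degree_eq_zeroE)
      have "f i = 0" for i using fun_cong[OF less.prems(2), of i] less.prems(1) by (simp add: c pC p0 T0)
      then show ?thesis using f(2) by blast
    next
      case False
      then obtain z where "poly p z = 0" using fundamental_theorem_of_algebra[of p] by (metis constant_degree)
      then obtain q where q: "p = [:- z, 1:] * q" by (metis poly_eq_0_iff_dvd dvdE)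
      have q0: "q \<noteq> 0" using q less.prems(1) by auto
      have "p = pCons 0 q + Polynomial.smult (- z) q" by (simp add: q)
      then have "pvec ?T p f = pvec ?T (pCons 0 q + Polynomial.smult (- z) q) f" by (rule arg_cong)
      then have e: "pvec ?T p f = (\<lambda>i. ?T (pvec ?T q f) i - z * pvec ?T q f i)"
        unfolding padd psm pC by simp
      show ?thesis
      proof (cases "pvec ?T q f = (\<lambda>_. 0)")
        case True
        have "degree q < degree p" using q q0 by (simp add: degree_mult_eq del: mult_pCons_left)
        then show ?thesis using less.hyps q0 True by blast
      next
        case False
        have "?T (pvec ?T q f) = (\<lambda>i. z * pvec ?T q f i)"
          using less.prems(2) unfolding e by (simp add: fun_eq_iff)
        then show ?thesis using False pW by blast
      qed
    qed
  qed
  \<comment> \<open>There are n + 1 vectors with n coordinates; the row with index n of the square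
    matrix is filled with zeros.\<close>
  obtain v where v: "v \<in> fv (Suc n)" "v \<noteq> (\<lambda>_. 0)"
      "\<And>i. i < Suc n \<Longrightarrow> (\<Sum>j<Suc n. (if i < n then (?T ^^ j) f i else 0) * v j) = 0"
    by (rule zero_row_kernel[of n "Suc n" "\<lambda>i j. if i < n then (?T ^^ j) f i else 0"]) auto
  define p where "p = (\<Sum>j<Suc n. Polynomial.monom (v j) j)"
  have pmon: "pvec ?T (Polynomial.monom c j) f = (\<lambda>i. c * (?T ^^ j) f i)" for c j
  proof (induction j)
    case (Suc j)
    then show ?case by (simp add: monom_Suc pC mv_scale)
  qed (simp add: monom_0 pC p0 T0)
  have psum: "pvec ?T (\<Sum>j<m. Polynomial.monom (v j) j) f i = (\<Sum>j<m. v j * (?T ^^ j) f i)" for m i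
    by (induction m) (auto simp: p0 padd pmon)
  have "pvec ?T p f = (\<lambda>_. 0)"
  proof
    fix i
    show "pvec ?T p f i = 0"
    proof (cases "i < n")
      case True
      have "pvec ?T p f i = (\<Sum>j<Suc n. (if i < n then (?T ^^ j) f i else 0) * v j)"
        unfolding p_def psum using True by (intro sum.cong) (auto simp: mult.commute)
      then show ?thesis using v(3)[of i] True by simp
    next
      case False
      then show ?thesis using pW[of p] W by (auto simp: fsub_def fv_def)
    qed
  qed
  moreover have "p \<noteq> 0"
  proof
    assume "p = 0"
    have "coeff p j = v j" if "j < Suc n" for j
    proof -
      have "coeff p j = (\<Sum>k<Suc n. if k = j then v k else 0)" unfolding p_def coeff_sum by (intro sum.cong) auto
      then show ?thesis using that by (simp del: sum.lessThan_Suc)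
    qed
    then have "v j = 0" for j using v(1) \<open>p = 0\<close> by (cases "j < Suc n") (auto simp: fv_def)
    then show False using v(2) by blast
  qed
  ultimately show ?thesis using main that by blast
qed

text \<open>An eigenspace of the last matrix inside \<open>W\<close> is invariant under the others,
  by commutation.\<close>

lemma joint_eigenvector:
  fixes k :: nat
  assumes "fsub n W" "f \<in> W" "f \<noteq> (\<lambda>_. 0)"
    and "\<And>i g. i < k \<Longrightarrow> g \<in> W \<Longrightarrow> mv n (A i) g \<in> W"
    and "\<And>i j g. i < k \<Longrightarrow> j < k \<Longrightarrow> mv n (A i) (mv n (A j) g) = mv n (A j) (mv n (A i) g)"
  shows "\<exists>u\<in>W. u \<noteq> (\<lambda>_. 0) \<and> (\<forall>i<k. \<exists>z. mv n (A i) u = (\<lambda>l. z * u l))"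
  using assms
proof (induction k arbitrary: W f)
  case (Suc k)
  obtain u z where u: "u \<in> W" "u \<noteq> (\<lambda>_. 0)" "mv n (A k) u = (\<lambda>i. z * u i)"
    using eigenvector_in_invariant[OF Suc.prems(1) _ Suc.prems(2,3), of "A k"] Suc.prems(4)[of k] by blast
  let ?W = "{w \<in> W. mv n (A k) w = (\<lambda>i. z * w i)}"
  have "fsub n ?W" using Suc.prems(1) unfolding fsub_def
    by (auto simp: mv_add mv_scale distrib_left mult.left_commute)
  moreover have "mv n (A i) g \<in> ?W" if "i < k" "g \<in> ?W" for i g
  proof -
    have "mv n (A k) (mv n (A i) g) = mv n (A i) (mv n (A k) g)" using Suc.prems(5)[of k i g] that by simp
    then show ?thesis using that Suc.prems(4)[of i g] by (simp add: mv_scale)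
  qed
  ultimately obtain w where "w \<in> ?W" "w \<noteq> (\<lambda>_. 0)" "\<forall>i<k. \<exists>z. mv n (A i) w = (\<lambda>l. z * w l)"
    using Suc.IH[of ?W u] u Suc.prems(5) by force
  then show ?case by (auto simp: less_Suc_eq)
qed auto

section \<open>Unitary matrices and joint orthonormal eigenbases\<close>

lemma adj_carrier: "(A :: complex mat) \<in> carrier_mat n m \<Longrightarrow> mat_adjoint A \<in> carrier_mat m n"
  by (auto simp: mat_adjoint_def)

lemma sq_mult_carrier [simp]:
  "A \<in> carrier_mat n n \<Longrightarrow> B \<in> carrier_mat n n \<Longrightarrow> A * B \<in> carrier_mat n n"
  by (rule mult_carrier_mat)

lemma adj_index: "(A :: complex mat) \<in> carrier_mat n m \<Longrightarrow> i < m \<Longrightarrow> j < n \<Longrightarrow> mat_adjoint A $$ (i, j) = cnj (A $$ (j, i))"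
  by (auto simp: mat_adjoint_def mat_of_rows_def conjugate_complex_def)

lemma mult_index: "A \<in> carrier_mat n n \<Longrightarrow> B \<in> carrier_mat n n \<Longrightarrow> i < n \<Longrightarrow> j < n \<Longrightarrow>
    (A * B) $$ (i, j) = (\<Sum>k<n. A $$ (i, k) * B $$ (k, j))"
  by (auto simp: scalar_prod_def atLeast0LessThan)

lemma adj_mult:
  assumes A: "(A :: complex mat) \<in> carrier_mat n n" and B: "B \<in> carrier_mat n n"
  shows "mat_adjoint (A * B) = mat_adjoint B * mat_adjoint A"
proof (rule eq_matI)
  have AB: "A * B \<in> carrier_mat n n" using A B by simp
  fix i j assume "i < dim_row (mat_adjoint B * mat_adjoint A)" "j < dim_col (mat_adjoint B * mat_adjoint A)"
  then have ij: "i < n" "j < n" using adj_carrier[OF A] adj_carrier[OF B] by auto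
  then show "mat_adjoint (A * B) $$ (i, j) = (mat_adjoint B * mat_adjoint A) $$ (i, j)"
    using mult_index[OF adj_carrier[OF B] adj_carrier[OF A] ij] mult_index[OF A B ij(2,1)] A B
    by (simp add: adj_index[OF AB] adj_index[OF A] adj_index[OF B] mult.commute)
qed (use adj_carrier[OF A] adj_carrier[OF B] A B adj_carrier[of "A * B" n n] in auto)

lemma adj_adj:
  assumes A: "(A :: complex mat) \<in> carrier_mat n n" shows "mat_adjoint (mat_adjoint A) = A"
proof (rule eq_matI)
  fix i j assume "i < dim_row A" "j < dim_col A"
  then show "mat_adjoint (mat_adjoint A) $$ (i, j) = A $$ (i, j)"
    using A by (simp add: adj_index[OF adj_carrier[OF A]] adj_index[OF A])
qed (use A adj_carrier[OF adj_carrier[OF A]] in auto)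

definition unitary_mat :: "nat \<Rightarrow> complex mat \<Rightarrow> bool" where
  "unitary_mat n A \<longleftrightarrow> A \<in> carrier_mat n n \<and> mat_adjoint A * A = 1\<^sub>m n"

lemma unitary_ipr:
  assumes "unitary_mat n A" shows "ipr n (mv n A f) (mv n A g) = ipr n f g"
proof -
  have A: "A \<in> carrier_mat n n" and AA: "mat_adjoint A * A = 1\<^sub>m n" using assms by (auto simp: unitary_mat_def)
  have 1: "(\<Sum>i<n. A $$ (i, j) * cnj (A $$ (i, k))) = (if j = k then 1 else 0)" if "j < n" "k < n" for j k
  proof -
    have "(mat_adjoint A * A) $$ (k, j) = (\<Sum>i<n. cnj (A $$ (i, k)) * A $$ (i, j))"
      using mult_index[OF adj_carrier[OF A] A that(2,1)] that by (simp add: adj_index[OF A])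
    then show ?thesis using AA that by (auto simp: mult.commute split: if_splits)
  qed
  have "ipr n (mv n A f) (mv n A g) = (\<Sum>i<n. \<Sum>j<n. \<Sum>k<n. A $$ (i, j) * cnj (A $$ (i, k)) * (f j * cnj (g k)))"
    by (simp add: ipr_def mv_def sum_product mult_ac)
  also have "\<dots> = (\<Sum>j<n. \<Sum>i<n. \<Sum>k<n. A $$ (i, j) * cnj (A $$ (i, k)) * (f j * cnj (g k)))" by (rule sum.swap)
  also have "\<dots> = (\<Sum>j<n. \<Sum>k<n. \<Sum>i<n. A $$ (i, j) * cnj (A $$ (i, k)) * (f j * cnj (g k)))"
    by (rule sum.cong[OF refl], rule sum.swap)
  also have "\<dots> = (\<Sum>j<n. \<Sum>k<n. if k = j then f j * cnj (g k) else 0)"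
    by (intro sum.cong refl) (simp only: sum_distrib_right[symmetric] 1 lessThan_iff, simp)
  finally show ?thesis by (simp add: ipr_def)
qed

definition eigv :: "nat \<Rightarrow> nat \<Rightarrow> (nat \<Rightarrow> complex mat) \<Rightarrow> (nat \<Rightarrow> complex) \<Rightarrow> bool" where
  "eigv n k A u \<longleftrightarrow> u \<in> fv n \<and> (\<forall>i<k. \<exists>z. mv n (A i) u = (\<lambda>l. z * u l))"

text \<open>For unitary matrices the orthogonal complement of joint eigenvectors is invariant, and
  it is nonzero because \<open>m < n\<close>; a joint eigenvector inside it is then
  normalized.\<close>

lemma orthogonal_eigenvector:
  assumes A: "\<And>i. i < k \<Longrightarrow> unitary_mat n (A i)" "\<And>i j. i < k \<Longrightarrow> j < k \<Longrightarrow> A i * A j = A j * A i"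
    and v: "\<And>j. j < m \<Longrightarrow> eigv n k A (v j)" and "m < n"
  obtains u where "eigv n k A u" "ipr n u u = 1" "\<And>j. j < m \<Longrightarrow> ipr n u (v j) = 0"
proof -
  let ?W = "{f \<in> fv n. \<forall>j<m. ipr n f (v j) = 0}"
  obtain f where f: "f \<in> fv n" "f \<noteq> (\<lambda>_. 0)" "\<And>i. i < n \<Longrightarrow> (\<Sum>j<n. (if i < m then cnj (v i j) else 0) * f j) = 0"
    using zero_row_kernel[of m n "\<lambda>i j. if i < m then cnj (v i j) else 0"] \<open>m < n\<close> by auto
  have fW: "f \<in> ?W"
  proof -
    have "ipr n f (v j) = 0" if "j < m" for j
      using f(3)[of j] that \<open>m < n\<close> by (simp add: ipr_def mult.commute)
    then show ?thesis using f(1) by simp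
  qed
  have W: "fsub n ?W" by (auto simp: fsub_def fv_def ipr_simps)
  have inv: "mv n (A i) g \<in> ?W" if "i < k" "g \<in> ?W" for i g
  proof -
    have "ipr n (mv n (A i) g) (v j) = 0" if j: "j < m" for j
    proof -
      obtain z where z: "mv n (A i) (v j) = (\<lambda>l. z * v j l)" using v[OF j] \<open>i < k\<close> by (auto simp: eigv_def)
      have "cnj z * ipr n (mv n (A i) g) (v j) = ipr n (mv n (A i) g) (mv n (A i) (v j))"
        unfolding z by (simp add: ipr_simps)
      also have "\<dots> = 0" using \<open>g \<in> ?W\<close> j by (simp add: unitary_ipr[OF A(1)[OF \<open>i < k\<close>]])
      finally have "z = 0 \<or> ipr n (mv n (A i) g) (v j) = 0" by simp
      moreover have "v j = (\<lambda>_. 0)" if "z = 0"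
      proof (rule ipr_self_eq_0)
        show "v j \<in> fv n" using v[OF j] by (simp add: eigv_def)
        show "ipr n (v j) (v j) = 0"
          using unitary_ipr[OF A(1)[OF \<open>i < k\<close>], of "v j" "v j"] that unfolding z by (simp add: ipr_def)
      qed
      ultimately show ?thesis by (auto simp: ipr_def)
    qed
    then show ?thesis by (simp add: mv_fv)
  qed
  have "mv n (A i) (mv n (A j) g) = mv n (A j) (mv n (A i) g)" if "i < k" "j < k" for i j g
    using A that by (simp add: mv_mult[symmetric] unitary_mat_def)
  then have "\<exists>u\<in>?W. u \<noteq> (\<lambda>_. 0) \<and> (\<forall>i<k. \<exists>z. mv n (A i) u = (\<lambda>l. z * u l))"
    by (intro joint_eigenvector[OF W fW f(2)] inv)
  then obtain u where u: "u \<in> ?W" "u \<noteq> (\<lambda>_. 0)" "\<forall>i<k. \<exists>z. mv n (A i) u = (\<lambda>l. z * u l)"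
    by (elim bexE conjE)
  define r where "r = sqrt (\<Sum>i<n. (cmod (u i))\<^sup>2)"
  have "ipr n u u \<noteq> 0" using ipr_self_eq_0 u by blast
  then have r: "r \<noteq> 0" unfolding ipr_self r_def by (simp only: of_real_eq_0_iff real_sqrt_eq_0_iff not_False_eq_True)
  have "ipr n u u = of_real (r * r)" by (simp add: ipr_self r_def sum_nonneg)
  show ?thesis
  proof (rule that[of "\<lambda>i. of_real (inverse r) * u i"])
    show "eigv n k A (\<lambda>i. of_real (inverse r) * u i)"
      using u unfolding eigv_def mv_scale by (auto simp: fv_def) (metis mult.left_commute)
    show "ipr n (\<lambda>i. of_real (inverse r) * u i) (\<lambda>i. of_real (inverse r) * u i) = 1"
      unfolding ipr_simps \<open>ipr n u u = of_real (r * r)\<close> using r by (simp add: field_simps)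
    show "ipr n (\<lambda>i. of_real (inverse r) * u i) (v j) = 0" if "j < m" for j
      unfolding ipr_simps using u that by simp
  qed
qed

definition orthonormal :: "nat \<Rightarrow> nat \<Rightarrow> (nat \<Rightarrow> nat \<Rightarrow> complex) \<Rightarrow> bool" where
  "orthonormal n m v \<longleftrightarrow> (\<forall>a<m. \<forall>b<m. ipr n (v a) (v b) = (if a = b then 1 else 0))"

lemma unitary_eigenbasis:
  assumes A: "\<And>i. i < k \<Longrightarrow> unitary_mat n (A i)" "\<And>i j. i < k \<Longrightarrow> j < k \<Longrightarrow> A i * A j = A j * A i"
    and "m \<le> n"
  shows "\<exists>v. orthonormal n m v \<and> (\<forall>a<m. eigv n k A (v a))"
  using \<open>m \<le> n\<close>
proof (induction m)
  case (Suc m)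
  then obtain v where v: "orthonormal n m v" "\<And>a. a < m \<Longrightarrow> eigv n k A (v a)" by auto
  obtain u where u: "eigv n k A u" "ipr n u u = 1" "\<And>j. j < m \<Longrightarrow> ipr n u (v j) = 0"
    using orthogonal_eigenvector[of k n A m v, OF A(1) A(2) v(2)] Suc.prems by auto
  have u': "ipr n (v j) u = 0" if "j < m" for j using u(3)[OF that] ipr_cnj[of n u "v j"] by simp
  show ?case
    by (rule exI[of _ "v(m := u)"]) (use v u u' in \<open>auto simp: orthonormal_def less_Suc_eq\<close>)
qed (simp add: orthonormal_def)

section \<open>Matrices with a given orthonormal eigenbasis\<close>

definition umat :: "nat \<Rightarrow> (nat \<Rightarrow> nat \<Rightarrow> complex) \<Rightarrow> complex mat" where
  "umat n v = Matrix.mat n n (\<lambda>(a, b). v b a)"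

definition dmat :: "nat \<Rightarrow> (nat \<Rightarrow> complex) \<Rightarrow> complex mat" where
  "dmat n d = Matrix.mat n n (\<lambda>(a, b). if a = b then d a else 0)"

text \<open>For orthonormal \<open>v\<close>, the matrix with eigenvectors \<open>v a\<close> and
  eigenvalues \<open>d a\<close>. The paths below keep \<open>v\<close> fixed and vary only
  \<open>d\<close>.\<close>

definition cmat :: "nat \<Rightarrow> (nat \<Rightarrow> nat \<Rightarrow> complex) \<Rightarrow> (nat \<Rightarrow> complex) \<Rightarrow> complex mat" where
  "cmat n v d = umat n v * dmat n d * mat_adjoint (umat n v)"

lemma umat_carrier [simp]: "umat n v \<in> carrier_mat n n" and dmat_carrier [simp]: "dmat n d \<in> carrier_mat n n"
  by (auto simp: umat_def dmat_def)

lemma adj_umat_carrier [simp]: "mat_adjoint (umat n v) \<in> carrier_mat n n"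
  by (rule adj_carrier) simp

lemma cmat_carrier [simp]: "cmat n v d \<in> carrier_mat n n"
  unfolding cmat_def by (intro mult_carrier_mat[of _ n n] umat_carrier dmat_carrier adj_umat_carrier)

lemma unitary_umat: assumes "orthonormal n n v" shows "unitary_mat n (umat n v)"
  unfolding unitary_mat_def
proof (intro conjI eq_matI)
  fix i j assume "i < dim_row (1\<^sub>m n)" "j < dim_col (1\<^sub>m n :: complex mat)"
  then have ij: "i < n" "j < n" by auto
  have "(mat_adjoint (umat n v) * umat n v) $$ (i, j) = (\<Sum>k<n. cnj (umat n v $$ (k, i)) * umat n v $$ (k, j))"
    using mult_index[OF adj_umat_carrier umat_carrier ij] ij by (simp add: adj_index[OF umat_carrier])
  also have "\<dots> = ipr n (v j) (v i)" using ij by (simp add: umat_def ipr_def mult.commute)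
  finally show "(mat_adjoint (umat n v) * umat n v) $$ (i, j) = 1\<^sub>m n $$ (i, j)"
    using assms ij by (auto simp: orthonormal_def)
qed (use adj_umat_carrier[of n v, THEN carrier_matD(1)] umat_carrier[of n v, THEN carrier_matD(2)] in simp_all)

lemma unitary_right_inverse: "unitary_mat n A \<Longrightarrow> A * mat_adjoint A = 1\<^sub>m n"
  using mat_mult_left_right_inverse[OF adj_carrier[of A n n]] by (auto simp: unitary_mat_def)

lemma dmat_mult: "dmat n d * dmat n e = dmat n (\<lambda>a. d a * e a)"
proof (rule eq_matI)
  fix i j assume "i < dim_row (dmat n (\<lambda>a. d a * e a))" "j < dim_col (dmat n (\<lambda>a. d a * e a))"
  then have ij: "i < n" "j < n" by (auto simp: dmat_def)
  have "(dmat n d * dmat n e) $$ (i, j) = (\<Sum>k<n. if k = i then d i * (if i = j then e i else 0) else 0)"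
    unfolding mult_index[OF dmat_carrier dmat_carrier ij] using ij by (intro sum.cong) (auto simp: dmat_def)
  then show "(dmat n d * dmat n e) $$ (i, j) = dmat n (\<lambda>a. d a * e a) $$ (i, j)" using ij by (simp add: dmat_def)
qed (auto simp: dmat_def)

lemma dmat_1: "dmat n (\<lambda>_. 1) = 1\<^sub>m n"
  by (intro eq_matI) (auto simp: dmat_def)

lemma adj_dmat: "mat_adjoint (dmat n d) = dmat n (\<lambda>a. cnj (d a))"
proof (rule eq_matI)
  fix i j assume "i < dim_row (dmat n (\<lambda>a. cnj (d a)))" "j < dim_col (dmat n (\<lambda>a. cnj (d a)))"
  then have ij: "i < n" "j < n" by (auto simp: dmat_def)
  show "mat_adjoint (dmat n d) $$ (i, j) = dmat n (\<lambda>a. cnj (d a)) $$ (i, j)"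
    unfolding adj_index[OF dmat_carrier ij] using ij by (simp add: dmat_def)
qed (use adj_carrier[OF dmat_carrier[of n d]] dmat_carrier[of n "\<lambda>a. cnj (d a)"] in \<open>auto simp del: dmat_carrier\<close>)

lemma cmat_mult: assumes "orthonormal n n v" shows "cmat n v d * cmat n v e = cmat n v (\<lambda>a. d a * e a)"
proof -
  let ?U = "umat n v" and ?V = "mat_adjoint (umat n v)"
  have VU: "?V * ?U = 1\<^sub>m n" using unitary_umat[OF assms] by (simp add: unitary_mat_def)
  have c: "?U \<in> carrier_mat n n" "?V \<in> carrier_mat n n" "dmat n d \<in> carrier_mat n n" "dmat n e \<in> carrier_mat n n" by simp_all
  have "cmat n v d * cmat n v e = ?U * dmat n d * (?V * (?U * dmat n e * ?V))"
    unfolding cmat_def using c by (intro assoc_mult_mat[of _ n n _ n _ n]) auto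
  also have "?V * (?U * dmat n e * ?V) = (?V * ?U) * dmat n e * ?V"
    using c by (simp add: assoc_mult_mat[of _ n n _ n _ n])
  also have "\<dots> = dmat n e * ?V" using left_mult_one_mat[OF c(4)] by (simp add: VU)
  also have "?U * dmat n d * (dmat n e * ?V) = ?U * (dmat n d * dmat n e) * ?V"
    using c by (simp add: assoc_mult_mat[of _ n n _ n _ n])
  finally show ?thesis by (simp add: dmat_mult cmat_def)
qed

lemma cmat_1: "orthonormal n n v \<Longrightarrow> cmat n v (\<lambda>_. 1) = 1\<^sub>m n"
  using unitary_right_inverse[OF unitary_umat[of n v]] right_mult_one_mat[OF umat_carrier[of n v]]
  by (simp add: cmat_def dmat_1)

lemma adj_cmat: "mat_adjoint (cmat n v d) = cmat n v (\<lambda>a. cnj (d a))"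
proof -
  let ?U = "umat n v" and ?V = "mat_adjoint (umat n v)"
  have c: "?U \<in> carrier_mat n n" "?V \<in> carrier_mat n n" "dmat n d \<in> carrier_mat n n" by simp_all
  have "mat_adjoint (cmat n v d) = mat_adjoint ?V * (mat_adjoint (dmat n d) * ?V)"
    unfolding cmat_def using c by (simp add: adj_mult[of _ n])
  also have "\<dots> = ?U * (dmat n (\<lambda>a. cnj (d a)) * ?V)" by (simp add: adj_adj[of _ n] adj_dmat)
  finally show ?thesis unfolding cmat_def using c by (simp add: assoc_mult_mat[of _ n n _ n _ n])
qed

lemma unitary_cmat: "orthonormal n n v \<Longrightarrow> (\<And>a. a < n \<Longrightarrow> cmod (d a) = 1) \<Longrightarrow> unitary_mat n (cmat n v d)"
proof -
  assume v: "orthonormal n n v" and d: "\<And>a. a < n \<Longrightarrow> cmod (d a) = 1"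
  have "dmat n (\<lambda>a. cnj (d a) * d a) = 1\<^sub>m n"
    by (intro eq_matI) (auto simp: dmat_def d complex_norm_square[symmetric] mult.commute)
  then have "cmat n v (\<lambda>a. cnj (d a) * d a) = cmat n v (\<lambda>_. 1)" by (simp add: cmat_def dmat_1)
  then show ?thesis by (simp add: unitary_mat_def adj_cmat cmat_mult[OF v] cmat_1[OF v])
qed

lemma cmat_eigen:
  assumes v: "orthonormal n n v" and A: "A \<in> carrier_mat n n"
    and e: "\<And>a. a < n \<Longrightarrow> mv n A (v a) = (\<lambda>l. d a * v a l)"
  shows "cmat n v d = A"
proof -
  let ?U = "umat n v" and ?V = "mat_adjoint (umat n v)"
  have "A * ?U = ?U * dmat n d"
  proof (rule eq_matI)
    fix i j assume "i < dim_row (?U * dmat n d)" "j < dim_col (?U * dmat n d)"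
    then have ij: "i < n" "j < n" by (auto simp: umat_def dmat_def)
    have "(A * ?U) $$ (i, j) = mv n A (v j) i"
      unfolding mult_index[OF A umat_carrier ij] using ij by (simp add: umat_def mv_def)
    also have "\<dots> = d j * v j i" using e[OF ij(2)] by simp
    also have "\<dots> = (\<Sum>k<n. if k = j then d j * v j i else 0)" using ij by simp
    also have "\<dots> = (?U * dmat n d) $$ (i, j)"
      unfolding mult_index[OF umat_carrier dmat_carrier ij] using ij by (intro sum.cong) (auto simp: umat_def dmat_def)
    finally show "(A * ?U) $$ (i, j) = (?U * dmat n d) $$ (i, j)" .
  qed (use A in \<open>auto simp: umat_def dmat_def\<close>)
  then have "cmat n v d = A * ?U * ?V" by (simp add: cmat_def)
  also have "\<dots> = A * (?U * ?V)" using A by (simp add: assoc_mult_mat[of _ n n _ n _ n])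
  finally show ?thesis using A unitary_right_inverse[OF unitary_umat[OF v]] by simp
qed

lemma det_cmat: assumes v: "orthonormal n n v" shows "Determinant.det (cmat n v d) = (\<Prod>a<n. d a)"
proof -
  let ?U = "umat n v" and ?V = "mat_adjoint (umat n v)"
  have "Determinant.det ?V * Determinant.det ?U = 1"
    using unitary_umat[OF v] det_mult[of ?V n ?U] by (simp add: unitary_mat_def)
  moreover have "Determinant.det (cmat n v d) = Determinant.det ?U * Determinant.det (dmat n d) * Determinant.det ?V"
    unfolding cmat_def using det_mult[of "?U * dmat n d" n ?V] det_mult[of ?U n "dmat n d"] by simp
  ultimately have "Determinant.det (cmat n v d) = Determinant.det (dmat n d)" by (simp add: mult_ac)
  also have "\<dots> = prod_list (diag_mat (dmat n d))"
    by (rule det_upper_triangular[OF _ dmat_carrier]) (auto simp: dmat_def)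
  also have "diag_mat (dmat n d) = map d [0..<n]" by (auto simp: diag_mat_def dmat_def)
  also have "prod_list (map d [0..<n]) = (\<Prod>a<n. d a)"
    by (simp add: prod.distinct_set_conv_list[symmetric] atLeast0LessThan)
  finally show ?thesis .
qed

lemma eigenvalue_angles:
  assumes A: "\<And>i. i < k \<Longrightarrow> unitary_mat n (A i)" and v: "orthonormal n m v" "\<And>a. a < m \<Longrightarrow> eigv n k A (v a)"
  obtains \<theta> :: "nat \<Rightarrow> nat \<Rightarrow> real" where "\<And>i a. i < k \<Longrightarrow> a < m \<Longrightarrow> mv n (A i) (v a) = (\<lambda>l. cis (\<theta> i a) * v a l)"
proof -
  have "\<exists>t. i < k \<longrightarrow> a < m \<longrightarrow> mv n (A i) (v a) = (\<lambda>l. cis t * v a l)" for i a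
  proof (cases "i < k \<and> a < m")
    case True
    then obtain z where z: "mv n (A i) (v a) = (\<lambda>l. z * v a l)" using v(2) by (auto simp: eigv_def)
    have "ipr n (v a) (v a) = 1" using v(1) True by (simp add: orthonormal_def)
    then have "z * cnj z = 1"
      using unitary_ipr[OF A, of i "v a" "v a"] True unfolding z by (simp add: ipr_simps)
    then have "cmod z = 1" by (metis complex_mod_sqrt_Re_mult_cnj one_complex.sel(1) real_sqrt_one)
    then have "z = cis (Arg z)" using rcis_cmod_Arg[of z] by (simp add: rcis_def)
    then obtain t where "z = cis t" ..
    then show ?thesis using z by blast
  qed auto
  then show ?thesis using that by metis
qed

lemma cmat_index:
  assumes "i < n" "j < n" shows "cmat n v d $$ (i, j) = (\<Sum>a<n. d a * v a i * cnj (v a j))"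
proof -
  have UD: "(umat n v * dmat n d) $$ (i, a) = d a * v a i" if "a < n" for a
  proof -
    have "(umat n v * dmat n d) $$ (i, a) = (\<Sum>k<n. if k = a then v a i * d a else 0)"
      unfolding mult_index[OF umat_carrier dmat_carrier assms(1) that]
      using assms that by (intro sum.cong) (auto simp: umat_def dmat_def)
    then show ?thesis using that by simp
  qed
  have "cmat n v d $$ (i, j) = (\<Sum>a<n. (umat n v * dmat n d) $$ (i, a) * mat_adjoint (umat n v) $$ (a, j))"
    unfolding cmat_def by (rule mult_index) (use assms in auto)
  also have "\<dots> = (\<Sum>a<n. d a * v a i * cnj (v a j))"
    using assms by (intro sum.cong) (auto simp: UD adj_index[OF umat_carrier], simp add: umat_def)
  finally show ?thesis .
qed

lemma continuous_map_mat_topology: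
  fixes p :: "real \<Rightarrow> complex mat"
  assumes p: "\<And>s. p s \<in> S" and S: "S \<subseteq> carrier_mat n n"
    and c: "\<And>i j. i < n \<Longrightarrow> j < n \<Longrightarrow> continuous_on T (\<lambda>s. p s $$ (i, j))"
  shows "continuous_map (top_of_set T) (mat_topology S) p"
  unfolding mat_topology_def
proof (rule continuous_map_pullback')
  let ?f = "\<lambda>A (i, j). if i < dim_row A \<and> j < dim_col A then A $$ (i, j) else (0 :: complex)"
  have d: "dim_row (p s) = n" "dim_col (p s) = n" for s using p[of s] S by auto
  have "continuous_on T (\<lambda>s. ?f (p s) ij)" for ij
    using c[of "fst ij" "snd ij"] by (cases ij; cases "fst ij < n \<and> snd ij < n") (auto simp: d)
  then have "continuous_on T (?f \<circ> p)"
    unfolding o_def by (intro continuous_on_coordinatewise_then_product)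
  then show "continuous_map (top_of_set T) euclidean (?f \<circ> p)" by simp
  show "topspace (top_of_set T) \<subseteq> p -` S" using p by auto
qed

text \<open>Scaling all angles in one common eigenbasis keeps the tuple commuting and ends at the
  identity. Only membership in \<open>S\<close> depends on the group and on the choice of
  angles.\<close>

lemma diagonal_path:
  fixes A :: "nat \<Rightarrow> complex mat"
  assumes v: "orthonormal n n v" and A: "\<And>i. i < k \<Longrightarrow> A i \<in> carrier_mat n n"
    and e: "\<And>i a. i < k \<Longrightarrow> a < n \<Longrightarrow> mv n (A i) (v a) = (\<lambda>l. cis (\<theta> i a) * v a l)"
    and S: "S \<subseteq> carrier_mat n n" "\<And>i s. i < k \<Longrightarrow> cmat n v (\<lambda>a. cis (s * \<theta> i a)) \<in> S"
  shows "\<exists>p. (\<forall>i<k. continuous_map (top_of_set {0..1}) (mat_topology S) (p i) \<and> p i 0 = 1\<^sub>m n \<and> p i 1 = A i) \<and>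
    (\<forall>i<k. \<forall>j<k. \<forall>s::real. p i s * p j s = p j s * p i s)"
proof (intro exI conjI allI impI)
  let ?p = "\<lambda>i s. cmat n v (\<lambda>a. cis (s * \<theta> i a))"
  fix i assume i: "i < k"
  show "?p i 0 = 1\<^sub>m n" by (simp add: cmat_1[OF v])
  show "?p i 1 = A i" using cmat_eigen[OF v A[OF i], of "\<lambda>a. cis (\<theta> i a)"] e[OF i] by simp
  show "continuous_map (top_of_set {0..1}) (mat_topology S) (?p i)"
    by (rule continuous_map_mat_topology[OF S(2)[OF i] S(1)])
      (auto simp: cmat_index cis_conv_exp intro!: continuous_intros)
  show "?p i s * ?p j s = ?p j s * ?p i s" for j s
    unfolding cmat_mult[OF v] by (simp add: mult.commute)
qed

lemma prod_cis: "(\<Prod>a\<in>I. cis (f a)) = cis (\<Sum>a\<in>I. f a)"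
  by (induction I rule: infinite_finite_induct) (auto simp: cis_mult)

text \<open>The scaled matrices have determinant 1 for all s only if the angles add up to exactly 0,
  while the determinant condition makes their sum merely a multiple of 2 pi. Such a multiple can be
  removed from one angle without changing the matrix.\<close>

lemma commuting_SU_path:
  fixes A :: "nat \<Rightarrow> complex mat"
  assumes n: "n \<ge> 1" and A: "\<And>i. i < k \<Longrightarrow> A i \<in> carrier (SU n)"
    and com: "\<And>i j. i < k \<Longrightarrow> j < k \<Longrightarrow> A i * A j = A j * A i"
  shows "\<exists>p. (\<forall>i<k. continuous_map (top_of_set {0..1}) (mat_topology (carrier (SU n))) (p i) \<and>
      p i 0 = 1\<^sub>m n \<and> p i 1 = A i) \<and> (\<forall>i<k. \<forall>j<k. \<forall>s::real. p i s * p j s = p j s * p i s)"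
proof -
  have U: "unitary_mat n (A i)" and det: "Determinant.det (A i) = 1" if "i < k" for i
    using A[OF that] by (auto simp: SU_def unitary_mat_def)
  obtain v where v: "orthonormal n n v" "\<And>a. a < n \<Longrightarrow> eigv n k A (v a)"
    using unitary_eigenbasis[of k n A n, OF U com] by auto
  obtain \<theta> where th: "\<And>i a. i < k \<Longrightarrow> a < n \<Longrightarrow> mv n (A i) (v a) = (\<lambda>l. cis (\<theta> i a) * v a l)"
    using eigenvalue_angles[of k n A n v, OF U v] by blast
  have car: "A i \<in> carrier_mat n n" if "i < k" for i using U[OF that] by (simp add: unitary_mat_def)
  define t where "t i = (\<Sum>a<n. \<theta> i a)" for i
  \<comment> \<open>The angle with index 0, present because \<open>n \<ge> 1\<close>, absorbs the
    whole sum \<open>t i\<close>.\<close>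
  define \<phi> where "\<phi> i a = (if a = 0 then \<theta> i 0 - t i else \<theta> i a)" for i a
  have "(\<Sum>a<n. \<phi> i a) = (\<Sum>a<n. \<theta> i a - (if a = 0 then t i else 0))" for i
    by (intro sum.cong) (auto simp: \<phi>_def)
  then have s0: "(\<Sum>a<n. \<phi> i a) = 0" for i using n by (simp add: sum_subtractf t_def)
  have ct: "cis (t i) = 1" if "i < k" for i
  proof -
    have "cmat n v (\<lambda>a. cis (\<theta> i a)) = A i" by (rule cmat_eigen[OF v(1) car[OF that] th[OF that]])
    then show ?thesis using det_cmat[OF v(1), of "\<lambda>a. cis (\<theta> i a)"] det[OF that] by (simp add: prod_cis t_def)
  qed
  have ph: "cis (\<phi> i a) = cis (\<theta> i a)" if "i < k" for i a
    using ct[OF that] by (simp add: \<phi>_def cis_divide[symmetric])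
  show ?thesis
  proof (rule diagonal_path[OF v(1) car])
    show "mv n (A i) (v a) = (\<lambda>l. cis (\<phi> i a) * v a l)" if "i < k" "a < n" for i a
      using th[OF that] ph[OF that(1)] by simp
    show "carrier (SU n) \<subseteq> carrier_mat n n" by (auto simp: SU_def)
    show "cmat n v (\<lambda>a. cis (s * \<phi> i a)) \<in> carrier (SU n)" for i s
    proof -
      have "Determinant.det (cmat n v (\<lambda>a. cis (s * \<phi> i a))) = cis (s * (\<Sum>a<n. \<phi> i a))"
        by (simp add: det_cmat[OF v(1)] prod_cis sum_distrib_left)
      then show ?thesis using unitary_cmat[OF v(1), of "\<lambda>a. cis (s * \<phi> i a)"]
        by (simp add: SU_def unitary_mat_def s0)
    qed
  qed
qed

section \<open>Compact symplectic groups and the quaternionic structure\<close>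

abbreviation jform :: "nat \<Rightarrow> complex mat" where
  "jform m \<equiv> mat_adjoint (symplectic_form m)"

lemma symplectic_form_carrier: "symplectic_form m \<in> carrier_mat (2 * m) (2 * m)"
  unfolding symplectic_form_def by (auto intro!: carrier_matI)

lemma jform_carrier: "jform m \<in> carrier_mat (2 * m) (2 * m)"
  by (rule adj_carrier[OF symplectic_form_carrier])

lemma jform_index:
  assumes "i < 2 * m" "j < 2 * m"
  shows "jform m $$ (i, j) = (if j = i + m then - 1 else if i = j + m then 1 else 0)"
  unfolding adj_index[OF symplectic_form_carrier assms]
  unfolding symplectic_form_def using assms by (auto simp: index_mat_four_block)

lemma sum_double: "(\<Sum>i<2 * m. f i) = (\<Sum>i<m. f i) + (\<Sum>i<m. f (i + m) :: complex)" for m :: nat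
  using sum.atLeastLessThan_concat[of 0 m "2 * m" f] sum.shift_bounds_nat_ivl[of f 0 m m]
  by (simp add: atLeast0LessThan mult_2)

lemma mult_jform_index:
  assumes M: "M \<in> carrier_mat (2 * m) (2 * m)" and ij: "i < 2 * m" "j < 2 * m"
  shows "(M * jform m) $$ (i, j) = (if j < m then M $$ (i, j + m) else - M $$ (i, j - m))"
proof -
  have "(M * jform m) $$ (i, j) =
      (\<Sum>k<2 * m. if k = (if j < m then j + m else j - m) then (if j < m then M $$ (i, k) else - M $$ (i, k)) else 0)"
    unfolding mult_index[OF M jform_carrier ij]
    using ij by (intro sum.cong) (auto simp: jform_index)
  then show ?thesis using ij by (cases "j < m") (simp_all add: less_imp_diff_less)
qed

lemma jform_mult_index:
  assumes M: "M \<in> carrier_mat (2 * m) (2 * m)" and ij: "i < 2 * m" "j < 2 * m"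
  shows "(jform m * M) $$ (i, j) = (if i < m then - M $$ (i + m, j) else M $$ (i - m, j))"
proof -
  have "(jform m * M) $$ (i, j) =
      (\<Sum>k<2 * m. if k = (if i < m then i + m else i - m) then (if i < m then - M $$ (k, j) else M $$ (k, j)) else 0)"
    unfolding mult_index[OF jform_carrier M ij]
    using ij by (intro sum.cong) (auto simp: jform_index)
  then show ?thesis using ij by (cases "i < m") (simp_all add: less_imp_diff_less)
qed

abbreviation conjm :: "complex mat \<Rightarrow> complex mat" where
  "conjm A \<equiv> mat_adjoint (transpose_mat A)"

lemma conjm_carrier: "A \<in> carrier_mat n n \<Longrightarrow> conjm A \<in> carrier_mat n n"
  by (intro adj_carrier) simp

lemma conjm_index: "A \<in> carrier_mat n n \<Longrightarrow> i < n \<Longrightarrow> j < n \<Longrightarrow> conjm A $$ (i, j) = cnj (A $$ (i, j))"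
  using adj_index[of "transpose_mat A" n n i j] by simp

text \<open>Since the form is skew with real entries, \<open>jform m\<close> is its negative.  For unitary \<open>A\<close>, preserving
  the form means commuting with the antilinear map \<open>jform m\<close> after conjugation.\<close>

lemma unitary_symplectic_iff:
  assumes U: "unitary_mat (2 * m) A"
  shows "transpose_mat A * symplectic_form m * A = symplectic_form m \<longleftrightarrow> A * jform m = jform m * conjm A"
proof -
  let ?n = "2 * m" and ?J = "symplectic_form m" and ?A = "mat_adjoint A"
  have c: "A \<in> carrier_mat ?n ?n" and AA: "?A * A = 1\<^sub>m ?n" using U by (auto simp: unitary_mat_def)
  have c': "transpose_mat A \<in> carrier_mat ?n ?n" "?A \<in> carrier_mat ?n ?n" "conjm A \<in> carrier_mat ?n ?n"
    "?J \<in> carrier_mat ?n ?n" "jform m \<in> carrier_mat ?n ?n"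
    using c by (simp_all add: adj_carrier symplectic_form_carrier)
  have adj1: "mat_adjoint (transpose_mat A * ?J * A) = ?A * (jform m * conjm A)"
  proof -
    have "mat_adjoint (transpose_mat A * ?J * A) = ?A * mat_adjoint (transpose_mat A * ?J)"
      by (rule adj_mult[of _ ?n]) (use c c' in auto)
    also have "mat_adjoint (transpose_mat A * ?J) = jform m * conjm A"
      by (rule adj_mult[of _ ?n]) (use c c' in auto)
    finally show ?thesis .
  qed
  have adj2: "mat_adjoint (?A * (jform m * conjm A)) = transpose_mat A * ?J * A"
    unfolding adj1[symmetric] by (rule adj_adj[of _ ?n]) (use c c' in \<open>intro sq_mult_carrier, auto\<close>)
  show ?thesis
  proof
    assume "transpose_mat A * ?J * A = ?J"
    then have "A * jform m = A * (?A * (jform m * conjm A))" using adj1 by simp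
    also have "\<dots> = (A * ?A) * (jform m * conjm A)" by (rule assoc_mult_mat[of _ ?n ?n _ ?n _ ?n, symmetric]) (use c c' in auto)
    also have "\<dots> = jform m * conjm A" unfolding unitary_right_inverse[OF U] by (rule left_mult_one_mat[of _ ?n ?n]) (use c' in auto)
    finally show "A * jform m = jform m * conjm A" .
  next
    assume "A * jform m = jform m * conjm A"
    then have "?A * (jform m * conjm A) = ?A * (A * jform m)" by simp
    also have "\<dots> = (?A * A) * jform m" by (rule assoc_mult_mat[of _ ?n ?n _ ?n _ ?n, symmetric]) (use c c' in auto)
    also have "\<dots> = jform m" unfolding AA by (rule left_mult_one_mat) (use c' in simp)
    finally show "transpose_mat A * ?J * A = ?J" using adj2 adj_adj[OF c'(4)] by simp
  qed
qed

text \<open>The quaternionic structure on the standard representation of \<open>Sp m\<close>.\<close>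

definition jv :: "nat \<Rightarrow> (nat \<Rightarrow> complex) \<Rightarrow> nat \<Rightarrow> complex" where
  "jv m f = (\<lambda>i. if i < m then - cnj (f (i + m)) else if i < 2 * m then cnj (f (i - m)) else 0)"

lemma jv_fv: "jv m f \<in> fv (2 * m)"
  by (simp add: jv_def fv_def)

lemma jv_scale: "jv m (\<lambda>i. c * f i) = (\<lambda>i. cnj c * jv m f i)"
  by (auto simp: jv_def)

lemma ipr_jv_jv: "ipr (2 * m) (jv m f) (jv m g) = ipr (2 * m) g f"
  unfolding ipr_def sum_double by (simp add: jv_def mult.commute)

lemma ipr_jv: "ipr (2 * m) f (jv m g) = - ipr (2 * m) g (jv m f)"
  unfolding ipr_def sum_double by (simp add: jv_def mult.commute sum_negf)

lemma jv_eq_mv: "jv m f = mv (2 * m) (jform m) (\<lambda>i. cnj (f i))"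
proof
  fix i
  show "jv m f i = mv (2 * m) (jform m) (\<lambda>i. cnj (f i)) i"
  proof (cases "i < 2 * m")
    case True
    have "mv (2 * m) (jform m) (\<lambda>i. cnj (f i)) i = (\<Sum>k<2 * m. jform m $$ (i, k) * cnj (f k))"
      using True by (simp add: mv_def)
    also have "\<dots> =
        (\<Sum>k<2 * m. if k = (if i < m then i + m else i - m) then (if i < m then - cnj (f k) else cnj (f k)) else 0)"
      using True by (intro sum.cong) (auto simp: jform_index)
    finally show ?thesis using True by (cases "i < m") (simp_all add: jv_def less_imp_diff_less)
  qed (simp add: jv_def mv_def)
qed

lemma mv_jv:
  assumes A: "A \<in> carrier_mat (2 * m) (2 * m)" and c: "A * jform m = jform m * conjm A"
  shows "mv (2 * m) A (jv m f) = jv m (mv (2 * m) A f)"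
proof -
  have "mv (2 * m) (conjm A) (\<lambda>i. cnj (f i)) = (\<lambda>i. cnj (mv (2 * m) A f i))"
    by (auto simp: mv_def conjm_index[OF A])
  moreover have "mv (2 * m) A (jv m f) = mv (2 * m) (jform m) (mv (2 * m) (conjm A) (\<lambda>i. cnj (f i)))"
    unfolding jv_eq_mv mv_mult[OF A jform_carrier, symmetric] c by (rule mv_mult[OF jform_carrier conjm_carrier[OF A]])
  ultimately show ?thesis by (simp add: jv_eq_mv)
qed

text \<open>\<open>jv\<close> sends joint eigenvectors to joint eigenvectors, so the next vector can
  be chosen orthogonal to all earlier \<open>v a\<close> and \<open>jv m (v a)\<close>. It is
  orthogonal to its own image automatically, by skew-symmetry.\<close>

lemma symplectic_eigenbasis:
  assumes A: "\<And>i. i < k \<Longrightarrow> unitary_mat (2 * m) (A i)" "\<And>i j. i < k \<Longrightarrow> j < k \<Longrightarrow> A i * A j = A j * A i"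
    and J: "\<And>i. i < k \<Longrightarrow> A i * jform m = jform m * conjm (A i)"
    and "p \<le> m"
  shows "\<exists>v. orthonormal (2 * m) p v \<and> (\<forall>a<p. eigv (2 * m) k A (v a)) \<and> (\<forall>a<p. \<forall>b<p. ipr (2 * m) (v a) (jv m (v b)) = 0)"
  using \<open>p \<le> m\<close>
proof (induction p)
  case (Suc p)
  let ?n = "2 * m"
  obtain v where v: "orthonormal ?n p v" "\<And>a. a < p \<Longrightarrow> eigv ?n k A (v a)"
      "\<And>a b. a < p \<Longrightarrow> b < p \<Longrightarrow> ipr ?n (v a) (jv m (v b)) = 0"
    using Suc by auto
  have ej: "eigv ?n k A (jv m (v a))" if a: "a < p" for a
    unfolding eigv_def
  proof (intro conjI allI impI jv_fv)
    fix i assume i: "i < k"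
    obtain z where z: "mv ?n (A i) (v a) = (\<lambda>l. z * v a l)" using v(2)[OF a] i by (auto simp: eigv_def)
    have "mv ?n (A i) (jv m (v a)) = jv m (mv ?n (A i) (v a))"
      using mv_jv[OF _ J[OF i]] A(1)[OF i] by (simp add: unitary_mat_def)
    then show "\<exists>z. mv ?n (A i) (jv m (v a)) = (\<lambda>l. z * jv m (v a) l)" unfolding z jv_scale by blast
  qed
  \<comment> \<open>All 2 p vectors in one list, the images under \<open>jv\<close> in the second
    half.\<close>
  let ?w = "\<lambda>j. if j < p then v j else jv m (v (j - p))"
  have w: "eigv ?n k A (?w j)" if "j < 2 * p" for j using v(2) ej that by simp
  obtain u where u: "eigv ?n k A u" "ipr ?n u u = 1" "\<And>j. j < 2 * p \<Longrightarrow> ipr ?n u (?w j) = 0"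
    using orthogonal_eigenvector[of k ?n A "2 * p" ?w, OF A(1) A(2) w] Suc.prems by auto
  have u1: "ipr ?n u (v j) = 0" "ipr ?n u (jv m (v j)) = 0" if "j < p" for j
    using u(3)[of j] u(3)[of "j + p"] that by auto
  have u2: "ipr ?n (v j) u = 0" "ipr ?n (v j) (jv m u) = 0" if "j < p" for j
    using u1[OF that] ipr_cnj[of ?n u "v j"] ipr_jv[of m "v j" u] by simp_all
  have u3: "ipr ?n u (jv m u) = 0" using ipr_jv[of m u u] by simp
  show ?case
    by (rule exI[of _ "v(p := u)"]) (use v u u1 u2 u3 in \<open>auto simp: orthonormal_def less_Suc_eq\<close>)
qed (simp add: orthonormal_def)

text \<open>The eigenbasis consists of pairs \<open>v a\<close>, \<open>jv m (v a)\<close>. Since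
  \<open>jv\<close> is antilinear, the eigenvalues in a pair are conjugate, and the angles must be
  chosen exactly opposite for the scaled matrices to commute with the quaternionic
  structure.\<close>

lemma commuting_Sp_path:
  fixes A :: "nat \<Rightarrow> complex mat"
  assumes A: "\<And>i. i < k \<Longrightarrow> A i \<in> carrier (Sp m)"
    and com: "\<And>i j. i < k \<Longrightarrow> j < k \<Longrightarrow> A i * A j = A j * A i"
  shows "\<exists>p. (\<forall>i<k. continuous_map (top_of_set {0..1}) (mat_topology (carrier (Sp m))) (p i) \<and>
      p i 0 = 1\<^sub>m (2 * m) \<and> p i 1 = A i) \<and> (\<forall>i<k. \<forall>j<k. \<forall>s::real. p i s * p j s = p j s * p i s)"
proof -
  let ?n = "2 * m"
  have U: "unitary_mat ?n (A i)" if "i < k" for i using A[OF that] by (auto simp: Sp_def unitary_mat_def)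
  have J: "A i * jform m = jform m * conjm (A i)" if "i < k" for i
    using A[OF that] unitary_symplectic_iff[OF U[OF that]] by (simp add: Sp_def)
  have car: "A i \<in> carrier_mat ?n ?n" if "i < k" for i using U[OF that] by (simp add: unitary_mat_def)
  obtain v where v: "orthonormal ?n m v" "\<And>a. a < m \<Longrightarrow> eigv ?n k A (v a)"
      "\<And>a b. a < m \<Longrightarrow> b < m \<Longrightarrow> ipr ?n (v a) (jv m (v b)) = 0"
    using symplectic_eigenbasis[of k m A m, OF U com J] by auto
  obtain \<theta> where th: "\<And>i a. i < k \<Longrightarrow> a < m \<Longrightarrow> mv ?n (A i) (v a) = (\<lambda>l. cis (\<theta> i a) * v a l)"
    using eigenvalue_angles[of k ?n A m v, OF U v(1,2)] by blast
  define V where "V a = (if a < m then v a else jv m (v (a - m)))" for a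
  \<comment> \<open>The minus sign for the second half is the choice of exactly opposite
    angles.\<close>
  define \<phi> where "\<phi> i a = (if a < m then \<theta> i a else - \<theta> i (a - m))" for i a
  have V: "orthonormal ?n ?n V"
    unfolding orthonormal_def
  proof (intro allI impI)
    fix a b assume ab: "a < ?n" "b < ?n"
    have sw: "ipr ?n (jv m f) g = 0" if "ipr ?n g (jv m f) = 0" for f g
      using ipr_cnj[of ?n g "jv m f"] that by simp
    show "ipr ?n (V a) (V b) = (if a = b then 1 else 0)"
      using ab v(1) v(3) by (auto simp: V_def orthonormal_def ipr_jv_jv sw)
  qed
  have mem: "cmat ?n V (\<lambda>a. cis (s * \<phi> i a)) \<in> carrier (Sp m)" (is "?P \<in> _") for i s
  proof -
    have UP: "unitary_mat ?n ?P" by (rule unitary_cmat[OF V]) simp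
    then have P: "?P \<in> carrier_mat ?n ?n" by simp
    have idx: "?P $$ (i', j') = (\<Sum>a<m. cis (s * \<theta> i a) * v a i' * cnj (v a j')) +
        (\<Sum>a<m. cis (- (s * \<theta> i a)) * jv m (v a) i' * cnj (jv m (v a) j'))" if "i' < ?n" "j' < ?n" for i' j'
      unfolding cmat_index[OF that] sum_double by (simp add: \<phi>_def V_def)
    note ci = conjm_index[OF P]
    have "?P * jform m = jform m * conjm ?P"
    proof (rule eq_matI)
      fix i' j' assume "i' < dim_row (jform m * conjm ?P)" "j' < dim_col (jform m * conjm ?P)"
      then have ij: "i' < ?n" "j' < ?n" using jform_carrier[of m] conjm_carrier[OF P] by auto
      have hi: "i' - m < m" "i' - m + m = i'" "jv m f i' = cnj (f (i' - m))" if "\<not> i' < m" for f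
        using ij that by (auto simp: jv_def)
      have hj: "j' - m < m" "j' - m + m = j'" "jv m f j' = cnj (f (j' - m))" if "\<not> j' < m" for f
        using ij that by (auto simp: jv_def)
      have jl: "jv m f l = - cnj (f (l + m))" "jv m f (l + m) = cnj (f l)" if "l < m" for f l
        using that by (auto simp: jv_def)
      show "(?P * jform m) $$ (i', j') = (jform m * conjm ?P) $$ (i', j')"
        unfolding mult_jform_index[OF P ij] jform_mult_index[OF conjm_carrier[OF P] ij]
        using ij
        by (cases "i' < m"; cases "j' < m"; simp add: ci idx jl hi hj cis_cnj sum_negf; (simp add: mult_ac add_ac)?)
    qed (use jform_carrier[of m, THEN carrier_matD(1)] jform_carrier[of m, THEN carrier_matD(2)]
      conjm_carrier[OF P, THEN carrier_matD(2)] P[THEN carrier_matD(1)] in simp_all)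
    then show ?thesis using UP unitary_symplectic_iff[OF UP] by (simp add: Sp_def unitary_mat_def)
  qed
  show ?thesis
  proof (rule diagonal_path[OF V car _ _ mem])
    show "mv ?n (A i) (V a) = (\<lambda>l. cis (\<phi> i a) * V a l)" if "i < k" "a < ?n" for i a
    proof (cases "a < m")
      case False
      then have "mv ?n (A i) (jv m (v (a - m))) = jv m (mv ?n (A i) (v (a - m)))"
        using mv_jv[OF car J] that by simp
      also have "\<dots> = (\<lambda>l. cis (- \<theta> i (a - m)) * jv m (v (a - m)) l)"
        using th[of i "a - m"] that False by (simp add: jv_scale cis_cnj)
      finally show ?thesis using False by (simp add: V_def \<phi>_def)
    qed (use th that in \<open>simp add: V_def \<phi>_def\<close>)
    show "carrier (Sp m) \<subseteq> carrier_mat ?n ?n" by (auto simp: Sp_def)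
  qed
qed

lemma commuting_tuple_path:
  fixes F :: "complex mat monoid" and k :: nat
  assumes F: "(\<exists>n\<ge>1. F = SU n) \<or> (\<exists>m\<ge>1. F = Sp m)"
    and A: "\<And>i. i < k \<Longrightarrow> A i \<in> carrier F"
    and com: "\<And>i j. i < k \<Longrightarrow> j < k \<Longrightarrow> A i \<otimes>\<^bsub>F\<^esub> A j = A j \<otimes>\<^bsub>F\<^esub> A i"
  obtains p where "\<And>i. i < k \<Longrightarrow> continuous_map (top_of_set {0..1}) (mat_topology (carrier F)) (p i)"
    "\<And>i. i < k \<Longrightarrow> p i 0 = \<one>\<^bsub>F\<^esub>" "\<And>i. i < k \<Longrightarrow> p i 1 = A i"
    "\<And>i j s. i < k \<Longrightarrow> j < k \<Longrightarrow> p i s \<otimes>\<^bsub>F\<^esub> p j s = p j s \<otimes>\<^bsub>F\<^esub> p i (s :: real)"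
  using F
proof (elim disjE exE conjE)
  fix n :: nat assume F: "n \<ge> 1" "F = SU n"
  have *: "x \<otimes>\<^bsub>F\<^esub> y = x * y" "\<one>\<^bsub>F\<^esub> = 1\<^sub>m n" for x y by (simp_all add: F SU_def)
  obtain p where p: "\<forall>i<k. continuous_map (top_of_set {0..1}) (mat_topology (carrier F)) (p i) \<and> p i 0 = 1\<^sub>m n \<and> p i 1 = A i"
      "\<forall>i<k. \<forall>j<k. \<forall>s::real. p i s * p j s = p j s * p i s"
    using commuting_SU_path[of n k A, OF F(1)] A com unfolding * unfolding F by auto
  show thesis by (rule that[of p]) (use p in \<open>auto simp: *\<close>)
next
  fix m :: nat assume F: "m \<ge> 1" "F = Sp m"
  have *: "x \<otimes>\<^bsub>F\<^esub> y = x * y" "\<one>\<^bsub>F\<^esub> = 1\<^sub>m (2 * m)" for x y by (simp_all add: F Sp_def)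
  obtain p where p: "\<forall>i<k. continuous_map (top_of_set {0..1}) (mat_topology (carrier F)) (p i) \<and> p i 0 = 1\<^sub>m (2 * m) \<and> p i 1 = A i"
      "\<forall>i<k. \<forall>j<k. \<forall>s::real. p i s * p j s = p j s * p i s"
    using commuting_Sp_path[of k A m] A com unfolding * unfolding F by auto
  show thesis by (rule that[of p]) (use p in \<open>auto simp: *\<close>)
qed

section \<open>Complete reducibility of the adjoint action of a tuple\<close>

text \<open>Subspaces are cut out by linear equations: the value in question is tested against its
  own component \<open>u\<close> orthogonal to \<open>W\<close>, a fixed vector.\<close>

theorem mexpol_density_subspace:
  assumes W: "subspace W" and M: "mexpol M" "\<And>m. M m (real m) (real m) \<in> W"
  shows "M m a c \<in> W"
proof -
  obtain w u where w: "w \<in> span W" "\<And>v. v \<in> span W \<Longrightarrow> orthogonal u v" "M m a c = w + u"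
    using orthogonal_subspace_decomp_exists[of W "M m a c"] by blast
  have sp: "span W = W" using W by (simp add: span_eq_iff)
  have "of_real (M m a c \<bullet> u) = (0 :: complex)"
  proof (rule expol_density[of "\<lambda>m a c. of_real (M m a c \<bullet> u)"])
    have "real_polynomial_function (\<lambda>X. X \<bullet> u)" by (intro real_polynomial_function.intros(1) bounded_linear_inner_left)
    then show "expol (\<lambda>m a c. of_real (M m a c \<bullet> u))" by (rule expol_polynomial[OF _ M(1)])
    show "of_real (M m (real m) (real m) \<bullet> u) = (0 :: complex)" for m
      using w(2)[of "M m (real m) (real m)"] M(2)[of m] by (simp add: sp orthogonal_def inner_commute)
  qed
  then have "(w + u) \<bullet> u = 0" unfolding w(3) by (simp only: of_real_eq_0_iff)
  moreover have "w \<bullet> u = 0" using w(2)[OF w(1)] by (simp add: orthogonal_def inner_commute)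
  ultimately have "u = 0" by (simp add: inner_add_left)
  then show ?thesis using w(1,3) by (simp add: sp)
qed

lemma inverses_power: "inverses x y \<Longrightarrow> inverses (x ^ m) (y ^ m)"
proof (induction m)
  case (Suc m)
  then show ?case using inverses_mult[of x y "x ^ m" "y ^ m"] by (simp add: power_commutes)
qed (simp add: inverses_def)

lemma power_conj_mem:
  assumes "\<And>X. X \<in> W \<Longrightarrow> x * X * y \<in> W" "X \<in> W" shows "x ^ m * X * y ^ m \<in> (W :: 'n::finite rsq set)"
proof (induction m)
  case (Suc m)
  have "x ^ Suc m * X * y ^ Suc m = x * (x ^ m * X * y ^ m) * y"
    by (simp add: mult.assoc power_commutes)
  then show ?case using assms(1)[OF Suc] by simp
qed (simp add: assms)

lemma jordi_power:
  assumes "inverses g h" shows "jordi g m (s * real m) (s * real m) = jordi g 1 s s ^ m"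
proof (rule inverses_unique)
  show "inverses (jord g m (s * real m) (s * real m)) (jordi g m (s * real m) (s * real m))"
    by (rule inverses_jord[OF assms])
  show "inverses (jord g m (s * real m) (s * real m)) (jordi g 1 s s ^ m)"
    unfolding jord_power[OF assms] by (intro inverses_power inverses_jord[OF assms])
qed

lemma jord_stable:
  assumes W: "subspace W" and g: "inverses g h" and X: "X \<in> W"
  shows "(\<And>X. X \<in> W \<Longrightarrow> jord g 1 s s * X * jordi g 1 s s \<in> W) \<Longrightarrow>
      jord g m (s * a) (s * c) * X * jordi g m (s * a) (s * c) \<in> W"
    and "(\<And>X. X \<in> W \<Longrightarrow> jordi g 1 s s * X * jord g 1 s s \<in> W) \<Longrightarrow>
      jordi g m (s * a) (s * c) * X * jord g m (s * a) (s * c) \<in> W"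
proof -
  note mj = mexpol_jord[OF g] and p = jord_power[OF g] jordi_power[OF g]
  show "jord g m (s * a) (s * c) * X * jordi g m (s * a) (s * c) \<in> W"
    if "\<And>X. X \<in> W \<Longrightarrow> jord g 1 s s * X * jordi g 1 s s \<in> W"
    by (rule mexpol_density_subspace[OF W, of "\<lambda>m a c. jord g m (s * a) (s * c) * X * jordi g m (s * a) (s * c)"])
      (use power_conj_mem[OF that X] in \<open>auto intro!: mexpol_mult mexpol_const mj simp: p\<close>)
  show "jordi g m (s * a) (s * c) * X * jord g m (s * a) (s * c) \<in> W"
    if "\<And>X. X \<in> W \<Longrightarrow> jordi g 1 s s * X * jord g 1 s s \<in> W"
    by (rule mexpol_density_subspace[OF W, of "\<lambda>m a c. jordi g m (s * a) (s * c) * X * jord g m (s * a) (s * c)"])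
      (use power_conj_mem[OF that X] in \<open>auto intro!: mexpol_mult mexpol_const mj simp: p\<close>)
qed

lemma inner_conj: "(k * A * tp k) \<bullet> B = A \<bullet> (tp k * B * k)" for k :: "'n::finite rsq"
  using inner_mult_right[of "k * A" "tp k" B] inner_mult_left[of k A "B * k"] by (simp add: mult.assoc)

definition Ad_stable :: "nat \<Rightarrow> (nat \<Rightarrow> 'n::finite rsq) \<Rightarrow> 'n rsq set \<Rightarrow> bool" where
  "Ad_stable k g W \<longleftrightarrow> (\<forall>i<k. \<forall>h. inverses (g i) h \<longrightarrow> (\<forall>X\<in>W. g i * X * h \<in> W \<and> h * X * g i \<in> W))"

text \<open>For nonzero \<open>s\<close> each of \<open>g\<close> and \<open>jord g 1 s s\<close>
  arises from the other by changing exponents, by the factor s or 1 / s. Density along powers then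
  transfers stability in both directions. At s = 0 information is lost, so that endpoint needs
  another argument.\<close>

lemma Ad_stable_jord:
  assumes W: "subspace W" and g: "\<And>i. i < k \<Longrightarrow> inverses (g i) (h i)" and s: "s \<noteq> 0"
  shows "Ad_stable k (\<lambda>i. jord (g i) 1 s s) W \<longleftrightarrow> Ad_stable k g W"
proof -
  have j: "inverses (jord (g i) 1 s s) (jordi (g i) 1 s s)" if "i < k" for i s by (rule inverses_jord[OF g[OF that]])
  have 1: "jord (g i) 1 1 1 = g i" "jordi (g i) 1 1 1 = h i" if "i < k" for i
    using jord_111[OF g[OF that]] inverses_unique[OF _ g[OF that]] j[OF that, of 1] by auto
  have eq1: "Ad_stable k (\<lambda>i. jord (g i) 1 s s) W \<longleftrightarrow>
      (\<forall>i<k. \<forall>X\<in>W. jord (g i) 1 s s * X * jordi (g i) 1 s s \<in> W \<and> jordi (g i) 1 s s * X * jord (g i) 1 s s \<in> W)" for s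
  proof (intro iffI allI impI ballI)
    fix i X assume "Ad_stable k (\<lambda>i. jord (g i) 1 s s) W" "i < k" "X \<in> W"
    then show "jord (g i) 1 s s * X * jordi (g i) 1 s s \<in> W \<and> jordi (g i) 1 s s * X * jord (g i) 1 s s \<in> W"
      using j[OF \<open>i < k\<close>] unfolding Ad_stable_def by blast
  next
    assume *: "\<forall>i<k. \<forall>X\<in>W. jord (g i) 1 s s * X * jordi (g i) 1 s s \<in> W \<and> jordi (g i) 1 s s * X * jord (g i) 1 s s \<in> W"
    show "Ad_stable k (\<lambda>i. jord (g i) 1 s s) W"
      unfolding Ad_stable_def
    proof (intro allI impI ballI)
      fix i h X assume i: "i < k" and h: "inverses (jord (g i) 1 s s) h" and X: "X \<in> W"
      have "h = jordi (g i) 1 s s" by (rule inverses_unique[OF h j[OF i]])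
      then show "jord (g i) 1 s s * X * h \<in> W \<and> h * X * jord (g i) 1 s s \<in> W" using * i X by simp
    qed
  qed
  have eq2: "Ad_stable k g W \<longleftrightarrow> Ad_stable k (\<lambda>i. jord (g i) 1 1 1) W"
    unfolding Ad_stable_def using 1 by simp
  have key: "Ad_stable k (\<lambda>i. jord (g i) 1 (s * a) (s * a)) W" if st: "Ad_stable k (\<lambda>i. jord (g i) 1 s s) W" for s a
    unfolding eq1
  proof (intro allI impI ballI conjI)
    fix i X assume i: "i < k" and X: "X \<in> W"
    note st' = st[unfolded eq1, rule_format, OF i]
    show "jord (g i) 1 (s * a) (s * a) * X * jordi (g i) 1 (s * a) (s * a) \<in> W"
      by (rule jord_stable(1)[OF W g[OF i] X]) (rule st'[THEN conjunct1])
    show "jordi (g i) 1 (s * a) (s * a) * X * jord (g i) 1 (s * a) (s * a) \<in> W"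
      by (rule jord_stable(2)[OF W g[OF i] X]) (rule st'[THEN conjunct2])
  qed
  show ?thesis
    unfolding eq2 using key[of s "1 / s"] key[of 1 s] s by auto
qed

definition completely_reducible :: "nat \<Rightarrow> 'n::finite rsq set \<Rightarrow> (nat \<Rightarrow> 'n rsq) \<Rightarrow> bool" where
  "completely_reducible k L g \<longleftrightarrow> (\<forall>W. subspace W \<and> W \<subseteq> L \<and> Ad_stable k g W \<longrightarrow>
    (\<exists>W'. subspace W' \<and> W' \<subseteq> L \<and> Ad_stable k g W' \<and> W \<inter> W' = {0} \<and> {x + y | x y. x \<in> W \<and> y \<in> W'} = L))"

lemma completely_reducible_jord:
  assumes g: "\<And>i. i < k \<Longrightarrow> inverses (g i) (h i)" and s: "s \<noteq> 0" and cr: "completely_reducible k L g"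
  shows "completely_reducible k L (\<lambda>i. jord (g i) 1 s s)"
  unfolding completely_reducible_def
proof (intro allI impI, elim conjE)
  note eq = Ad_stable_jord[OF _ g s]
  fix W assume W: "subspace W" "W \<subseteq> L" "Ad_stable k (\<lambda>i. jord (g i) 1 s s) W"
  have "Ad_stable k g W" using W(3) eq[OF W(1)] by simp
  then obtain W' where W': "subspace W'" "W' \<subseteq> L" "Ad_stable k g W'" "W \<inter> W' = {0}"
      "{x + y | x y. x \<in> W \<and> y \<in> W'} = L"
    using cr[unfolded completely_reducible_def, rule_format, of W] W(1,2) by (elim meta_impE exE conjE) auto
  have "Ad_stable k (\<lambda>i. jord (g i) 1 s s) W'" using W'(3) eq[OF W'(1)] by simp
  then show "\<exists>W'. subspace W' \<and> W' \<subseteq> L \<and> Ad_stable k (\<lambda>i. jord (g i) 1 s s) W' \<and> W \<inter> W' = {0} \<and>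
      {x + y | x y. x \<in> W \<and> y \<in> W'} = L"
    using W' by (intro exI[of _ W'] conjI)
qed

text \<open>The form is adapted to one member of the tuple after another by \<open>HH\<close>;
  commutation preserves the invariance already achieved, and elliptic parts have eigenvalues of
  modulus 1.\<close>

lemma elliptic_invariant_form:
  fixes k :: nat
  assumes "\<And>i. i < k \<Longrightarrow> inverses (g i) (h i)" "\<And>i j. i < k \<Longrightarrow> j < k \<Longrightarrow> g i * g j = g j * g i"
  shows "\<exists>H. pd H \<and> (\<forall>i<k. tp (fc sgn (g i)) * H * fc sgn (g i) = (H :: 'n::finite rsq))"
  using assms
proof (induction k)
  case (Suc k)
  then obtain H where H: "pd H" "\<And>i. i < k \<Longrightarrow> tp (fc sgn (g i)) * H * fc sgn (g i) = H" by auto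
  have "tp (fc sgn (g i)) * HH (g k) H * fc sgn (g i) = HH (g k) H" if "i < k" for i
    by (rule HH_commute[OF _ H(2)[OF that]], rule fc_commute[symmetric], rule Suc.prems(2)) (use that in auto)
  moreover have "tp (fc sgn (g k)) * HH (g k) H * fc sgn (g k) = HH (g k) H"
  proof (rule HH_unitary[OF csym_simps(3)])
    fix z assume "z \<in> sp (g k)"
    then have "z \<noteq> 0" using sp_inverses[OF Suc.prems(1)[of k]] by auto
    then show "cmod (sgn z) = 1" by (simp add: norm_sgn)
  qed
  ultimately show ?case using pd_HH[OF H(1)] by (intro exI[of _ "HH (g k) H"]) (auto simp: less_Suc_eq)
qed (use pd_1 in auto)

context rgroup
begin

lemma elliptic_orth:
  fixes k :: nat
  assumes "\<And>i. i < k \<Longrightarrow> inverses (g i) (h i)" "\<And>i j. i < k \<Longrightarrow> j < k \<Longrightarrow> g i * g j = g j * g i"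
  shows "\<exists>x y. inverses x y \<and> (\<forall>i<k. orth_at x y (fc sgn (g i)))"
proof -
  obtain H where H: "pd H" "\<And>i. i < k \<Longrightarrow> tp (fc sgn (g i)) * H * fc sgn (g i) = H"
    using elliptic_invariant_form[of k g h] assms by blast
  obtain x y where xy: "inverses x y" "tp x * x = H" using pd_square_root[OF H(1)] .
  show ?thesis
  proof (intro exI conjI allI impI)
    show "inverses y x" by (rule inverses_sym[OF xy(1)])
    fix i assume i: "i < k"
    let ?E = "fc sgn (g i)"
    have "tp (x * ?E * y) * (x * ?E * y) = tp y * (tp ?E * (tp x * x) * ?E) * y"
      by (simp add: mult.assoc)
    also have "\<dots> = tp y * (tp x * x) * y" by (simp only: xy(2) H(2)[OF i])
    also have "\<dots> = tp (x * y) * (x * y)" by (simp add: mult.assoc)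
    finally show "orth_at y x ?E" using inversesD(1)[OF xy(1)] by (simp add: orth_at_def)
  qed
qed

text \<open>The inner product transported by conjugation with \<open>x\<close> is invariant under
  the adjoint action of the tuple, so orthogonal complements are invariant complements.\<close>

theorem orth_completely_reducible:
  assumes xy: "inverses x y" and g: "\<And>i. i < k \<Longrightarrow> g i \<in> G" "\<And>i. i < k \<Longrightarrow> orth_at x y (g i)"
  shows "completely_reducible k (lieal G) g"
  unfolding completely_reducible_def
proof (intro allI impI, elim conjE)
  fix W assume W: "subspace W" "W \<subseteq> lieal G" "Ad_stable k g W"
  let ?f = "\<lambda>X. y * X * x"
  have lin: "linear ?f" by (auto intro!: linearI simp: algebra_simps)
  have inj: "X = 0" if "?f X = 0" for X
  proof -
    have "X = x * ?f X * y" using inversesD[OF xy] by (simp add: mult.assoc)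
    then show ?thesis using that by simp
  qed
  define W' where "W' = {X \<in> lieal G. \<forall>Y\<in>W. ?f X \<bullet> ?f Y = 0}"
  have sW': "subspace W'"
    using subspace_lieal unfolding subspace_def W'_def by (auto simp: algebra_simps inner_add_left)
  have inv: "?f (g i * X * h) \<bullet> ?f Y = ?f X \<bullet> ?f (h * Y * g i)"
    if i: "i < k" and h: "inverses (g i) h" for i h X Y
  proof -
    let ?k = "y * g i * x"
    have k: "inverses (tp ?k) ?k" using g(2)[OF i] by (simp add: orth_at_def inverses_def)
    have ik: "inverses ?k (y * h * x)"
      using inversesD[OF xy] inversesD[OF h] by (simp add: inverses_def mult.assoc)
    have tk: "y * h * x = tp ?k" by (rule inverses_unique[OF ik inverses_sym[OF k]])
    have "?f (g i * X * h) = ?k * ?f X * (y * h * x)" using inversesD[OF xy] by (simp add: mult.assoc)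
    moreover have "?f (h * Y * g i) = (y * h * x) * ?f Y * ?k" using inversesD[OF xy] by (simp add: mult.assoc)
    moreover have "(?k * ?f X * tp ?k) \<bullet> ?f Y = ?f X \<bullet> (tp ?k * ?f Y * ?k)"
      by (rule inner_conj)
    ultimately show ?thesis by (simp only: tk)
  qed
  have "Ad_stable k g W'"
    unfolding Ad_stable_def
  proof (intro allI impI ballI conjI)
    fix i h X assume i: "i < k" and h: "inverses (g i) h" and X: "X \<in> W'"
    have W1: "Y \<in> W \<Longrightarrow> g i * Y * h \<in> W" "Y \<in> W \<Longrightarrow> h * Y * g i \<in> W" for Y
      using W(3) i h by (auto simp: Ad_stable_def)
    have hG: "h \<in> G" by (rule inverses_mem[OF g(1)[OF i] h])
    show "g i * X * h \<in> W'"
      using X W1(2) lieal_Ad[OF g(1)[OF i] h] by (simp add: W'_def inv[OF i h])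
    have "?f (h * X * g i) \<bullet> ?f Y = ?f X \<bullet> ?f (g i * Y * h)" for Y
      using inv[OF i h, of Y X] by (simp add: inner_commute)
    then show "h * X * g i \<in> W'"
      using X W1(1) lieal_Ad[OF hG inverses_sym[OF h]] by (simp add: W'_def)
  qed
  moreover have "W \<inter> W' = {0}"
  proof
    have "X = 0" if "X \<in> W" "X \<in> W'" for X
    proof (rule inj)
      have "?f X \<bullet> ?f X = 0" using that unfolding W'_def by blast
      then show "?f X = 0" by simp
    qed
    then show "W \<inter> W' \<subseteq> {0}" by blast
    show "{0} \<subseteq> W \<inter> W'" using W(1) sW' by (simp add: subspace_0)
  qed
  moreover have "{X + Y | X Y. X \<in> W \<and> Y \<in> W'} = lieal G"
  proof
    show "{X + Y | X Y. X \<in> W \<and> Y \<in> W'} \<subseteq> lieal G"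
      using W(2) subspace_lieal by (auto simp: W'_def subspace_add)
    show "lieal G \<subseteq> {X + Y | X Y. X \<in> W \<and> Y \<in> W'}"
    proof
      fix Z assume Z: "Z \<in> lieal G"
      have sf: "span (?f ` W) = ?f ` W" using linear_subspace_image[OF lin W(1)] by (simp add: span_eq_iff)
      obtain w u where w: "w \<in> ?f ` W" "\<And>v. v \<in> ?f ` W \<Longrightarrow> orthogonal u v" "?f Z = w + u"
        using orthogonal_subspace_decomp_exists[of "?f ` W" "?f Z"] unfolding sf by blast
      then obtain X where X: "X \<in> W" "w = ?f X" by blast
      have "?f (Z - X) = u" using w(3) X(2) by (simp add: algebra_simps)
      then have "Z - X \<in> W'"
        using w(2) Z X(1) W(2) subspace_lieal by (auto simp: W'_def orthogonal_def subspace_diff)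
      then show "Z \<in> {X + Y | X Y. X \<in> W \<and> Y \<in> W'}"
        using X(1) by (intro CollectI exI[of _ X] exI[of _ "Z - X"]) simp
    qed
  qed
  ultimately show "\<exists>W'. subspace W' \<and> W' \<subseteq> lieal G \<and> Ad_stable k g W' \<and> W \<inter> W' = {0} \<and>
      {x + y | x y. x \<in> W \<and> y \<in> W'} = lieal G"
    using sW' by (intro exI[of _ W']) (auto simp: W'_def)
qed

lemma jord_in_group: assumes "g \<in> G" "inverses g h" shows "jord g 1 s s \<in> G"
proof -
  have "jord g 1 1 1 ^ m \<in> G" for m unfolding jord_111[OF assms(2)] by (rule power_mem[OF assms(1)])
  then have "jord g 1 (1 * s) (1 * s) \<in> G" by (rule jord_mem[OF zar assms(2)])
  then show ?thesis by (simp only: mult_1)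
qed

text \<open>For nonzero s the invariant subspaces are those of \<open>g\<close>; at s = 0 the tuple
  is elliptic and preserves an inner product.\<close>

theorem jord_path_completely_reducible:
  assumes g: "\<And>i. i < k \<Longrightarrow> g i \<in> G" "\<And>i j. i < k \<Longrightarrow> j < k \<Longrightarrow> g i * g j = g j * g i"
    and cr: "completely_reducible k (lieal G) g"
  shows "completely_reducible k (lieal G) (\<lambda>i. jord (g i) 1 s s)"
proof -
  define h where "h i = (SOME h. inverses (g i) h)" for i
  have h: "inverses (g i) (h i)" if "i < k" for i
    unfolding h_def by (rule someI_ex) (use inv_mem[OF g(1)[OF that]] in blast)
  show ?thesis
  proof (cases "s = 0")
    case True
    obtain x y where xy: "inverses x y" "\<And>i. i < k \<Longrightarrow> orth_at x y (fc sgn (g i))"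
    proof -
    have "\<exists>x y. inverses x y \<and> (\<forall>i<k. orth_at x y (fc sgn (g i)))"
      by (rule elliptic_orth[of k g h]) (use h g(2) in auto)
    then show thesis using that by blast
  qed
    show ?thesis
      by (rule orth_completely_reducible[OF xy(1)])
        (use xy(2) jord_100[OF h] jord_in_group[OF g(1) h, of _ 0] in \<open>simp_all add: True\<close>)
  qed (rule completely_reducible_jord[OF h _ cr])
qed

text \<open>The whole stabilizer in \<open>G\<close> of the inner product preserved by the elliptic
  tuple is compact, and conjugating it into \<open>K\<close> moves all members at once.\<close>

theorem elliptic_into_maximal_compact:
  fixes k :: nat
  assumes g: "\<And>i. i < k \<Longrightarrow> g i \<in> G" "\<And>i j. i < k \<Longrightarrow> j < k \<Longrightarrow> g i * g j = g j * g i"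
    and K: "csubgroup K" "\<And>M. csubgroup M \<Longrightarrow> K \<subseteq> M \<Longrightarrow> M = K"
  obtains u u' where "u \<in> G" "inverses u u'" "\<And>i. i < k \<Longrightarrow> u * jord (g i) 1 0 0 * u' \<in> K"
proof -
  define h where "h i = (SOME h. inverses (g i) h)" for i
  have h: "inverses (g i) (h i)" if "i < k" for i
    unfolding h_def by (rule someI_ex) (use inv_mem[OF g(1)[OF that]] in blast)
  obtain x y where xy: "inverses x y" "\<And>i. i < k \<Longrightarrow> orth_at x y (fc sgn (g i))"
  proof -
    have "\<exists>x y. inverses x y \<and> (\<forall>i<k. orth_at x y (fc sgn (g i)))"
      by (rule elliptic_orth[of k g h]) (use h g(2) in auto)
    then show thesis using that by blast
  qed
  obtain u u' where u: "u \<in> G" "inverses u u'" "\<And>l. l \<in> {g \<in> G. orth_at x y g} \<Longrightarrow> u * l * u' \<in> K"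
    using conjugate_into_maximal_compact[OF K csubgroup_orth[OF xy(1)]] by blast
  show ?thesis
  proof (rule that[OF u(1,2)])
    fix i assume i: "i < k"
    show "u * jord (g i) 1 0 0 * u' \<in> K"
      by (rule u(3)) (use xy(2)[OF i] jord_100[OF h[OF i]] jord_in_group[OF g(1)[OF i] h[OF i], of 0] in simp)
  qed
qed

end

section \<open>Real matrices as elements of the matrix algebra\<close>

definition mx :: "real^'n^'n \<Rightarrow> 'n::finite rsq" where
  "mx A = Sqm (\<lambda>i j. vec_nth (vec_nth A i) j)"

definition xm :: "'n::finite rsq \<Rightarrow> real^'n^'n" where
  "xm X = vec_lambda (\<lambda>i. vec_lambda (\<lambda>j. ent X i j))"

lemma xm_mx [simp]: "xm (mx A) = A"
  by (simp add: xm_def mx_def)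

lemma mx_xm [simp]: "mx (xm X) = X"
  by (rule sqm_eqI) (simp add: xm_def mx_def)

lemma mx_eq_iff [simp]: "mx A = mx B \<longleftrightarrow> A = B"
  by (metis xm_mx)

lemma inj_mx: "inj mx"
  by (simp add: inj_def)

lemma mx_mult [simp]: "mx (A ** B) = mx A * mx B"
  by (rule sqm_eqI) (simp add: mx_def ent_times matrix_matrix_mult_def)

lemma mx_1 [simp]: "mx (Finite_Cartesian_Product.mat 1) = 1"
  by (rule sqm_eqI) (simp add: mx_def ent_one Finite_Cartesian_Product.mat_def)

lemma xm_1: "xm 1 = Finite_Cartesian_Product.mat 1"
  by (simp flip: mx_eq_iff)

lemma linear_mx: "linear mx"
  by (rule linearI) (auto intro!: sqm_eqI simp: mx_def)

lemma linear_xm: "linear xm"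
  by (rule linearI) (auto simp: xm_def vec_eq_iff)

lemma bounded_linear_mx: "bounded_linear mx" and bounded_linear_xm: "bounded_linear xm"
  using linear_mx linear_xm by (simp_all add: linear_conv_bounded_linear)

lemma mx_0 [simp]: "mx 0 = 0" and mx_add [simp]: "mx (A + B) = mx A + mx B" and mx_diff: "mx (A - B) = mx A - mx B"
  using linear_0[OF linear_mx] linear_add[OF linear_mx] linear_diff[OF linear_mx] by auto

lemma xm_image_mx [simp]: "xm ` mx ` S = S" and mx_image_xm [simp]: "mx ` xm ` T = T"
  by (simp_all add: image_image)

lemma mx_image_iff: "mx A \<in> mx ` S \<longleftrightarrow> A \<in> S"
  by (rule inj_image_mem_iff[OF inj_mx])

lemma xm_image_iff: "A \<in> xm ` T \<longleftrightarrow> mx A \<in> T"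
  by (auto intro: image_eqI[of _ _ "mx A"])

lemma xm_mem_iff: "xm X \<in> S \<longleftrightarrow> X \<in> mx ` S"
  by (auto intro: image_eqI[of _ _ "xm X"])

lemma invertible_mx: "invertible A \<longleftrightarrow> (\<exists>y. inverses (mx A) y)"
proof
  assume "invertible A"
  then obtain B where "A ** B = Finite_Cartesian_Product.mat 1" unfolding invertible_def by blast
  then have "mx A * mx B = 1" by (metis mx_1 mx_mult)
  then show "\<exists>y. inverses (mx A) y" by (auto simp: inverses_def)
next
  assume "\<exists>y. inverses (mx A) y"
  then obtain y where "inverses (mx A) y" ..
  then have "mx (A ** xm y) = mx (Finite_Cartesian_Product.mat 1)" by (simp add: inverses_def)
  then show "invertible A" unfolding mx_eq_iff invertible_right_inverse by blast
qed

lemma inverses_matrix_inv: "invertible A \<Longrightarrow> inverses (mx A) (mx (matrix_inv A))"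
proof -
  assume "invertible A"
  then have "A ** matrix_inv A = Finite_Cartesian_Product.mat 1 \<and> matrix_inv A ** A = Finite_Cartesian_Product.mat 1"
    unfolding invertible_def matrix_inv_def by (rule someI_ex)
  then show ?thesis unfolding inverses_def by (metis mx_1 mx_mult)
qed

lemma matrix_inv_eqI: "inverses (mx A) (mx B) \<Longrightarrow> matrix_inv A = B"
  using inverses_matrix_inv[of A] inverses_unique[of "mx A" "mx (matrix_inv A)" "mx B"] invertible_mx[of A] by auto

lemma group_GL: "group (GL :: (real^'n^'n) monoid)"
proof (rule groupI)
  fix x y z :: "real^'n^'n"
  show "x \<otimes>\<^bsub>GL\<^esub> y \<in> carrier GL" if "x \<in> carrier GL" "y \<in> carrier GL"
    using that by (simp add: GL_def invertible_mult)
  show "x \<otimes>\<^bsub>GL\<^esub> y \<otimes>\<^bsub>GL\<^esub> z = x \<otimes>\<^bsub>GL\<^esub> (y \<otimes>\<^bsub>GL\<^esub> z)"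
    by (simp add: GL_def matrix_mul_assoc)
  show "\<exists>y\<in>carrier GL. y \<otimes>\<^bsub>GL\<^esub> x = \<one>\<^bsub>GL\<^esub>" if "x \<in> carrier GL"
    using that unfolding GL_def invertible_def by auto
qed (auto simp: GL_def invertible_def intro: exI[of _ "Finite_Cartesian_Product.mat 1"])

lemma inv_GL: "invertible A \<Longrightarrow> inv\<^bsub>GL\<^esub> A = matrix_inv A"
proof (rule group.inv_equality[OF group_GL])
  assume A: "invertible A"
  note i = inverses_matrix_inv[OF A]
  show "A \<in> carrier GL" "matrix_inv A \<in> carrier GL"
    using A inverses_sym[OF i] by (auto simp: GL_def invertible_mx)
  have "mx (matrix_inv A ** A) = mx (Finite_Cartesian_Product.mat 1)" using inversesD(2)[OF i] by simp
  then have "matrix_inv A ** A = Finite_Cartesian_Product.mat 1" by (simp only: mx_eq_iff)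
  then show "matrix_inv A \<otimes>\<^bsub>GL\<^esub> A = \<one>\<^bsub>GL\<^esub>" by (simp add: GL_def)
qed

lemma subgroup_GL_iff:
  "subgroup H GL \<longleftrightarrow> (\<forall>A\<in>H. invertible A) \<and> Finite_Cartesian_Product.mat 1 \<in> H \<and>
    (\<forall>A\<in>H. \<forall>B\<in>H. A ** B \<in> H) \<and> (\<forall>A\<in>H. matrix_inv A \<in> H)"
  unfolding subgroup_def using inv_GL by (auto simp: GL_def subset_iff)

lemma subgroup_mx:
  assumes "subgroup H GL"
  shows "1 \<in> mx ` H" "\<And>x y. x \<in> mx ` H \<Longrightarrow> y \<in> mx ` H \<Longrightarrow> x * y \<in> mx ` H"
    "\<And>x. x \<in> mx ` H \<Longrightarrow> \<exists>y\<in>mx ` H. inverses x y"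
proof -
  note H = assms[unfolded subgroup_GL_iff]
  show "1 \<in> mx ` H" using H mx_1 by (metis mx_image_iff)
  show "x * y \<in> mx ` H" if "x \<in> mx ` H" "y \<in> mx ` H" for x y
    using that H by (auto simp flip: mx_mult)
  show "\<exists>y\<in>mx ` H. inverses x y" if "x \<in> mx ` H" for x
    using that H inverses_matrix_inv by blast
qed

lemma subgroup_xm:
  assumes "1 \<in> L" "\<And>x y. x \<in> L \<Longrightarrow> y \<in> L \<Longrightarrow> x * y \<in> L" "\<And>x. x \<in> L \<Longrightarrow> \<exists>y\<in>L. inverses x y"
  shows "subgroup (xm ` L) GL"
  unfolding subgroup_GL_iff
proof (intro conjI ballI)
  show "Finite_Cartesian_Product.mat 1 \<in> xm ` L" using assms(1) by (simp add: xm_image_iff)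
  fix A assume A: "A \<in> xm ` L"
  then obtain y where y: "y \<in> L" "inverses (mx A) y" using assms(3)[of "mx A"] by (auto simp: xm_image_iff)
  then show "invertible A" by (auto simp: invertible_mx)
  have "matrix_inv A = xm y" by (rule matrix_inv_eqI) (simp add: y)
  then show "matrix_inv A \<in> xm ` L" using y by simp
  show "A ** B \<in> xm ` L" if "B \<in> xm ` L" for B
    using A that assms(2) by (simp add: xm_image_iff)
qed

lemma zar_mx: assumes "zariski_closed S" shows "zar (mx ` S)"
proof -
  obtain P where P: "\<forall>p\<in>P. real_polynomial_function p" "S = {A \<in> carrier GL. \<forall>p\<in>P. p A = 0}"
    using assms unfolding zariski_closed_def by blast
  have "x \<in> mx ` S \<longleftrightarrow> (\<exists>y. inverses x y) \<and> (\<forall>p\<in>(\<lambda>p. p \<circ> xm) ` P. p x = 0)" for x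
    unfolding xm_mem_iff[symmetric] P(2) by (simp add: GL_def invertible_mx)
  moreover have "\<forall>p\<in>(\<lambda>p. p \<circ> xm) ` P. real_polynomial_function p"
    using P(1) polynomial_function_bounded_linear[OF bounded_linear_xm] by auto
  ultimately show ?thesis unfolding zar_def by blast
qed

lemma zariski_closed_xm: assumes "zar S" shows "zariski_closed (xm ` S)"
proof -
  obtain P where P: "\<forall>p\<in>P. real_polynomial_function p" "S = {x. (\<exists>y. inverses x y) \<and> (\<forall>p\<in>P. p x = 0)}"
    using assms unfolding zar_def by blast
  have "A \<in> xm ` S \<longleftrightarrow> A \<in> carrier GL \<and> (\<forall>p\<in>(\<lambda>p. p \<circ> mx) ` P. p A = 0)" for A
    unfolding xm_image_iff unfolding P(2) by (simp add: GL_def invertible_mx)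
  moreover have "\<forall>p\<in>(\<lambda>p. p \<circ> mx) ` P. real_polynomial_function p"
    using P(1) polynomial_function_bounded_linear[OF bounded_linear_mx] by auto
  ultimately show ?thesis unfolding zariski_closed_def by blast
qed

lemma zar_limit:
  assumes "zar S" "\<And>k. u k \<in> S" "u \<longlonglongrightarrow> x" "inverses x y" shows "x \<in> S"
proof -
  obtain P where P: "\<forall>p\<in>P. real_polynomial_function p" "S = {x. (\<exists>y. inverses x y) \<and> (\<forall>p\<in>P. p x = 0)}"
    using assms(1) unfolding zar_def by blast
  have "p x = 0" if p: "p \<in> P" for p
  proof -
    have "(\<lambda>k. p (u k)) \<longlonglongrightarrow> p x"
      by (rule isCont_tendsto_compose[OF continuous_real_polymonial_function assms(3)]) (use P p in auto)
    moreover have "p (u k) = 0" for k using assms(2)[of k] p unfolding P(2) by blast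
    ultimately show ?thesis by (simp add: LIMSEQ_const_iff)
  qed
  then show ?thesis unfolding P(2) using assms(4) by blast
qed

lemma matgroup_mx: assumes "real_algebraic_group G" shows "matgroup (mx ` G)"
proof -
  have G: "subgroup G GL" "zariski_closed G" using assms by (auto simp: real_algebraic_group_def)
  show ?thesis
  proof (rule matgroup.intro)
    show "x \<in> mx ` G" if "\<And>k. u k \<in> mx ` G" "u \<longlonglongrightarrow> x" "inverses x y" for u x y
      by (rule zar_limit[OF zar_mx[OF G(2)] that])
  qed (use subgroup_mx[OF G(1)] in blast)+
qed

lemma real_algebraic_group_xm: assumes "matgroup N" "zar N" shows "real_algebraic_group (xm ` N)"
  unfolding real_algebraic_group_def
proof
  interpret matgroup N by (rule assms(1))
  show "subgroup (xm ` N) GL"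
  proof (rule subgroup_xm)
    show "1 \<in> N" by (rule one_mem)
    show "x * y \<in> N" if "x \<in> N" "y \<in> N" for x y using that by (rule mult_mem)
    show "\<exists>y\<in>N. inverses x y" if "x \<in> N" for x using that by (rule inv_mem)
  qed
qed (rule zariski_closed_xm[OF assms(2)])

lemma mx_power: "mx (((**) B ^^ m) (Finite_Cartesian_Product.mat 1)) = mx B ^ m"
  by (induction m) simp_all

lemma rgroup_mx:
  assumes red: "real_reductive_algebraic_group G" and conn: "connected G"
  shows "rgroup (mx ` G)"
proof -
  have alg: "real_algebraic_group G"
    and R: "\<And>N. real_algebraic_group N \<Longrightarrow> connected N \<Longrightarrow> \<forall>A\<in>N. unipotent A \<Longrightarrow> N \<lhd> GL\<lparr>carrier := G\<rparr> \<Longrightarrow>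
      N = {Finite_Cartesian_Product.mat 1}"
    using red unfolding real_reductive_algebraic_group_def by blast+
  have G: "subgroup G GL" "zariski_closed G" using alg by (auto simp: real_algebraic_group_def)
  have invG: "invertible A" if "A \<in> G" for A using G(1) that unfolding subgroup_GL_iff by blast
  show ?thesis
  proof (intro rgroup.intro zgroup.intro zgroup_axioms.intro rgroup_axioms.intro)
    show "matgroup (mx ` G)" by (rule matgroup_mx[OF alg])
    show "zar (mx ` G)" by (rule zar_mx[OF G(2)])
    show "connected (mx ` G)"
      by (intro connected_continuous_image conn linear_continuous_on bounded_linear_mx)
    fix N assume N: "matgroup N" "zar N" "N \<subseteq> mx ` G" "connected N"
      and u: "\<And>x. x \<in> N \<Longrightarrow> \<exists>m. (x - 1) ^ m = 0"
      and n: "\<And>g h x. g \<in> mx ` G \<Longrightarrow> inverses g h \<Longrightarrow> x \<in> N \<Longrightarrow> g * x * h \<in> N"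
    have alN: "real_algebraic_group (xm ` N)" by (rule real_algebraic_group_xm[OF N(1,2)])
    have NG: "xm ` N \<subseteq> G" using N(3) by (auto simp: xm_mem_iff)
    have "xm ` N = {Finite_Cartesian_Product.mat 1}"
    proof (rule R[OF alN])
      show "connected (xm ` N)"
        by (intro connected_continuous_image N(4) linear_continuous_on bounded_linear_xm)
      show "\<forall>A\<in>xm ` N. unipotent A"
      proof
        fix A assume "A \<in> xm ` N"
        then obtain m where "(mx A - 1) ^ m = 0" using u[of "mx A"] by (auto simp: xm_image_iff)
        then have "mx (((**) (A - Finite_Cartesian_Product.mat 1) ^^ m) (Finite_Cartesian_Product.mat 1)) = mx 0"
          unfolding mx_power by (simp add: mx_diff)
        then show "unipotent A" unfolding unipotent_def mx_eq_iff by blast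
      qed
      have gG: "group (GL\<lparr>carrier := G\<rparr>)" by (rule subgroup.subgroup_is_group[OF G(1) group_GL])
      have sN: "subgroup (xm ` N) (GL\<lparr>carrier := G\<rparr>)"
        using group.subgroup_incl[OF group_GL _ G(1) NG] alN by (simp add: real_algebraic_group_def)
      show "xm ` N \<lhd> GL\<lparr>carrier := G\<rparr>"
        unfolding group.normal_inv_iff[OF gG]
      proof (intro conjI sN ballI)
        fix A B assume A: "A \<in> carrier (GL\<lparr>carrier := G\<rparr>)" and B: "B \<in> xm ` N"
        have AG: "A \<in> G" using A by simp
        have "inv\<^bsub>GL\<lparr>carrier := G\<rparr>\<^esub> A = matrix_inv A"
          using group.m_inv_consistent[OF group_GL G(1) AG] inv_GL[OF invG[OF AG]] by simp
        moreover have "mx A * mx B * mx (matrix_inv A) \<in> N"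
          by (rule n) (use AG B inverses_matrix_inv[OF invG[OF AG]] in \<open>auto simp: xm_image_iff\<close>)
        ultimately show "A \<otimes>\<^bsub>GL\<lparr>carrier := G\<rparr>\<^esub> B \<otimes>\<^bsub>GL\<lparr>carrier := G\<rparr>\<^esub> inv\<^bsub>GL\<lparr>carrier := G\<rparr>\<^esub> A \<in> xm ` N"
          by (simp add: GL_def xm_image_iff)
      qed
    qed
    then have "mx ` xm ` N = {1}" by simp
    then show "N = {1}" by simp
  qed
qed

lemma mx_lie_algebra: assumes "matgroup (mx ` G)" shows "mx ` lie_algebra G = lieal (mx ` G)"
proof
  show "mx ` lie_algebra G \<subseteq> lieal (mx ` G)"
  proof
    fix X assume "X \<in> mx ` lie_algebra G"
    then obtain \<gamma> Y where *: "\<forall>t. \<gamma> t \<in> G" "\<gamma> 0 = Finite_Cartesian_Product.mat 1"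
        "(\<gamma> has_vector_derivative Y) (at 0)" "X = mx Y"
      unfolding lie_algebra_def by blast
    show "X \<in> lieal (mx ` G)"
      unfolding *(4)
      by (rule matgroup.curve_in_lieal[OF assms, of "\<lambda>t. mx (\<gamma> t)"])
        (use * bounded_linear.has_vector_derivative[OF bounded_linear_mx *(3)] in auto)
  qed
  show "lieal (mx ` G) \<subseteq> mx ` lie_algebra G"
  proof
    fix X assume X: "X \<in> lieal (mx ` G)"
    have "xm X \<in> lie_algebra G"
      unfolding lie_algebra_def
    proof (intro CollectI exI[of _ "\<lambda>t. xm (mexp (t *\<^sub>R X))"] conjI allI)
      show "xm (mexp (t *\<^sub>R X)) \<in> G" for t using X by (simp add: lieal_def xm_mem_iff)
      show "((\<lambda>t. xm (mexp (t *\<^sub>R X))) has_vector_derivative xm X) (at 0)"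
        by (rule bounded_linear.has_vector_derivative[OF bounded_linear_xm mexp_has_vector_derivative_0])
    qed (simp add: xm_1)
    then show "X \<in> mx ` lie_algebra G" by (simp add: xm_mem_iff)
  qed
qed

lemma Ad_image_iff:
  assumes h: "inverses (mx A) h"
  shows "Ad A ` W = W \<longleftrightarrow> (\<forall>X\<in>mx ` W. mx A * X * h \<in> mx ` W \<and> h * X * mx A \<in> mx ` W)"
proof -
  have "invertible A" using h by (auto simp: invertible_mx)
  then have hi: "h = mx (matrix_inv A)" using inverses_unique[OF h inverses_matrix_inv] by blast
  have Ad: "mx (Ad A X) = mx A * mx X * h" for X by (simp add: Ad_def hi)
  show ?thesis
  proof
    assume eq: "Ad A ` W = W"
    show "\<forall>X\<in>mx ` W. mx A * X * h \<in> mx ` W \<and> h * X * mx A \<in> mx ` W"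
    proof (intro ballI conjI)
      fix X assume "X \<in> mx ` W"
      then obtain Y where Y: "Y \<in> W" "X = mx Y" by blast
      show "mx A * X * h \<in> mx ` W" unfolding Y(2) Ad[symmetric] mx_image_iff using eq Y(1) by blast
      obtain Z where Z: "Z \<in> W" "Y = Ad A Z" using eq Y(1) by blast
      have "h * X * mx A = mx Z" unfolding Y(2) Z(2) Ad using inversesD[OF h] by (simp add: mult.assoc)
      then show "h * X * mx A \<in> mx ` W" using Z(1) by simp
    qed
  next
    assume *: "\<forall>X\<in>mx ` W. mx A * X * h \<in> mx ` W \<and> h * X * mx A \<in> mx ` W"
    show "Ad A ` W = W"
    proof (intro equalityI subsetI)
      fix Y assume "Y \<in> Ad A ` W"
      then obtain X where X: "X \<in> W" "Y = Ad A X" by blast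
      have "mx Y \<in> mx ` W" unfolding X(2) Ad using * X(1) by blast
      then show "Y \<in> W" by (simp only: mx_image_iff)
    next
      fix Y assume Y: "Y \<in> W"
      let ?Z = "xm (h * mx Y * mx A)"
      have "?Z \<in> W" using * Y by (auto simp: xm_mem_iff)
      moreover have "mx Y = mx (Ad A ?Z)" unfolding Ad using inversesD[OF h] by (simp add: mult.assoc)
      ultimately show "Y \<in> Ad A ` W" by auto
    qed
  qed
qed

section \<open>The space of reductive tuples and its quotient\<close>

locale real_reductive =
  fixes G :: "(real^'n^'n) set"
  assumes reductive: "real_reductive_algebraic_group G" and connected: "connected G"
begin

sublocale R: rgroup "mx ` G"
  by (rule rgroup_mx[OF reductive connected])

lemma subgroup_G: "subgroup G GL"
  using reductive by (simp add: real_reductive_algebraic_group_def real_algebraic_group_def)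

lemma G_simps:
  "A \<in> G \<Longrightarrow> invertible A" "Finite_Cartesian_Product.mat 1 \<in> G" "A \<in> G \<Longrightarrow> B \<in> G \<Longrightarrow> A ** B \<in> G" "A \<in> G \<Longrightarrow> matrix_inv A \<in> G"
  using subgroup_G unfolding subgroup_GL_iff by auto

lemma inverses_G: "A \<in> G \<Longrightarrow> inverses (mx A) (mx (matrix_inv A))"
  by (rule inverses_matrix_inv[OF G_simps(1)])

lemma Ad_invariant_iff:
  assumes "\<And>i. i < k \<Longrightarrow> g i \<in> G"
  shows "Ad_invariant k G g W \<longleftrightarrow>
    subspace (mx ` W) \<and> mx ` W \<subseteq> lieal (mx ` G) \<and> Ad_stable k (\<lambda>i. mx (g i)) (mx ` W)"
proof -
  have "subspace W \<longleftrightarrow> subspace (mx ` W)"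
    using linear_subspace_image[OF linear_mx, of W] linear_subspace_image[OF linear_xm, of "mx ` W"] by auto
  moreover have "W \<subseteq> lie_algebra G \<longleftrightarrow> mx ` W \<subseteq> lieal (mx ` G)"
    unfolding mx_lie_algebra[OF R.matgroup_axioms, symmetric] by (simp add: inj_image_subset_iff[OF inj_mx])
  moreover have "(\<forall>i<k. Ad (g i) ` W = W) \<longleftrightarrow> Ad_stable k (\<lambda>i. mx (g i)) (mx ` W)"
  proof -
    have "Ad (g i) ` W = W \<longleftrightarrow> (\<forall>h. inverses (mx (g i)) h \<longrightarrow>
        (\<forall>X\<in>mx ` W. mx (g i) * X * h \<in> mx ` W \<and> h * X * mx (g i) \<in> mx ` W))" (is "_ \<longleftrightarrow> ?R") if "i < k" for i
    proof
      show ?R if "Ad (g i) ` W = W" using that Ad_image_iff by blast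
      have h: "inverses (mx (g i)) (mx (matrix_inv (g i)))" by (rule inverses_G[OF assms[OF \<open>i < k\<close>]])
      show "Ad (g i) ` W = W" if ?R unfolding Ad_image_iff[OF h] using that h by blast
    qed
    then show ?thesis unfolding Ad_stable_def by simp
  qed
  ultimately show ?thesis by (simp add: Ad_invariant_def)
qed

lemma complementary_mx:
  "W \<inter> W' = {0} \<and> {x + y | x y. x \<in> W \<and> y \<in> W'} = lie_algebra G \<longleftrightarrow>
    mx ` W \<inter> mx ` W' = {0} \<and> {x + y | x y. x \<in> mx ` W \<and> y \<in> mx ` W'} = lieal (mx ` G)"
proof -
  have "{x + y | x y. x \<in> mx ` W \<and> y \<in> mx ` W'} = mx ` {x + y | x y. x \<in> W \<and> y \<in> W'}"
    by (force simp: image_iff)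
  moreover have "mx ` W \<inter> mx ` W' = mx ` (W \<inter> W')" by (simp add: image_Int[OF inj_mx])
  moreover have "mx ` A = {0} \<longleftrightarrow> A = {0}" for A :: "(real^'n^'n) set" using inj_image_eq_iff[OF inj_mx, of A "{0}"] by simp
  ultimately show ?thesis
    by (simp only: mx_lie_algebra[OF R.matgroup_axioms, symmetric] inj_image_eq_iff[OF inj_mx])
qed

lemma reductive_rep_iff:
  assumes "\<And>i. i < k \<Longrightarrow> g i \<in> G"
  shows "reductive_rep k G g \<longleftrightarrow> completely_reducible k (lieal (mx ` G)) (\<lambda>i. mx (g i))"
proof -
  have all: "(\<forall>V. P V) \<longleftrightarrow> (\<forall>W. P (mx ` W))" for P :: "'n rsq set \<Rightarrow> bool" by (metis mx_image_xm)
  have ex: "(\<exists>V. P V) \<longleftrightarrow> (\<exists>W. P (mx ` W))" for P :: "'n rsq set \<Rightarrow> bool" by (metis mx_image_xm)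
  have inv: "Ad_invariant k G g W \<longleftrightarrow>
      subspace (mx ` W) \<and> mx ` W \<subseteq> lieal (mx ` G) \<and> Ad_stable k (\<lambda>i. mx (g i)) (mx ` W)" for W
    by (rule Ad_invariant_iff) (rule assms)
  show ?thesis
    unfolding reductive_rep_def completely_reducible_def all ex inv complementary_mx by simp
qed

lemma Hom_Z_reductive_iff:
  "g \<in> Hom_Z_reductive k G \<longleftrightarrow> g \<in> extensional {..<k} \<and> (\<forall>i<k. g i \<in> G) \<and>
    (\<forall>i<k. \<forall>j<k. mx (g i) * mx (g j) = mx (g j) * mx (g i)) \<and>
    completely_reducible k (lieal (mx ` G)) (\<lambda>i. mx (g i))"
proof -
  have "g i ** g j = g j ** g i \<longleftrightarrow> mx (g i) * mx (g j) = mx (g j) * mx (g i)" for i j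
    by (simp flip: mx_eq_iff)
  then show ?thesis using reductive_rep_iff[of k g]
    unfolding Hom_Z_reductive_def Hom_Z_def by (auto simp: PiE_iff)
qed

lemma path_component_of_character_space:
  assumes c: "\<And>i. i < k \<Longrightarrow> continuous_on {0..1} (\<lambda>s. p s i)"
    and p: "\<And>s. s \<in> {0..1} \<Longrightarrow> p s \<in> Hom_Z_reductive k G"
  shows "path_component_of (character_space k G) (conj_orbit k G (p 0)) (conj_orbit k G (p (1::real)))"
proof -
  have G: "p s i \<in> G" and E: "p s \<in> extensional {..<k}" if "s \<in> {0..1}" "i < k" for s i
    using p[OF that(1)] that by (auto simp: Hom_Z_reductive_iff)
  have E: "p s \<in> extensional {..<k}" if "s \<in> {0..1}" for s
    using p[OF that] by (auto simp: Hom_Z_reductive_iff)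
  have "continuous_map (top_of_set {0..1}) (product_topology (\<lambda>_. top_of_set G) {..<k}) p"
    unfolding continuous_map_componentwise
    using c G E by (auto simp: continuous_map_in_subtopology)
  then have "continuous_map (top_of_set {0..1}) (Hom_Z_reductive_topology k G) p"
    unfolding Hom_Z_reductive_topology_def using p by (auto simp: continuous_map_in_subtopology)
  then have "continuous_map (top_of_set {0..1}) (character_space k G) (conj_orbit k G \<circ> p)"
    unfolding character_space_def
    by (rule continuous_map_compose[OF _ quotient_imp_continuous_map[OF quotient_map_quotient_topology]])
  then show ?thesis
    unfolding path_component_of_def pathin_def by (intro exI[of _ "conj_orbit k G \<circ> p"]) auto
qed

text \<open>Right translation by \<open>u\<close> permutes the group. In the quotient a conjugation
  is therefore no move at all, and \<open>u\<close> need not be joined to the identity.\<close>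

lemma conj_orbit_conj:
  assumes u: "u \<in> G"
  shows "conj_orbit k G (\<lambda>i\<in>{..<k}. u ** g i ** matrix_inv u) = conj_orbit k G g"
proof -
  have inv: "matrix_inv (h ** u) = matrix_inv u ** matrix_inv h" if "h \<in> G" for h
    by (rule matrix_inv_eqI) (use inverses_mult[OF inverses_G[OF that] inverses_G[OF u]] in simp)
  have eq: "(\<lambda>i\<in>{..<k}. h ** (\<lambda>i\<in>{..<k}. u ** g i ** matrix_inv u) i ** matrix_inv h) =
      (\<lambda>i\<in>{..<k}. (h ** u) ** g i ** matrix_inv (h ** u))" if "h \<in> G" for h
    by (rule restrict_ext) (simp add: inv[OF that] matrix_mul_assoc)
  have "(\<lambda>h. h ** u) ` G = G"
  proof (intro equalityI subsetI)
    fix h assume h: "h \<in> G"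
    have "mx h = mx (h ** matrix_inv u ** u)" using inversesD[OF inverses_G[OF u]] by simp
    then have "h = h ** matrix_inv u ** u" by (simp only: mx_eq_iff)
    then show "h \<in> (\<lambda>h. h ** u) ` G" using h u G_simps by (intro image_eqI[of _ _ "h ** matrix_inv u"]) auto
  qed (use u G_simps in auto)
  then have "conj_orbit k G g = (\<lambda>h. \<lambda>i\<in>{..<k}. h ** g i ** matrix_inv h) ` (\<lambda>h. h ** u) ` G"
    by (simp add: conj_orbit_def)
  also have "\<dots> = conj_orbit k G (\<lambda>i\<in>{..<k}. u ** g i ** matrix_inv u)"
    unfolding conj_orbit_def image_image by (rule image_cong[OF refl]) (rule eq[symmetric])
  finally show ?thesis ..
qed

end

section \<open>Connecting every representation to the trivial one\<close>

lemma SU_Sp_one: "(\<exists>n\<ge>1. F = SU n) \<or> (\<exists>m\<ge>1. F = Sp m) \<Longrightarrow> \<one>\<^bsub>F\<^esub> \<otimes>\<^bsub>F\<^esub> \<one>\<^bsub>F\<^esub> = \<one>\<^bsub>F\<^esub>"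
  by (auto simp: SU_def Sp_def)

text \<open>Each component of the tuple moves in its own factor; the product path is continuous and
  commuting componentwise and is carried back to \<open>K\<close> by the inverse
  homeomorphism.\<close>

lemma SU_Sp_product_tuple_path:
  fixes K :: "(real^'n^'n) set" and k :: nat
  assumes K: "subgroup K GL" "SU_Sp_product K"
    and g: "\<And>i. i < k \<Longrightarrow> g i \<in> K" "\<And>i j. i < k \<Longrightarrow> j < k \<Longrightarrow> g i ** g j = g j ** g i"
  shows "\<exists>p. \<forall>i<k. continuous_on {0..1} (p i) \<and> p i 0 = Finite_Cartesian_Product.mat 1 \<and> p i (1::real) = g i \<and>
    (\<forall>s\<in>{0..1}. p i s \<in> K \<and> (\<forall>j<k. p i s ** p j s = p j s ** p i s))"
proof -
  obtain r F \<phi> where F: "\<And>j. j < (r::nat) \<Longrightarrow> (\<exists>n\<ge>1. F j = SU n) \<or> (\<exists>m\<ge>1. F j = Sp m)"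
    and iso: "\<phi> \<in> iso (GL\<lparr>carrier := K\<rparr>) (product_group {..<r} F)"
    and hom: "homeomorphic_map (top_of_set K) (product_topology (\<lambda>j. mat_topology (carrier (F j))) {..<r}) \<phi>"
    using K(2) unfolding SU_Sp_product_def by blast
  let ?P = "product_group {..<r} F" and ?T = "product_topology (\<lambda>j. mat_topology (carrier (F j))) {..<r}"
  have \<phi>_mult: "\<phi> (A ** B) = (\<lambda>j\<in>{..<r}. \<phi> A j \<otimes>\<^bsub>F j\<^esub> \<phi> B j)" if "A \<in> K" "B \<in> K" for A B
    using iso that unfolding iso_def hom_def by (auto simp: GL_def product_group_def)
  have \<phi>_mem: "\<phi> A j \<in> carrier (F j)" if "A \<in> K" "j < r" for A j
    using iso that unfolding iso_def hom_def by (auto simp: product_group_def PiE_iff Pi_iff)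
  have \<phi>_inj: "A = B" if "\<phi> A = \<phi> B" "A \<in> K" "B \<in> K" for A B
    using iso that unfolding iso_def bij_betw_def inj_on_def by auto
  have Kmult: "A ** B \<in> K" if "A \<in> K" "B \<in> K" for A B
    using K(1) that unfolding subgroup_GL_iff by blast
  obtain \<psi> where \<psi>: "homeomorphic_maps (top_of_set K) ?T \<phi> \<psi>" using hom unfolding homeomorphic_map_maps ..
  have \<psi>c: "continuous_map ?T (top_of_set K) \<psi>" and \<phi>c: "continuous_map (top_of_set K) ?T \<phi>" and \<phi>\<psi>: "\<And>y. y \<in> topspace ?T \<Longrightarrow> \<phi> (\<psi> y) = y"
    and \<psi>\<phi>: "\<And>A. A \<in> K \<Longrightarrow> \<psi> (\<phi> A) = A"
    using \<psi> unfolding homeomorphic_maps_def by auto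
  have \<psi>K: "\<psi> y \<in> K" if "y \<in> topspace ?T" for y
    using continuous_map_funspace[OF \<psi>c] that by auto
  let ?Q = "\<lambda>j p. (\<forall>i<k. continuous_map (top_of_set {0..1}) (mat_topology (carrier (F j))) (p i)) \<and>
      (\<forall>i<k. p i 0 = \<one>\<^bsub>F j\<^esub>) \<and> (\<forall>i<k. p i (1::real) = \<phi> (g i) j) \<and>
      (\<forall>i<k. \<forall>i'<k. \<forall>s. p i s \<otimes>\<^bsub>F j\<^esub> p i' s = p i' s \<otimes>\<^bsub>F j\<^esub> p i s)"
  have ex: "\<exists>p. ?Q j p" if j: "j < r" for j
  proof (rule commuting_tuple_path[OF F[OF j], of k "\<lambda>i. \<phi> (g i) j"])
    show "\<phi> (g i) j \<in> carrier (F j)" if "i < k" for i by (rule \<phi>_mem[OF g(1)[OF that] j])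
    show "\<phi> (g i) j \<otimes>\<^bsub>F j\<^esub> \<phi> (g i') j = \<phi> (g i') j \<otimes>\<^bsub>F j\<^esub> \<phi> (g i) j" if "i < k" "i' < k" for i i'
      using fun_cong[OF \<phi>_mult[OF g(1)[OF that(1)] g(1)[OF that(2)]], of j]
        fun_cong[OF \<phi>_mult[OF g(1)[OF that(2)] g(1)[OF that(1)]], of j] g(2)[OF that] j by simp
  qed blast
  define p where "p j = (SOME p. ?Q j p)" for j
  have Q: "?Q j (p j)" if "j < r" for j
    unfolding p_def by (rule someI_ex[OF ex[OF that]])
  have p: "\<And>j i. j < r \<Longrightarrow> i < k \<Longrightarrow> continuous_map (top_of_set {0..1}) (mat_topology (carrier (F j))) (p j i)"
      "\<And>j i. j < r \<Longrightarrow> i < k \<Longrightarrow> p j i 0 = \<one>\<^bsub>F j\<^esub>" "\<And>j i. j < r \<Longrightarrow> i < k \<Longrightarrow> p j i (1::real) = \<phi> (g i) j"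
      "\<And>j i i' s. j < r \<Longrightarrow> i < k \<Longrightarrow> i' < k \<Longrightarrow> p j i s \<otimes>\<^bsub>F j\<^esub> p j i' s = p j i' s \<otimes>\<^bsub>F j\<^esub> p j i s"
    using Q by simp_all
  define q where "q i s = (\<lambda>j\<in>{..<r}. p j i s)" for i s
  have qc: "continuous_map (top_of_set {0..1}) ?T (q i)" if "i < k" for i
    unfolding continuous_map_componentwise using p(1)[OF _ that] by (auto simp: q_def)
  have qT: "q i s \<in> topspace ?T" if "i < k" "s \<in> {0..1}" for i s
    using continuous_map_funspace[OF qc[OF that(1)]] that(2) by auto
  show ?thesis
  proof (intro exI[of _ "\<lambda>i s. \<psi> (q i s)"] allI impI conjI ballI)
    fix i assume i: "i < k"
    have c: "continuous_map (top_of_set {0..1}) (top_of_set K) (\<psi> \<circ> q i)"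
      by (rule continuous_map_compose[OF qc[OF i] \<psi>c])
    then show "continuous_on {0..1} (\<lambda>s. \<psi> (q i s))" by (simp add: o_def)
    show "\<psi> (q i s) \<in> K" if "s \<in> {0..1}" for s by (rule \<psi>K[OF qT[OF i that]])
    show "\<psi> (q i s) ** \<psi> (q i' s) = \<psi> (q i' s) ** \<psi> (q i s)" if s: "s \<in> {0..1}" and i': "i' < k" for s i'
    proof (rule \<phi>_inj)
      note m = \<psi>K[OF qT[OF i s]] \<psi>K[OF qT[OF i' s]]
      show "\<psi> (q i s) ** \<psi> (q i' s) \<in> K" "\<psi> (q i' s) ** \<psi> (q i s) \<in> K" using m Kmult by auto
      show "\<phi> (\<psi> (q i s) ** \<psi> (q i' s)) = \<phi> (\<psi> (q i' s) ** \<psi> (q i s))"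
        unfolding \<phi>_mult[OF m] \<phi>_mult[OF m(2,1)] \<phi>\<psi>[OF qT[OF i s]] \<phi>\<psi>[OF qT[OF i' s]]
        by (rule restrict_ext) (use p(4) i i' in \<open>simp add: q_def\<close>)
    qed
    have "q i 1 = \<phi> (g i)"
    proof
      fix j
      have "\<phi> (g i) \<in> topspace ?T"
        using continuous_map_funspace[OF \<phi>c] g(1)[OF i] by auto
      then show "q i 1 j = \<phi> (g i) j" using p(3)[of j i] i by (auto simp: q_def PiE_iff extensional_def)
    qed
    then show "\<psi> (q i 1) = g i" by (simp add: \<psi>\<phi> g(1)[OF i])
    let ?e = "\<psi> (q i 0)"
    have eK: "?e \<in> K" using \<psi>K[OF qT[OF i]] by simp
    \<comment> \<open>The starting point is recognized as the identity by being an invertible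
      idempotent, which the multiplicativity of \<phi> shows factor by factor.\<close>
    have "\<phi> (?e ** ?e) = \<phi> ?e"
    proof -
      have q0: "\<phi> ?e = q i 0" using \<phi>\<psi>[OF qT[OF i]] by simp
      show ?thesis unfolding \<phi>_mult[OF eK eK] q0
        by (auto simp: q_def p(2)[OF _ i] SU_Sp_one[OF F] intro!: restrict_ext)
    qed
    then have ee: "?e ** ?e = ?e" by (rule \<phi>_inj[OF _ Kmult[OF eK eK] eK])
    have "invertible ?e" using K(1) eK unfolding subgroup_GL_iff by blast
    then obtain y where y: "inverses (mx ?e) y" by (auto simp: invertible_mx)
    have "mx ?e * mx ?e = mx ?e" unfolding mx_mult[symmetric] ee ..
    then have "mx ?e = 1" using inversesD[OF y] by metis
    then show "?e = Finite_Cartesian_Product.mat 1" by (metis mx_1 mx_eq_iff)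
  qed
qed

context real_reductive
begin

lemma csubgroup_mx:
  assumes "subgroup L GL" "compact L" "L \<subseteq> G" shows "R.csubgroup (mx ` L)"
  unfolding R.csubgroup_def
proof (intro conjI ballI)
  show "compact (mx ` L)" by (intro compact_continuous_image assms(2) linear_continuous_on bounded_linear_mx)
qed (use assms(3) subgroup_mx[OF assms(1)] in auto)

lemma csubgroup_mx_maximal:
  assumes K: "maximal_compact_subgroup K G" and M: "R.csubgroup M" "mx ` K \<subseteq> M" shows "M = mx ` K"
proof -
  have "subgroup (xm ` M) GL" by (rule subgroup_xm) (use M(1) in \<open>auto simp: R.csubgroup_def\<close>)
  moreover have "compact (xm ` M)"
    using M(1) by (intro compact_continuous_image linear_continuous_on bounded_linear_xm) (simp add: R.csubgroup_def)
  moreover have "K \<subseteq> xm ` M" using M(2) by (auto simp: xm_image_iff)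
  moreover have "xm ` M \<subseteq> G" using M(1) by (auto simp: R.csubgroup_def xm_mem_iff)
  ultimately have "xm ` M = K" using K unfolding maximal_compact_subgroup_def by blast
  then have "mx ` xm ` M = mx ` K" by simp
  then show ?thesis by simp
qed

lemma compact_tuple_reductive:
  assumes K: "R.csubgroup (mx ` K)" and g: "g \<in> extensional {..<k}" "\<And>i. i < k \<Longrightarrow> g i \<in> K"
    "\<And>i j. i < k \<Longrightarrow> j < k \<Longrightarrow> g i ** g j = g j ** g i"
  shows "g \<in> Hom_Z_reductive k G"
proof -
  have KG: "K \<subseteq> G" using K by (auto simp: R.csubgroup_def mx_image_iff)
  obtain x y where xy: "R.minp x y" "\<And>l. l \<in> mx ` K \<Longrightarrow> R.orth_at x y l" using R.compact_fixed_point[OF K] by blast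
  have "completely_reducible k (lieal (mx ` G)) (\<lambda>i. mx (g i))"
    by (rule R.orth_completely_reducible[OF R.minp_inverses[OF xy(1)]]) (use xy(2) g(2) KG in auto)
  moreover have "mx (g i) * mx (g j) = mx (g j) * mx (g i)" if "i < k" "j < k" for i j
    using g(3)[OF that] by (metis mx_mult)
  ultimately show ?thesis using g KG by (auto simp: Hom_Z_reductive_iff)
qed

text \<open>Two paths that meet in the quotient: one from the tuple \<open>g\<close> to its elliptic
  parts, the other inside \<open>K\<close> from the trivial tuple to a conjugate of those
  parts.\<close>

theorem path_component_of_trivial:
  assumes K: "maximal_compact_subgroup K G" "SU_Sp_product K" and g: "g \<in> Hom_Z_reductive k G"
  shows "path_component_of (character_space k G) (conj_orbit k G g)
    (conj_orbit k G (\<lambda>i\<in>{..<k}. Finite_Cartesian_Product.mat 1))"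
proof -
  let ?c = "\<lambda>i. mx (g i)"
  have sK: "subgroup K GL" and cK: "R.csubgroup (mx ` K)"
    using K(1) csubgroup_mx unfolding maximal_compact_subgroup_def by auto
  have g': "g \<in> extensional {..<k}" "\<And>i. i < k \<Longrightarrow> ?c i \<in> mx ` G"
      "\<And>i j. i < k \<Longrightarrow> j < k \<Longrightarrow> ?c i * ?c j = ?c j * ?c i"
      "completely_reducible k (lieal (mx ` G)) ?c"
    using g by (auto simp: Hom_Z_reductive_iff)
  have inv: "inverses (?c i) (mx (matrix_inv (g i)))" if "i < k" for i
    using g'(2)[OF that] inverses_G by (auto simp: mx_image_iff)
  define p where "p s = (\<lambda>i\<in>{..<k}. xm (jord (?c i) 1 s s))" for s
  have pcr: "completely_reducible k (lieal (mx ` G)) (\<lambda>i. jord (?c i) 1 s s)" for s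
    by (rule R.jord_path_completely_reducible[OF g'(2,3,4)])
  have pm: "p s \<in> Hom_Z_reductive k G" for s
  proof -
    have "completely_reducible k (lieal (mx ` G)) (\<lambda>i. mx (p s i)) \<longleftrightarrow>
        completely_reducible k (lieal (mx ` G)) (\<lambda>i. jord (?c i) 1 s s)"
      unfolding completely_reducible_def Ad_stable_def by (simp add: p_def)
    moreover have "mx (p s i) * mx (p s j) = mx (p s j) * mx (p s i)" if "i < k" "j < k" for i j
      using that jord_commute2[OF g'(3)[OF that]] by (simp add: p_def)
    moreover have "p s i \<in> G" if "i < k" for i
      using R.jord_in_group[OF g'(2)[OF that] inv[OF that]] that by (simp add: p_def xm_mem_iff)
    ultimately show ?thesis using pcr by (auto simp: Hom_Z_reductive_iff p_def)
  qed
  have pc: "continuous_on {0..1} (\<lambda>s. p s i)" if "i < k" for i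
  proof -
    have "continuous_on {0..1} (\<lambda>s. jord (?c i) 1 s s)"
      by (rule continuous_on_subset[OF continuous_jord[OF inv[OF that]]]) simp
    then have "continuous_on {0..1} (\<lambda>s. xm (jord (?c i) 1 s s))"
      by (rule bounded_linear.continuous_on[OF bounded_linear_xm])
    then show ?thesis using that by (simp add: p_def)
  qed
  have p1: "p 1 = g"
  proof
    fix i
    show "p 1 i = g i"
      using jord_111[OF inv, of i] g'(1) by (cases "i < k") (simp_all add: p_def extensional_def del: One_nat_def)
  qed
  have 1: "path_component_of (character_space k G) (conj_orbit k G (p 0)) (conj_orbit k G g)"
    using path_component_of_character_space[of k p, OF pc pm] unfolding p1 .
  have "\<exists>u u'. u \<in> mx ` G \<and> inverses u u' \<and> (\<forall>i<k. u * jord (?c i) 1 0 0 * u' \<in> mx ` K)"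
  proof (rule R.elliptic_into_maximal_compact[of k ?c "mx ` K"])
    show "?c i \<in> mx ` G" if "i < k" for i by (rule g'(2)[OF that])
    show "?c i * ?c j = ?c j * ?c i" if "i < k" "j < k" for i j by (rule g'(3)[OF that])
    show "R.csubgroup (mx ` K)" by (rule cK)
    show "M = mx ` K" if "R.csubgroup M" "mx ` K \<subseteq> M" for M by (rule csubgroup_mx_maximal[OF K(1) that])
  qed blast
  then obtain u u' where u: "u \<in> mx ` G" "inverses u u'" "\<And>i. i < k \<Longrightarrow> u * jord (?c i) 1 0 0 * u' \<in> mx ` K"
    by blast
  obtain v where v: "v \<in> G" "u = mx v" using u(1) by blast
  have u': "u' = mx (matrix_inv v)" using u(2) inverses_G[OF v(1)] inverses_unique unfolding v(2) by blast
  \<comment> \<open>The conjugated elliptic tuple: it lies in \<open>K\<close> and has the same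
    orbit as \<open>p 0\<close>.\<close>
  define q where "q = (\<lambda>i\<in>{..<k}. v ** p 0 i ** matrix_inv v)"
  have mq: "mx (q i) = u * jord (?c i) 1 0 0 * u'" if "i < k" for i
    using that by (simp add: q_def p_def v(2) u')
  have qK: "q i \<in> K" if "i < k" for i
    using u(3)[OF that] unfolding mq[OF that, symmetric] mx_image_iff .
  have qq: "q i ** q j = q j ** q i" if "i < k" "j < k" for i j
  proof -
    have "mx (q i) * mx (q j) = mx (q j) * mx (q i)"
    proof -
      let ?a = "jord (?c i) 1 0 0" and ?b = "jord (?c j) 1 0 0"
      have "mx (q i) * mx (q j) = u * (?a * ?b) * u'" "mx (q j) * mx (q i) = u * (?b * ?a) * u'"
        unfolding mq[OF that(1)] mq[OF that(2)] using inversesD(4)[OF u(2)] by (simp_all only: mult.assoc)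
      then show ?thesis using jord_commute2[OF g'(3)[OF that], of 1 0 0 1 0 0] by (simp only:)
    qed
    then have "mx (q i ** q j) = mx (q j ** q i)" by (simp only: mx_mult)
    then show ?thesis by (simp only: mx_eq_iff)
  qed
  have "\<exists>p. \<forall>i<k. continuous_on {0..1} (p i) \<and> p i 0 = Finite_Cartesian_Product.mat 1 \<and> p i (1::real) = q i \<and>
      (\<forall>s\<in>{0..1}. p i s \<in> K \<and> (\<forall>j<k. p i s ** p j s = p j s ** p i s))"
    by (rule SU_Sp_product_tuple_path[OF sK K(2)]) (simp_all add: qK qq)
  then obtain w where w': "\<forall>i<k. continuous_on {0..1} (w i) \<and> w i 0 = Finite_Cartesian_Product.mat 1 \<and> w i (1::real) = q i \<and>
      (\<forall>s\<in>{0..1}. w i s \<in> K \<and> (\<forall>j<k. w i s ** w j s = w j s ** w i s))" ..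
  have w: "\<And>i. i < k \<Longrightarrow> continuous_on {0..1} (w i)" "\<And>i s. i < k \<Longrightarrow> s \<in> {0..1} \<Longrightarrow> w i s \<in> K"
    "\<And>i j s. i < k \<Longrightarrow> j < k \<Longrightarrow> s \<in> {0..1} \<Longrightarrow> w i s ** w j s = w j s ** w i s"
    "\<And>i. i < k \<Longrightarrow> w i 0 = Finite_Cartesian_Product.mat 1" "\<And>i. i < k \<Longrightarrow> w i (1::real) = q i"
    using w' by simp_all
  let ?w = "\<lambda>s. \<lambda>i\<in>{..<k}. w i s"
  have "path_component_of (character_space k G) (conj_orbit k G (?w 0)) (conj_orbit k G (?w 1))"
  proof (rule path_component_of_character_space)
    show "continuous_on {0..1} (\<lambda>s. ?w s i)" if "i < k" for i using w(1) that by simp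
    show "?w s \<in> Hom_Z_reductive k G" if "s \<in> {0..1}" for s
      by (rule compact_tuple_reductive[OF cK]) (use w(2,3) that in auto)
  qed
  moreover have "?w 0 = (\<lambda>i\<in>{..<k}. Finite_Cartesian_Product.mat 1)" by (rule restrict_ext) (simp add: w(4))
  moreover have "?w 1 = q"
    by (rule ext) (simp add: restrict_def w(5), simp add: q_def)
  moreover have "conj_orbit k G q = conj_orbit k G (p 0)" unfolding q_def by (rule conj_orbit_conj[OF v(1)])
  ultimately have "path_component_of (character_space k G)
      (conj_orbit k G (\<lambda>i\<in>{..<k}. Finite_Cartesian_Product.mat 1)) (conj_orbit k G (p 0))" by simp
  then show ?thesis using 1 path_component_of_sym path_component_of_trans by metis
qed

end

theorem corollary4p8:
  fixes G K :: "(real^'n^'n) set" and d :: nat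
  assumes "real_reductive_algebraic_group G"
    and "connected G"
    and "maximal_compact_subgroup K G"
    and "SU_Sp_product K"
  shows "path_connected_space (character_space (2 * d) G)"
proof -
  interpret real_reductive G using assms(1,2) by unfold_locales
  let ?k = "2 * d"
  have "Hom_Z_reductive ?k G \<subseteq> {..<?k} \<rightarrow>\<^sub>E G" by (auto simp: Hom_Z_reductive_def Hom_Z_def)
  then have "topspace (character_space ?k G) = conj_orbit ?k G ` Hom_Z_reductive ?k G"
    unfolding character_space_def topspace_quotient_topology Hom_Z_reductive_topology_def by auto
  then show ?thesis
    unfolding path_connected_space_iff_path_component
  proof (intro ballI)
    fix x y assume "x \<in> topspace (character_space ?k G)" "y \<in> topspace (character_space ?k G)"
    then obtain g h where g: "g \<in> Hom_Z_reductive ?k G" "x = conj_orbit ?k G g"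
      and h: "h \<in> Hom_Z_reductive ?k G" "y = conj_orbit ?k G h"
      using \<open>topspace (character_space ?k G) = _\<close> by auto
    note t = path_component_of_trivial[OF assms(3,4)]
    show "path_component_of (character_space ?k G) x y"
      unfolding g(2) h(2) by (rule path_component_of_trans[OF t[OF g(1)] path_component_of_sym[OF t[OF h(1)]]])
  qed
qed

end
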